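(* For every integer $n\ge2$ and every $k\in\{-\infty,0,1,\dots,n-1\}$, there exists a compact almost complex manifold $(X,J)$ of real dimension $2n$ with $J$ non-integrable and $\kappa^J(X)=k$.
   Context: Let $(X,J)$ be a compact almost complex manifold of real dimension $2n$. Split $T^*X\otimes\mathbb C=(T^*X)^{1,0}\oplus(T^*X)^{0,1}$; put $\Lambda^{p,q}=\Lambda^p((T^*X)^{1,0})\otimes\Lambda^q((T^*X)^{0,1})$ and $\bar\partial=\pi^{p,q+1}\circ d$ on $(p,q)$-forms, where $\pi^{p,q}$ is the projection onto type $(p,q)$. Let $\mathcal K=\Lambda^{n,0}$. Using $\Lambda^{n,1}\cong(T^*X)^{0,1}\otimes\mathcal K$ regard $\bar\partial_1=\bar\partial$ as an operator $\Gamma(\mathcal K)\to\Gamma((T^*X)^{0,1}\otimes\mathcal K)$, and define $\bar\partial_m$ on $\mathcal K^{\otimes m}$ inductively by $\bar\partial_m(s_1\otimes s_2)=\bar\partial s_1\otimes s_2+s_1\otimes\bar\partial_{m-1}s_2$. Set $P_m(X,J)=\dim_{\mathbb C}\{s\in\Gamma(X,\mathcal K^{\otimes m}):\bar\partial_m s=0\}$ (finite). The Kodaira dimension $\kappa^J(X)$ is $-\infty$ if $P_m(X,J)=0$ for all $m\ge1$, and otherwise $\kappa^J(X)=\limsup_{m\to\infty}\frac{\log P_m(X,J)}{\log m}$. $J$ is integrable if it is induced by a complex manifold structure (equivalently its Nijenhuis tensor vanishes). *)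

theory Defs
  imports "HOL-Analysis.Analysis" "HOL-Library.Function_Algebras"
begin

section \<open>Smooth manifolds\<close>

text \<open>
  The model space of dimension \<open>d\<close> is \<^const>\<open>Euclidean_space\<close> \<open>d\<close>, i.e. the sequences
  \<open>x :: nat \<Rightarrow> real\<close> with \<open>x i = 0\<close> for \<open>i \<ge> d\<close>. Since \<open>d\<close> is an ordinary number
  rather than a type, statements may quantify over it.
\<close>

definition pdiff :: "nat \<Rightarrow> ((nat \<Rightarrow> real) \<Rightarrow> 'b::real_normed_vector) \<Rightarrow> (nat \<Rightarrow> real) \<Rightarrow> 'b" where
  "pdiff i f x = vector_derivative (\<lambda>t. f (x(i := t))) (at (x i))"

fun Ck_on :: "nat \<Rightarrow> nat \<Rightarrow> (nat \<Rightarrow> real) set \<Rightarrow> ((nat \<Rightarrow> real) \<Rightarrow> 'b::real_normed_vector) \<Rightarrow> bool" where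
  "Ck_on d 0 W f \<longleftrightarrow> continuous_on W f"
| "Ck_on d (Suc k) W f \<longleftrightarrow> continuous_on W f \<and>
     (\<forall>i<d. (\<forall>x\<in>W. (\<lambda>t. f (x(i := t))) differentiable (at (x i))) \<and> Ck_on d k W (pdiff i f))"

text \<open>Meant for sets \<open>W\<close> that are open in the model space.\<close>

definition smooth_on :: "nat \<Rightarrow> (nat \<Rightarrow> real) set \<Rightarrow> ((nat \<Rightarrow> real) \<Rightarrow> 'b::real_normed_vector) \<Rightarrow> bool" where
  "smooth_on d W f \<longleftrightarrow> (\<forall>k. Ck_on d k W f)"

text \<open>A chart is a pair of its domain and its coordinate map; values of the coordinate map
  outside the domain are irrelevant.\<close>

type_synonym 'a chart = "'a set \<times> ('a \<Rightarrow> nat \<Rightarrow> real)"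

definition chart_inv :: "'a chart \<Rightarrow> (nat \<Rightarrow> real) \<Rightarrow> 'a" where
  "chart_inv c = inv_into (fst c) (snd c)"

definition is_chart :: "nat \<Rightarrow> 'a topology \<Rightarrow> 'a chart \<Rightarrow> bool" where
  "is_chart d X c \<longleftrightarrow>
     openin X (fst c) \<and> openin (Euclidean_space d) (snd c ` fst c) \<and>
     homeomorphic_map (subtopology X (fst c)) (subtopology (Euclidean_space d) (snd c ` fst c)) (snd c)"

definition smooth_atlas :: "nat \<Rightarrow> 'a topology \<Rightarrow> 'a chart set \<Rightarrow> bool" where
  "smooth_atlas d X A \<longleftrightarrow>
     (\<forall>c\<in>A. is_chart d X c) \<and> (\<Union>c\<in>A. fst c) = topspace X \<and>
     (\<forall>c\<in>A. \<forall>c'\<in>A. \<forall>i<d.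
        smooth_on d (snd c ` (fst c \<inter> fst c')) (\<lambda>x. snd c' (chart_inv c x) i))"

definition smooth_manifold :: "nat \<Rightarrow> 'a topology \<Rightarrow> 'a chart set \<Rightarrow> bool" where
  "smooth_manifold d X A \<longleftrightarrow> Hausdorff_space X \<and> second_countable X \<and> smooth_atlas d X A"

text \<open>Jacobian matrix at \<open>p\<close> of the change of coordinates from \<open>c\<close> to \<open>c'\<close>.\<close>

definition jacobian :: "'a chart \<Rightarrow> 'a chart \<Rightarrow> 'a \<Rightarrow> nat \<Rightarrow> nat \<Rightarrow> real" where
  "jacobian c c' p i j = pdiff j (\<lambda>x. snd c' (chart_inv c x) i) (snd c p)"


section \<open>Almost complex structures\<close>

text \<open>
  Tensor fields are given in the classical way: by their local representative in every chart of
  the atlas, as a function of the chart and of the point, subject to the transformation law under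
  changes of coordinates. An almost complex structure is thus a family \<open>J\<close> where \<open>J c p\<close> is the
  matrix, in the coordinates \<open>c\<close>, of the endomorphism of the tangent space at \<open>p\<close>; only
  entries with indices below the dimension matter.
\<close>

type_synonym 'a acs = "'a chart \<Rightarrow> 'a \<Rightarrow> nat \<Rightarrow> nat \<Rightarrow> real"

definition mat_mult :: "nat \<Rightarrow> (nat \<Rightarrow> nat \<Rightarrow> real) \<Rightarrow> (nat \<Rightarrow> nat \<Rightarrow> real) \<Rightarrow> nat \<Rightarrow> nat \<Rightarrow> real" where
  "mat_mult d M N i j = (\<Sum>k<d. M i k * N k j)"

definition almost_complex_structure ::
  "nat \<Rightarrow> 'a topology \<Rightarrow> 'a chart set \<Rightarrow> 'a acs \<Rightarrow> bool" where
  "almost_complex_structure d X A J \<longleftrightarrow>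
     (\<forall>c\<in>A. \<forall>i<d. \<forall>j<d.
        smooth_on d (snd c ` fst c) (\<lambda>x. J c (chart_inv c x) i j) \<and>
        (\<forall>p\<in>fst c. mat_mult d (J c p) (J c p) i j = (if i = j then -1 else 0)) \<and>
        (\<forall>c'\<in>A. \<forall>p\<in>fst c \<inter> fst c'.
           mat_mult d (jacobian c c' p) (J c p) i j = mat_mult d (J c' p) (jacobian c c' p) i j))"

definition almost_complex_manifold ::
  "nat \<Rightarrow> 'a topology \<Rightarrow> 'a chart set \<Rightarrow> 'a acs \<Rightarrow> bool" where
  "almost_complex_manifold n X A J \<longleftrightarrow>
     smooth_manifold (2 * n) X A \<and> almost_complex_structure (2 * n) X A J"

text \<open>The complex coordinates on the model space of dimension \<open>2 * n\<close> are
  \<open>z\<^sub>k = x (2 * k) + \<i> * x (2 * k + 1)\<close>; \<open>std_J\<close> is multiplication by \<open>\<i>\<close>.\<close>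

definition std_J :: "nat \<Rightarrow> nat \<Rightarrow> real" where
  "std_J i j = (if even i \<and> j = Suc i then -1 else if odd i \<and> i = Suc j then 1 else 0)"

text \<open>A smooth coordinate change is holomorphic iff its Jacobian is complex linear
  (the Cauchy-Riemann equations).\<close>

definition complex_atlas :: "nat \<Rightarrow> 'a topology \<Rightarrow> 'a chart set \<Rightarrow> bool" where
  "complex_atlas n X B \<longleftrightarrow>
     smooth_atlas (2 * n) X B \<and>
     (\<forall>b\<in>B. \<forall>b'\<in>B. \<forall>p\<in>fst b \<inter> fst b'. \<forall>i<2*n. \<forall>j<2*n.
        mat_mult (2 * n) (jacobian b b' p) std_J i j = mat_mult (2 * n) std_J (jacobian b b' p) i j)"

text \<open>\<open>J\<close> is induced by a complex manifold structure on \<open>X\<close> whose underlying smooth structure is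
  the given one.\<close>

definition integrable_acs :: "nat \<Rightarrow> 'a topology \<Rightarrow> 'a chart set \<Rightarrow> 'a acs \<Rightarrow> bool" where
  "integrable_acs n X A J \<longleftrightarrow>
     (\<exists>B. complex_atlas n X B \<and> smooth_atlas (2 * n) X (A \<union> B) \<and>
        (\<forall>c\<in>A. \<forall>b\<in>B. \<forall>p\<in>fst c \<inter> fst b. \<forall>i<2*n. \<forall>j<2*n.
           mat_mult (2 * n) (jacobian c b p) (J c p) i j = mat_mult (2 * n) std_J (jacobian c b p) i j))"


section \<open>Complex differential forms and types\<close>

type_synonym cvec = "nat \<Rightarrow> complex"

text \<open>Coordinate representatives of complexified tangent vectors.\<close>

definition cvecs :: "nat \<Rightarrow> cvec set" where
  "cvecs d = {v. \<forall>i\<ge>d. v i = 0}"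

definition mat_app :: "nat \<Rightarrow> (nat \<Rightarrow> nat \<Rightarrow> real) \<Rightarrow> cvec \<Rightarrow> cvec" where
  "mat_app d M v = (\<lambda>i. if i < d then \<Sum>j<d. of_real (M i j) * v j else 0)"

text \<open>Vectors of type \<open>(1,0)\<close> and \<open>(0,1)\<close> with respect to \<open>M\<close> (where \<open>M\<^sup>2 = -1\<close>), and the
  projections onto them.\<close>

definition T10 :: "nat \<Rightarrow> (nat \<Rightarrow> nat \<Rightarrow> real) \<Rightarrow> cvec set" where
  "T10 d M = {v \<in> cvecs d. mat_app d M v = (\<lambda>i. \<i> * v i)}"

definition T01 :: "nat \<Rightarrow> (nat \<Rightarrow> nat \<Rightarrow> real) \<Rightarrow> cvec set" where
  "T01 d M = {v \<in> cvecs d. mat_app d M v = (\<lambda>i. - \<i> * v i)}"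

definition pr10 :: "nat \<Rightarrow> (nat \<Rightarrow> nat \<Rightarrow> real) \<Rightarrow> cvec \<Rightarrow> cvec" where
  "pr10 d M v = (\<lambda>i. (v i - \<i> * mat_app d M v i) / 2)"

definition pr01 :: "nat \<Rightarrow> (nat \<Rightarrow> nat \<Rightarrow> real) \<Rightarrow> cvec \<Rightarrow> cvec" where
  "pr01 d M v = (\<lambda>i. (v i + \<i> * mat_app d M v i) / 2)"

text \<open>Alternating complex multilinear \<open>k\<close>-forms on the complexified tangent space, as functions of
  the list of arguments. They vanish on lists that are not proper arguments, so that a form is
  determined by its values on proper arguments.\<close>

type_synonym cform = "cvec list \<Rightarrow> complex"

definition alternating_form :: "nat \<Rightarrow> nat \<Rightarrow> cform \<Rightarrow> bool" where
  "alternating_form d k \<omega> \<longleftrightarrow>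
     (\<forall>vs. \<not> (length vs = k \<and> set vs \<subseteq> cvecs d) \<longrightarrow> \<omega> vs = 0) \<and>
     (\<forall>vs i a v w. length vs = k \<and> set vs \<subseteq> cvecs d \<and> i < k \<and> v \<in> cvecs d \<and> w \<in> cvecs d \<longrightarrow>
        \<omega> (vs[i := (\<lambda>l. a * v l + w l)]) = a * \<omega> (vs[i := v]) + \<omega> (vs[i := w])) \<and>
     (\<forall>vs i j. length vs = k \<and> i < j \<and> j < k \<and> vs ! i = vs ! j \<longrightarrow> \<omega> vs = 0)"

text \<open>The space \<open>\<Lambda>\<^sup>p\<^sup>,\<^sup>q\<close>: a form of degree \<open>p + q\<close> belongs to it iff, on arguments each of which is
  of type \<open>(1,0)\<close> or \<open>(0,1)\<close>, it vanishes unless exactly \<open>p\<close> of them are of type \<open>(1,0)\<close>.\<close>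

definition form_of_type :: "nat \<Rightarrow> (nat \<Rightarrow> nat \<Rightarrow> real) \<Rightarrow> nat \<Rightarrow> nat \<Rightarrow> cform \<Rightarrow> bool" where
  "form_of_type d M p q \<omega> \<longleftrightarrow>
     alternating_form d (p + q) \<omega> \<and>
     (\<forall>vs. set vs \<subseteq> T10 d M \<union> T01 d M \<and> length (filter (\<lambda>v. v \<in> T10 d M) vs) \<noteq> p \<longrightarrow> \<omega> vs = 0)"

text \<open>The projection \<open>\<pi>\<^sup>p\<^sup>,\<^sup>q\<close>, from forms of degree \<open>p + q\<close> onto \<open>\<Lambda>\<^sup>p\<^sup>,\<^sup>q\<close>: expand
  \<open>\<omega> (v\<^sub>0, v\<^sub>1, \<dots>)\<close> by splitting every argument into its \<open>(1,0)\<close>- and \<open>(0,1)\<close>-parts and keep the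
  terms in which exactly \<open>p\<close> arguments are of type \<open>(1,0)\<close>.\<close>

definition type_proj :: "nat \<Rightarrow> (nat \<Rightarrow> nat \<Rightarrow> real) \<Rightarrow> nat \<Rightarrow> nat \<Rightarrow> cform \<Rightarrow> cform" where
  "type_proj d M p q \<omega> vs =
     (if length vs = p + q \<and> set vs \<subseteq> cvecs d
      then \<Sum>S | S \<subseteq> {..<p + q} \<and> card S = p.
             \<omega> (map (\<lambda>i. if i \<in> S then pr10 d M (vs ! i) else pr01 d M (vs ! i)) [0..<p + q])
      else 0)"

text \<open>Exterior derivative in the chart \<open>c\<close> of the form of degree \<open>k\<close> with representative
  \<open>\<omega>\<close> in this chart: for vectors with constant coordinates,
  \<open>d\<omega> (v\<^sub>0, \<dots>, v\<^sub>k) = \<Sum>\<^sub>a (-1)\<^sup>a v\<^sub>a (\<omega> (v\<^sub>0, \<dots>, v\<^sub>a omitted, \<dots>, v\<^sub>k))\<close>.\<close>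

definition ext_deriv :: "nat \<Rightarrow> nat \<Rightarrow> 'a chart \<Rightarrow> ('a \<Rightarrow> cform) \<Rightarrow> 'a \<Rightarrow> cform" where
  "ext_deriv d k c \<omega> p vs =
     (if length vs = Suc k \<and> set vs \<subseteq> cvecs d
      then \<Sum>a<Suc k. (-1) ^ a *
             (\<Sum>i<d. (vs ! a) i *
                pdiff i (\<lambda>x. \<omega> (chart_inv c x) (take a vs @ drop (Suc a) vs)) (snd c p))
      else 0)"

definition dbar ::
  "nat \<Rightarrow> 'a acs \<Rightarrow> nat \<Rightarrow> nat \<Rightarrow> 'a chart \<Rightarrow> ('a \<Rightarrow> cform) \<Rightarrow> 'a \<Rightarrow> cform" where
  "dbar d J p q c \<omega> x = type_proj d (J c x) p (q + 1) (ext_deriv d (p + q) c \<omega> x)"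


section \<open>Pluricanonical sections\<close>

text \<open>
  The fibre of the \<open>m\<close>-th tensor power of the canonical bundle \<open>\<K> = \<Lambda>\<^sup>n\<^sup>,\<^sup>0\<close>: functions of \<open>m\<close> blocks of
  \<open>n\<close> tangent vectors which are an \<open>(n,0)\<close>-form in each block. The tensor product of \<open>s\<close> and \<open>s'\<close>
  is \<open>(vs, vss) \<mapsto> s vs * s' vss\<close>.
\<close>

definition canonical_fibre ::
  "nat \<Rightarrow> (nat \<Rightarrow> nat \<Rightarrow> real) \<Rightarrow> nat \<Rightarrow> (cvec list list \<Rightarrow> complex) \<Rightarrow> bool" where
  "canonical_fibre n M m \<tau> \<longleftrightarrow>
     (\<forall>vss. length vss \<noteq> m \<longrightarrow> \<tau> vss = 0) \<and>
     (\<forall>vss j. length vss = m \<and> j < m \<longrightarrow>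
        form_of_type (2 * n) M n 0 (\<lambda>vs. \<tau> (vss[j := vs])))"

type_synonym 'a pluri = "'a chart \<Rightarrow> 'a \<Rightarrow> cvec list list \<Rightarrow> complex"

text \<open>Representatives of elements of \<open>(T\<^sup>*X)\<^sup>0\<^sup>,\<^sup>1 \<otimes> \<K>\<^sup>m\<close>; the additional vector argument belongs to the
  first factor.\<close>

type_synonym 'a pluri1 = "'a chart \<Rightarrow> 'a \<Rightarrow> cvec \<Rightarrow> cvec list list \<Rightarrow> complex"

text \<open>Smooth sections over an open set \<open>U\<close> of the \<open>m\<close>-th tensor power, extended by \<open>0\<close> outside \<open>U\<close>
  so that equality of functions is equality of sections.\<close>

definition pluri_section ::
  "nat \<Rightarrow> 'a chart set \<Rightarrow> 'a acs \<Rightarrow> 'a set \<Rightarrow> nat \<Rightarrow> 'a pluri \<Rightarrow> bool" where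
  "pluri_section n A J U m s \<longleftrightarrow>
     (\<forall>c p. \<not> (c \<in> A \<and> p \<in> fst c \<inter> U) \<longrightarrow> s c p = (\<lambda>_. 0)) \<and>
     (\<forall>c\<in>A. \<forall>p\<in>fst c \<inter> U. canonical_fibre n (J c p) m (s c p)) \<and>
     (\<forall>c\<in>A. \<forall>vss. smooth_on (2 * n) (snd c ` (fst c \<inter> U)) (\<lambda>x. s c (chart_inv c x) vss)) \<and>
     (\<forall>c\<in>A. \<forall>c'\<in>A. \<forall>p\<in>fst c \<inter> fst c' \<inter> U. \<forall>vss.
        length vss = m \<and> (\<forall>vs\<in>set vss. length vs = n \<and> set vs \<subseteq> cvecs (2 * n)) \<longrightarrow>
        s c' p (map (map (mat_app (2 * n) (jacobian c c' p))) vss) = s c p vss)"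

text \<open>\<open>\<partial>\<close>-bar of an \<open>(n,0)\<close>-form, regarded as an element of \<open>(T\<^sup>*X)\<^sup>0\<^sup>,\<^sup>1 \<otimes> \<K>\<close> through the
  isomorphism with \<open>\<Lambda>\<^sup>n\<^sup>,\<^sup>1\<close> under which \<open>\<alpha> \<otimes> \<kappa>\<close> corresponds to \<open>\<alpha> \<and> \<kappa>\<close>.\<close>

definition dbar_canonical ::
  "nat \<Rightarrow> 'a acs \<Rightarrow> 'a chart \<Rightarrow> ('a \<Rightarrow> cform) \<Rightarrow> 'a \<Rightarrow> cvec \<Rightarrow> cvec list \<Rightarrow> complex" where
  "dbar_canonical n J c \<kappa> p u vs =
     dbar (2 * n) J n 0 c \<kappa> p (pr01 (2 * n) (J c p) u # map (pr10 (2 * n) (J c p)) vs)"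

text \<open>
  The graph of the operator \<open>\<partial>\<close>-bar on the tensor powers of \<open>\<K>\<close>: \<open>dbar_pluri n X A J U m s t\<close> says
  that \<open>s\<close> is a smooth section over the open set \<open>U\<close> and that \<open>t\<close> is its image. As \<open>\<K>\<close> is a
  line bundle, every section of \<open>\<K>\<^sup>m\<^sup>+\<^sup>1\<close> is locally of the form \<open>s\<^sub>1 \<otimes> s\<^sub>2\<close> (globally it need not be),
  so the Leibniz rule determines the operator when applied locally. Values of \<open>t\<close> on
  argument lists of the wrong length are left unspecified.
\<close>

inductive dbar_pluri ::
  "nat \<Rightarrow> 'a topology \<Rightarrow> 'a chart set \<Rightarrow> 'a acs \<Rightarrow> 'a set \<Rightarrow> nat \<Rightarrow> 'a pluri \<Rightarrow> 'a pluri1 \<Rightarrow> bool"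
  for n X A J where
  one:
    "openin X U \<Longrightarrow> pluri_section n A J U 1 s \<Longrightarrow>
     (\<And>c p u vs. c \<in> A \<Longrightarrow> p \<in> fst c \<inter> U \<Longrightarrow>
        t c p u [vs] = dbar_canonical n J c (\<lambda>q ws. s c q [ws]) p u vs) \<Longrightarrow>
     dbar_pluri n X A J U 1 s t"
| tensor:
    "openin X U \<Longrightarrow> m \<ge> 1 \<Longrightarrow> pluri_section n A J U (Suc m) s \<Longrightarrow>
     (\<And>p. p \<in> U \<Longrightarrow>
        \<exists>V s1 s2 t1 t2. openin X V \<and> p \<in> V \<and> V \<subseteq> U \<and>
          dbar_pluri n X A J V 1 s1 t1 \<and> dbar_pluri n X A J V m s2 t2 \<and>
          (\<forall>c\<in>A. \<forall>q\<in>fst c \<inter> V. \<forall>vs vss. length vss = m \<longrightarrow>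
             s c q (vs # vss) = s1 c q [vs] * s2 c q vss \<and>
             (\<forall>u. t c q u (vs # vss) = t1 c q u [vs] * s2 c q vss + s1 c q [vs] * t2 c q u vss))) \<Longrightarrow>
     dbar_pluri n X A J U (Suc m) s t"

definition holomorphic_pluri ::
  "nat \<Rightarrow> 'a topology \<Rightarrow> 'a chart set \<Rightarrow> 'a acs \<Rightarrow> nat \<Rightarrow> 'a pluri set" where
  "holomorphic_pluri n X A J m = {s. dbar_pluri n X A J (topspace X) m s (\<lambda>_ _ _ _. 0)}"

definition scale_pluri :: "complex \<Rightarrow> 'a pluri \<Rightarrow> 'a pluri" where
  "scale_pluri a s = (\<lambda>c p vss. a * s c p vss)"

lemma vector_space_scale_pluri: "vector_space scale_pluri"
  by unfold_locales (auto simp: scale_pluri_def fun_eq_iff algebra_simps)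

definition plurigenus :: "nat \<Rightarrow> 'a topology \<Rightarrow> 'a chart set \<Rightarrow> 'a acs \<Rightarrow> nat \<Rightarrow> nat" where
  "plurigenus n X A J m = vector_space.dim scale_pluri (holomorphic_pluri n X A J m)"

text \<open>The logarithm of \<open>0\<close> is \<open>-\<infinity>\<close> here, whereas \<^term>\<open>ln (0::real)\<close> is \<open>0\<close>.\<close>

definition kodaira_dim :: "nat \<Rightarrow> 'a topology \<Rightarrow> 'a chart set \<Rightarrow> 'a acs \<Rightarrow> ereal" where
  "kodaira_dim n X A J =
     (if \<forall>m\<ge>1. plurigenus n X A J m = 0 then -\<infinity>
      else limsup (\<lambda>m. if plurigenus n X A J m = 0 then -\<infinity>
                       else ereal (ln (real (plurigenus n X A J m)) / ln (real m))))"

end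

theory Submission
  imports Defs "HOL-Complex_Analysis.Complex_Analysis" "Jordan_Normal_Form.Determinant"
    "HOL-Real_Asymp.Real_Asymp"
begin

text \<open>
  On a product of \<open>n\<close> compact Riemann surfaces whose last factor is a flat torus with coordinate
  \<open>x + \<i> y\<close>, twist the product structure by \<open>J \<partial>\<^sub>x = G\<^sup>-\<^sup>2 \<partial>\<^sub>y\<close> on the last factor, where \<open>G > 0\<close>
  is a function on the first factor. A function holomorphic for this structure is annihilated by
  commutators of vector fields of type \<open>(0,1)\<close>, hence independent of the torus wherever \<open>G\<close> is
  not locally constant; so the structure is not integrable. Pluricanonical sections are multiples \<open>F\<close>
  of a frame built from \<open>dx / G + \<i> G dy\<close>. On each torus fibre \<open>F\<close> is holomorphic for the complex
  structure of some elliptic curve, hence constant, so that the plurigenera are the products of those of the other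
  \<open>n - 1\<close> factors. Copies of \<open>y\<^sup>2 = 1 + x\<^sup>6\<close> (genus 2) and of a torus give \<open>0, \<dots>, n - 1\<close>, and the
  conic \<open>y\<^sup>2 = 1 + x\<^sup>2\<close> as first factor gives \<open>-\<infinity>\<close>.
\<close>

section \<open>Smooth functions on the model space\<close>

text \<open>The frame stays d-bar closed although \<open>J\<close> is not integrable:
  differentiating dx / G + i G dy in \<open>G\<close> gives a multiple of its conjugate, so d of the
  frame is, up to sign, dG / G wedge a form of type (n-1,1) that still contains dz_0. The dz_0-part
  of dG dies against it and the rest has type (n-1,2), so no part of type (n,1) remains. This is why
  \<open>G\<close> lives on a factor other than the twisted one. The frame is global because
  transitions of the last factor are translations. The operator on tensor powers is an inductively
  defined local relation, so it is met from both ends: products of differentials are split locally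
  as dz times a differential of lower weight, and rule induction reduces the operator on an
  arbitrary section to derivatives of its coefficient. Dimensions multiply by interpolation:
  finitely many points of each factor determine a differential, and their grid determines a section.
  The even exponent in y^2 = 1 + x^(2e) makes (1 / x, y / x^e) preserve the affine curve, so two
  equal copies glue; linear bounds on dimensions suffice for the limit of logarithms.\<close>

definition has_pd :: "nat \<Rightarrow> ((nat \<Rightarrow> real) \<Rightarrow> 'b::real_normed_vector) \<Rightarrow> 'b \<Rightarrow> (nat \<Rightarrow> real) \<Rightarrow> bool" where
  "has_pd i f f' x \<longleftrightarrow> ((\<lambda>t. f (x(i := t))) has_vector_derivative f') (at (x i))"

text \<open>\<open>pdiff\<close> returns an arbitrary value where the partial derivative does not
  exist. Computations therefore run on \<open>has_pd\<close>, which asserts existence too, and pass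
  to \<open>pdiff\<close> only at the end.\<close>

lemma has_pd_pdiff: "has_pd i f f' x \<Longrightarrow> pdiff i f x = f'"
  unfolding has_pd_def pdiff_def by (rule vector_derivative_at)

lemma Ck_on_has_pd:
  "Ck_on d (Suc k) W f \<Longrightarrow> i < d \<Longrightarrow> x \<in> W \<Longrightarrow> has_pd i f (pdiff i f x) x"
  by (simp add: has_pd_def pdiff_def vector_derivative_works)

lemma openin_Euclidean_space_iff:
  "openin (Euclidean_space d) W \<longleftrightarrow> (\<exists>T. open T \<and> W = T \<inter> {x. \<forall>i\<ge>d. x i = 0})"
  by (auto simp: Euclidean_space_def openin_subtopology euclidean_product_topology)

text \<open>Sets open in the model space are only relatively open among all sequences, but a change
  of a coordinate below \<open>d\<close> keeps the vanishing of those from \<open>d\<close> on. So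
  derivatives along coordinate lines are determined by the values on \<open>W\<close>.\<close>

lemma eventually_line_mem:
  assumes "openin (Euclidean_space d) W" "x \<in> W" "i < d"
  shows "eventually (\<lambda>t. x(i := t) \<in> W) (nhds (x i))"
proof -
  obtain T where T: "open T" "W = T \<inter> {x. \<forall>i\<ge>d. x i = 0}"
    using assms(1) by (auto simp: openin_Euclidean_space_iff)
  have "continuous_on UNIV (\<lambda>t. x(i := t))"
  proof (rule continuous_on_coordinatewise_then_product)
    show "continuous_on UNIV (\<lambda>t. (x(i := t)) j)" for j
      by (cases "j = i") auto
  qed
  then have op: "open ((\<lambda>t. x(i := t)) -` T)"
    using T(1) by (rule open_vimage[rotated])
  have "x i \<in> (\<lambda>t. x(i := t)) -` T"
    using T(2) assms(2) by auto
  with op have "eventually (\<lambda>t. t \<in> (\<lambda>t. x(i := t)) -` T) (nhds (x i))"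
    by (rule eventually_nhds_in_open)
  then show ?thesis
    by eventually_elim (use T(2) assms(2,3) in auto)
qed

lemma has_pd_cong:
  assumes "openin (Euclidean_space d) W" "x \<in> W" "i < d" "\<And>y. y \<in> W \<Longrightarrow> f y = g y"
  shows "has_pd i f f' x \<longleftrightarrow> has_pd i g f' x"
  unfolding has_pd_def
proof (rule has_vector_derivative_cong_ev)
  show "\<forall>\<^sub>F t in nhds (x i). t \<in> UNIV \<longrightarrow> f (x(i := t)) = g (x(i := t))"
    using eventually_line_mem[OF assms(1-3)] by eventually_elim (use assms(4) in auto)
qed (use assms in auto)

lemma pdiff_cong:
  assumes "openin (Euclidean_space d) W" "x \<in> W" "i < d" "\<And>y. y \<in> W \<Longrightarrow> f y = g y"
  shows "pdiff i f x = pdiff i g x"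
proof -
  have "has_pd i f f' x \<longleftrightarrow> has_pd i g f' x" for f'
    by (rule has_pd_cong[OF assms])
  then show ?thesis
    unfolding pdiff_def has_pd_def vector_derivative_def by simp
qed

text \<open>Derivatives at points of an open set depend on the values there alone. This allows
  \<open>chart_inv\<close>, arbitrary outside the chart image, to be replaced by explicit
  formulas.\<close>

lemma Ck_on_cong:
  fixes f g :: "(nat \<Rightarrow> real) \<Rightarrow> 'b::real_normed_vector"
  assumes "openin (Euclidean_space d) W" "\<And>y. y \<in> W \<Longrightarrow> f y = g y"
  shows "Ck_on d k W f \<longleftrightarrow> Ck_on d k W g"
  using assms(2)
proof (induction k arbitrary: f g)
  case 0
  then show ?case by (simp cong: continuous_on_cong)
next
  case (Suc k)
  have imp: "Ck_on d (Suc k) W g'" if "Ck_on d (Suc k) W f'" "\<And>y. y \<in> W \<Longrightarrow> f' y = g' y"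
    for f' g' :: "(nat \<Rightarrow> real) \<Rightarrow> 'b"
  proof -
    have "continuous_on W g'"
      using that by (simp cong: continuous_on_cong)
    moreover have "(\<lambda>t. g' (x(i := t))) differentiable (at (x i))" if "x \<in> W" "i < d" for x i
    proof -
      have "has_pd i f' (pdiff i f' x) x"
        using Ck_on_has_pd[OF \<open>Ck_on d (Suc k) W f'\<close>] that by blast
      then have "has_pd i g' (pdiff i f' x) x"
        using has_pd_cong[OF assms(1) that(1,2)] \<open>\<And>y. y \<in> W \<Longrightarrow> f' y = g' y\<close> by blast
      then show ?thesis
        unfolding has_pd_def by (rule differentiableI_vector)
    qed
    moreover have "Ck_on d k W (pdiff i g')" if "i < d" for i
    proof -
      have "Ck_on d k W (pdiff i f') \<longleftrightarrow> Ck_on d k W (pdiff i g')"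
        by (rule Suc.IH) (use pdiff_cong[OF assms(1) _ that] \<open>\<And>y. y \<in> W \<Longrightarrow> f' y = g' y\<close> in blast)
      then show ?thesis
        using \<open>Ck_on d (Suc k) W f'\<close> that by simp
    qed
    ultimately show ?thesis by simp
  qed
  show ?case
    using imp[of f g] imp[of g f] Suc.prems by metis
qed

text \<open>Replaces \<open>pdiff\<close> in the recursion by a known derivative \<open>f'\<close>,
  which has to agree with it on \<open>W\<close> only; the inductions below then run on closed
  formulas.\<close>

lemma Ck_on_SucI:
  assumes "openin (Euclidean_space d) W" "continuous_on W f"
    and "\<And>i x. i < d \<Longrightarrow> x \<in> W \<Longrightarrow> has_pd i f (f' i x) x"
    and "\<And>i. i < d \<Longrightarrow> Ck_on d k W (f' i)"
  shows "Ck_on d (Suc k) W f"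
proof -
  have "Ck_on d k W (pdiff i f)" if "i < d" for i
    using Ck_on_cong[OF assms(1), of "pdiff i f" "f' i" k] has_pd_pdiff[OF assms(3)] assms(4) that by blast
  moreover have "(\<lambda>t. f (x(i := t))) differentiable (at (x i))" if "i < d" "x \<in> W" for i x
    using assms(3)[OF that] unfolding has_pd_def by (rule differentiableI_vector)
  ultimately show ?thesis using assms(2) by simp
qed

lemma Ck_on_continuous: "Ck_on d k W f \<Longrightarrow> continuous_on W f"
  by (cases k) auto

lemma Ck_on_SucD: "Ck_on d (Suc k) W f \<Longrightarrow> Ck_on d k W f"
proof (induction k arbitrary: f)
  case 0
  then show ?case by simp
next
  case (Suc k)
  have "Ck_on d k W (pdiff i f)" if "i < d" for i
    using Suc.prems that by (intro Suc.IH) simp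
  then show ?case using Suc.prems by simp
qed

lemma Ck_on_subset: "Ck_on d k W f \<Longrightarrow> V \<subseteq> W \<Longrightarrow> Ck_on d k V f"
  by (induction k arbitrary: f) (auto intro: continuous_on_subset)

lemma has_pd_const [simp]: "has_pd i (\<lambda>x. c) 0 x"
  by (simp add: has_pd_def)

lemma Ck_on_const:
  assumes "openin (Euclidean_space d) W"
  shows "Ck_on d k W (\<lambda>x. c)"
proof (induction k arbitrary: c)
  case (Suc k)
  show ?case
    by (rule Ck_on_SucI[OF assms, where f' = "\<lambda>i x. 0"]) (use Suc in auto)
qed auto

lemma has_pd_add: "has_pd i f f' x \<Longrightarrow> has_pd i g g' x \<Longrightarrow> has_pd i (\<lambda>x. f x + g x) (f' + g') x"
  unfolding has_pd_def by (rule has_vector_derivative_add)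

lemma Ck_on_add:
  assumes "openin (Euclidean_space d) W"
  shows "Ck_on d k W f \<Longrightarrow> Ck_on d k W g \<Longrightarrow> Ck_on d k W (\<lambda>x. f x + g x)"
proof (induction k arbitrary: f g)
  case (Suc k)
  show ?case
  proof (rule Ck_on_SucI[OF assms, where f' = "\<lambda>i x. pdiff i f x + pdiff i g x"])
    show "continuous_on W (\<lambda>x. f x + g x)"
      using Suc.prems by (intro continuous_intros) (auto dest: Ck_on_continuous)
  qed (use Suc in \<open>auto intro!: has_pd_add Ck_on_has_pd simp del: Ck_on.simps, auto\<close>)
qed (auto intro: continuous_intros)

lemma has_pd_bilinear:
  assumes "bounded_bilinear pr" "has_pd i f f' x" "has_pd i g g' x"
  shows "has_pd i (\<lambda>x. pr (f x) (g x)) (pr (f x) g' + pr f' (g x)) x"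
  using bounded_bilinear.has_vector_derivative[OF assms(1) assms(2,3)[unfolded has_pd_def]]
  unfolding has_pd_def by simp

text \<open>The product rule gives two products of the same kind, so the induction needs
  \<open>f\<close> and \<open>g\<close> themselves at the lower order, which
  \<open>Ck_on_SucD\<close> supplies.\<close>

lemma Ck_on_bilinear:
  assumes "openin (Euclidean_space d) W" "bounded_bilinear pr"
  shows "Ck_on d k W f \<Longrightarrow> Ck_on d k W g \<Longrightarrow> Ck_on d k W (\<lambda>x. pr (f x) (g x))"
proof (induction k arbitrary: f g)
  case 0
  then show ?case using bounded_bilinear.continuous_on[OF assms(2)] by auto
next
  case (Suc k)
  show ?case
  proof (rule Ck_on_SucI[OF assms(1), where f' = "\<lambda>i x. pr (f x) (pdiff i g x) + pr (pdiff i f x) (g x)"])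
    show "continuous_on W (\<lambda>x. pr (f x) (g x))"
      using Suc.prems by (intro bounded_bilinear.continuous_on[OF assms(2)]) (auto dest: Ck_on_continuous)
    show "has_pd i (\<lambda>x. pr (f x) (g x)) (pr (f x) (pdiff i g x) + pr (pdiff i f x) (g x)) x"
      if "i < d" "x \<in> W" for i x
      using Ck_on_has_pd[OF Suc.prems(1) that] Ck_on_has_pd[OF Suc.prems(2) that]
      by (intro has_pd_bilinear[OF assms(2)])
    show "Ck_on d k W (\<lambda>x. pr (f x) (pdiff i g x) + pr (pdiff i f x) (g x))" if "i < d" for i
      using Suc.prems that Suc.prems[THEN Ck_on_SucD]
      by (intro Ck_on_add[OF assms(1)] Suc.IH) auto
  qed
qed

lemma has_pd_linear:
  assumes "bounded_linear L" "has_pd i f f' x"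
  shows "has_pd i (\<lambda>x. L (f x)) (L f') x"
  using assms bounded_linear.has_vector_derivative unfolding has_pd_def by blast

lemma Ck_on_linear:
  assumes "openin (Euclidean_space d) W" "bounded_linear L"
  shows "Ck_on d k W f \<Longrightarrow> Ck_on d k W (\<lambda>x. L (f x))"
proof (induction k arbitrary: f)
  case 0
  then show ?case using bounded_linear.continuous_on[OF assms(2)] by auto
next
  case (Suc k)
  show ?case
  proof (rule Ck_on_SucI[OF assms(1), where f' = "\<lambda>i x. L (pdiff i f x)"])
    show "continuous_on W (\<lambda>x. L (f x))"
      using Suc.prems by (intro bounded_linear.continuous_on[OF assms(2)]) (auto dest: Ck_on_continuous)
  qed (use Suc in \<open>auto intro!: has_pd_linear[OF assms(2)] Ck_on_has_pd simp del: Ck_on.simps, auto\<close>)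
qed

lemma has_pd_inverse:
  fixes f :: "(nat \<Rightarrow> real) \<Rightarrow> 'b::real_normed_field"
  assumes "has_pd i f f' x" "f x \<noteq> 0"
  shows "has_pd i (\<lambda>x. inverse (f x)) (- (inverse (f x) * f' * inverse (f x))) x"
proof -
  have "((\<lambda>t. inverse (f (x(i := t)))) has_derivative
      (\<lambda>h. - (inverse (f (x(i := x i))) * (h *\<^sub>R f') * inverse (f (x(i := x i)))))) (at (x i))"
    using assms unfolding has_pd_def has_vector_derivative_def
    by (intro Deriv.has_derivative_inverse) auto
  then show ?thesis
    unfolding has_pd_def has_vector_derivative_def by (simp add: algebra_simps)
qed

lemma Ck_on_inverse:
  fixes f :: "(nat \<Rightarrow> real) \<Rightarrow> 'b::real_normed_field"
  assumes "openin (Euclidean_space d) W" "\<And>x. x \<in> W \<Longrightarrow> f x \<noteq> 0"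
  shows "Ck_on d k W f \<Longrightarrow> Ck_on d k W (\<lambda>x. inverse (f x))"
proof (induction k)
  case 0
  then show ?case using assms(2) by (auto intro: continuous_intros)
next
  case (Suc k)
  show ?case
  proof (rule Ck_on_SucI[OF assms(1), where f' = "\<lambda>i x. - (inverse (f x) * pdiff i f x * inverse (f x))"])
    show "continuous_on W (\<lambda>x. inverse (f x))"
      using Suc.prems assms(2) by (intro continuous_intros) (auto dest: Ck_on_continuous)
    show "has_pd i (\<lambda>x. inverse (f x)) (- (inverse (f x) * pdiff i f x * inverse (f x))) x"
      if "i < d" "x \<in> W" for i x
      using Ck_on_has_pd[OF Suc.prems that] assms(2)[OF that(2)] by (rule has_pd_inverse)
    show "Ck_on d k W (\<lambda>x. - (inverse (f x) * pdiff i f x * inverse (f x)))" if "i < d" for i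
      using Suc.prems that Suc.prems[THEN Ck_on_SucD] Suc.IH
      by (intro Ck_on_linear[OF assms(1) bounded_linear_minus[OF bounded_linear_ident]]
          Ck_on_bilinear[OF assms(1) bounded_bilinear_mult]) auto
  qed
qed

abbreviation (input) zc :: "nat \<Rightarrow> (nat \<Rightarrow> real) \<Rightarrow> complex" where
  "zc l x \<equiv> Complex (x (2 * l)) (x (Suc (2 * l)))"

lemma continuous_on_zc [continuous_intros]: "continuous_on W (zc l)"
  unfolding Complex_eq
  by (intro continuous_intros continuous_on_subset[OF continuous_on_product_coordinates]) auto

lemma has_pd_holomorphic:
  assumes "(F has_field_derivative F') (at (zc l x))"
  shows "has_pd i (\<lambda>x. F (zc l x)) (if i = 2 * l then F' else if i = Suc (2 * l) then \<i> * F' else 0) x"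
proof -
  let ?D = "if i = 2 * l then 1 else if i = Suc (2 * l) then \<i> else 0 :: complex"
  have "((\<lambda>t. zc l (x(i := t))) has_vector_derivative ?D) (at (x i))"
    by (auto simp: Complex_eq fun_upd_def intro!: derivative_eq_intros)
  moreover have "(F has_field_derivative F') (at (zc l (x(i := x i))))"
    using assms by simp
  ultimately have "((F \<circ> (\<lambda>t. zc l (x(i := t)))) has_vector_derivative (?D * F')) (at (x i))"
    by (rule field_vector_diff_chain_at)
  then show ?thesis
    unfolding has_pd_def o_def by (rule has_vector_derivative_eq_rhs) auto
qed

text \<open>Every partial derivative of \<open>F (zc l x)\<close> is a constant times
  \<open>deriv F (zc l x)\<close>, and \<open>deriv F\<close> is again holomorphic on
  \<open>S\<close>; hence the induction ranges over all holomorphic functions at once.\<close>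

lemma Ck_on_holomorphic:
  assumes "openin (Euclidean_space d) W" "open S" "\<And>x. x \<in> W \<Longrightarrow> zc l x \<in> S"
  shows "F holomorphic_on S \<Longrightarrow> Ck_on d k W (\<lambda>x. F (zc l x))"
proof (induction k arbitrary: F)
  case 0
  then have "continuous_on W (\<lambda>x. F (zc l x))"
    by (rule continuous_on_compose2[OF holomorphic_on_imp_continuous_on continuous_on_zc]) (use assms(3) in blast)
  then show ?case by simp
next
  case (Suc k)
  have d: "deriv F holomorphic_on S"
    using Suc.prems assms(2) by (rule holomorphic_deriv)
  show ?case
  proof (rule Ck_on_SucI[OF assms(1), where f' = "\<lambda>i x. (if i = 2 * l then 1 else if i = Suc (2 * l) then \<i> else 0) * deriv F (zc l x)"])
    show "continuous_on W (\<lambda>x. F (zc l x))"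
      by (rule continuous_on_compose2[OF holomorphic_on_imp_continuous_on[OF Suc.prems] continuous_on_zc])
        (use assms(3) in blast)
    fix i x assume "x \<in> W"
    then have "(F has_field_derivative deriv F (zc l x)) (at (zc l x))"
      using holomorphic_derivI[OF Suc.prems assms(2)] assms(3) by blast
    from has_pd_holomorphic[OF this, of i]
    show "has_pd i (\<lambda>x. F (zc l x)) ((if i = 2 * l then 1 else if i = Suc (2 * l) then \<i> else 0) * deriv F (zc l x)) x"
      by (auto split: if_splits)
  next
    show "Ck_on d k W (\<lambda>x. (if i = 2 * l then 1 else if i = Suc (2 * l) then \<i> else 0) * deriv F (zc l x))" for i
      by (intro Ck_on_bilinear[OF assms(1) bounded_bilinear_mult] Ck_on_const[OF assms(1)] Suc.IH d)
  qed
qed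

context
  fixes d :: nat and W :: "(nat \<Rightarrow> real) set"
  assumes W: "openin (Euclidean_space d) W"
begin

lemma smooth_on_const: "smooth_on d W (\<lambda>x. c)"
  unfolding smooth_on_def using Ck_on_const[OF W] by blast

lemma smooth_on_add: "smooth_on d W f \<Longrightarrow> smooth_on d W g \<Longrightarrow> smooth_on d W (\<lambda>x. f x + g x)"
  unfolding smooth_on_def using Ck_on_add[OF W] by blast

lemma smooth_on_linear: "bounded_linear L \<Longrightarrow> smooth_on d W f \<Longrightarrow> smooth_on d W (\<lambda>x. L (f x))"
  unfolding smooth_on_def using Ck_on_linear[OF W] by blast

lemma smooth_on_mult:
  fixes f g :: "(nat \<Rightarrow> real) \<Rightarrow> 'b::real_normed_algebra"
  shows "smooth_on d W f \<Longrightarrow> smooth_on d W g \<Longrightarrow> smooth_on d W (\<lambda>x. f x * g x)"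
  unfolding smooth_on_def using Ck_on_bilinear[OF W bounded_bilinear_mult] by blast

lemma smooth_on_inverse:
  fixes f :: "(nat \<Rightarrow> real) \<Rightarrow> 'b::real_normed_field"
  shows "smooth_on d W f \<Longrightarrow> (\<And>x. x \<in> W \<Longrightarrow> f x \<noteq> 0) \<Longrightarrow> smooth_on d W (\<lambda>x. inverse (f x))"
  unfolding smooth_on_def using Ck_on_inverse[OF W] by blast

lemma smooth_on_holomorphic:
  "open S \<Longrightarrow> (\<And>x. x \<in> W \<Longrightarrow> zc l x \<in> S) \<Longrightarrow> F holomorphic_on S \<Longrightarrow> smooth_on d W (\<lambda>x. F (zc l x))"
  unfolding smooth_on_def using Ck_on_holomorphic[OF W] by blast

lemma smooth_on_cong:
  "(\<And>x. x \<in> W \<Longrightarrow> f x = g x) \<Longrightarrow> smooth_on d W f \<longleftrightarrow> smooth_on d W g"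
  unfolding smooth_on_def using Ck_on_cong[OF W, of f g] by blast

lemma smooth_on_sum:
  assumes "\<And>a. a \<in> A \<Longrightarrow> smooth_on d W (f a)"
  shows "smooth_on d W (\<lambda>x. \<Sum>a\<in>A. f a x)"
  using assms
proof (induction A rule: infinite_finite_induct)
  case (insert a A)
  then show ?case
    using smooth_on_add[of "f a" "\<lambda>x. \<Sum>a\<in>A. f a x"] by simp
qed (simp_all add: smooth_on_const)

lemma smooth_on_prod:
  fixes f :: "'a \<Rightarrow> (nat \<Rightarrow> real) \<Rightarrow> 'b::real_normed_field"
  assumes "\<And>a. a \<in> A \<Longrightarrow> smooth_on d W (f a)"
  shows "smooth_on d W (\<lambda>x. \<Prod>a\<in>A. f a x)"
  using assms
proof (induction A rule: infinite_finite_induct)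
  case (insert a A)
  then show ?case
    using smooth_on_mult[of "f a" "\<lambda>x. \<Prod>a\<in>A. f a x"] by simp
qed (simp_all add: smooth_on_const)

end

lemma smooth_on_pdiff:
  assumes "smooth_on d W f" "i < d"
  shows "smooth_on d W (pdiff i f)"
proof -
  have "Ck_on d k W (pdiff i f)" for k
  proof -
    have "Ck_on d (Suc k) W f"
      using assms(1) unfolding smooth_on_def by blast
    then show ?thesis using assms(2) by simp
  qed
  then show ?thesis unfolding smooth_on_def by blast
qed

lemma smooth_on_has_pd: "smooth_on d W f \<Longrightarrow> i < d \<Longrightarrow> x \<in> W \<Longrightarrow> has_pd i f (pdiff i f x) x"
  unfolding smooth_on_def using Ck_on_has_pd by blast

lemma smooth_on_continuous: "smooth_on d W f \<Longrightarrow> continuous_on W f"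
  unfolding smooth_on_def using Ck_on_continuous by blast

lemma smooth_on_subset: "smooth_on d W f \<Longrightarrow> V \<subseteq> W \<Longrightarrow> smooth_on d V f"
  unfolding smooth_on_def using Ck_on_subset by blast

section \<open>Symmetry of mixed partial derivatives\<close>

definition upd2 :: "(nat \<Rightarrow> real) \<Rightarrow> nat \<Rightarrow> nat \<Rightarrow> real \<times> real \<Rightarrow> nat \<Rightarrow> real" where
  "upd2 x i j = (\<lambda>(s, t). x(i := s, j := t))"

lemma continuous_on_upd2: "continuous_on UNIV (upd2 x i j)"
proof (rule continuous_on_coordinatewise_then_product)
  show "continuous_on UNIV (\<lambda>p. upd2 x i j p k)" for k
    by (cases "k = j"; cases "k = i") (auto simp: upd2_def case_prod_beta intro!: continuous_intros)
qed

lemma open_upd2: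
  assumes "openin (Euclidean_space d) W" "upd2 x i j p \<in> W" "i < d" "j < d"
  shows "\<exists>T. open T \<and> p \<in> T \<and> (\<forall>q\<in>T. upd2 x i j q \<in> W)"
proof -
  obtain T where T: "open T" "W = T \<inter> {x. \<forall>i\<ge>d. x i = 0}"
    using assms(1) by (auto simp: openin_Euclidean_space_iff)
  have "open (upd2 x i j -` T)"
    using T(1) continuous_on_upd2 by (rule open_vimage)
  moreover have "p \<in> upd2 x i j -` T"
    using T assms by auto
  moreover have "upd2 x i j q \<in> W" if "q \<in> upd2 x i j -` T" for q
  proof -
    have "x k = 0" if "k \<ge> d" for k
      using T(2) assms(2-4) that by (force simp: upd2_def case_prod_beta split: if_splits)
    then show ?thesis
      using that T(2) assms(3,4) by (auto simp: upd2_def case_prod_beta)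
  qed
  ultimately show ?thesis by blast
qed

text \<open>The mean value theorem is applied twice: in \<open>s\<close> to the difference of
  \<open>f\<close> between the heights \<open>b + h\<close> and \<open>b\<close>, then in
  \<open>t\<close> to \<open>pdiff i f\<close> along the vertical segment found.\<close>

lemma second_difference:
  fixes f :: "(nat \<Rightarrow> real) \<Rightarrow> real"
  assumes "smooth_on d W f" and W: "openin (Euclidean_space d) W" and ij: "i < d" "j < d" "i \<noteq> j" and h: "0 < h"
    and sub: "\<And>s t. a \<le> s \<Longrightarrow> s \<le> a + h \<Longrightarrow> b \<le> t \<Longrightarrow> t \<le> b + h \<Longrightarrow> x(i := s, j := t) \<in> W"
  shows "\<exists>s t. a < s \<and> s < a + h \<and> b < t \<and> t < b + h \<and>
    f (x(i := a + h, j := b + h)) - f (x(i := a, j := b + h)) - f (x(i := a + h, j := b)) + f (x(i := a, j := b))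
      = h * h * pdiff j (pdiff i f) (x(i := s, j := t))"
proof -
  have sm: "smooth_on d W (pdiff i f)"
    using smooth_on_pdiff[OF assms(1) ij(1)] .
  have di: "((\<lambda>u. f (x(i := u, j := t))) has_real_derivative pdiff i f (x(i := s, j := t))) (at s)"
    if "a \<le> s" "s \<le> a + h" "b \<le> t" "t \<le> b + h" for s t
    using smooth_on_has_pd[OF assms(1) ij(1) sub[OF that]] ij(3)
    unfolding has_pd_def has_real_derivative_iff_has_vector_derivative by (simp add: fun_upd_twist)
  have dj: "((\<lambda>u. pdiff i f (x(i := s, j := u))) has_real_derivative pdiff j (pdiff i f) (x(i := s, j := t))) (at t)"
    if "a \<le> s" "s \<le> a + h" "b \<le> t" "t \<le> b + h" for s t
    using smooth_on_has_pd[OF sm ij(2) sub[OF that]] ij(3)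
    unfolding has_pd_def has_real_derivative_iff_has_vector_derivative by simp
  have "\<exists>s. a < s \<and> s < a + h \<and>
      (f (x(i := a + h, j := b + h)) - f (x(i := a + h, j := b))) - (f (x(i := a, j := b + h)) - f (x(i := a, j := b)))
      = (a + h - a) * (pdiff i f (x(i := s, j := b + h)) - pdiff i f (x(i := s, j := b)))"
    using h by (intro MVT2[of a "a + h" "\<lambda>s. f (x(i := s, j := b + h)) - f (x(i := s, j := b))"
          "\<lambda>s. pdiff i f (x(i := s, j := b + h)) - pdiff i f (x(i := s, j := b))"] DERIV_diff di) auto
  then obtain s where s: "a < s" "s < a + h"
      "(f (x(i := a + h, j := b + h)) - f (x(i := a + h, j := b))) - (f (x(i := a, j := b + h)) - f (x(i := a, j := b)))
      = (a + h - a) * (pdiff i f (x(i := s, j := b + h)) - pdiff i f (x(i := s, j := b)))"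
    by auto
  have "\<exists>t. b < t \<and> t < b + h \<and>
      pdiff i f (x(i := s, j := b + h)) - pdiff i f (x(i := s, j := b)) =
      (b + h - b) * pdiff j (pdiff i f) (x(i := s, j := t))"
    using h s(1,2) by (intro MVT2 dj) auto
  then obtain t where t: "b < t" "t < b + h"
      "pdiff i f (x(i := s, j := b + h)) - pdiff i f (x(i := s, j := b)) =
      (b + h - b) * pdiff j (pdiff i f) (x(i := s, j := t))"
    by auto
  show ?thesis
    using s t by (intro exI[of _ s] exI[of _ t]) (simp add: algebra_simps)
qed

text \<open>The second difference over a small square is symmetric in the two directions. By
  \<open>second_difference\<close> one mixed derivative at some point of the square therefore equals
  the other at a second point, and continuity does the rest.\<close>

lemma pdiff_commute:
  fixes f :: "(nat \<Rightarrow> real) \<Rightarrow> real"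
  assumes f: "smooth_on d W f" and W: "openin (Euclidean_space d) W" and ij: "i < d" "j < d" "i \<noteq> j" and x: "x \<in> W"
  shows "pdiff i (pdiff j f) x = pdiff j (pdiff i f) x"
proof (rule ccontr)
  assume ne: "\<not> ?thesis"
  define p where "p = (x i, x j)"
  have up: "upd2 x i j p = x"
    by (simp add: upd2_def p_def)
  define A where "A = (\<lambda>q. pdiff i (pdiff j f) (upd2 x i j q))"
  define B where "B = (\<lambda>q. pdiff j (pdiff i f) (upd2 x i j q))"
  obtain T where T: "open T" "p \<in> T" "\<And>q. q \<in> T \<Longrightarrow> upd2 x i j q \<in> W"
    using open_upd2[OF W, of x i j p] up x ij by auto
  have sm: "smooth_on d W (pdiff i (pdiff j f))" "smooth_on d W (pdiff j (pdiff i f))"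
    using ij f by (auto intro!: smooth_on_pdiff)
  have cont: "continuous_on T A" "continuous_on T B"
    unfolding A_def B_def
    by (rule continuous_on_compose2[OF smooth_on_continuous[OF sm(1)] continuous_on_subset[OF continuous_on_upd2]],
        use T in auto)
      (rule continuous_on_compose2[OF smooth_on_continuous[OF sm(2)] continuous_on_subset[OF continuous_on_upd2]],
        use T in auto)
  have AB: "A p \<noteq> B p"
    using ne by (simp add: A_def B_def up)
  \<comment> \<open>Half the gap: a value within \<open>e\<close> of \<open>A p\<close> cannot equal
    a value within \<open>e\<close> of \<open>B p\<close>.\<close>
  define e where "e = \<bar>A p - B p\<bar> / 2"
  have e: "e > 0" using AB by (simp add: e_def)
  have "isCont A p" "isCont B p"
    using cont T(1,2) by (simp_all add: continuous_on_eq_continuous_at)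
  then obtain d1 d2 where d: "d1 > 0" "d2 > 0" "\<And>q. dist q p < d1 \<Longrightarrow> dist (A q) (A p) < e"
      "\<And>q. dist q p < d2 \<Longrightarrow> dist (B q) (B p) < e"
    using e unfolding continuous_at_eps_delta by metis
  obtain d3 where d3: "d3 > 0" "ball p d3 \<subseteq> T"
    using T(1,2) openE by blast
  \<comment> \<open>Points of the square with side \<open>h\<close> have distance at most
    \<open>2 * h\<close> from \<open>p\<close>, so a third of the smallest radius keeps the square
    inside all three balls.\<close>
  define h where "h = min d1 (min d2 d3) / 3"
  have h: "h > 0" using d d3 by (simp add: h_def)
  have close: "dist (s, t) p < min d1 (min d2 d3)" if "x i \<le> s" "s \<le> x i + h" "x j \<le> t" "t \<le> x j + h" for s t
  proof -
    have "dist (s, t) p \<le> \<bar>s - x i\<bar> + \<bar>t - x j\<bar>"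
      unfolding p_def dist_prod_def
      using sqrt_sum_squares_le_sum_abs[of "s - x i" "t - x j"] by (simp add: dist_real_def)
    also have "\<dots> \<le> 2 * h" using that by auto
    also have "\<dots> < min d1 (min d2 d3)" using h by (auto simp: h_def)
    finally show ?thesis .
  qed
  have inW: "x(i := s, j := t) \<in> W" if "x i \<le> s" "s \<le> x i + h" "x j \<le> t" "t \<le> x j + h" for s t
    using T(3)[of "(s, t)"] d3(2) close[OF that] by (auto simp: upd2_def dist_commute)
  obtain s t where st: "x i < s" "s < x i + h" "x j < t" "t < x j + h"
    "f (x(i := x i + h, j := x j + h)) - f (x(i := x i, j := x j + h)) - f (x(i := x i + h, j := x j)) + f (x(i := x i, j := x j))
      = h * h * B (s, t)"
    using second_difference[OF f W ij h, of "x i" "x j" x] inW by (auto simp: B_def upd2_def)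
  have inW': "x(j := t, i := s) \<in> W" if "x i \<le> s" "s \<le> x i + h" "x j \<le> t" "t \<le> x j + h" for s t
    using inW[OF that] ij(3) by (simp add: fun_upd_twist)
  obtain t' s' where st': "x i < s'" "s' < x i + h" "x j < t'" "t' < x j + h"
    "f (x(j := x j + h, i := x i + h)) - f (x(j := x j, i := x i + h)) - f (x(j := x j + h, i := x i)) + f (x(j := x j, i := x i))
      = h * h * pdiff i (pdiff j f) (x(j := t', i := s'))"
    using second_difference[OF f W ij(2,1) ij(3)[symmetric] h, of "x j" "x i" x] inW' by auto
  have "x(i := x i + h, j := x j) = x(i := x i + h)"
    using ij(3) by auto
  then have "f (x(i := x i + h, j := x j + h)) - f (x(i := x i + h)) - f (x(j := x j + h)) + f x = h * h * A (s', t')"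
    "f (x(i := x i + h, j := x j + h)) - f (x(j := x j + h)) - f (x(i := x i + h)) + f x = h * h * B (s, t)"
    using st(5) st'(5) ij(3) unfolding A_def upd2_def by (simp_all add: fun_upd_twist[of j i])
  then have "h * h * A (s', t') = h * h * B (s, t)" by linarith
  then have "A (s', t') = B (s, t)" using h by simp
  moreover have "dist (A (s', t')) (A p) < e" "dist (B (s, t)) (B p) < e"
    using d(3)[of "(s', t')"] d(4)[of "(s, t)"] close[of s' t'] close[of s t] st st' by auto
  ultimately show False
    unfolding e_def dist_real_def by (auto simp: abs_if split: if_splits)
qed

lemma pdiff_mult:
  fixes f g :: "(nat \<Rightarrow> real) \<Rightarrow> real"
  assumes "smooth_on d W f" "smooth_on d W g" "i < d" "x \<in> W"
  shows "pdiff i (\<lambda>x. f x * g x) x = f x * pdiff i g x + pdiff i f x * g x"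
  using has_pd_bilinear[OF bounded_bilinear_mult smooth_on_has_pd[OF assms(1,3,4)] smooth_on_has_pd[OF assms(2,3,4)]]
  by (rule has_pd_pdiff)

lemma pdiff_minus:
  assumes "smooth_on d W f" "i < d" "x \<in> W"
  shows "pdiff i (\<lambda>x. - f x) x = - pdiff i f x"
  using has_pd_linear[OF bounded_linear_minus[OF bounded_linear_ident] smooth_on_has_pd[OF assms]]
  by (rule has_pd_pdiff)

text \<open>\<open>P + \<i> Q\<close> is annihilated by \<open>D = \<partial>\<^sub>k + \<i> \<partial>\<^sub>l\<close> and by \<open>\<partial>\<^sub>b - \<i> h \<partial>\<^sub>a\<close>, hence by their commutator
  \<open>- \<i> (D h) \<partial>\<^sub>a\<close>.\<close>

lemma commutator_annihilates:
  fixes P Q h :: "(nat \<Rightarrow> real) \<Rightarrow> real"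
  assumes W: "openin (Euclidean_space d) W" and sm: "smooth_on d W P" "smooth_on d W Q" "smooth_on d W h"
    and ix: "k < d" "l < d" "a < d" "b < d" "distinct [k, l, a, b]"
    and eq: "\<And>y. y \<in> W \<Longrightarrow> pdiff k P y = pdiff l Q y" "\<And>y. y \<in> W \<Longrightarrow> pdiff l P y = - pdiff k Q y"
      "\<And>y. y \<in> W \<Longrightarrow> pdiff b P y = - (h y * pdiff a Q y)" "\<And>y. y \<in> W \<Longrightarrow> pdiff b Q y = h y * pdiff a P y"
    and x: "x \<in> W" and nz: "pdiff k h x \<noteq> 0 \<or> pdiff l h x \<noteq> 0"
  shows "pdiff a P x = 0" "pdiff a Q x = 0"
proof -
  have com: "pdiff i (pdiff j f) x = pdiff j (pdiff i f) x" if "smooth_on d W f" "i < d" "j < d" "i \<noteq> j"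
    for i j and f :: "(nat \<Rightarrow> real) \<Rightarrow> real"
    using pdiff_commute[OF that(1) W that(2-4) x] .
  have smd: "smooth_on d W (pdiff i f)" if "smooth_on d W f" "i < d"
    for i and f :: "(nat \<Rightarrow> real) \<Rightarrow> real"
    using smooth_on_pdiff[OF that] .
  have c: "pdiff i f x = pdiff i g x" if "\<And>y. y \<in> W \<Longrightarrow> f y = g y" "i < d" for i and f g :: "(nat \<Rightarrow> real) \<Rightarrow> real"
    using pdiff_cong[OF W x that(2,1)] .
  have bQ: "pdiff i (pdiff b Q) x = h x * pdiff i (pdiff a P) x + pdiff i h x * pdiff a P x" if "i < d" for i
    using c[OF eq(4) that] pdiff_mult[OF sm(3) smd[OF sm(1) ix(3)] that x] by simp
  have smhQ: "smooth_on d W (\<lambda>y. h y * pdiff a Q y)"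
    by (intro smooth_on_mult[OF W] sm smd ix)
  have bP: "pdiff i (pdiff b P) x = - (h x * pdiff i (pdiff a Q) x + pdiff i h x * pdiff a Q x)" if "i < d" for i
    using c[OF eq(3) that] pdiff_mult[OF sm(3) smd[OF sm(2) ix(3)] that x] pdiff_minus[OF smhQ that x] by simp
  have kl: "pdiff i (pdiff k P) x = pdiff i (pdiff l Q) x" "pdiff i (pdiff l P) x = - pdiff i (pdiff k Q) x" if "i < d" for i
    using c[OF eq(1) that] c[OF eq(2) that] pdiff_minus[OF smd[OF sm(2) ix(1)] that x] by simp_all
  \<comment> \<open>\<open>1\<close> and \<open>2\<close> are the two real equations contained in
    the vanishing of the commutator; the second derivatives cancel after commuting them and applying
    the Cauchy-Riemann equations in \<open>k\<close>, \<open>l\<close>.\<close>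
  have 1: "pdiff k h x * pdiff a P x = pdiff l h x * pdiff a Q x"
  proof -
    have m: "pdiff k (pdiff a P) x = pdiff l (pdiff a Q) x"
      using kl(1)[OF ix(3)] com[OF sm(1) ix(3,1)] com[OF sm(2) ix(3,2)] ix(5) by simp
    have "pdiff k (pdiff b Q) x = - pdiff l (pdiff b P) x"
      using kl(2)[OF ix(4)] com[OF sm(2) ix(4,1)] com[OF sm(1) ix(4,2)] ix(5) by simp
    then show ?thesis
      using bQ[OF ix(1)] bP[OF ix(2)] unfolding m by linarith
  qed
  have 2: "pdiff l h x * pdiff a P x = - pdiff k h x * pdiff a Q x"
  proof -
    have m: "pdiff l (pdiff a P) x = - pdiff k (pdiff a Q) x"
      using kl(2)[OF ix(3)] com[OF sm(1) ix(3,2)] com[OF sm(2) ix(3,1)] ix(5) by simp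
    have "pdiff l (pdiff b Q) x = pdiff k (pdiff b P) x"
      using kl(1)[OF ix(4)] com[OF sm(2) ix(4,2)] com[OF sm(1) ix(4,1)] ix(5) by simp
    moreover have "pdiff l (pdiff b Q) x = - (h x * pdiff k (pdiff a Q) x) + pdiff l h x * pdiff a P x"
      using bQ[OF ix(2)] unfolding m by simp
    ultimately show ?thesis
      using bP[OF ix(1)] by linarith
  qed
  \<comment> \<open>A homogeneous linear system for \<open>p\<close>, \<open>q\<close> with
    determinant \<open>u * u + v * v\<close>, which is nonzero.\<close>
  define u v p q where "u = pdiff k h x" "v = pdiff l h x" "p = pdiff a P x" "q = pdiff a Q x"
  have e: "u * p = v * q" "v * p = - u * q" "u \<noteq> 0 \<or> v \<noteq> 0"
    using 1 2 nz by (simp_all add: u_v_p_q_def)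
  have "(u * u + v * v) * p = u * (u * p) + v * (v * p)" by (simp add: algebra_simps)
  also have "\<dots> = 0" unfolding e(1,2) by (simp add: algebra_simps)
  finally have p: "p = 0"
    using e(3) by (auto simp: sum_squares_eq_zero_iff)
  have "(u * u + v * v) * q = v * (v * q) - u * (- u * q)" by (simp add: algebra_simps)
  also have "\<dots> = v * (u * p) - u * (v * p)" unfolding e(1,2) ..
  also have "\<dots> = 0" by (simp add: algebra_simps)
  finally have "q = 0"
    using e(3) by (auto simp: sum_squares_eq_zero_iff)
  with p show "pdiff a P x = 0" "pdiff a Q x = 0"
    by (simp_all add: u_v_p_q_def)
qed

text \<open>Continuity of one partial derivative gives real differentiability in two variables, and
  \<open>CR\<close> makes the differential multiplication by a complex number. The scalings
  \<open>\<alpha>\<close>, \<open>\<beta>\<close> are meant for the twisted factor, where they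
  become \<open>G\<close> and \<open>1 / G\<close>.\<close>

lemma holomorphic_slice:
  fixes f :: "(nat \<Rightarrow> real) \<Rightarrow> complex" and \<alpha> \<beta> :: real
  assumes W: "openin (Euclidean_space d) W" and f: "smooth_on d W f" and l: "Suc (2 * l) < d"
    and z: "x(2 * l := \<alpha> * Re z, Suc (2 * l) := \<beta> * Im z) \<in> W"
    and CR: "\<alpha> * pdiff (2 * l) f (x(2 * l := \<alpha> * Re z, Suc (2 * l) := \<beta> * Im z)) +
      \<i> * \<beta> * pdiff (Suc (2 * l)) f (x(2 * l := \<alpha> * Re z, Suc (2 * l) := \<beta> * Im z)) = 0"
  shows "(\<lambda>\<zeta>. f (x(2 * l := \<alpha> * Re \<zeta>, Suc (2 * l) := \<beta> * Im \<zeta>))) field_differentiable (at z)"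
proof -
  let ?i = "2 * l" and ?j = "Suc (2 * l)"
  define F where "F = (\<lambda>s t. f (x(?i := s, ?j := t)))"
  obtain T where T: "open T" "(\<alpha> * Re z, \<beta> * Im z) \<in> T" "\<And>q. q \<in> T \<Longrightarrow> upd2 x ?i ?j q \<in> W"
  proof -
    have "upd2 x ?i ?j (\<alpha> * Re z, \<beta> * Im z) \<in> W"
      using z by (simp add: upd2_def)
    from open_upd2[OF W this] l that show thesis by auto
  qed
  obtain A B where AB: "open A" "open B" "\<alpha> * Re z \<in> A" "\<beta> * Im z \<in> B" "A \<times> B \<subseteq> T"
    using T(1,2) by (auto elim: open_prod_elim)
  \<comment> \<open>The rule that combines partial derivatives demands a convex set in the second
    variable, hence a ball inside \<open>B\<close>.\<close>
  obtain e where e: "e > 0" "ball (\<beta> * Im z) e \<subseteq> B"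
    using AB(2,4) openE by blast
  define B' where "B' = ball (\<beta> * Im z) e"
  have inW: "x(?i := s, ?j := t) \<in> W" if "s \<in> A" "t \<in> B'" for s t
  proof -
    have "(s, t) \<in> A \<times> B" using e(2) that by (auto simp: B'_def)
    then show ?thesis using T(3)[of "(s, t)"] AB(5) by (auto simp: upd2_def)
  qed
  let ?fi = "\<lambda>s t. pdiff ?i f (x(?i := s, ?j := t))" and ?fj = "\<lambda>s t. pdiff ?j f (x(?i := s, ?j := t))"
  have di: "((\<lambda>s. F s t) has_vector_derivative ?fi s t) (at s)" if "s \<in> A" "t \<in> B'" for s t
    using smooth_on_has_pd[OF f _ inW[OF that], of ?i] l unfolding has_pd_def F_def
    by (simp add: fun_upd_twist[of ?j ?i])
  have dj: "(F s has_vector_derivative ?fj s t) (at t)" if "s \<in> A" "t \<in> B'" for s t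
    using smooth_on_has_pd[OF f l inW[OF that]] unfolding has_pd_def F_def by simp
  have cj: "continuous_on (A \<times> B') (\<lambda>(s, t). ?fj s t)"
  proof -
    have "continuous_on (A \<times> B') (\<lambda>p. pdiff ?j f (upd2 x ?i ?j p))"
      by (rule continuous_on_compose2[OF smooth_on_continuous[OF smooth_on_pdiff[OF f l]]
            continuous_on_subset[OF continuous_on_upd2]]) (use inW in \<open>auto simp: upd2_def\<close>)
    then show ?thesis by (simp add: upd2_def case_prod_beta)
  qed
  let ?s = "\<alpha> * Re z" and ?t = "\<beta> * Im z"
  have tB: "?t \<in> B'" using e(1) by (simp add: B'_def)
  have "((\<lambda>(s, t). F s t) has_derivative
      (\<lambda>(tx, ty). tx *\<^sub>R ?fi ?s ?t + blinfun_apply (blinfun_scaleR_left (?fj ?s ?t)) ty)) (at (?s, ?t) within A \<times> B')"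
  proof (rule has_derivative_partialsI)
    show "((\<lambda>s. F s ?t) has_derivative (\<lambda>tx. tx *\<^sub>R ?fi ?s ?t)) (at ?s within A)"
      using di[OF AB(3) tB] unfolding has_vector_derivative_def by (rule has_derivative_at_withinI)
    show "(F s has_derivative blinfun_apply (blinfun_scaleR_left (?fj s t))) (at t within B')"
      if "s \<in> A" "t \<in> B'" for s t
      using dj[OF that] unfolding has_vector_derivative_def blinfun_scaleR_left.rep_eq
      by (rule has_derivative_at_withinI)
    have "continuous_on (A \<times> B') (\<lambda>p. blinfun_scaleR_left (case p of (s, t) \<Rightarrow> ?fj s t))"
      by (rule bounded_linear.continuous_on[OF bounded_linear_blinfun_scaleR_left cj])
    then have "continuous_on (A \<times> B') (\<lambda>(s, t). blinfun_scaleR_left (?fj s t))"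
      by (simp add: case_prod_beta)
    then show "continuous (at (?s, ?t) within A \<times> B') (\<lambda>(s, t). blinfun_scaleR_left (?fj s t))"
      using AB(3) tB by (simp add: continuous_on_eq_continuous_within)
    show "?t \<in> B'" "convex B'" using tB by (auto simp: B'_def)
  qed
  moreover have "at (?s, ?t) within A \<times> B' = at (?s, ?t)"
    using AB(1,3) tB by (intro at_within_open) (auto simp: B'_def intro!: open_Times)
  ultimately have D: "((\<lambda>(s, t). F s t) has_derivative
      (\<lambda>(tx, ty). tx *\<^sub>R ?fi ?s ?t + ty *\<^sub>R ?fj ?s ?t)) (at (?s, ?t))"
    by simp
  have "((\<lambda>\<zeta>. (\<alpha> * Re \<zeta>, \<beta> * Im \<zeta>)) has_derivative (\<lambda>h. (\<alpha> * Re h, \<beta> * Im h))) (at z)"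
    by (auto intro!: derivative_eq_intros)
  from has_derivative_compose[OF this D]
  have "((\<lambda>\<zeta>. F (\<alpha> * Re \<zeta>) (\<beta> * Im \<zeta>)) has_derivative
      (\<lambda>h. (\<alpha> * Re h) *\<^sub>R ?fi ?s ?t + (\<beta> * Im h) *\<^sub>R ?fj ?s ?t)) (at z)"
    by simp
  moreover have "(\<alpha> * Re h) *\<^sub>R ?fi ?s ?t + (\<beta> * Im h) *\<^sub>R ?fj ?s ?t = (\<alpha> * ?fi ?s ?t) * h" for h
  proof -
    have "\<beta> * ?fj ?s ?t = \<i> * (\<alpha> * ?fi ?s ?t)"
      using CR by (simp add: add_eq_0_iff complex_eq_iff)
    then have "(\<beta> * Im h) *\<^sub>R ?fj ?s ?t = \<i> * Im h * (\<alpha> * ?fi ?s ?t)"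
      by (simp add: scaleR_conv_of_real algebra_simps)
    then have "(\<alpha> * Re h) *\<^sub>R ?fi ?s ?t + (\<beta> * Im h) *\<^sub>R ?fj ?s ?t = (\<alpha> * ?fi ?s ?t) * (Re h + \<i> * Im h)"
      by (simp add: scaleR_conv_of_real algebra_simps)
    then show ?thesis by (simp add: complex_eq[symmetric])
  qed
  ultimately have "((\<lambda>\<zeta>. F (\<alpha> * Re \<zeta>) (\<beta> * Im \<zeta>)) has_field_derivative (\<alpha> * ?fi ?s ?t)) (at z)"
    unfolding has_field_derivative_def by simp
  then show ?thesis
    unfolding F_def field_differentiable_def by blast
qed

section \<open>The model almost complex structure and its canonical forms\<close>

text \<open>\<open>Jm n g\<close> has the \<open>(1,0)\<close>-forms \<open>dz\<^sub>l\<close> for \<open>l < n - 1\<close> and \<open>dx / g + \<i> g dy\<close> in the last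
  coordinates.\<close>

definition scl :: "nat \<Rightarrow> real \<Rightarrow> nat \<Rightarrow> real" where
  "scl n g l = (if l = n - 1 then g else 1)"

definition Jm :: "nat \<Rightarrow> real \<Rightarrow> nat \<Rightarrow> nat \<Rightarrow> real" where
  "Jm n g i j = (if even i \<and> j = Suc i then - (scl n g (i div 2))\<^sup>2
     else if odd i \<and> i = Suc j then inverse ((scl n g (i div 2))\<^sup>2) else 0)"

definition th :: "nat \<Rightarrow> real \<Rightarrow> nat \<Rightarrow> cvec \<Rightarrow> complex" where
  "th n g l v = v (2 * l) / scl n g l + \<i> * scl n g l * v (Suc (2 * l))"

definition thb :: "nat \<Rightarrow> real \<Rightarrow> nat \<Rightarrow> cvec \<Rightarrow> complex" where
  "thb n g l v = v (2 * l) / scl n g l - \<i> * scl n g l * v (Suc (2 * l))"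

text \<open>\<open>eb\<close> and \<open>ebb\<close> form the frame of complex tangent vectors dual
  to the coframe \<open>th\<close>, \<open>thb\<close>; on an untwisted factor they are the
  Wirtinger vectors of the coordinate.\<close>

definition eb :: "nat \<Rightarrow> real \<Rightarrow> nat \<Rightarrow> cvec" where
  "eb n g l i = (if i = 2 * l then complex_of_real (scl n g l) / 2
     else if i = Suc (2 * l) then - \<i> / (2 * scl n g l) else 0)"

definition ebb :: "nat \<Rightarrow> real \<Rightarrow> nat \<Rightarrow> cvec" where
  "ebb n g l i = (if i = 2 * l then complex_of_real (scl n g l) / 2
     else if i = Suc (2 * l) then \<i> / (2 * scl n g l) else 0)"

text \<open>As a function of \<open>vs\<close> this is the wedge product of the covectors
  \<open>R i\<close>.\<close>

definition Dt :: "nat \<Rightarrow> (nat \<Rightarrow> cvec \<Rightarrow> complex) \<Rightarrow> cvec list \<Rightarrow> complex" where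
  "Dt n R vs = Determinant.det (Matrix.mat n n (\<lambda>(i, j). R i (vs ! j)))"

text \<open>The frame of the canonical bundle. The case distinction follows the convention that a
  form vanishes on improper argument lists.\<close>

definition Om :: "nat \<Rightarrow> real \<Rightarrow> cform" where
  "Om n g vs = (if length vs = n \<and> set vs \<subseteq> cvecs (2 * n) then Dt n (th n g) vs else 0)"

lemma sum_pairs: "(\<Sum>j<2 * n. f j) = (\<Sum>l<n. f (2 * l) + f (Suc (2 * l)))" for f :: "nat \<Rightarrow> 'a::comm_monoid_add"
  by (induction n) (simp_all add: add.assoc)

lemma sum_single:
  assumes "finite A" "a \<in> A" "\<And>b. b \<in> A \<Longrightarrow> b \<noteq> a \<Longrightarrow> f b = 0"
  shows "sum f A = f a"
  using assms by (metis (mono_tags, lifting) sum.remove sum.neutral DiffE insertI1 add.right_neutral)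

context
  fixes n :: nat and g :: real
  assumes g: "g \<noteq> 0"
begin

lemma scl_nz [simp]: "scl n g l \<noteq> 0"
  using g by (simp add: scl_def)

lemma mat_app_Jm:
  fixes v :: cvec
  assumes "l < n"
  shows "mat_app (2 * n) (Jm n g) v (2 * l) = - (scl n g l)\<^sup>2 * v (Suc (2 * l))"
    "mat_app (2 * n) (Jm n g) v (Suc (2 * l)) = v (2 * l) / (scl n g l)\<^sup>2"
proof -
  have "(\<Sum>j<2 * n. complex_of_real (Jm n g (2 * l) j) * v j) = of_real (Jm n g (2 * l) (Suc (2 * l))) * v (Suc (2 * l))"
    using assms by (intro sum_single) (auto simp: Jm_def)
  then show "mat_app (2 * n) (Jm n g) v (2 * l) = - (scl n g l)\<^sup>2 * v (Suc (2 * l))"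
    using assms by (simp add: mat_app_def Jm_def)
  have "(\<Sum>j<2 * n. complex_of_real (Jm n g (Suc (2 * l)) j) * v j) = of_real (Jm n g (Suc (2 * l)) (2 * l)) * v (2 * l)"
    using assms by (intro sum_single) (auto simp: Jm_def)
  then show "mat_app (2 * n) (Jm n g) v (Suc (2 * l)) = v (2 * l) / (scl n g l)\<^sup>2"
    using assms by (simp add: mat_app_def Jm_def field_simps)
qed

lemma mat_mult_Jm:
  assumes "i < 2 * n" "j < 2 * n"
  shows "mat_mult (2 * n) (Jm n g) (Jm n g) i j = (if i = j then -1 else 0)"
proof (cases "even i")
  case True
  then have "(\<Sum>k<2 * n. Jm n g i k * Jm n g k j) = Jm n g i (Suc i) * Jm n g (Suc i) j"
    using assms by (intro sum_single) (auto simp: Jm_def elim!: evenE)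
  then show ?thesis
    using True by (auto simp: mat_mult_def Jm_def elim!: evenE)
next
  case False
  then obtain l where l: "i = Suc (2 * l)" by (auto elim: oddE)
  then have "(\<Sum>k<2 * n. Jm n g i k * Jm n g k j) = Jm n g i (2 * l) * Jm n g (2 * l) j"
    using assms by (intro sum_single) (auto simp: Jm_def)
  then show ?thesis
    using l by (auto simp: mat_mult_def Jm_def)
qed

lemma th_lin: "th n g l (\<lambda>i. a * v i + w i) = a * th n g l v + th n g l w"
  and thb_lin: "thb n g l (\<lambda>i. a * v i + w i) = a * thb n g l v + thb n g l w"
  by (simp_all add: th_def thb_def field_simps)

lemma th_mat_app: "l < n \<Longrightarrow> th n g l (mat_app (2 * n) (Jm n g) v) = \<i> * th n g l v"
  and thb_mat_app: "l < n \<Longrightarrow> thb n g l (mat_app (2 * n) (Jm n g) v) = - \<i> * thb n g l v"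
  by (simp_all only: th_def thb_def mat_app_Jm) (simp_all add: field_simps power2_eq_square)

lemma mat_app_cvecs [simp]: "mat_app d M v \<in> cvecs d"
  by (simp add: mat_app_def cvecs_def)

text \<open>Sum and difference of \<open>th\<close> and \<open>thb\<close> recover both coordinates
  of a factor, so the coframe separates vectors. Identities between vectors are checked on it
  below.\<close>

lemma cvec_eqI:
  assumes "v \<in> cvecs (2 * n)" "w \<in> cvecs (2 * n)"
    and "\<And>l. l < n \<Longrightarrow> th n g l v = th n g l w" "\<And>l. l < n \<Longrightarrow> thb n g l v = thb n g l w"
  shows "v = w"
proof
  fix i
  have pair: "v (2 * l) = w (2 * l) \<and> v (Suc (2 * l)) = w (Suc (2 * l))" if "l < n" for l
  proof -
    have "th n g l v + thb n g l v = th n g l w + thb n g l w" "th n g l v - thb n g l v = th n g l w - thb n g l w"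
      using assms(3,4)[OF that] by simp_all
    then show ?thesis by (simp add: th_def thb_def)
  qed
  show "v i = w i"
  proof (cases "i < 2 * n")
    case True
    show ?thesis
    proof (cases "even i")
      case True
      then show ?thesis using pair[of "i div 2"] \<open>i < 2 * n\<close> by auto
    next
      case False
      then show ?thesis using pair[of "i div 2"] \<open>i < 2 * n\<close> by (auto elim!: oddE)
    qed
  qed (use assms(1,2) in \<open>simp add: cvecs_def\<close>)
qed

lemma th_scale: "th n g l (\<lambda>i. a * v i) = a * th n g l v" and thb_scale: "thb n g l (\<lambda>i. a * v i) = a * thb n g l v"
  by (simp_all add: th_def thb_def field_simps)

text \<open>The structure acts on \<open>th\<close> by \<open>\<i>\<close> and on \<open>thb\<close>
  by \<open>- \<i>\<close>, so the eigenvector equation amounts to the vanishing of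
  \<open>thb\<close>.\<close>

lemma T10_iff: "v \<in> T10 (2 * n) (Jm n g) \<longleftrightarrow> v \<in> cvecs (2 * n) \<and> (\<forall>l<n. thb n g l v = 0)"
proof (intro iffI conjI allI impI)
  assume v: "v \<in> T10 (2 * n) (Jm n g)"
  then show "v \<in> cvecs (2 * n)" by (simp add: T10_def)
  fix l assume l: "l < n"
  have "thb n g l (\<lambda>i. \<i> * v i) = - \<i> * thb n g l v"
    using thb_mat_app[OF l, of v] v by (simp add: T10_def)
  then show "thb n g l v = 0" by (simp add: thb_scale)
next
  assume v: "v \<in> cvecs (2 * n) \<and> (\<forall>l<n. thb n g l v = 0)"
  have "mat_app (2 * n) (Jm n g) v = (\<lambda>i. \<i> * v i)"
  proof (rule cvec_eqI)
    show "(\<lambda>i. \<i> * v i) \<in> cvecs (2 * n)" using v by (simp add: cvecs_def)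
  qed (use v in \<open>simp_all only: mat_app_cvecs th_mat_app thb_mat_app th_scale thb_scale, simp_all\<close>)
  with v show "v \<in> T10 (2 * n) (Jm n g)" by (simp add: T10_def)
qed

lemma T01_iff: "v \<in> T01 (2 * n) (Jm n g) \<longleftrightarrow> v \<in> cvecs (2 * n) \<and> (\<forall>l<n. th n g l v = 0)"
proof (intro iffI conjI allI impI)
  assume v: "v \<in> T01 (2 * n) (Jm n g)"
  then show "v \<in> cvecs (2 * n)" by (simp add: T01_def)
  fix l assume l: "l < n"
  have "th n g l (\<lambda>i. - \<i> * v i) = \<i> * th n g l v"
    using th_mat_app[OF l, of v] v by (simp add: T01_def)
  then show "th n g l v = 0" by (simp only: th_scale) simp
next
  assume v: "v \<in> cvecs (2 * n) \<and> (\<forall>l<n. th n g l v = 0)"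
  have "mat_app (2 * n) (Jm n g) v = (\<lambda>i. - \<i> * v i)"
  proof (rule cvec_eqI)
    show "(\<lambda>i. - \<i> * v i) \<in> cvecs (2 * n)" using v by (simp add: cvecs_def)
  qed (use v in \<open>simp_all only: mat_app_cvecs th_mat_app thb_mat_app th_scale thb_scale, simp_all\<close>)
  with v show "v \<in> T01 (2 * n) (Jm n g)" by (simp add: T01_def)
qed

lemma th_pr:
  assumes "l < n"
  shows "th n g l (pr10 (2 * n) (Jm n g) v) = th n g l v" "thb n g l (pr10 (2 * n) (Jm n g) v) = 0"
    "th n g l (pr01 (2 * n) (Jm n g) v) = 0" "thb n g l (pr01 (2 * n) (Jm n g) v) = thb n g l v"
proof -
  have eqs: "pr10 (2 * n) (Jm n g) v = (\<lambda>i. (- \<i> / 2) * mat_app (2 * n) (Jm n g) v i + (1 / 2) * v i)"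
    "pr01 (2 * n) (Jm n g) v = (\<lambda>i. (\<i> / 2) * mat_app (2 * n) (Jm n g) v i + (1 / 2) * v i)"
    by (auto simp: pr10_def pr01_def fun_eq_iff field_simps)
  show "th n g l (pr10 (2 * n) (Jm n g) v) = th n g l v" "thb n g l (pr10 (2 * n) (Jm n g) v) = 0"
    "th n g l (pr01 (2 * n) (Jm n g) v) = 0" "thb n g l (pr01 (2 * n) (Jm n g) v) = thb n g l v"
    unfolding eqs th_lin thb_lin th_scale thb_scale th_mat_app[OF assms] thb_mat_app[OF assms]
    by (simp_all add: field_simps)
qed

lemma pr_cvecs [simp]:
  "pr10 (2 * n) (Jm n g) v \<in> cvecs (2 * n) \<longleftrightarrow> v \<in> cvecs (2 * n)"
  "pr01 (2 * n) (Jm n g) v \<in> cvecs (2 * n) \<longleftrightarrow> v \<in> cvecs (2 * n)"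
  by (auto simp: cvecs_def pr10_def pr01_def mat_app_def)

lemma th_eb: "l < n \<Longrightarrow> k < n \<Longrightarrow> th n g l (eb n g k) = (if l = k then 1 else 0)"
  and thb_eb: "l < n \<Longrightarrow> k < n \<Longrightarrow> thb n g l (eb n g k) = 0"
  and th_ebb: "l < n \<Longrightarrow> k < n \<Longrightarrow> th n g l (ebb n g k) = 0"
  and thb_ebb: "l < n \<Longrightarrow> k < n \<Longrightarrow> thb n g l (ebb n g k) = (if l = k then 1 else 0)"
  by (auto simp: th_def thb_def eb_def ebb_def field_simps; presburger)+

lemma eb_cvecs: "k < n \<Longrightarrow> eb n g k \<in> cvecs (2 * n)" "k < n \<Longrightarrow> ebb n g k \<in> cvecs (2 * n)"
  by (auto simp: cvecs_def eb_def ebb_def)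

lemma eb_T: "k < n \<Longrightarrow> eb n g k \<in> T10 (2 * n) (Jm n g)" "k < n \<Longrightarrow> ebb n g k \<in> T01 (2 * n) (Jm n g)"
  "k < n \<Longrightarrow> ebb n g k \<notin> T10 (2 * n) (Jm n g)"
  by (auto simp: T10_iff T01_iff eb_cvecs thb_eb th_ebb thb_ebb)

lemma th_sum: "th n g l (\<lambda>i. \<Sum>k\<in>A. f k i) = (\<Sum>k\<in>A. th n g l (f k))"
  and thb_sum: "thb n g l (\<lambda>i. \<Sum>k\<in>A. f k i) = (\<Sum>k\<in>A. thb n g l (f k))"
  by (simp_all add: th_def thb_def sum.distrib sum_subtractf sum_divide_distrib sum_distrib_left)

lemma cvec_expand:
  assumes "v \<in> cvecs (2 * n)"
  shows "v = (\<lambda>i. \<Sum>k<n. th n g k v * eb n g k i + thb n g k v * ebb n g k i)"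
proof (rule cvec_eqI[OF assms])
  show "(\<lambda>i. \<Sum>k<n. th n g k v * eb n g k i + thb n g k v * ebb n g k i) \<in> cvecs (2 * n)"
    using eb_cvecs by (auto simp: cvecs_def)
  fix l assume l: "l < n"
  have "th n g l (\<lambda>i. \<Sum>k<n. th n g k v * eb n g k i + thb n g k v * ebb n g k i) =
      (\<Sum>k<n. if l = k then th n g k v else 0)"
    unfolding th_sum th_lin th_scale using l by (intro sum.cong) (auto simp: th_eb th_ebb)
  then show "th n g l v = th n g l (\<lambda>i. \<Sum>k<n. th n g k v * eb n g k i + thb n g k v * ebb n g k i)"
    using l by simp
  have "thb n g l (\<lambda>i. \<Sum>k<n. th n g k v * eb n g k i + thb n g k v * ebb n g k i) =
      (\<Sum>k<n. if l = k then thb n g k v else 0)"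
    unfolding thb_sum thb_lin thb_scale using l by (intro sum.cong) (auto simp: thb_eb thb_ebb)
  then show "thb n g l v = thb n g l (\<lambda>i. \<Sum>k<n. th n g k v * eb n g k i + thb n g k v * ebb n g k i)"
    using l by simp
qed

end

section \<open>Determinants of covectors\<close>

lemma Dt_lin:
  assumes "length vs = n" "j < n" "\<And>i. i < n \<Longrightarrow> R i x = a * R i v + R i w"
  shows "Dt n R (vs[j := x]) = a * Dt n R (vs[j := v]) + Dt n R (vs[j := w])"
proof -
  let ?M = "\<lambda>y. Matrix.mat n n (\<lambda>(i, k). R i ((vs[j := y]) ! k))"
  have exp: "Dt n R (vs[j := y]) = (\<Sum>i<n. R i y * cofactor (?M y) i j)" for y
    unfolding Dt_def using assms(1,2) by (subst laplace_expansion_column[of _ n j]) auto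
  \<comment> \<open>The cofactors of column \<open>j\<close> do not see the entries of that column,
    so all three determinants share them.\<close>
  have cof: "cofactor (?M y) i j = cofactor (?M v) i j" if "i < n" for y i
  proof -
    have "mat_delete (?M y) i j = mat_delete (?M v) i j"
      using assms(1,2) that by (intro eq_matI) (auto simp: mat_delete_def)
    then show ?thesis by (simp add: cofactor_def)
  qed
  have "Dt n R (vs[j := x]) = (\<Sum>i<n. R i x * cofactor (?M v) i j)"
    unfolding exp[of x] by (intro sum.cong refl, subst cof) auto
  also have "\<dots> = a * (\<Sum>i<n. R i v * cofactor (?M v) i j) + (\<Sum>i<n. R i w * cofactor (?M v) i j)"
    using assms(3) by (simp add: sum_distrib_left sum.distrib algebra_simps)
  also have "(\<Sum>i<n. R i w * cofactor (?M v) i j) = Dt n R (vs[j := w])"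
    unfolding exp[of w] by (intro sum.cong refl, subst cof[of _ w]) auto
  finally show ?thesis unfolding exp[of v] .
qed

lemma Dt_zero_column:
  assumes "j < n" "\<And>i. i < n \<Longrightarrow> R i (vs ! j) = 0"
  shows "Dt n R vs = 0"
  unfolding Dt_def using assms by (subst laplace_expansion_column[of _ n j]) auto

lemma Dt_zero_row:
  assumes "i < n" "\<And>j. j < n \<Longrightarrow> R i (vs ! j) = 0"
  shows "Dt n R vs = 0"
  unfolding Dt_def using assms by (subst laplace_expansion_row[of _ n i]) auto

lemma Dt_eq_columns:
  assumes "i < j" "j < n" "vs ! i = vs ! j"
  shows "Dt n R vs = 0"
  unfolding Dt_def
  by (rule det_identical_columns[of _ n i j]) (use assms in \<open>auto intro!: eq_vecI\<close>)

lemma Dt_scale_rows: "Dt n (\<lambda>i v. c i * R i v) vs = (\<Prod>i<n. c i) * Dt n R vs"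
proof -
  have perm: "(\<Prod>i = 0..<n. c i * R i (vs ! p i)) = (\<Prod>i<n. c i) * (\<Prod>i = 0..<n. R i (vs ! p i))" for p
    by (simp add: prod.distrib atLeast0LessThan)
  have "Dt n R' vs = (\<Sum>p | p permutes {0..<n}. of_int (sign p) * (\<Prod>i = 0..<n. R' i (vs ! p i)))" for R'
    unfolding Dt_def by (subst det_def'[of _ n]) (auto intro!: sum.cong prod.cong simp: permutes_in_image)
  then show ?thesis
    unfolding perm by (simp only: sum_distrib_left mult.left_commute perm)
qed

lemma Dt_cong: "(\<And>i j. i < n \<Longrightarrow> j < n \<Longrightarrow> R i (vs ! j) = R' i (ws ! j)) \<Longrightarrow> Dt n R vs = Dt n R' ws"
  unfolding Dt_def by (intro arg_cong[where f = Determinant.det] eq_matI) auto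

text \<open>Laplace expansion of an \<open>(n+1)\<close>-dimensional determinant whose last row repeats the row \<open>k\<close>.\<close>

lemma Dt_repeated_row:
  assumes "length vs = Suc n" "k < n"
  shows "(\<Sum>a<Suc n. (-1) ^ a * (R k (vs ! a) * Dt n R (take a vs @ drop (Suc a) vs))) = 0"
proof -
  let ?R = "\<lambda>i. if i < n then R i else R k"
  let ?A = "Matrix.mat (Suc n) (Suc n) (\<lambda>(i, j). ?R i (vs ! j))"
  have "Determinant.det ?A = 0"
    by (rule det_identical_rows[of _ "Suc n" k n]) (use assms in \<open>auto intro!: eq_vecI\<close>)
  moreover have "Determinant.det ?A = (\<Sum>j<Suc n. ?A $$ (n, j) * cofactor ?A n j)"
    by (rule laplace_expansion_row) auto
  moreover have "cofactor ?A n a = (-1) ^ (n + a) * Dt n R (take a vs @ drop (Suc a) vs)" if "a < Suc n" for a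
  proof -
    have "mat_delete ?A n a = Matrix.mat n n (\<lambda>(i, j). R i ((take a vs @ drop (Suc a) vs) ! j))"
      using assms that by (intro eq_matI) (auto simp: mat_delete_def nth_append)
    then show ?thesis by (simp add: cofactor_def Dt_def)
  qed
  ultimately have "0 = (\<Sum>a<Suc n. R k (vs ! a) * ((-1) ^ (n + a) * Dt n R (take a vs @ drop (Suc a) vs)))"
    by simp
  also have "\<dots> = (-1) ^ n * (\<Sum>a<Suc n. (-1) ^ a * (R k (vs ! a) * Dt n R (take a vs @ drop (Suc a) vs)))"
    by (simp only: sum_distrib_left power_add mult_ac)
  finally show ?thesis by simp
qed

section \<open>Alternating forms and the line of (n,0)-forms\<close>

lemma cvecs_lin: "v \<in> cvecs d \<Longrightarrow> w \<in> cvecs d \<Longrightarrow> (\<lambda>l. a * v l + w l) \<in> cvecs d"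
  by (simp add: cvecs_def)

lemma set_list_update_subset: "set vs \<subseteq> C \<Longrightarrow> v \<in> C \<Longrightarrow> set (vs[i := v]) \<subseteq> C"
  by (metis insert_subset set_update_subset_insert subset_trans)

lemma alternating_formD:
  assumes "alternating_form d k \<omega>"
  shows "\<not> (length vs = k \<and> set vs \<subseteq> cvecs d) \<Longrightarrow> \<omega> vs = 0"
    "length vs = k \<Longrightarrow> set vs \<subseteq> cvecs d \<Longrightarrow> i < k \<Longrightarrow> v \<in> cvecs d \<Longrightarrow> w \<in> cvecs d \<Longrightarrow>
      \<omega> (vs[i := (\<lambda>l. a * v l + w l)]) = a * \<omega> (vs[i := v]) + \<omega> (vs[i := w])"
    "length vs = k \<Longrightarrow> i < j \<Longrightarrow> j < k \<Longrightarrow> vs ! i = vs ! j \<Longrightarrow> \<omega> vs = 0"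
  using assms unfolding alternating_form_def by blast+

lemma form_of_type_diff_scale:
  assumes "form_of_type d M p q \<omega>" "form_of_type d M p q \<eta>"
  shows "form_of_type d M p q (\<lambda>vs. a * \<omega> vs + b * \<eta> vs)"
proof -
  have alt: "alternating_form d (p + q) \<omega>" "alternating_form d (p + q) \<eta>"
    using assms unfolding form_of_type_def by blast+
  have "alternating_form d (p + q) (\<lambda>vs. a * \<omega> vs + b * \<eta> vs)"
    unfolding alternating_form_def
  proof (intro conjI allI impI)
    fix vs :: "cvec list" and i c and v w :: cvec
    assume "length vs = p + q \<and> set vs \<subseteq> cvecs d \<and> i < p + q \<and> v \<in> cvecs d \<and> w \<in> cvecs d"
    then have "\<omega> (vs[i := (\<lambda>l. c * v l + w l)]) = c * \<omega> (vs[i := v]) + \<omega> (vs[i := w])"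
      "\<eta> (vs[i := (\<lambda>l. c * v l + w l)]) = c * \<eta> (vs[i := v]) + \<eta> (vs[i := w])"
      using alternating_formD(2)[OF alt(1)] alternating_formD(2)[OF alt(2)] by blast+
    then show "a * \<omega> (vs[i := (\<lambda>l. c * v l + w l)]) + b * \<eta> (vs[i := (\<lambda>l. c * v l + w l)]) =
        c * (a * \<omega> (vs[i := v]) + b * \<eta> (vs[i := v])) + (a * \<omega> (vs[i := w]) + b * \<eta> (vs[i := w]))"
      by (simp add: algebra_simps)
  next
    fix vs assume "\<not> (length vs = p + q \<and> set vs \<subseteq> cvecs d)"
    then show "a * \<omega> vs + b * \<eta> vs = 0"
      using alternating_formD(1)[OF alt(1)] alternating_formD(1)[OF alt(2)] by simp
  next
    fix vs :: "cvec list" and i j assume "length vs = p + q \<and> i < j \<and> j < p + q \<and> vs ! i = vs ! j"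
    then have "\<omega> vs = 0" "\<eta> vs = 0"
      using alternating_formD(3)[OF alt(1)] alternating_formD(3)[OF alt(2)] by blast+
    then show "a * \<omega> vs + b * \<eta> vs = 0" by simp
  qed
  moreover have "a * \<omega> vs + b * \<eta> vs = 0"
    if "set vs \<subseteq> T10 d M \<union> T01 d M \<and> length (filter (\<lambda>v. v \<in> T10 d M) vs) \<noteq> p" for vs
  proof -
    have "\<omega> vs = 0" "\<eta> vs = 0"
      using assms that unfolding form_of_type_def by blast+
    then show ?thesis by simp
  qed
  ultimately show ?thesis unfolding form_of_type_def by blast
qed

lemma alternating_form_zero:
  assumes "alternating_form d k \<omega>" "length vs = k" "set vs \<subseteq> cvecs d" "i < k"
  shows "\<omega> (vs[i := (\<lambda>_. 0)]) = 0"
  using alternating_formD(2)[OF assms, of "\<lambda>_. 0" "\<lambda>_. 0" 1] by (simp add: cvecs_def)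

lemma alternating_form_sum:
  assumes "alternating_form d k \<omega>" "length vs = k" "set vs \<subseteq> cvecs d" "i < k"
    and "finite A" "\<And>a. a \<in> A \<Longrightarrow> w a \<in> cvecs d"
  shows "\<omega> (vs[i := (\<lambda>l. \<Sum>a\<in>A. w a l)]) = (\<Sum>a\<in>A. \<omega> (vs[i := w a]))"
  using assms(5,6)
proof (induction A)
  case empty
  then show ?case using alternating_form_zero[OF assms(1-4)] by simp
next
  case (insert a A)
  have "(\<lambda>l. \<Sum>a\<in>A. w a l) \<in> cvecs d"
    using insert.prems by (simp add: cvecs_def)
  then show ?case
    using alternating_formD(2)[OF assms(1-4), of "w a" "\<lambda>l. \<Sum>a\<in>A. w a l" 1] insert by simp
qed

text \<open>\<open>alternating_form\<close> speaks of equal arguments only; antisymmetry follows by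
  polarisation, with the sum of the two vectors in both slots.\<close>

lemma alternating_form_swap:
  assumes "alternating_form d k \<omega>" "length vs = k" "set vs \<subseteq> cvecs d" "i < j" "j < k"
  shows "\<omega> (vs[i := vs ! j, j := vs ! i]) = - \<omega> vs"
proof -
  let ?a = "vs ! i" and ?b = "vs ! j" and ?s = "\<lambda>l. 1 * (vs ! i) l + (vs ! j) l"
  have ab: "?a \<in> cvecs d" "?b \<in> cvecs d"
    using assms by auto
  have s: "?s \<in> cvecs d" using ab by (rule cvecs_lin)
  have split: "\<omega> (ws[m := ?s]) = \<omega> (ws[m := ?a]) + \<omega> (ws[m := ?b])"
    if "length ws = k" "set ws \<subseteq> cvecs d" "m < k" for ws m
    using alternating_formD(2)[OF assms(1) that ab, of 1] by simp
  have sub: "set (vs[m := v]) \<subseteq> cvecs d" if "v \<in> cvecs d" for m v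
    using set_list_update_subset[OF assms(3) that] .
  have al: "\<omega> (vs[i := v, j := v]) = 0" for v
    using alternating_formD(3)[OF assms(1), of "vs[i := v, j := v]" i j] assms by simp
  have split_i: "\<omega> (vs[i := ?s, j := v]) = \<omega> (vs[i := ?a, j := v]) + \<omega> (vs[i := ?b, j := v])"
    if "v \<in> cvecs d" for v
  proof -
    have "vs[j := v, i := vs ! i] = vs[j := v]"
      using assms(4) by (metis list_update_id nth_list_update_neq order_less_irrefl)
    then show ?thesis
      using split[of "vs[j := v]" i] assms sub[OF that] by (simp add: list_update_swap[of i j])
  qed
  have "\<omega> (vs[i := ?s, j := ?s]) = \<omega> (vs[i := ?s, j := ?a]) + \<omega> (vs[i := ?s, j := ?b])"
    using assms sub[OF s] by (intro split) auto
  then have "\<omega> (vs[i := ?a, j := ?b]) + \<omega> (vs[i := ?b, j := ?a]) = 0"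
    unfolding split_i[OF ab(1)] split_i[OF ab(2)] al by (simp add: add.commute)
  moreover have "vs[i := ?a, j := ?b] = vs" by simp
  ultimately show ?thesis by (metis add.commute add_eq_0_iff)
qed

context
  fixes n :: nat and g :: real
  assumes g: "g \<noteq> 0"
begin

lemma Om_alternating: "alternating_form (2 * n) n (Om n g)"
  unfolding alternating_form_def
proof (intro conjI allI impI)
  fix vs :: "cvec list" and i a and v w :: cvec
  assume "length vs = n \<and> set vs \<subseteq> cvecs (2 * n) \<and> i < n \<and> v \<in> cvecs (2 * n) \<and> w \<in> cvecs (2 * n)"
  then show "Om n g (vs[i := (\<lambda>l. a * v l + w l)]) = a * Om n g (vs[i := v]) + Om n g (vs[i := w])"
    using th_lin[OF g] set_list_update_subset[of vs "cvecs (2 * n)"] cvecs_lin[of v "2 * n" w a]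
    by (auto simp: Om_def intro!: Dt_lin)
qed (auto simp: Om_def intro: Dt_eq_columns)

lemma Om_zero:
  assumes "v \<in> set vs" "\<And>l. l < n \<Longrightarrow> th n g l v = 0"
  shows "Om n g vs = 0"
  using assms by (auto simp: Om_def in_set_conv_nth intro: Dt_zero_column)

text \<open>An argument of type (0,1) is annihilated by all \<open>th\<close> and produces a zero
  column; if all arguments have type (1,0), their number differs from \<open>n\<close> only for a
  list of the wrong length.\<close>

lemma Om_form: "form_of_type (2 * n) (Jm n g) n 0 (Om n g)"
  unfolding form_of_type_def
proof (intro conjI allI impI)
  show "alternating_form (2 * n) (n + 0) (Om n g)" using Om_alternating by simp
  fix vs assume vs: "set vs \<subseteq> T10 (2 * n) (Jm n g) \<union> T01 (2 * n) (Jm n g) \<and>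
      length (filter (\<lambda>v. v \<in> T10 (2 * n) (Jm n g)) vs) \<noteq> n"
  show "Om n g vs = 0"
  proof (cases "\<forall>v\<in>set vs. v \<in> T10 (2 * n) (Jm n g)")
    case True
    then have "length vs \<noteq> n" using vs by (metis filter_True)
    then show ?thesis by (simp add: Om_def)
  next
    case False
    then obtain v where "v \<in> set vs" "v \<in> T01 (2 * n) (Jm n g)" using vs by auto
    then show ?thesis by (auto simp: T01_iff[OF g] intro: Om_zero)
  qed
qed

abbreviation "ebl \<equiv> map (eb n g) [0..<n]"

lemma ebl_cvecs: "length ebl = n" "set ebl \<subseteq> cvecs (2 * n)"
  using eb_cvecs[OF g] by auto

lemma Om_ebl: "Om n g ebl = 1"
proof -
  have "Matrix.mat n n (\<lambda>(i, j). th n g i (ebl ! j)) = 1\<^sub>m n"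
    by (intro eq_matI) (auto simp: th_eb[OF g])
  then show ?thesis using ebl_cvecs by (simp add: Om_def Dt_def)
qed

text \<open>Equal indices repeat an argument. Distinct ones permute \<open>ebl\<close>, and the
  permutation is reached by transpositions, each of which only changes the sign.\<close>

lemma form_zero_on_frames:
  assumes \<omega>: "form_of_type (2 * n) (Jm n g) n 0 \<omega>" and z: "\<omega> ebl = 0" and f: "f ` {..<n} \<subseteq> {..<n}"
  shows "\<omega> (map (\<lambda>j. eb n g (f j)) [0..<n]) = 0"
proof -
  have alt: "alternating_form (2 * n) n \<omega>" using \<omega> by (simp add: form_of_type_def)
  show ?thesis
  proof (cases "inj_on f {..<n}")
    case False
    then obtain i j where "i < n" "j < n" "i \<noteq> j" "f i = f j" by (auto simp: inj_on_def)
    then have "\<exists>i j. i < j \<and> j < n \<and> f i = f j" by (metis nat_neq_iff)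
    then obtain i j where ij: "i < j" "j < n" "f i = f j" by blast
    show ?thesis by (rule alternating_formD(3)[OF alt, of _ i j]) (use ij in auto)
  next
    case True
    \<comment> \<open>Extended by the identity, since \<open>permutes\<close> requires points
      outside the set to be fixed.\<close>
    define p where "p = (\<lambda>j. if j < n then f j else j)"
    have "bij_betw f {..<n} {..<n}"
      using True f by (simp add: bij_betw_def endo_inj_surj)
    then have "bij_betw p {..<n} {..<n}"
      by (rule bij_betw_cong[THEN iffD1, rotated]) (simp add: p_def)
    then have p: "p permutes {..<n}" by (rule bij_imp_permutes) (simp add: p_def)
    have "\<omega> (map (\<lambda>j. eb n g (p j)) [0..<n]) = 0"
      using finite_lessThan p
    proof (induction rule: permutes_rev_induct)
      case id
      then show ?case using z by simp
    next
      case (swap a b q)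
      have *: "\<omega> (map (\<lambda>j. eb n g ((q \<circ> Transposition.transpose a b) j)) [0..<n]) = 0" if "a < b" "b < n" for a b
      proof -
        let ?vs = "map (\<lambda>j. eb n g (q j)) [0..<n]"
        have q: "q j < n" if "j < n" for j
          using permutes_in_image[OF \<open>q permutes {..<n}\<close>] that by auto
        have "map (\<lambda>j. eb n g ((q \<circ> Transposition.transpose a b) j)) [0..<n] = ?vs[a := ?vs ! b, b := ?vs ! a]"
          using that by (intro nth_equalityI) (auto simp: nth_list_update Transposition.transpose_def)
        moreover have "set ?vs \<subseteq> cvecs (2 * n)"
          using q eb_cvecs(1)[OF g] by auto
        then have "\<omega> (?vs[a := ?vs ! b, b := ?vs ! a]) = - \<omega> ?vs"
          by (intro alternating_form_swap[OF alt]) (use that in auto)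
        ultimately show ?thesis using swap by simp
      qed
      show ?case
        using *[of a b] *[of b a] swap by (auto simp: transpose_commute neq_iff)
    qed
    moreover have "map (\<lambda>j. eb n g (p j)) [0..<n] = map (\<lambda>j. eb n g (f j)) [0..<n]"
      by (simp add: p_def)
    ultimately show ?thesis by simp
  qed
qed

text \<open>If some \<open>ebb\<close> occurs, fewer than \<open>n\<close> arguments have type (1,0)
  and the form vanishes by its type; otherwise the list is one of frame vectors.\<close>

lemma form_zero_on_basis:
  assumes \<omega>: "form_of_type (2 * n) (Jm n g) n 0 \<omega>" and z: "\<omega> ebl = 0"
    and vs: "length vs = n" "set vs \<subseteq> eb n g ` {..<n} \<union> ebb n g ` {..<n}"
  shows "\<omega> vs = 0"
proof (cases "set vs \<subseteq> eb n g ` {..<n}")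
  case True
  then have "\<forall>j<n. \<exists>k<n. vs ! j = eb n g k"
    using vs(1) by (metis imageE lessThan_iff nth_mem subsetD)
  then obtain f where f: "\<And>j. j < n \<Longrightarrow> f j < n \<and> vs ! j = eb n g (f j)" by metis
  then have "vs = map (\<lambda>j. eb n g (f j)) [0..<n]"
    using vs(1) by (intro nth_equalityI) auto
  then show ?thesis using form_zero_on_frames[OF \<omega> z, of f] f by auto
next
  case False
  then obtain v where v: "v \<in> set vs" "v \<in> ebb n g ` {..<n}" using vs(2) by blast
  then have "v \<notin> T10 (2 * n) (Jm n g)" using eb_T[OF g] by auto
  then have "length (filter (\<lambda>v. v \<in> T10 (2 * n) (Jm n g)) vs) \<noteq> n"
    using v(1) vs(1) by (metis length_filter_less less_irrefl)
  moreover have "set vs \<subseteq> T10 (2 * n) (Jm n g) \<union> T01 (2 * n) (Jm n g)"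
    using vs(2) eb_T[OF g] by blast
  ultimately show ?thesis using \<omega> by (auto simp: form_of_type_def)
qed

text \<open>Multilinear expansion in the basis \<open>eb\<close>, \<open>ebb\<close>, one slot at a
  time: the induction is on the number \<open>k\<close> of leading slots that are still
  arbitrary.\<close>

lemma form_zero:
  assumes \<omega>: "form_of_type (2 * n) (Jm n g) n 0 \<omega>" and z: "\<omega> ebl = 0"
  shows "\<omega> vs = 0"
proof -
  have alt: "alternating_form (2 * n) n \<omega>" using \<omega> by (simp add: form_of_type_def)
  let ?B = "eb n g ` {..<n} \<union> ebb n g ` {..<n}"
  have BC: "?B \<subseteq> cvecs (2 * n)" using eb_cvecs[OF g] by auto
  have "\<omega> vs = 0" if "k \<le> n" "length vs = n" "set vs \<subseteq> cvecs (2 * n)" "\<And>j. k \<le> j \<Longrightarrow> j < n \<Longrightarrow> vs ! j \<in> ?B"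
    for k and vs :: "cvec list"
    using that
  proof (induction k arbitrary: vs)
    case 0
    have "set vs \<subseteq> ?B"
    proof
      fix v assume "v \<in> set vs"
      then obtain j where "j < n" "v = vs ! j" using 0 by (metis in_set_conv_nth)
      then show "v \<in> ?B" using 0(4)[of j] by simp
    qed
    then show ?case using form_zero_on_basis[OF \<omega> z] 0 by blast
  next
    case (Suc k)
    have k: "k < n" using Suc.prems by simp
    have IH: "\<omega> (vs[k := v]) = 0" if "v \<in> ?B" for v
    proof (rule Suc.IH)
      show "set (vs[k := v]) \<subseteq> cvecs (2 * n)"
        using set_list_update_subset[OF Suc.prems(3)] that BC by blast
      show "vs[k := v] ! j \<in> ?B" if "k \<le> j" "j < n" for j
        using Suc.prems(2,4) \<open>v \<in> ?B\<close> that by (cases "j = k") auto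
    qed (use Suc.prems k in auto)
    let ?v = "vs ! k"
    have v: "?v \<in> cvecs (2 * n)" using Suc.prems k by auto
    let ?w = "\<lambda>l i. th n g l ?v * eb n g l i + thb n g l ?v * ebb n g l i"
    have w: "?w l \<in> cvecs (2 * n)" if "l < n" for l
      using eb_cvecs[OF g that] by (simp add: cvecs_def)
    have "\<omega> vs = \<omega> (vs[k := (\<lambda>i. \<Sum>l<n. ?w l i)])"
      using cvec_expand[OF g v] by simp
    also have "\<dots> = (\<Sum>l<n. \<omega> (vs[k := ?w l]))"
      using w by (intro alternating_form_sum[OF alt Suc.prems(2,3) k]) auto
    also have "\<dots> = 0"
    proof (intro sum.neutral ballI)
      fix l assume "l \<in> {..<n}"
      then have l: "l < n" by simp
      have sc: "(\<lambda>i. c * ebb n g l i + 0) \<in> cvecs (2 * n)" for c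
        using eb_cvecs[OF g l] by (simp add: cvecs_def)
      have "\<omega> (vs[k := ?w l]) = th n g l ?v * \<omega> (vs[k := eb n g l]) + \<omega> (vs[k := (\<lambda>i. thb n g l ?v * ebb n g l i + 0)])"
        using alternating_formD(2)[OF alt Suc.prems(2,3) k eb_cvecs(1)[OF g l] sc] by simp
      also have "\<omega> (vs[k := (\<lambda>i. thb n g l ?v * ebb n g l i + 0)]) =
          thb n g l ?v * \<omega> (vs[k := ebb n g l]) + \<omega> (vs[k := (\<lambda>_. 0)])"
        by (rule alternating_formD(2)[OF alt Suc.prems(2,3) k eb_cvecs(2)[OF g l]]) (simp add: cvecs_def)
      finally show "\<omega> (vs[k := ?w l]) = 0"
        using IH[of "eb n g l"] IH[of "ebb n g l"] l alternating_form_zero[OF alt Suc.prems(2,3) k] by auto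
    qed
    finally show ?case .
  qed
  from this[of n vs] show ?thesis using alternating_formD(1)[OF alt, of vs] by auto
qed

text \<open>The difference of both sides is an (n,0)-form that vanishes on the frame, hence zero:
  the (n,0)-forms are a line spanned by \<open>Om\<close>.\<close>

lemma form_eq_Om:
  assumes \<omega>: "form_of_type (2 * n) (Jm n g) n 0 \<omega>"
  shows "\<omega> vs = \<omega> ebl * Om n g vs"
proof -
  have "form_of_type (2 * n) (Jm n g) n 0 (\<lambda>vs. 1 * \<omega> vs + (- \<omega> ebl) * Om n g vs)"
    by (rule form_of_type_diff_scale[OF \<omega> Om_form])
  then have "1 * \<omega> vs + (- \<omega> ebl) * Om n g vs = 0"
    by (rule form_zero) (simp add: Om_ebl)
  then show ?thesis by simp
qed

lemma canonical_fibre_Om: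
  "canonical_fibre n (Jm n g) m (\<lambda>vss. if length vss = m then c * (\<Prod>vs\<leftarrow>vss. Om n g vs) else 0)"
  unfolding canonical_fibre_def
proof (intro conjI allI impI)
  fix vss :: "cvec list list" and j assume j: "length vss = m \<and> j < m"
  define b where "b = c * (\<Prod>vs\<leftarrow>take j vss. Om n g vs) * (\<Prod>vs\<leftarrow>drop (Suc j) vss. Om n g vs)"
  have eq: "(\<lambda>vs. if length (vss[j := vs]) = m then c * (\<Prod>vs\<leftarrow>vss[j := vs]. Om n g vs) else 0) =
      (\<lambda>vs. b * Om n g vs)"
    using j by (auto simp: upd_conv_take_nth_drop b_def)
  show "form_of_type (2 * n) (Jm n g) n 0 (\<lambda>vs. if length (vss[j := vs]) = m then c * (\<Prod>vs\<leftarrow>vss[j := vs]. Om n g vs) else 0)"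
    using form_of_type_diff_scale[OF Om_form Om_form, of b 0] unfolding eq by simp
qed auto

text \<open>One-dimensionality is applied to one block after the other, the blocks being replaced
  from the left by the frame. So the fibre of the tensor power is a line, with the value on the
  frame as coordinate.\<close>

lemma canonical_fibre_eq:
  assumes \<tau>: "canonical_fibre n (Jm n g) m \<tau>" and l: "length vss = m"
  shows "\<tau> vss = \<tau> (replicate m ebl) * (\<Prod>vs\<leftarrow>vss. Om n g vs)"
proof -
  have "\<tau> (replicate k ebl @ drop k vss) * (\<Prod>vs\<leftarrow>take k vss. Om n g vs) = \<tau> vss" if "k \<le> m" for k
    using that
  proof (induction k)
    case (Suc k)
    have k: "k < m" using Suc.prems by simp
    let ?us = "replicate k ebl @ drop k vss"
    have lu: "length ?us = m" using l k by simp
    have "form_of_type (2 * n) (Jm n g) n 0 (\<lambda>vs. \<tau> (?us[k := vs]))"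
      using \<tau> lu k unfolding canonical_fibre_def by blast
    from form_eq_Om[OF this, of "?us ! k"]
    have "\<tau> ?us = \<tau> (?us[k := ebl]) * Om n g (?us ! k)" by simp
    moreover have "?us[k := ebl] = replicate (Suc k) ebl @ drop (Suc k) vss"
    proof -
      have "drop k vss = vss ! k # drop (Suc k) vss" using l k by (simp add: Cons_nth_drop_Suc)
      then show ?thesis
        by (simp add: list_update_append replicate_app_Cons_same)
    qed
    moreover have "?us ! k = vss ! k" using l k by (simp add: nth_append)
    moreover have "(\<Prod>vs\<leftarrow>take (Suc k) vss. Om n g vs) = (\<Prod>vs\<leftarrow>take k vss. Om n g vs) * Om n g (vss ! k)"
      using l k by (simp add: take_Suc_conv_app_nth)
    ultimately show ?case using Suc by (simp add: mult_ac)
  qed simp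
  from this[of m] show ?thesis using l by simp
qed

lemma Om_map_app:
  assumes "\<And>l v. l < n \<Longrightarrow> v \<in> cvecs (2 * n) \<Longrightarrow> th n g l (mat_app (2 * n) M v) = c l * th n g l v"
    and "length vs = n" "set vs \<subseteq> cvecs (2 * n)"
  shows "Om n g (map (mat_app (2 * n) M) vs) = (\<Prod>l<n. c l) * Om n g vs"
proof -
  have "Dt n (th n g) (map (mat_app (2 * n) M) vs) = Dt n (\<lambda>i v. c i * th n g i v) vs"
    using assms by (intro Dt_cong) (auto simp: subset_iff)
  then show ?thesis
    using assms mat_app_cvecs[OF g] by (auto simp: Om_def Dt_scale_rows)
qed

end

section \<open>The Cauchy-Riemann operator on pluricanonical sections\<close>

text \<open>The derivative of dx / g + i g dy with respect to \<open>g\<close> is its complex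
  conjugate times \<open>- 1 / g\<close>. \<open>Omb\<close> is \<open>Om\<close> with the last
  covector conjugated and thus carries the derivative of the frame.\<close>

definition Omb :: "nat \<Rightarrow> real \<Rightarrow> cform" where
  "Omb n g = Dt n (\<lambda>i. if i = n - 1 then thb n g i else th n g i)"

lemma has_pd_sum:
  assumes "\<And>a. a \<in> A \<Longrightarrow> has_pd i (f a) (f' a) x"
  shows "has_pd i (\<lambda>x. \<Sum>a\<in>A. f a x) (\<Sum>a\<in>A. f' a) x"
  using assms unfolding has_pd_def by (intro has_vector_derivative_sum) auto

lemma has_pd_Dt:
  fixes g :: "(nat \<Rightarrow> real) \<Rightarrow> real"
  assumes n: "n > 0" and g: "has_pd i g g' x" "g x \<noteq> 0"
  shows "has_pd i (\<lambda>x. Dt n (th n (g x)) vs) (- (g' / g x) * Omb n (g x) vs) x"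
proof -
  \<comment> \<open>Only the last row depends on \<open>g\<close>, so in the expansion along it the
    cofactors may be taken at the constant parameter 1.\<close>
  let ?c = "\<lambda>j. cofactor (Matrix.mat n n (\<lambda>(i, j). th n 1 i (vs ! j))) (n - 1) j"
  have cof: "?c j = cofactor (Matrix.mat n n (\<lambda>(i, j). R i (vs ! j))) (n - 1) j"
    if "j < n" "\<And>i v. i < n - 1 \<Longrightarrow> R i v = th n 1 i v" for R j
  proof -
    have "mat_delete (Matrix.mat n n (\<lambda>(i, j). th n 1 i (vs ! j))) (n - 1) j =
        mat_delete (Matrix.mat n n (\<lambda>(i, j). R i (vs ! j))) (n - 1) j"
      using n that by (intro eq_matI) (auto simp: mat_delete_def)
    then show ?thesis by (simp add: cofactor_def)
  qed
  have exp: "Dt n R vs = (\<Sum>j<n. R (n - 1) (vs ! j) * ?c j)"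
    if "\<And>i v. i < n - 1 \<Longrightarrow> R i v = th n 1 i v" for R
  proof -
    have "Dt n R vs = (\<Sum>j<n. R (n - 1) (vs ! j) * cofactor (Matrix.mat n n (\<lambda>(i, j). R i (vs ! j))) (n - 1) j)"
      unfolding Dt_def using n by (subst laplace_expansion_row[of _ n "n - 1"]) auto
    then show ?thesis using cof[OF _ that] by simp
  qed
  have D: "Dt n (th n \<gamma>) vs = (\<Sum>j<n. th n \<gamma> (n - 1) (vs ! j) * ?c j)" for \<gamma>
    by (rule exp) (simp add: th_def scl_def)
  have B: "Omb n \<gamma> vs = (\<Sum>j<n. thb n \<gamma> (n - 1) (vs ! j) * ?c j)" for \<gamma>
    unfolding Omb_def by (subst exp) (auto simp: th_def scl_def)
  have "has_pd i (\<lambda>x. th n (g x) (n - 1) v) (- (g' / g x) * thb n (g x) (n - 1) v) x" for v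
  proof -
    have "has_pd i (\<lambda>x. complex_of_real (g x)) (of_real g') x"
      by (rule has_pd_linear[OF bounded_linear_of_real g(1)])
    moreover have "has_pd i (\<lambda>x. complex_of_real (inverse (g x))) (of_real (- (inverse (g x) * g' * inverse (g x)))) x"
      by (rule has_pd_linear[OF bounded_linear_of_real has_pd_inverse[OF g]])
    ultimately have "has_pd i (\<lambda>x. (of_real (inverse (g x)) * v (2 * (n - 1)) + \<i> * (of_real (g x) * v (Suc (2 * (n - 1))))))
        ((of_real (inverse (g x)) * 0 + of_real (- (inverse (g x) * g' * inverse (g x))) * v (2 * (n - 1))) +
          (\<i> * (of_real (g x) * 0 + of_real g' * v (Suc (2 * (n - 1)))) + 0 * (of_real (g x) * v (Suc (2 * (n - 1)))))) x"
      by (intro has_pd_add has_pd_bilinear[OF bounded_bilinear_mult] has_pd_const)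
    moreover have "(of_real (inverse (g x)) * 0 + of_real (- (inverse (g x) * g' * inverse (g x))) * v (2 * (n - 1))) +
          (\<i> * (of_real (g x) * 0 + of_real g' * v (Suc (2 * (n - 1)))) + 0 * (of_real (g x) * v (Suc (2 * (n - 1))))) =
        - (g' / g x) * thb n (g x) (n - 1) v"
      using g(2) by (simp add: thb_def scl_def field_simps)
    ultimately show ?thesis
      by (simp add: th_def scl_def divide_inverse mult_ac)
  qed
  then have "has_pd i (\<lambda>x. \<Sum>j<n. th n (g x) (n - 1) (vs ! j) * ?c j)
      (\<Sum>j<n. th n (g x) (n - 1) (vs ! j) * 0 + (- (g' / g x) * thb n (g x) (n - 1) (vs ! j)) * ?c j) x"
    by (intro has_pd_sum has_pd_bilinear[OF bounded_bilinear_mult] has_pd_const)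
  then show ?thesis
    unfolding D B by (simp add: sum_distrib_left mult_ac)
qed

lemma Omb_zero:
  assumes "length vs = n" "v \<in> set vs" "\<And>l. l < n \<Longrightarrow> th n g l v = 0" "\<And>l. l < n \<Longrightarrow> thb n g l v = 0"
  shows "Omb n g vs = 0"
proof -
  obtain j where "j < n" "v = vs ! j" using assms(1,2) by (metis in_set_conv_nth)
  then show ?thesis unfolding Omb_def using assms(3,4) by (intro Dt_zero_column[of j]) auto
qed

lemma pr10_pr01:
  assumes "g \<noteq> 0" "v \<in> cvecs (2 * n)"
  shows "pr10 (2 * n) (Jm n g) (pr01 (2 * n) (Jm n g) v) = (\<lambda>_. 0)"
    "pr10 (2 * n) (Jm n g) (pr10 (2 * n) (Jm n g) v) = pr10 (2 * n) (Jm n g) v"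
    "pr01 (2 * n) (Jm n g) (pr01 (2 * n) (Jm n g) v) = pr01 (2 * n) (Jm n g) v"
proof -
  have z: "(\<lambda>_. 0) \<in> cvecs (2 * n)" "th n g l (\<lambda>_. 0) = 0" "thb n g l (\<lambda>_. 0) = 0" for l
    by (simp_all add: cvecs_def th_def thb_def)
  show "pr10 (2 * n) (Jm n g) (pr01 (2 * n) (Jm n g) v) = (\<lambda>_. 0)"
    by (rule cvec_eqI[OF assms(1), where n = n]) (simp_all add: assms(2) z th_pr[OF assms(1)] pr_cvecs[OF assms(1)])
  show "pr10 (2 * n) (Jm n g) (pr10 (2 * n) (Jm n g) v) = pr10 (2 * n) (Jm n g) v"
    by (rule cvec_eqI[OF assms(1), where n = n]) (simp_all add: assms(2) z th_pr[OF assms(1)] pr_cvecs[OF assms(1)])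
  show "pr01 (2 * n) (Jm n g) (pr01 (2 * n) (Jm n g) v) = pr01 (2 * n) (Jm n g) v"
    by (rule cvec_eqI[OF assms(1), where n = n]) (simp_all add: assms(2) z th_pr[OF assms(1)] pr_cvecs[OF assms(1)])
qed

section \<open>The d-bar operator on a function times the frame, in one chart\<close>

context
  fixes n :: nat and W :: "(nat \<Rightarrow> real) set" and c :: "'a chart" and p :: 'a and \<kappa> :: "'a \<Rightarrow> cform"
    and f :: "(nat \<Rightarrow> real) \<Rightarrow> complex" and G :: "(nat \<Rightarrow> real) \<Rightarrow> real" and f' :: "nat \<Rightarrow> complex" and G' :: "nat \<Rightarrow> real"
  assumes n: "n \<ge> 2" and W: "openin (Euclidean_space (2 * n)) W" and x0: "snd c p \<in> W"
    and \<kappa>: "\<And>x ws. x \<in> W \<Longrightarrow> \<kappa> (chart_inv c x) ws = f x * Om n (G x) ws"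
    and g: "G (snd c p) \<noteq> 0"
    and f': "\<And>i. i < 2 * n \<Longrightarrow> has_pd i f (f' i) (snd c p)"
    and G': "\<And>i. i < 2 * n \<Longrightarrow> has_pd i G (G' i) (snd c p)"
    and z: "\<And>i. 2 \<le> i \<Longrightarrow> i < 2 * n \<Longrightarrow> G' i = 0"
begin

lemma pdiff_form:
  assumes "length ws = n" "set ws \<subseteq> cvecs (2 * n)" "i < 2 * n"
  shows "pdiff i (\<lambda>x. \<kappa> (chart_inv c x) ws) (snd c p) =
    f' i * Om n (G (snd c p)) ws - f (snd c p) / G (snd c p) * (G' i * Omb n (G (snd c p)) ws)"
proof -
  have Om: "Om n \<gamma> ws = Dt n (th n \<gamma>) ws" for \<gamma> using assms by (simp add: Om_def)
  have "has_pd i (\<lambda>x. f x * Om n (G x) ws)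
      (f (snd c p) * (- (G' i / G (snd c p)) * Omb n (G (snd c p)) ws) + f' i * Om n (G (snd c p)) ws) (snd c p)"
    unfolding Om using n by (intro has_pd_bilinear[OF bounded_bilinear_mult] f' assms has_pd_Dt G' g) auto
  from has_pd_pdiff[OF this] show ?thesis
    using pdiff_cong[OF W x0 assms(3), of "\<lambda>x. \<kappa> (chart_inv c x) ws" "\<lambda>x. f x * Om n (G x) ws"] \<kappa>
    by simp
qed

lemma ext_deriv_form:
  assumes "length vs = Suc n" "set vs \<subseteq> cvecs (2 * n)"
  shows "ext_deriv (2 * n) n c \<kappa> p vs = (\<Sum>a<Suc n. (-1) ^ a *
      ((\<Sum>i<2 * n. (vs ! a) i * f' i) * Om n (G (snd c p)) (take a vs @ drop (Suc a) vs)
        - f (snd c p) / G (snd c p) * ((\<Sum>i<2 * n. (vs ! a) i * G' i) * Omb n (G (snd c p)) (take a vs @ drop (Suc a) vs))))"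
proof -
  have "(\<Sum>i<2 * n. (vs ! a) i * pdiff i (\<lambda>x. \<kappa> (chart_inv c x) (take a vs @ drop (Suc a) vs)) (snd c p)) =
      ((\<Sum>i<2 * n. (vs ! a) i * f' i) * Om n (G (snd c p)) (take a vs @ drop (Suc a) vs)
        - f (snd c p) / G (snd c p) * ((\<Sum>i<2 * n. (vs ! a) i * G' i) * Omb n (G (snd c p)) (take a vs @ drop (Suc a) vs)))"
    if a: "a < Suc n" for a
  proof -
    let ?ws = "take a vs @ drop (Suc a) vs"
    have ws: "length ?ws = n" "set ?ws \<subseteq> cvecs (2 * n)"
      using assms a by (auto dest: in_set_takeD in_set_dropD)
    have "(\<Sum>i<2 * n. (vs ! a) i * pdiff i (\<lambda>x. \<kappa> (chart_inv c x) ?ws) (snd c p)) =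
        (\<Sum>i<2 * n. (vs ! a) i * f' i * Om n (G (snd c p)) ?ws
          - f (snd c p) / G (snd c p) * ((vs ! a) i * G' i * Omb n (G (snd c p)) ?ws))"
      by (intro sum.cong refl) (simp add: pdiff_form[OF ws] algebra_simps)
    then show ?thesis
      by (simp only: sum_subtractf sum_distrib_left[symmetric] sum_distrib_right[symmetric])
  qed
  then show ?thesis using assms by (simp add: ext_deriv_def)
qed

lemma ext_deriv_zero_head:
  assumes "length vs = Suc n" "set vs \<subseteq> cvecs (2 * n)" "vs ! 0 = (\<lambda>_. 0)"
  shows "ext_deriv (2 * n) n c \<kappa> p vs = 0"
  unfolding ext_deriv_form[OF assms(1,2)]
proof (intro sum.neutral ballI)
  fix a assume a: "a \<in> {..<Suc n}"
  let ?ws = "take a vs @ drop (Suc a) vs"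
  show "(-1) ^ a *
      ((\<Sum>i<2 * n. (vs ! a) i * f' i) * Om n (G (snd c p)) ?ws
        - f (snd c p) / G (snd c p) * ((\<Sum>i<2 * n. (vs ! a) i * G' i) * Omb n (G (snd c p)) ?ws)) = 0"
  proof (cases "a = 0")
    case True
    then show ?thesis using assms(3) by simp
  next
    case False
    then have "(\<lambda>_. 0) \<in> set ?ws"
      using assms(1,3) by (metis Un_iff gr0I in_set_conv_nth length_take min_less_iff_conj nth_take set_append zero_less_Suc)
    moreover have "length ?ws = n" using assms(1) a by simp
    ultimately have "Om n (G (snd c p)) ?ws = 0" "Omb n (G (snd c p)) ?ws = 0"
      using Om_zero[OF g] Omb_zero by (auto simp: th_def thb_def)
    then show ?thesis by simp
  qed
qed

text \<open>The derivative of \<open>G\<close> contributes dG wedge \<open>Omb\<close>. On vectors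
  of type (1,0), dG is a multiple of the row \<open>th 0\<close>, which is also a row of
  \<open>Omb\<close> because \<open>n \<ge> 2\<close>, so these terms form a determinant with a
  repeated row. The term with \<open>u\<close> in front is 0 as well, since the conjugated row
  vanishes on \<open>vs\<close>. In the part with \<open>f'\<close>, \<open>Om\<close> vanishes
  whenever \<open>u\<close> is among its arguments, so only the first term survives.\<close>

lemma ext_deriv_mixed:
  assumes u: "u \<in> T01 (2 * n) (Jm n (G (snd c p)))"
    and vs: "length vs = n" "set vs \<subseteq> T10 (2 * n) (Jm n (G (snd c p)))"
  shows "ext_deriv (2 * n) n c \<kappa> p (u # vs) = (\<Sum>i<2 * n. u i * f' i) * Om n (G (snd c p)) vs"
proof -
  let ?\<gamma> = "G (snd c p)" and ?us = "u # vs"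
  let ?om = "\<lambda>a. take a ?us @ drop (Suc a) ?us"
  let ?R = "\<lambda>i. if i = n - 1 then thb n ?\<gamma> i else th n ?\<gamma> i"
  \<comment> \<open>The Wirtinger derivative of \<open>G\<close> in the first complex
    coordinate.\<close>
  let ?k = "(G' 0 - \<i> * G' 1) / 2"
  have us: "length ?us = Suc n" "set ?us \<subseteq> cvecs (2 * n)"
    using u vs by (auto simp: T10_def T01_def)
  have Om0: "Om n ?\<gamma> (?om a) = 0" if "a \<noteq> 0" "a < Suc n" for a
  proof (rule Om_zero[OF g])
    show "u \<in> set (?om a)" using that by (cases a) auto
  qed (use u in \<open>simp add: T01_iff[OF g]\<close>)
  have dG: "(\<Sum>i<2 * n. v i * G' i) = v 0 * G' 0 + v 1 * G' 1" for v :: cvec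
  proof -
    have "(\<Sum>i<2 * n. v i * G' i) = (\<Sum>i\<in>{0, 1}. v i * G' i)"
      using n z by (intro sum.mono_neutral_right) (auto simp: numeral_2_eq_2 not_less_eq_eq Suc_le_eq)
    then show ?thesis by simp
  qed
  have dG10: "(\<Sum>i<2 * n. v i * G' i) = ?k * th n ?\<gamma> 0 v" if "v \<in> set vs" for v
  proof -
    have "v \<in> T10 (2 * n) (Jm n ?\<gamma>)" using that vs(2) by blast
    then have "thb n ?\<gamma> 0 v = 0" using n by (simp add: T10_iff[OF g])
    then have "v 0 = \<i> * v 1" using n by (simp add: thb_def scl_def)
    then show ?thesis unfolding dG using n by (simp add: th_def scl_def algebra_simps)
  qed
  have Omb_vs: "Omb n ?\<gamma> vs = 0"
    unfolding Omb_def using n vs by (intro Dt_zero_row[of "n - 1"]) (auto simp: T10_iff[OF g] subset_iff)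
  have "th n ?\<gamma> 0 u = 0" using u n by (simp add: T01_iff[OF g])
  then have G_term: "(\<Sum>i<2 * n. (?us ! a) i * G' i) * Omb n ?\<gamma> (?om a) = ?k * (?R 0 (?us ! a) * Omb n ?\<gamma> (?om a))"
    if "a < Suc n" for a
    using dG10 Omb_vs that vs(1) n by (cases a) (auto simp: mult.assoc)
  have "ext_deriv (2 * n) n c \<kappa> p ?us = (\<Sum>a<Suc n. (-1) ^ a * ((\<Sum>i<2 * n. (?us ! a) i * f' i) * Om n ?\<gamma> (?om a))
      - f (snd c p) / ?\<gamma> * ?k * ((-1) ^ a * (?R 0 (?us ! a) * Omb n ?\<gamma> (?om a))))"
    unfolding ext_deriv_form[OF us]
  proof (intro sum.cong refl)
    have ring: "s * (A - F * B) = s * A - F * k * (s * C)" if "B = k * C" for s A F B k C :: complex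
      using that by (simp add: algebra_simps)
    show "(-1) ^ a * ((\<Sum>i<2 * n. (?us ! a) i * f' i) * Om n ?\<gamma> (?om a)
        - f (snd c p) / ?\<gamma> * ((\<Sum>i<2 * n. (?us ! a) i * G' i) * Omb n ?\<gamma> (?om a))) =
      (-1) ^ a * ((\<Sum>i<2 * n. (?us ! a) i * f' i) * Om n ?\<gamma> (?om a))
        - f (snd c p) / ?\<gamma> * ?k * ((-1) ^ a * (?R 0 (?us ! a) * Omb n ?\<gamma> (?om a)))"
      if "a \<in> {..<Suc n}" for a
      by (rule ring[OF G_term]) (use that in simp)
  qed
  also have "\<dots> = (\<Sum>a<Suc n. (-1) ^ a * ((\<Sum>i<2 * n. (?us ! a) i * f' i) * Om n ?\<gamma> (?om a)))
      - f (snd c p) / ?\<gamma> * ?k * (\<Sum>a<Suc n. (-1) ^ a * (?R 0 (?us ! a) * Omb n ?\<gamma> (?om a)))"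
    by (simp only: sum_subtractf sum_distrib_left)
  also have "(\<Sum>a<Suc n. (-1) ^ a * (?R 0 (?us ! a) * Omb n ?\<gamma> (?om a))) = 0"
    unfolding Omb_def using n us(1) by (intro Dt_repeated_row) auto
  also have "(\<Sum>a<Suc n. (-1) ^ a * ((\<Sum>i<2 * n. (?us ! a) i * f' i) * Om n ?\<gamma> (?om a))) =
      (-1) ^ 0 * ((\<Sum>i<2 * n. (?us ! 0) i * f' i) * Om n ?\<gamma> (?om 0))"
    by (rule sum_single) (use Om0 in auto)
  finally show ?thesis by simp
qed

text \<open>Differentiating \<open>f\<close> times the frame differentiates \<open>f\<close> alone:
  \<open>Om\<close> behaves like a holomorphic frame as long as \<open>G\<close> varies in the first
  complex coordinate only.\<close>

lemma dbar_canonical_formula: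
  assumes J: "J c p = Jm n (G (snd c p))"
  shows "dbar_canonical n J c \<kappa> p u vs =
    (if u \<in> cvecs (2 * n) \<and> length vs = n \<and> set vs \<subseteq> cvecs (2 * n)
     then (\<Sum>i<2 * n. pr01 (2 * n) (J c p) u i * f' i) * Om n (G (snd c p)) vs else 0)"
proof -
  let ?M = "Jm n (G (snd c p))"
  let ?vs = "pr01 (2 * n) ?M u # map (pr10 (2 * n) ?M) vs"
  have cv: "set ?vs \<subseteq> cvecs (2 * n) \<longleftrightarrow> u \<in> cvecs (2 * n) \<and> set vs \<subseteq> cvecs (2 * n)"
    by (auto simp: pr_cvecs[OF g])
  have dc: "dbar_canonical n J c \<kappa> p u vs = type_proj (2 * n) ?M n 1 (ext_deriv (2 * n) n c \<kappa> p) ?vs"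
    by (simp add: dbar_canonical_def dbar_def J)
  show ?thesis
  proof (cases "u \<in> cvecs (2 * n) \<and> length vs = n \<and> set vs \<subseteq> cvecs (2 * n)")
    case False
    then show ?thesis unfolding dc type_proj_def using cv by auto
  next
    case True
    define ws where "ws = (\<lambda>S. map (\<lambda>i. if i \<in> S then pr10 (2 * n) ?M (?vs ! i) else pr01 (2 * n) ?M (?vs ! i)) [0..<n + 1])"
    have wc: "set (ws S) \<subseteq> cvecs (2 * n)" for S
    proof -
      have "?vs ! i \<in> cvecs (2 * n)" if "i < n + 1" for i
        using cv True that by (metis length_Cons length_map add.commute nth_mem plus_1_eq_Suc subsetD)
      then show ?thesis unfolding ws_def by (auto simp: pr_cvecs[OF g])
    qed
    have "dbar_canonical n J c \<kappa> p u vs =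
        (\<Sum>S | S \<subseteq> {..<n + 1} \<and> card S = n. ext_deriv (2 * n) n c \<kappa> p (ws S))"
      unfolding dc type_proj_def ws_def using cv True by simp
    also have "\<dots> = ext_deriv (2 * n) n c \<kappa> p (ws {1..n})"
    proof (rule sum_single)
      fix S assume S: "S \<in> {S. S \<subseteq> {..<n + 1} \<and> card S = n}" "S \<noteq> {1..n}"
      \<comment> \<open>An \<open>n\<close>-element set of slots other than \<open>{1..n}\<close>
        contains slot 0, whose argument already has type (0,1) and is therefore projected to
        0.\<close>
      have "0 \<in> S"
      proof (rule ccontr)
        assume "0 \<notin> S"
        then have "S \<subseteq> {1..n}" using S(1) by (auto simp: subset_iff Suc_le_eq) (metis gr0I)
        then show False using S by (metis (mono_tags) card_atLeastAtMost card_subset_eq diff_Suc_1 finite_atLeastAtMost mem_Collect_eq)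
      qed
      then have "ws S ! 0 = (\<lambda>_. 0)"
        using True pr10_pr01(1)[OF g] by (simp add: ws_def del: upt_Suc)
      then show "ext_deriv (2 * n) n c \<kappa> p (ws S) = 0"
        using wc by (intro ext_deriv_zero_head) (simp_all add: ws_def del: upt_Suc)
    qed auto
    also have "ws {1..n} = ?vs"
    proof (rule nth_equalityI)
      show "length (ws {1..n}) = length ?vs" using True by (simp add: ws_def del: upt_Suc)
      fix i assume "i < length (ws {1..n})"
      then have i: "i < Suc n" by (simp add: ws_def del: upt_Suc)
      show "ws {1..n} ! i = ?vs ! i"
        using i True pr10_pr01(2,3)[OF g] by (cases i) (auto simp: ws_def subset_iff simp del: upt_Suc)
    qed
    also have "ext_deriv (2 * n) n c \<kappa> p ?vs =
        (\<Sum>i<2 * n. pr01 (2 * n) ?M u i * f' i) * Om n (G (snd c p)) (map (pr10 (2 * n) ?M) vs)"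
      using True by (intro ext_deriv_mixed) (auto simp: T10_iff[OF g] T01_iff[OF g] th_pr[OF g] pr_cvecs[OF g])
    also have "Om n (G (snd c p)) (map (pr10 (2 * n) ?M) vs) = Om n (G (snd c p)) vs"
      using True by (auto simp: Om_def pr_cvecs[OF g] subset_iff th_pr[OF g] intro!: Dt_cong)
    finally show ?thesis using True J by simp
  qed
qed

end

section \<open>Riemann surfaces and differentials of weight \<open>m\<close>\<close>

type_synonym 'b rchart = "'b set \<times> ('b \<Rightarrow> complex)"

definition rinv :: "'b rchart \<Rightarrow> complex \<Rightarrow> 'b" where
  "rinv c = inv_into (fst c) (snd c)"

definition tder :: "'b rchart \<Rightarrow> 'b rchart \<Rightarrow> 'b \<Rightarrow> complex" where
  "tder c c' q = deriv (\<lambda>z. snd c' (rinv c z)) (snd c q)"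

text \<open>Chart domains are nonempty so that a product chart determines its factors
  (\<open>mk_inj\<close>) and every chart offers a base point for slices.\<close>

definition rs_atlas :: "'b::topological_space set \<Rightarrow> 'b rchart set \<Rightarrow> bool" where
  "rs_atlas S C \<longleftrightarrow>
     (\<forall>c\<in>C. fst c \<noteq> {} \<and> openin (top_of_set S) (fst c) \<and> open (snd c ` fst c) \<and> inj_on (snd c) (fst c) \<and>
        continuous_on (fst c) (snd c) \<and> continuous_on (snd c ` fst c) (rinv c)) \<and>
     (\<Union>c\<in>C. fst c) = S \<and>
     (\<forall>c\<in>C. \<forall>c'\<in>C. (\<lambda>z. snd c' (rinv c z)) holomorphic_on snd c ` (fst c \<inter> fst c'))"

definition riemann_surface :: "'b::topological_space set \<Rightarrow> 'b rchart set \<Rightarrow> bool" where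
  "riemann_surface S C \<longleftrightarrow> rs_atlas S C \<and> compact S \<and> connected S \<and> S \<noteq> {}"

text \<open>Differentials of weight \<open>m\<close>, written locally as \<open>f c\<close> times
  the m-th power of dz; the power of \<open>tder\<close> is their transformation law. The value 0
  outside the domain makes equality of functions equality of differentials.\<close>

definition holo_diff :: "'b rchart set \<Rightarrow> 'b set \<Rightarrow> nat \<Rightarrow> ('b rchart \<Rightarrow> 'b \<Rightarrow> complex) set" where
  "holo_diff C U m = {f.
     (\<forall>c q. \<not> (c \<in> C \<and> q \<in> fst c \<inter> U) \<longrightarrow> f c q = 0) \<and>
     (\<forall>c\<in>C. (\<lambda>z. f c (rinv c z)) holomorphic_on snd c ` (fst c \<inter> U)) \<and>
     (\<forall>c\<in>C. \<forall>c'\<in>C. \<forall>q\<in>fst c \<inter> fst c' \<inter> U. f c q = f c' q * tder c c' q ^ m)}"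

lemma holo_diffD:
  assumes "f \<in> holo_diff C U m"
  shows "\<not> (c \<in> C \<and> q \<in> fst c \<inter> U) \<Longrightarrow> f c q = 0"
    "c \<in> C \<Longrightarrow> (\<lambda>z. f c (rinv c z)) holomorphic_on snd c ` (fst c \<inter> U)"
    "c \<in> C \<Longrightarrow> c' \<in> C \<Longrightarrow> q \<in> fst c \<inter> fst c' \<inter> U \<Longrightarrow> f c q = f c' q * tder c c' q ^ m"
  using assms unfolding holo_diff_def mem_Collect_eq by blast+

context
  fixes S :: "'b::topological_space set" and C :: "'b rchart set"
  assumes at: "rs_atlas S C"
begin

lemma rs_chart:
  assumes "c \<in> C"
  shows "fst c \<noteq> {}" "openin (top_of_set S) (fst c)" "open (snd c ` fst c)" "inj_on (snd c) (fst c)"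
    "continuous_on (fst c) (snd c)" "continuous_on (snd c ` fst c) (rinv c)"
  using at assms unfolding rs_atlas_def by blast+

lemma rs_cover: "q \<in> S \<Longrightarrow> \<exists>c\<in>C. q \<in> fst c"
  using at unfolding rs_atlas_def by blast

lemma rs_subset: "c \<in> C \<Longrightarrow> fst c \<subseteq> S"
  using at unfolding rs_atlas_def by blast

lemma rs_trans: "c \<in> C \<Longrightarrow> c' \<in> C \<Longrightarrow> (\<lambda>z. snd c' (rinv c z)) holomorphic_on snd c ` (fst c \<inter> fst c')"
  using at unfolding rs_atlas_def by blast

lemma rinv_snd [simp]: "c \<in> C \<Longrightarrow> q \<in> fst c \<Longrightarrow> rinv c (snd c q) = q"
  unfolding rinv_def using rs_chart(4) by (intro inv_into_f_f) auto

lemma rs_image_eq: "c \<in> C \<Longrightarrow> snd c ` (fst c \<inter> U) = {z \<in> snd c ` fst c. rinv c z \<in> U}"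
  by auto

lemma rs_open_image:
  assumes "c \<in> C" "openin (top_of_set S) U"
  shows "open (snd c ` (fst c \<inter> U))"
proof -
  obtain T where T: "open T" "U = S \<inter> T" using assms(2) by (auto simp: openin_open)
  have "snd c ` (fst c \<inter> U) = snd c ` fst c \<inter> rinv c -` T"
    unfolding rs_image_eq[OF assms(1)] using T(2) rs_subset[OF assms(1)] assms(1) by auto
  then show ?thesis
    using continuous_open_preimage[OF rs_chart(6)[OF assms(1)] rs_chart(3)[OF assms(1)] T(1)] by simp
qed

lemma rs_open_overlap: "c \<in> C \<Longrightarrow> c' \<in> C \<Longrightarrow> open (snd c ` (fst c \<inter> fst c'))"
  using rs_open_image rs_chart(2) by blast

lemma tder_has_field_derivative:
  assumes "c \<in> C" "c' \<in> C" "q \<in> fst c \<inter> fst c'"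
  shows "((\<lambda>z. snd c' (rinv c z)) has_field_derivative tder c c' q) (at (snd c q))"
  unfolding tder_def using rs_trans[OF assms(1,2)] rs_open_overlap[OF assms(1,2)] assms(3)
  by (intro holomorphic_derivI) auto

lemma tder_self: "c \<in> C \<Longrightarrow> q \<in> fst c \<Longrightarrow> tder c c q = 1"
proof -
  assume c: "c \<in> C" "q \<in> fst c"
  have "((\<lambda>z. z) has_field_derivative tder c c q) (at (snd c q))"
    by (rule has_field_derivative_transform_within_open[OF tder_has_field_derivative[OF c(1) c(1)] rs_chart(3)[OF c(1)]])
      (use c in auto)
  then show ?thesis using DERIV_ident DERIV_unique by blast
qed

lemma tder_cocycle:
  assumes "c \<in> C" "c' \<in> C" "c'' \<in> C" "q \<in> fst c" "q \<in> fst c'" "q \<in> fst c''"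
  shows "tder c c'' q = tder c' c'' q * tder c c' q"
proof -
  have "((\<lambda>z. snd c'' (rinv c' (snd c' (rinv c z)))) has_field_derivative tder c' c'' q * tder c c' q) (at (snd c q))"
    using assms tder_has_field_derivative[of c' c'' q] tder_has_field_derivative[of c c' q]
    by (intro DERIV_chain2[where f = "\<lambda>w. snd c'' (rinv c' w)"]) auto
  then have "((\<lambda>z. snd c'' (rinv c z)) has_field_derivative tder c' c'' q * tder c c' q) (at (snd c q))"
    by (rule has_field_derivative_transform_within_open[OF _ rs_open_overlap[OF assms(1,2)]]) (use assms in auto)
  then show ?thesis
    using tder_has_field_derivative[of c c'' q] assms DERIV_unique by blast
qed

lemma tder_nz:
  assumes "c \<in> C" "c' \<in> C" "q \<in> fst c" "q \<in> fst c'"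
  shows "tder c c' q \<noteq> 0"
  using tder_cocycle[OF assms(1,2,1,3,4,3)] tder_self[OF assms(1,3)] by auto

lemma tder_holomorphic:
  assumes "c \<in> C" "c' \<in> C"
  shows "(\<lambda>z. tder c c' (rinv c z)) holomorphic_on snd c ` (fst c \<inter> fst c')"
  by (rule holomorphic_transform[OF holomorphic_deriv[OF rs_trans[OF assms] rs_open_overlap[OF assms]]])
    (use assms in \<open>auto simp: tder_def\<close>)

text \<open>On the domain of \<open>c0\<close> the form dz of that chart vanishes nowhere, and its
  coefficient in the chart \<open>c\<close> is \<open>tder c c0\<close>. Together with
  \<open>holo_diff_tder\<close> this splits a differential of weight \<open>Suc m\<close> locally
  into weights 1 and \<open>m\<close>, as the Leibniz rule requires.\<close>

lemma holo_diff_divide: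
  assumes f: "f \<in> holo_diff C U (Suc m)" and U: "openin (top_of_set S) U" and c0: "c0 \<in> C"
  shows "(\<lambda>c q. if c \<in> C \<and> q \<in> fst c \<inter> fst c0 \<inter> U then f c q / tder c c0 q else 0) \<in> holo_diff C (fst c0 \<inter> U) m"
  unfolding holo_diff_def
proof (intro CollectI conjI ballI allI impI)
  fix c assume c: "c \<in> C"
  have "(\<lambda>z. f c (rinv c z) / tder c c0 (rinv c z)) holomorphic_on snd c ` (fst c \<inter> (fst c0 \<inter> U))"
  proof (intro holomorphic_on_divide)
    show "(\<lambda>z. f c (rinv c z)) holomorphic_on snd c ` (fst c \<inter> (fst c0 \<inter> U))"
      using f c unfolding holo_diff_def by (auto intro: holomorphic_on_subset)
    show "(\<lambda>z. tder c c0 (rinv c z)) holomorphic_on snd c ` (fst c \<inter> (fst c0 \<inter> U))"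
      by (rule holomorphic_on_subset[OF tder_holomorphic[OF c c0]]) auto
    show "tder c c0 (rinv c z) \<noteq> 0" if "z \<in> snd c ` (fst c \<inter> (fst c0 \<inter> U))" for z
      using that tder_nz[OF c c0] c by auto
  qed
  then show "(\<lambda>z. if c \<in> C \<and> rinv c z \<in> fst c \<inter> fst c0 \<inter> U then f c (rinv c z) / tder c c0 (rinv c z) else 0)
      holomorphic_on snd c ` (fst c \<inter> (fst c0 \<inter> U))"
    by (rule holomorphic_transform) (use c in auto)
  fix c' q assume c': "c' \<in> C" and q: "q \<in> fst c \<inter> fst c' \<inter> (fst c0 \<inter> U)"
  have "f c q = f c' q * tder c c' q ^ Suc m"
    using f c c' q unfolding holo_diff_def by blast
  moreover have "tder c c0 q = tder c' c0 q * tder c c' q"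
    using tder_cocycle c c' c0 q by blast
  moreover have "tder c c' q \<noteq> 0" "tder c' c0 q \<noteq> 0" using tder_nz c c' c0 q by blast+
  ultimately show "(if c \<in> C \<and> q \<in> fst c \<inter> fst c0 \<inter> U then f c q / tder c c0 q else 0) =
      (if c' \<in> C \<and> q \<in> fst c' \<inter> fst c0 \<inter> U then f c' q / tder c' c0 q else 0) * tder c c' q ^ m"
    using c c' q by (simp add: field_simps)
qed auto

lemma holo_diff_tder:
  assumes c0: "c0 \<in> C" and U: "openin (top_of_set S) U"
  shows "(\<lambda>c q. if c \<in> C \<and> q \<in> fst c \<inter> fst c0 \<inter> U then tder c c0 q else 0) \<in> holo_diff C (fst c0 \<inter> U) 1"
  unfolding holo_diff_def
proof (intro CollectI conjI ballI allI impI)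
  fix c assume c: "c \<in> C"
  have "(\<lambda>z. tder c c0 (rinv c z)) holomorphic_on snd c ` (fst c \<inter> (fst c0 \<inter> U))"
    by (rule holomorphic_on_subset[OF tder_holomorphic[OF c c0]]) auto
  then show "(\<lambda>z. if c \<in> C \<and> rinv c z \<in> fst c \<inter> fst c0 \<inter> U then tder c c0 (rinv c z) else 0)
      holomorphic_on snd c ` (fst c \<inter> (fst c0 \<inter> U))"
    by (rule holomorphic_transform) (use c in auto)
  fix c' q assume "c' \<in> C" "q \<in> fst c \<inter> fst c' \<inter> (fst c0 \<inter> U)"
  then show "(if c \<in> C \<and> q \<in> fst c \<inter> fst c0 \<inter> U then tder c c0 q else 0) =
      (if c' \<in> C \<and> q \<in> fst c' \<inter> fst c0 \<inter> U then tder c' c0 q else 0) * tder c c' q ^ 1"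
    using c tder_cocycle[OF c _ c0, of c' q] by simp
qed auto

end

section \<open>Products of Riemann surfaces with a twisted last factor\<close>

lemma zc_eqI:
  assumes "\<And>j. j \<ge> 2 * n \<Longrightarrow> x j = 0" "\<And>j. j \<ge> 2 * n \<Longrightarrow> y j = 0" "\<And>l. l < n \<Longrightarrow> zc l x = zc l y"
  shows "x = (y :: nat \<Rightarrow> real)"
proof
  fix j
  show "x j = y j"
  proof (cases "j < 2 * n")
    case True
    then have "zc (j div 2) x = zc (j div 2) y" by (intro assms(3)) simp
    then have "x (2 * (j div 2)) = y (2 * (j div 2))" "x (Suc (2 * (j div 2))) = y (Suc (2 * (j div 2)))"
      by simp_all
    then show ?thesis by (cases "even j") simp_all
  qed (use assms(1,2) in simp)
qed

lemma openin_box: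
  assumes "\<And>l. l < n \<Longrightarrow> open (U l)"
  shows "openin (Euclidean_space (2 * n)) {x. (\<forall>j\<ge>2 * n. x j = 0) \<and> (\<forall>l<n. zc l x \<in> U l)}"
  unfolding openin_Euclidean_space_iff
proof (intro exI conjI)
  show "open (\<Inter>l\<in>{..<n}. zc l -` U l)"
  proof (intro open_INT ballI)
    show "open (zc l -` U l)" if "l \<in> {..<n}" for l
      using that by (intro open_vimage[OF assms continuous_on_zc]) simp
  qed simp
  show "{x. (\<forall>j\<ge>2 * n. x j = 0) \<and> (\<forall>l<n. zc l x \<in> U l)} =
      (\<Inter>l\<in>{..<n}. zc l -` U l) \<inter> {x. \<forall>i\<ge>2 * n. x i = 0}"
    by blast
qed

lemma second_countable_euclidean: "second_countable (euclidean :: 'a::second_countable_topology topology)"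
proof -
  obtain B :: "'a set set" where B: "countable B" "topological_basis B"
    using ex_countable_basis by (elim exE conjE)
  show ?thesis
    unfolding second_countable_def open_openin[symmetric]
  proof (intro exI conjI allI impI ballI)
    show "open V" if "V \<in> B" for V using topological_basis_open[OF B(2) that] .
    show "\<exists>V\<in>B. x \<in> V \<and> V \<subseteq> U" if U: "open U \<and> x \<in> U" for U x
      by (rule topological_basisE[OF B(2) U[THEN conjunct1] U[THEN conjunct2]]) (intro bexI conjI)
  qed (rule B(1))
qed

lemma smooth_on_If:
  "(P \<Longrightarrow> smooth_on d W f) \<Longrightarrow> (\<not> P \<Longrightarrow> smooth_on d W g) \<Longrightarrow> smooth_on d W (\<lambda>x. if P then f x else g x)"
  by (cases P) simp_all

text \<open>\<open>enc\<close> realises tuples of points as real sequences, the carrier that the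
  theorem asks for; with the continuous left inverse \<open>dec\<close> it is an embedding.
  \<open>flat\<close> makes the twisted structure well defined on the last factor.
  \<open>G_smooth\<close> ranges over model spaces of every dimension because \<open>G\<close> is
  composed with one complex coordinate of a product chart.\<close>

locale surface_product =
  fixes n :: nat and S :: "nat \<Rightarrow> 'b::topological_space set" and C :: "nat \<Rightarrow> 'b rchart set" and G :: "'b \<Rightarrow> real"
    and enc :: "(nat \<Rightarrow> 'b) \<Rightarrow> nat \<Rightarrow> real" and dec :: "(nat \<Rightarrow> real) \<Rightarrow> nat \<Rightarrow> 'b"
  assumes n: "n \<ge> 2"
    and rs: "\<And>l. l < n \<Longrightarrow> riemann_surface (S l) (C l)"
    and flat: "\<And>c c' q. c \<in> C (n - 1) \<Longrightarrow> c' \<in> C (n - 1) \<Longrightarrow> q \<in> fst c \<Longrightarrow> q \<in> fst c' \<Longrightarrow> tder c c' q = 1"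
    and dec_enc [simp]: "\<And>q. dec (enc q) = q"
    and cont_enc: "continuous_on UNIV enc" and cont_dec: "continuous_on UNIV dec"
    and G_pos: "\<And>q. G q > 0"
    and G_smooth: "\<And>c d W l. c \<in> C 0 \<Longrightarrow> openin (Euclidean_space d) W \<Longrightarrow> Suc (2 * l) < d \<Longrightarrow>
      (\<And>x. x \<in> W \<Longrightarrow> zc l x \<in> snd c ` fst c) \<Longrightarrow> smooth_on d W (\<lambda>x. G (rinv c (zc l x)))"
    and G_nonconst: "\<exists>c\<in>C 0. \<exists>V. open V \<and> V \<noteq> {} \<and> V \<subseteq> snd c ` fst c \<and>
      (\<forall>z\<in>V. vector_derivative (\<lambda>t. (G (rinv c (Complex t (Im z))))\<^sup>2) (at (Re z)) \<noteq> 0)"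
begin

lemma G_nz [simp]: "G q \<noteq> 0"
  using G_pos[of q] by simp

lemma atl: "l < n \<Longrightarrow> rs_atlas (S l) (C l)"
  using rs unfolding riemann_surface_def by blast

text \<open>Components from \<open>n\<close> on are fixed so that points correspond to
  \<open>n\<close>-tuples.\<close>

definition K :: "(nat \<Rightarrow> real) set" where
  "K = enc ` {q. (\<forall>l<n. q l \<in> S l) \<and> (\<forall>l\<ge>n. q l = undefined)}"

definition I :: "(nat \<Rightarrow> 'b rchart) set" where
  "I = {i. \<forall>l<n. i l \<in> C l}"

definition mk :: "(nat \<Rightarrow> 'b rchart) \<Rightarrow> (nat \<Rightarrow> real) chart" where
  "mk i = ({p \<in> K. \<forall>l<n. dec p l \<in> fst (i l)},
     \<lambda>p j. if j < 2 * n then (if even j then Re else Im) (snd (i (j div 2)) (dec p (j div 2))) else 0)"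

definition A :: "(nat \<Rightarrow> real) chart set" where
  "A = mk ` I"

definition J :: "(nat \<Rightarrow> real) acs" where
  "J c p = Jm n (G (dec p 0))"

definition pinv :: "(nat \<Rightarrow> 'b rchart) \<Rightarrow> (nat \<Rightarrow> real) \<Rightarrow> nat \<Rightarrow> real" where
  "pinv i x = enc (\<lambda>l. if l < n then rinv (i l) (zc l x) else undefined)"

lemma I_C: "i \<in> I \<Longrightarrow> l < n \<Longrightarrow> i l \<in> C l"
  by (simp add: I_def)

lemma enc_dec [simp]: "p \<in> K \<Longrightarrow> enc (dec p) = p"
  by (auto simp: K_def)

lemma dec_S: "p \<in> K \<Longrightarrow> l < n \<Longrightarrow> dec p l \<in> S l"
  by (auto simp: K_def)

lemma K_eqI: "p \<in> K \<Longrightarrow> p' \<in> K \<Longrightarrow> (\<And>l. l < n \<Longrightarrow> dec p l = dec p' l) \<Longrightarrow> p = p'"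
proof -
  assume p: "p \<in> K" "p' \<in> K" and eq: "\<And>l. l < n \<Longrightarrow> dec p l = dec p' l"
  have "dec p l = dec p' l" for l
    using p eq[of l] by (cases "l < n") (auto simp: K_def)
  then show ?thesis using p by (metis enc_dec ext)
qed

lemma fst_mk: "fst (mk i) = {p \<in> K. \<forall>l<n. dec p l \<in> fst (i l)}"
  by (simp add: mk_def)

lemma zc_mk: "l < n \<Longrightarrow> zc l (snd (mk i) p) = snd (i l) (dec p l)"
  by (simp add: mk_def)

lemma mk_zero: "j \<ge> 2 * n \<Longrightarrow> snd (mk i) p j = 0"
  by (simp add: mk_def)

lemma snd_mk: "j < 2 * n \<Longrightarrow> snd (mk i) p j = (if even j then Re else Im) (snd (i (j div 2)) (dec p (j div 2)))"
  by (simp add: mk_def)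

lemma dec_pinv: "l < n \<Longrightarrow> dec (pinv i x) l = rinv (i l) (zc l x)"
  by (simp add: pinv_def)

lemma pinv_mk:
  assumes "i \<in> I" "p \<in> fst (mk i)"
  shows "pinv i (snd (mk i) p) = p"
proof -
  have "dec p l = undefined" if "\<not> l < n" for l
    using assms(2) that by (auto simp: fst_mk K_def)
  moreover have "rinv (i l) (zc l (snd (mk i) p)) = dec p l" if l: "l < n" for l
    unfolding zc_mk[OF l] using assms l rinv_snd[OF atl[OF l] I_C[OF assms(1) l]] by (simp add: fst_mk)
  ultimately have "(\<lambda>l. if l < n then rinv (i l) (zc l (snd (mk i) p)) else undefined) = dec p"
    by (simp add: fun_eq_iff)
  then show ?thesis using assms by (simp add: pinv_def fst_mk)
qed

lemma pinv_in:
  assumes "i \<in> I" "\<And>l. l < n \<Longrightarrow> zc l x \<in> snd (i l) ` fst (i l)"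
  shows "pinv i x \<in> fst (mk i)" "\<And>l. l < n \<Longrightarrow> zc l (snd (mk i) (pinv i x)) = zc l x"
proof -
  have r: "rinv (i l) (zc l x) \<in> fst (i l)" "snd (i l) (rinv (i l) (zc l x)) = zc l x" if l: "l < n" for l
  proof -
    obtain q where q: "q \<in> fst (i l)" "zc l x = snd (i l) q" using assms(2)[OF l] by blast
    show "rinv (i l) (zc l x) \<in> fst (i l)" "snd (i l) (rinv (i l) (zc l x)) = zc l x"
      unfolding q(2) using q(1) rinv_snd[OF atl[OF l] I_C[OF assms(1) l]] by simp_all
  qed
  moreover have "rinv (i l) (zc l x) \<in> S l" if "l < n" for l
    using r[OF that] rs_subset[OF atl[OF that] I_C[OF assms(1) that]] by blast
  then have "pinv i x \<in> K"
    unfolding K_def pinv_def by (intro imageI) simp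
  ultimately show "pinv i x \<in> fst (mk i)" by (simp add: fst_mk dec_pinv)
  show "zc l (snd (mk i) (pinv i x)) = zc l x" if "l < n" for l
    using r[OF that] that by (simp only: zc_mk dec_pinv)
qed

lemma mk_image:
  assumes i: "i \<in> I"
  shows "snd (mk i) ` {p \<in> K. \<forall>l<n. dec p l \<in> fst (i l) \<inter> U l} =
    {x. (\<forall>j\<ge>2 * n. x j = 0) \<and> (\<forall>l<n. zc l x \<in> snd (i l) ` (fst (i l) \<inter> U l))}" (is "?L = ?R")
proof
  show "?L \<subseteq> ?R"
    by (auto simp: mk_zero zc_mk)
  show "?R \<subseteq> ?L"
  proof
    fix x assume x: "x \<in> ?R"
    have in': "zc l x \<in> snd (i l) ` fst (i l)" if "l < n" for l
      using x that by blast
    have "rinv (i l) (zc l x) \<in> fst (i l) \<inter> U l" if l: "l < n" for l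
    proof -
      obtain q where "q \<in> fst (i l) \<inter> U l" "zc l x = snd (i l) q" using x l by blast
      then show ?thesis using rinv_snd[OF atl[OF l] I_C[OF i l]] by simp
    qed
    then have "pinv i x \<in> {p \<in> K. \<forall>l<n. dec p l \<in> fst (i l) \<inter> U l}"
      using pinv_in(1)[OF i in'] by (simp add: fst_mk dec_pinv)
    moreover have "x = snd (mk i) (pinv i x)"
      by (rule zc_eqI[of n]) (use x mk_zero pinv_in(2)[OF i in'] in auto)
    ultimately show "x \<in> ?L" by blast
  qed
qed

lemma mk_image_chart:
  assumes "i \<in> I"
  shows "snd (mk i) ` fst (mk i) = {x. (\<forall>j\<ge>2 * n. x j = 0) \<and> (\<forall>l<n. zc l x \<in> snd (i l) ` fst (i l))}"
  using mk_image[OF assms, of "\<lambda>_. UNIV"] by (simp add: fst_mk)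

lemma zc_in: "i \<in> I \<Longrightarrow> x \<in> snd (mk i) ` fst (mk i) \<Longrightarrow> l < n \<Longrightarrow> zc l x \<in> snd (i l) ` fst (i l)"
  unfolding mk_image_chart by blast

lemma inj_on_mk:
  assumes "i \<in> I"
  shows "inj_on (snd (mk i)) (fst (mk i))"
  by (rule inj_on_inverseI[where g = "pinv i"]) (rule pinv_mk[OF assms])

lemma chart_inv_mk:
  assumes "i \<in> I" "x \<in> snd (mk i) ` fst (mk i)"
  shows "chart_inv (mk i) x = pinv i x"
proof -
  obtain p where p: "p \<in> fst (mk i)" "x = snd (mk i) p" using assms(2) by blast
  then have "chart_inv (mk i) x = p"
    unfolding chart_inv_def using inj_on_mk[OF assms(1)] by simp
  then show ?thesis using pinv_mk[OF assms(1)] p by simp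
qed

lemma open_mk_image:
  assumes i: "i \<in> I" and U: "\<And>l. l < n \<Longrightarrow> openin (top_of_set (S l)) (U l)"
  shows "openin (Euclidean_space (2 * n)) (snd (mk i) ` {p \<in> K. \<forall>l<n. dec p l \<in> fst (i l) \<inter> U l})"
  unfolding mk_image[OF i]
  by (rule openin_box) (rule rs_open_image[OF atl I_C[OF i] U])

lemma continuous_dec: "continuous_on T (\<lambda>p. dec p l)"
proof -
  have "continuous_on UNIV (\<lambda>p. dec p l)"
    by (rule continuous_on_product_then_coordinatewise[OF cont_dec])
  then show ?thesis by (rule continuous_on_subset) auto
qed

lemma openin_K_box:
  assumes "\<And>l. l < n \<Longrightarrow> openin (top_of_set (S l)) (U l)"
  shows "openin (top_of_set K) {p \<in> K. \<forall>l<n. dec p l \<in> U l}"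
proof -
  have "\<exists>T. open T \<and> U l = S l \<inter> T" if "l < n" for l
    using assms[OF that] by (auto simp: openin_open)
  then obtain T where T: "\<And>l. l < n \<Longrightarrow> open (T l)" "\<And>l. l < n \<Longrightarrow> U l = S l \<inter> T l" by metis
  have "open (\<Inter>l\<in>{..<n}. (\<lambda>p. dec p l) -` T l)"
  proof (intro open_INT ballI)
    show "open ((\<lambda>p. dec p l) -` T l)" if "l \<in> {..<n}" for l
      using that by (intro open_vimage[OF T(1) continuous_dec]) simp
  qed simp
  moreover have "{p \<in> K. \<forall>l<n. dec p l \<in> U l} = K \<inter> (\<Inter>l\<in>{..<n}. (\<lambda>p. dec p l) -` T l)"
    using T(2) dec_S by auto
  ultimately show ?thesis by (auto simp: openin_open)
qed

lemma openin_fst_mk: "i \<in> I \<Longrightarrow> openin (top_of_set K) (fst (mk i))"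
  unfolding fst_mk by (rule openin_K_box) (rule rs_chart(2)[OF atl I_C])

lemma is_chart_mk:
  assumes i: "i \<in> I"
  shows "is_chart (2 * n) (top_of_set K) (mk i)"
  unfolding is_chart_def
proof (intro conjI)
  show "openin (top_of_set K) (fst (mk i))" by (rule openin_fst_mk[OF i])
  let ?D = "snd (mk i) ` fst (mk i)"
  show "openin (Euclidean_space (2 * n)) ?D"
    unfolding mk_image_chart[OF i] by (rule openin_box) (rule rs_chart(3)[OF atl I_C[OF i]])
  have sub: "subtopology (top_of_set K) (fst (mk i)) = top_of_set (fst (mk i))"
  proof -
    have "K \<inter> fst (mk i) = fst (mk i)" by (auto simp: fst_mk)
    then show ?thesis by (simp add: subtopology_subtopology)
  qed
  have "{x. \<forall>i\<ge>2 * n. x i = 0} \<inter> ?D = ?D"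
    unfolding mk_image_chart[OF i] by blast
  then have sub': "subtopology (Euclidean_space (2 * n)) ?D = top_of_set ?D"
    unfolding Euclidean_space_def by (simp add: subtopology_subtopology euclidean_product_topology)
  have c1: "continuous_on (fst (mk i)) (snd (mk i))"
  proof (rule continuous_on_coordinatewise_then_product)
    fix j
    show "continuous_on (fst (mk i)) (\<lambda>p. snd (mk i) p j)"
    proof (cases "j < 2 * n")
      case True
      then have l: "j div 2 < n" by simp
      have "continuous_on (fst (mk i)) (\<lambda>p. snd (i (j div 2)) (dec p (j div 2)))"
        by (rule continuous_on_compose2[OF rs_chart(5)[OF atl[OF l] I_C[OF i l]] continuous_dec])
          (use l in \<open>simp add: fst_mk image_subset_iff\<close>)
      then show ?thesis
        using True by (cases "even j") (simp_all add: snd_mk continuous_on_Re continuous_on_Im)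
    qed (simp add: mk_zero)
  qed
  have c2: "continuous_on ?D (pinv i)"
    unfolding pinv_def
  proof (rule continuous_on_compose2[OF cont_enc])
    show "continuous_on ?D (\<lambda>x l. if l < n then rinv (i l) (zc l x) else undefined)"
    proof (rule continuous_on_coordinatewise_then_product)
      fix l show "continuous_on ?D (\<lambda>x. if l < n then rinv (i l) (zc l x) else undefined)"
      proof (cases "l < n")
        case True
        have "continuous_on ?D (\<lambda>x. rinv (i l) (zc l x))"
          by (rule continuous_on_compose2[OF rs_chart(6)[OF atl[OF True] I_C[OF i True]] continuous_on_zc])
            (use zc_in[OF i _ True] in blast)
        then show ?thesis using True by simp
      qed simp
    qed
  qed auto
  have "homeomorphic_maps (top_of_set (fst (mk i))) (top_of_set ?D) (snd (mk i)) (pinv i)"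
    unfolding homeomorphic_maps_def
  proof (intro conjI ballI)
    show "continuous_map (top_of_set (fst (mk i))) (top_of_set ?D) (snd (mk i))"
      using c1 by (simp add: Pi_iff)
    show "continuous_map (top_of_set ?D) (top_of_set (fst (mk i))) (pinv i)"
      using c2 pinv_mk[OF i] by (simp add: Pi_iff)
    show "snd (mk i) (pinv i x) = x" if "x \<in> topspace (top_of_set ?D)" for x
    proof -
      obtain p where "p \<in> fst (mk i)" "x = snd (mk i) p" using \<open>x \<in> topspace (top_of_set ?D)\<close> by (auto simp only: topspace_euclidean_subtopology)
      then show ?thesis using pinv_mk[OF i] by simp
    qed
  qed (use pinv_mk[OF i] in simp)
  then show "homeomorphic_map (subtopology (top_of_set K) (fst (mk i)))
      (subtopology (Euclidean_space (2 * n)) ?D) (snd (mk i))"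
    unfolding sub sub' homeomorphic_map_maps by blast
qed

lemma cover: "(\<Union>c\<in>A. fst c) = K"
proof
  have "fst (mk i) \<subseteq> K" for i unfolding fst_mk by blast
  then show "(\<Union>c\<in>A. fst c) \<subseteq> K" unfolding A_def by (intro UN_least) (erule imageE, simp only:)
  show "K \<subseteq> (\<Union>c\<in>A. fst c)"
  proof
    fix p assume p: "p \<in> K"
    have "\<forall>l. \<exists>c. l < n \<longrightarrow> c \<in> C l \<and> dec p l \<in> fst c"
    proof
      fix l show "\<exists>c. l < n \<longrightarrow> c \<in> C l \<and> dec p l \<in> fst c"
      proof (cases "l < n")
        case True
        obtain c where "c \<in> C l" "dec p l \<in> fst c"
          using rs_cover[OF atl[OF True] dec_S[OF p True]] by (elim bexE)
        then show ?thesis by (intro exI[of _ c] impI conjI)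
      qed simp
    qed
    from choice[OF this] obtain i where i: "\<forall>l. l < n \<longrightarrow> i l \<in> C l \<and> dec p l \<in> fst (i l)"
      by (elim exE)
    have "i \<in> I" unfolding I_def using i by simp
    moreover have "p \<in> fst (mk i)" unfolding fst_mk using i p by simp
    ultimately show "p \<in> (\<Union>c\<in>A. fst c)" unfolding A_def by (intro UnionI[of "fst (mk i)"] imageI)
  qed
qed

lemma fst_mk_Int: "fst (mk i) \<inter> fst (mk i') = {p \<in> K. \<forall>l<n. dec p l \<in> fst (i l) \<inter> fst (i' l)}"
  unfolding fst_mk by blast

lemma transition_mk:
  assumes "i \<in> I" "x \<in> snd (mk i) ` fst (mk i)" "j < 2 * n"
  shows "snd (mk i') (chart_inv (mk i) x) j =
    (if even j then Re else Im) (snd (i' (j div 2)) (rinv (i (j div 2)) (zc (j div 2) x)))"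
  using assms by (simp add: chart_inv_mk snd_mk dec_pinv)

lemma open_overlap_image:
  assumes "i \<in> I" "i' \<in> I"
  shows "openin (Euclidean_space (2 * n)) (snd (mk i) ` (fst (mk i) \<inter> fst (mk i')))"
  unfolding fst_mk_Int by (rule open_mk_image[OF assms(1)]) (rule rs_chart(2)[OF atl I_C[OF assms(2)]])

lemma zc_overlap:
  assumes "i \<in> I" "x \<in> snd (mk i) ` (fst (mk i) \<inter> fst (mk i'))" "l < n"
  shows "zc l x \<in> snd (i l) ` (fst (i l) \<inter> fst (i' l))"
  using assms(2,3) unfolding fst_mk_Int mk_image[OF assms(1)] by blast

lemma smooth_transition:
  assumes i: "i \<in> I" and i': "i' \<in> I" and j: "j < 2 * n"
  shows "smooth_on (2 * n) (snd (mk i) ` (fst (mk i) \<inter> fst (mk i'))) (\<lambda>x. snd (mk i') (chart_inv (mk i) x) j)"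
proof -
  let ?l = "j div 2"
  let ?W = "snd (mk i) ` (fst (mk i) \<inter> fst (mk i'))"
  have l: "?l < n" using j by simp
  have W: "openin (Euclidean_space (2 * n)) ?W" by (rule open_overlap_image[OF i i'])
  have "smooth_on (2 * n) ?W (\<lambda>x. snd (i' ?l) (rinv (i ?l) (zc ?l x)))"
    using zc_overlap[OF i _ l]
    by (intro smooth_on_holomorphic[OF W rs_open_overlap[OF atl[OF l] I_C[OF i l] I_C[OF i' l]] _
          rs_trans[OF atl[OF l] I_C[OF i l] I_C[OF i' l]]])
  then have "smooth_on (2 * n) ?W (\<lambda>x. (if even j then Re else Im) (snd (i' ?l) (rinv (i ?l) (zc ?l x))))"
    by (cases "even j") (auto intro: smooth_on_linear[OF W] bounded_linear_Re bounded_linear_Im)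
  then show ?thesis
    by (rule smooth_on_cong[OF W, THEN iffD1, rotated]) (use i j in \<open>auto simp: transition_mk\<close>)
qed

lemma smooth_atlas_A: "smooth_atlas (2 * n) (top_of_set K) A"
  unfolding smooth_atlas_def
proof (intro conjI ballI allI impI)
  show "is_chart (2 * n) (top_of_set K) c" if "c \<in> A" for c
    using that is_chart_mk unfolding A_def by blast
  show "smooth_on (2 * n) (snd c ` (fst c \<inter> fst c')) (\<lambda>x. snd c' (chart_inv c x) j)"
    if "c \<in> A" "c' \<in> A" "j < 2 * n" for c c' j
    using that smooth_transition unfolding A_def by blast
qed (simp add: cover)

text \<open>Each complex coordinate of a change of product charts depends on the same coordinate
  only, so the Jacobian is block diagonal and its blocks are multiplications by \<open>tder\<close>;
  the factor \<open>1\<close> or \<open>\<i>\<close> is the direction of differentiation.\<close>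

lemma jac_entry:
  assumes i: "i \<in> I" and i': "i' \<in> I" and p: "p \<in> fst (mk i) \<inter> fst (mk i')" and jk: "j < 2 * n" "k < 2 * n"
  shows "jacobian (mk i) (mk i') p j k =
    (if j div 2 = k div 2
     then (if even j then Re else Im) (tder (i (j div 2)) (i' (j div 2)) (dec p (j div 2)) * (if even k then 1 else \<i>)) else 0)"
proof -
  let ?l = "j div 2" and ?x = "snd (mk i) p"
  let ?W = "snd (mk i) ` (fst (mk i) \<inter> fst (mk i'))"
  let ?L = "if even j then Re else Im" and ?t = "tder (i (j div 2)) (i' (j div 2)) (dec p (j div 2))"
  have l: "?l < n" using jk by simp
  have W: "openin (Euclidean_space (2 * n)) ?W" by (rule open_overlap_image[OF i i'])
  have x: "?x \<in> ?W" using p by blast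
  have L: "bounded_linear ?L" by (simp add: bounded_linear_Re bounded_linear_Im)
  have "dec p ?l \<in> fst (i ?l) \<inter> fst (i' ?l)" using p l by (simp add: fst_mk)
  from tder_has_field_derivative[OF atl[OF l] I_C[OF i l] I_C[OF i' l] this]
  have "((\<lambda>z. snd (i' ?l) (rinv (i ?l) z)) has_field_derivative ?t) (at (zc ?l ?x))"
    unfolding zc_mk[OF l] .
  from has_pd_linear[OF L has_pd_holomorphic[OF this, of k]]
  have "has_pd k (\<lambda>x. ?L (snd (i' ?l) (rinv (i ?l) (zc ?l x))))
      (?L (if k = 2 * ?l then ?t else if k = Suc (2 * ?l) then \<i> * ?t else 0)) ?x" .
  then have "has_pd k (\<lambda>x. snd (mk i') (chart_inv (mk i) x) j)
      (?L (if k = 2 * ?l then ?t else if k = Suc (2 * ?l) then \<i> * ?t else 0)) ?x"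
    by (rule has_pd_cong[OF W x jk(2), THEN iffD1, rotated]) (use i jk in \<open>auto simp: transition_mk\<close>)
  then have "jacobian (mk i) (mk i') p j k = ?L (if k = 2 * ?l then ?t else if k = Suc (2 * ?l) then \<i> * ?t else 0)"
    unfolding jacobian_def by (rule has_pd_pdiff)
  moreover have "k = 2 * ?l \<longleftrightarrow> ?l = k div 2 \<and> even k" "k = Suc (2 * ?l) \<longleftrightarrow> ?l = k div 2 \<and> odd k"
    by (auto elim!: oddE)
  ultimately show ?thesis by (auto simp: mult.commute)
qed

lemma mat_app_jac:
  fixes v :: cvec
  assumes i: "i \<in> I" and i': "i' \<in> I" and p: "p \<in> fst (mk i) \<inter> fst (mk i')" and l: "l < n"
  defines "t \<equiv> tder (i l) (i' l) (dec p l)"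
  shows "mat_app (2 * n) (jacobian (mk i) (mk i') p) v (2 * l) = Re t * v (2 * l) - Im t * v (Suc (2 * l))"
    "mat_app (2 * n) (jacobian (mk i) (mk i') p) v (Suc (2 * l)) = Im t * v (2 * l) + Re t * v (Suc (2 * l))"
proof -
  have "(\<Sum>k<2 * n. complex_of_real (jacobian (mk i) (mk i') p j k) * v k) =
      complex_of_real (jacobian (mk i) (mk i') p j (2 * l)) * v (2 * l) +
      complex_of_real (jacobian (mk i) (mk i') p j (Suc (2 * l))) * v (Suc (2 * l))"
    if j: "j < 2 * n" "j div 2 = l" for j
    unfolding sum_pairs
    by (rule sum_single) (use j l in \<open>auto simp: jac_entry[OF i i' p j(1)]\<close>)
  from this[of "2 * l"] this[of "Suc (2 * l)"]
  show "mat_app (2 * n) (jacobian (mk i) (mk i') p) v (2 * l) = Re t * v (2 * l) - Im t * v (Suc (2 * l))"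
    "mat_app (2 * n) (jacobian (mk i) (mk i') p) v (Suc (2 * l)) = Im t * v (2 * l) + Re t * v (Suc (2 * l))"
    using l by (simp_all add: mat_app_def jac_entry[OF i i' p] t_def)
qed

lemma tder_flat:
  assumes "i \<in> I" "i' \<in> I" "p \<in> fst (mk i) \<inter> fst (mk i')"
  shows "tder (i (n - 1)) (i' (n - 1)) (dec p (n - 1)) = 1"
  using assms n by (intro flat) (auto simp: fst_mk I_C)

text \<open>A block of the Jacobian is multiplication by \<open>tder\<close>. On the last factor
  this is the identity, so the twisted covector is invariant whatever \<open>g\<close> is; on the
  others the covector is plain dz.\<close>

lemma th_jac:
  assumes i: "i \<in> I" and i': "i' \<in> I" and p: "p \<in> fst (mk i) \<inter> fst (mk i')" and l: "l < n"
  shows "th n g l (mat_app (2 * n) (jacobian (mk i) (mk i') p) v) = tder (i l) (i' l) (dec p l) * th n g l v"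
proof (cases "l = n - 1")
  case True
  then show ?thesis
    unfolding th_def mat_app_jac[OF i i' p l] using tder_flat[OF i i' p] by simp
next
  case False
  then have "scl n g l = 1" by (simp add: scl_def)
  moreover have "Re t * a - Im t * b + \<i> * (Im t * a + Re t * b) = t * (a + \<i> * b)" for t a b :: complex
  proof -
    have "t * (a + \<i> * b) = (Re t + \<i> * Im t) * (a + \<i> * b)" by (simp add: complex_eq[symmetric])
    then show ?thesis by (simp add: algebra_simps)
  qed
  ultimately show ?thesis
    unfolding th_def mat_app_jac[OF i i' p l] by simp
qed

text \<open>On untwisted factors the blocks are multiplications by complex numbers and commute with
  multiplication by \<open>\<i>\<close>. On the last factor the block is the identity and commutes
  with any matrix, which permits the same twisted matrix in every chart.\<close>

lemma jac_J:
  assumes i: "i \<in> I" and i': "i' \<in> I" and p: "p \<in> fst (mk i) \<inter> fst (mk i')" and jk: "j < 2 * n" "k < 2 * n"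
  shows "mat_mult (2 * n) (jacobian (mk i) (mk i') p) (J c p) j k =
    mat_mult (2 * n) (J c' p) (jacobian (mk i) (mk i') p) j k"
proof -
  let ?D = "jacobian (mk i) (mk i') p"
  \<comment> \<open>The partner of an index within its complex coordinate. \<open>Jm\<close> can be
    nonzero only between partners, so each matrix product reduces to one term.\<close>
  define pa where "pa = (\<lambda>k::nat. if even k then Suc k else k - 1)"
  have pa: "pa k < 2 * n" "pa k div 2 = k div 2" "even (pa k) \<longleftrightarrow> odd k" "pa (pa k) = k" if "k < 2 * n" for k
    using that by (auto simp: pa_def elim!: evenE oddE)
  have Jz: "Jm n g a b = 0" if "b \<noteq> pa a" for g a b
    using that by (auto simp: Jm_def pa_def elim!: oddE)
  have Jz': "Jm n g a b = 0" if "a \<noteq> pa b" for g a b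
    using that by (auto simp: Jm_def pa_def elim!: oddE)
  have L: "mat_mult (2 * n) ?D (J c p) j k = ?D j (pa k) * Jm n (G (dec p 0)) (pa k) k"
    unfolding mat_mult_def J_def by (rule sum_single) (use jk pa Jz' in auto)
  have R: "mat_mult (2 * n) (J c' p) ?D j k = Jm n (G (dec p 0)) j (pa j) * ?D (pa j) k"
    unfolding mat_mult_def J_def by (rule sum_single) (use jk pa Jz in auto)
  have JE: "Jm n g a (pa a) = (if even a then - (scl n g (a div 2))\<^sup>2 else inverse ((scl n g (a div 2))\<^sup>2))" for g a
    by (auto simp: Jm_def pa_def elim!: oddE)
  have JE': "Jm n g (pa a) a = (if odd a then - (scl n g (a div 2))\<^sup>2 else inverse ((scl n g (a div 2))\<^sup>2))" for g a
    by (auto simp: Jm_def pa_def elim!: oddE)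
  note e = jac_entry[OF i i' p jk(1) pa(1)[OF jk(2)]] jac_entry[OF i i' p pa(1)[OF jk(1)] jk(2)]
  note pj = pa(2,3)[OF jk(1)] pa(2,3)[OF jk(2)]
  show ?thesis
  proof (cases "j div 2 = k div 2")
    case False
    then show ?thesis
      unfolding L R e pj by simp
  next
    case True
    show ?thesis
    proof (cases "j div 2 = n - 1")
      case last: True
      then have "tder (i (k div 2)) (i' (k div 2)) (dec p (k div 2)) = 1"
        using tder_flat[OF i i' p] True by simp
      then show ?thesis
        unfolding L R JE JE' e pj True by (cases "even j"; cases "even k") simp_all
    next
      case False
      then have "scl n g (j div 2) = 1" "scl n g (k div 2) = 1" for g using True by (simp_all add: scl_def)
      then show ?thesis
        unfolding L R JE JE' e pj True by (cases "even j"; cases "even k") simp_all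
    qed
  qed
qed

lemma smooth_G:
  assumes i: "i \<in> I" and W: "openin (Euclidean_space (2 * n)) W" "W \<subseteq> snd (mk i) ` fst (mk i)"
  shows "smooth_on (2 * n) W (\<lambda>x. G (dec (chart_inv (mk i) x) 0))"
proof -
  have "smooth_on (2 * n) W (\<lambda>x. G (rinv (i 0) (zc 0 x)))"
  proof (rule G_smooth[OF I_C[OF i] W(1)])
    show "zc 0 x \<in> snd (i 0) ` fst (i 0)" if "x \<in> W" for x
      using zc_in[OF i, of x 0] that W(2) n by auto
  qed (use n in auto)
  then show ?thesis
  proof (rule smooth_on_cong[OF W(1), THEN iffD1, rotated])
    fix x assume "x \<in> W"
    then show "G (rinv (i 0) (zc 0 x)) = G (dec (chart_inv (mk i) x) 0)"
      using W(2) i n by (simp add: chart_inv_mk subset_iff dec_pinv)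
  qed
qed

lemma acs_J: "almost_complex_structure (2 * n) (top_of_set K) A J"
  unfolding almost_complex_structure_def
proof (intro ballI allI impI conjI)
  fix c j k assume c: "c \<in> A" and jk: "j < 2 * n" "k < 2 * n"
  then obtain i where i: "i \<in> I" "c = mk i" by (auto simp: A_def)
  let ?W = "snd c ` fst c"
  have W: "openin (Euclidean_space (2 * n)) ?W"
    using is_chart_mk[OF i(1)] i(2) by (simp add: is_chart_def)
  have G: "smooth_on (2 * n) ?W (\<lambda>x. G (dec (chart_inv c x) 0))"
    using smooth_G[OF i(1)] W i(2) by simp
  have s: "smooth_on (2 * n) ?W (\<lambda>x. scl n (G (dec (chart_inv c x) 0)) l)" for l
    using G smooth_on_const[OF W] by (cases "l = n - 1") (simp_all add: scl_def)
  have s2: "smooth_on (2 * n) ?W (\<lambda>x. (scl n (G (dec (chart_inv c x) 0)) l)\<^sup>2)" for l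
    unfolding power2_eq_square by (intro smooth_on_mult[OF W] s)
  have m: "smooth_on (2 * n) ?W (\<lambda>x. - (scl n (G (dec (chart_inv c x) 0)) l)\<^sup>2)" for l
    by (intro smooth_on_linear[OF W bounded_linear_minus[OF bounded_linear_ident]] s2)
  have v: "smooth_on (2 * n) ?W (\<lambda>x. inverse ((scl n (G (dec (chart_inv c x) 0)) l)\<^sup>2))" for l
    by (intro smooth_on_inverse[OF W] s2) (simp add: scl_def)
  show "smooth_on (2 * n) ?W (\<lambda>x. J c (chart_inv c x) j k)"
    unfolding J_def Jm_def using m v smooth_on_const[OF W, of 0]
    by (intro smooth_on_If)
  show "mat_mult (2 * n) (J c p) (J c p) j k = (if j = k then - 1 else 0)" for p
    unfolding J_def using jk by (rule mat_mult_Jm[OF G_nz])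
  fix c' p assume "c' \<in> A" and p: "p \<in> fst c \<inter> fst c'"
  then obtain i' where "i' \<in> I" "c' = mk i'" by (auto simp: A_def)
  then show "mat_mult (2 * n) (jacobian c c' p) (J c p) j k = mat_mult (2 * n) (J c' p) (jacobian c c' p) j k"
    using jac_J i p jk by blast
qed

lemma almost_complex_manifold: "almost_complex_manifold n (top_of_set K) A J"
proof -
  have "second_countable (top_of_set K)"
    by (intro second_countable_subtopology second_countable_euclidean)
  moreover have "Hausdorff_space (top_of_set K)"
    by (intro Hausdorff_space_subtopology Hausdorff_space_euclidean)
  ultimately show ?thesis
    unfolding almost_complex_manifold_def smooth_manifold_def
    using smooth_atlas_A acs_J by blast
qed

lemma compact_connected: "compact_space (top_of_set K)" "connected_space (top_of_set K)"
proof -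
  \<comment> \<open>Singletons in the components from \<open>n\<close> on turn \<open>K\<close> into
    the image of a full product, to which the product theorems for compact and connected sets
    apply.\<close>
  let ?T = "\<lambda>l. if l < n then S l else {undefined}"
  have mem: "(\<forall>l. q l \<in> ?T l) \<longleftrightarrow> (\<forall>l<n. q l \<in> S l) \<and> (\<forall>l\<ge>n. q l = undefined)" for q
  proof (intro iffI conjI allI impI)
    show "q l \<in> S l" if "\<forall>l. q l \<in> ?T l" "l < n" for l using that(1)[THEN spec, of l] that(2) by simp
    show "q l = undefined" if "\<forall>l. q l \<in> ?T l" "n \<le> l" for l using that(1)[THEN spec, of l] that(2) by simp
  qed simp
  have "PiE UNIV ?T = {q. (\<forall>l<n. q l \<in> S l) \<and> (\<forall>l\<ge>n. q l = undefined)}"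
    unfolding mem[symmetric] PiE_UNIV_domain Pi_def by simp
  then have K: "K = enc ` PiE UNIV ?T"
    unfolding K_def by simp
  have ne: "compact (?T l)" "connected (?T l)" for l
    using rs[of l] unfolding riemann_surface_def by (cases "l < n"; simp)+
  have "compactin (product_topology (\<lambda>_. euclidean) UNIV) (PiE UNIV ?T)"
    using ne by (simp add: compactin_PiE)
  then have "compact (PiE UNIV ?T)" by (simp add: euclidean_product_topology)
  then have "compact K" unfolding K
    by (rule compact_continuous_image[OF continuous_on_subset[OF cont_enc subset_UNIV]])
  then show "compact_space (top_of_set K)" by (simp add: compact_space_subtopology)
  have "connectedin (product_topology (\<lambda>_. euclidean) UNIV) (PiE UNIV ?T)"
    using ne by (simp add: connectedin_PiE)
  then have "connected (PiE UNIV ?T)" by (simp add: euclidean_product_topology)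
  then have "connected K" unfolding K
    by (rule connected_continuous_image[OF continuous_on_subset[OF cont_enc subset_UNIV]])
  then have "connectedin euclidean K" by simp
  then show "connected_space (top_of_set K)" unfolding connectedin_def by blast
qed

end

section \<open>Non-integrability\<close>

lemma chart_open_image:
  assumes c: "is_chart d X c" and U: "openin X U"
  shows "openin (Euclidean_space d) (snd c ` (fst c \<inter> U))"
proof -
  have D: "openin (Euclidean_space d) (snd c ` fst c)"
    and h: "homeomorphic_map (subtopology X (fst c)) (subtopology (Euclidean_space d) (snd c ` fst c)) (snd c)"
    using c unfolding is_chart_def by simp_all
  have "openin (subtopology X (fst c)) (fst c \<inter> U)"
    using U by (rule openin_subtopology_Int2)
  moreover have "\<forall>V. openin (subtopology X (fst c)) V \<longrightarrow>
      openin (subtopology (Euclidean_space d) (snd c ` fst c)) (snd c ` V)"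
    using homeomorphic_imp_open_map[OF h] unfolding open_map_def .
  ultimately have "openin (subtopology (Euclidean_space d) (snd c ` fst c)) (snd c ` (fst c \<inter> U))"
    by (elim allE impE)
  then show ?thesis using D by (rule openin_trans_full)
qed

lemma chart_inj_on:
  assumes c: "is_chart d X c"
  shows "inj_on (snd c) (fst c)"
proof -
  have o: "openin X (fst c)"
    and h: "homeomorphic_map (subtopology X (fst c)) (subtopology (Euclidean_space d) (snd c ` fst c)) (snd c)"
    using c unfolding is_chart_def by simp_all
  have t: "topspace (subtopology X (fst c)) = fst c"
    using openin_subset[OF o] by (rule topspace_subtopology_subset)
  show ?thesis using homeomorphic_imp_injective_map[OF h] unfolding t .
qed

lemma chart_inv_in:
  assumes "is_chart d X c" "x \<in> snd c ` (fst c \<inter> U)"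
  shows "chart_inv c x \<in> fst c \<inter> U" "snd c (chart_inv c x) = x"
proof -
  obtain p where p: "p \<in> fst c" "p \<in> U" "x = snd c p" using assms(2) by blast
  have "chart_inv c x = p"
    unfolding chart_inv_def p(3) using chart_inj_on[OF assms(1)] p(1) by (rule inv_into_f_f)
  then show "chart_inv c x \<in> fst c \<inter> U" "snd c (chart_inv c x) = x" using p by simp_all
qed

lemma chart_zero: "is_chart d X c \<Longrightarrow> p \<in> fst c \<Longrightarrow> j \<ge> d \<Longrightarrow> snd c p j = 0"
proof -
  assume c: "is_chart d X c" and p: "p \<in> fst c" and j: "j \<ge> d"
  have "snd c ` fst c \<subseteq> topspace (Euclidean_space d)"
    using c openin_subset unfolding is_chart_def by (elim conjE) (rule openin_subset)
  then show ?thesis using p j unfolding topspace_Euclidean_space by blast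
qed

lemma mat_mult_std_J:
  assumes "r < n"
  shows "mat_mult (2 * n) std_J M (2 * r) j = - M (Suc (2 * r)) j"
    "mat_mult (2 * n) std_J M (Suc (2 * r)) j = M (2 * r) j"
proof -
  have "(\<Sum>k<2 * n. std_J (2 * r) k * M k j) = std_J (2 * r) (Suc (2 * r)) * M (Suc (2 * r)) j"
    by (rule sum_single) (use assms in \<open>simp_all add: std_J_def\<close>)
  then show "mat_mult (2 * n) std_J M (2 * r) j = - M (Suc (2 * r)) j"
    by (simp add: mat_mult_def std_J_def)
  have "(\<Sum>k<2 * n. std_J (Suc (2 * r)) k * M k j) = std_J (Suc (2 * r)) (2 * r) * M (2 * r) j"
    by (rule sum_single) (use assms in \<open>simp_all add: std_J_def\<close>)
  then show "mat_mult (2 * n) std_J M (Suc (2 * r)) j = M (2 * r) j"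
    by (simp add: mat_mult_def std_J_def)
qed

lemma mat_mult_Jm_right:
  assumes "l < n"
  shows "mat_mult (2 * n) M (Jm n g) i (2 * l) = M i (Suc (2 * l)) * inverse ((scl n g l)\<^sup>2)"
proof -
  have "(\<Sum>k<2 * n. M i k * Jm n g k (2 * l)) = M i (Suc (2 * l)) * Jm n g (Suc (2 * l)) (2 * l)"
  proof (rule sum_single)
    show "M i b * Jm n g b (2 * l) = 0" if "b \<noteq> Suc (2 * l)" for b
    proof -
      have "\<not> (even b \<and> 2 * l = Suc b)" by presburger
      then show ?thesis using that by (auto simp: Jm_def)
    qed
  qed (use assms in simp_all)
  then show ?thesis by (simp add: mat_mult_def Jm_def)
qed

context surface_product
begin

text \<open>The components of a chart \<open>b\<close> of a compatible complex atlas, read in a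
  product chart \<open>c\<close>, satisfy the equations of \<open>commutator_annihilates\<close>
  wherever the derivative of the square of \<open>G\<close> is nonzero. So \<open>b\<close> does not
  see the x-direction of the torus and fails to be injective.\<close>

lemma not_integrable: "\<not> integrable_acs n (top_of_set K) A J"
proof
  assume "integrable_acs n (top_of_set K) A J"
  then obtain B where B: "complex_atlas n (top_of_set K) B \<and> smooth_atlas (2 * n) (top_of_set K) (A \<union> B) \<and>
    (\<forall>c\<in>A. \<forall>b\<in>B. \<forall>p\<in>fst c \<inter> fst b. \<forall>i<2 * n. \<forall>j<2 * n.
      mat_mult (2 * n) (jacobian c b p) (J c p) i j = mat_mult (2 * n) std_J (jacobian c b p) i j)"
    unfolding integrable_acs_def by (elim exE)
  note cB = B[THEN conjunct1] and sAB = B[THEN conjunct2, THEN conjunct1] and eq = B[THEN conjunct2, THEN conjunct2, rule_format]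
  obtain c0 V where c0: "c0 \<in> C 0" and V: "open V" "V \<noteq> {}" "V \<subseteq> snd c0 ` fst c0"
    and dG: "\<forall>z\<in>V. vector_derivative (\<lambda>t. (G (rinv c0 (Complex t (Im z))))\<^sup>2) (at (Re z)) \<noteq> 0"
    using G_nonconst by (elim bexE exE conjE)
  obtain q0 where q0: "q0 \<in> fst c0" "snd c0 q0 \<in> V" using V by blast
  \<comment> \<open>A chart and a point for each factor: the given ones on the first, where
    \<open>G\<close> varies, and arbitrary ones elsewhere.\<close>
  have "\<forall>l. \<exists>cq. l < n \<longrightarrow> fst cq \<in> C l \<and> snd cq \<in> fst (fst cq) \<and> (l = 0 \<longrightarrow> cq = (c0, q0))"
  proof
    fix l show "\<exists>cq. l < n \<longrightarrow> fst cq \<in> C l \<and> snd cq \<in> fst (fst cq) \<and> (l = 0 \<longrightarrow> cq = (c0, q0))"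
    proof (cases "l < n \<and> l \<noteq> 0")
      case True
      then have "riemann_surface (S l) (C l)" using rs by simp
      then have "S l \<noteq> {}" unfolding riemann_surface_def by simp
      then obtain q where "q \<in> S l" by blast
      moreover have "rs_atlas (S l) (C l)" using atl True by simp
      ultimately obtain c where "c \<in> C l" "q \<in> fst c" using rs_cover by blast
      then show ?thesis using True by (intro exI[of _ "(c, q)"]) simp
    next
      case False
      then show ?thesis using c0 q0 by (intro exI[of _ "(c0, q0)"]) auto
    qed
  qed
  from choice[OF this] obtain cq where cq: "\<forall>l. l < n \<longrightarrow> fst (cq l) \<in> C l \<and> snd (cq l) \<in> fst (fst (cq l)) \<and> (l = 0 \<longrightarrow> cq l = (c0, q0))"
    by (elim exE)
  have cqC: "fst (cq l) \<in> C l" and cqm: "snd (cq l) \<in> fst (fst (cq l))" if "l < n" for l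
  proof -
    note * = cq[THEN spec, THEN mp, OF that]
    show "fst (cq l) \<in> C l" "snd (cq l) \<in> fst (fst (cq l))"
      by (rule *[THEN conjunct1], rule *[THEN conjunct2, THEN conjunct1])
  qed
  have "0 < n" using n by simp
  then have cq0: "cq 0 = (c0, q0)"
    by (rule cq[THEN spec, THEN mp, THEN conjunct2, THEN conjunct2, THEN mp, OF _ refl])
  define i where "i = (\<lambda>l. fst (cq l))"
  define p0 where "p0 = enc (\<lambda>l. if l < n then snd (cq l) else undefined)"
  have i: "i \<in> I" using cqC by (simp add: I_def i_def)
  have i0: "i 0 = c0" using cq0 by (simp add: i_def)
  have "snd (cq l) \<in> S l" if "l < n" for l
    using rs_subset[OF atl[OF that] cqC[OF that]] cqm[OF that] by (rule subsetD)
  then have "p0 \<in> K" unfolding K_def p0_def by (intro imageI) simp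
  then have p0: "p0 \<in> fst (mk i)" using cqm unfolding fst_mk by (simp add: p0_def i_def)
  define c where "c = mk i"
  have c: "c \<in> A" unfolding c_def A_def using i by (rule imageI)
  have "(\<Union>b\<in>B. fst b) = topspace (top_of_set K)"
    using cB unfolding complex_atlas_def smooth_atlas_def by (elim conjE)
  then have "(\<Union>b\<in>B. fst b) = K" by simp
  then obtain b where b: "b \<in> B" "p0 \<in> fst b" using \<open>p0 \<in> K\<close> by blast
  have chc: "is_chart (2 * n) (top_of_set K) c" and chb: "is_chart (2 * n) (top_of_set K) b"
  proof -
    have "\<forall>c\<in>A \<union> B. is_chart (2 * n) (top_of_set K) c"
      using sAB unfolding smooth_atlas_def by (elim conjE)
    then show "is_chart (2 * n) (top_of_set K) c" "is_chart (2 * n) (top_of_set K) b"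
      using c b(1) by simp_all
  qed
  define W where "W = snd c ` (fst c \<inter> fst b)"
  have W: "openin (Euclidean_space (2 * n)) W"
    unfolding W_def using chb by (intro chart_open_image[OF chc]) (simp add: is_chart_def)
  \<comment> \<open>\<open>W\<close> is cut down to points whose first complex coordinate lies in
    \<open>V\<close>, where the derivative of \<open>h\<close> below does not vanish.\<close>
  define W' where "W' = W \<inter> {x. (\<forall>j\<ge>2 * n. x j = 0) \<and> (\<forall>l<n. zc l x \<in> (if l = 0 then V else UNIV))}"
  have W': "openin (Euclidean_space (2 * n)) W'"
    unfolding W'_def by (intro openin_Int W openin_box) (simp add: V)
  define x0 where "x0 = snd c p0"
  have "zc 0 x0 = snd c0 q0"
    unfolding x0_def c_def using n cq0 i0 by (subst zc_mk) (simp_all add: p0_def)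
  then have x0: "x0 \<in> W'"
    using p0 b(2) q0(2) unfolding W'_def W_def x0_def c_def by (simp add: mk_zero)
  have inW: "chart_inv c x \<in> fst c \<inter> fst b" "snd c (chart_inv c x) = x" if "x \<in> W'" for x
  proof -
    have "x \<in> snd c ` (fst c \<inter> fst b)" using that unfolding W'_def W_def by (rule IntD1)
    from chart_inv_in[OF chc this] show "chart_inv c x \<in> fst c \<inter> fst b" "snd c (chart_inv c x) = x" .
  qed
  have W'sub: "W' \<subseteq> snd c ` fst c" "W' \<subseteq> W" unfolding W'_def W_def by blast+
  \<comment> \<open>Up to a factor, the twisted vector of type (0,1) is the y-derivative minus
    \<open>\<i> * h\<close> times the x-derivative, with \<open>h\<close> the square of
    \<open>G\<close>.\<close>
  define h where "h = (\<lambda>x. (G (dec (chart_inv c x) 0))\<^sup>2)"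
  have hs: "smooth_on (2 * n) W' h"
    unfolding h_def power2_eq_square c_def
    by (intro smooth_on_mult[OF W'] smooth_G[OF i W']) (use W'sub(1) c_def in simp_all)
  have hd: "pdiff 0 h x \<noteq> 0" if x: "x \<in> W'" for x
  proof -
    have "pdiff 0 h x = pdiff 0 (\<lambda>x. (G (rinv c0 (zc 0 x)))\<^sup>2) x"
    proof (rule pdiff_cong[OF W' x])
      fix y assume "y \<in> W'"
      then have "y \<in> snd (mk i) ` fst (mk i)" using W'sub(1) c_def by blast
      then show "h y = (G (rinv c0 (zc 0 y)))\<^sup>2"
        unfolding h_def c_def using n i0 by (simp only: chart_inv_mk[OF i]) (simp add: dec_pinv)
    qed (use n in simp)
    also have "\<dots> = vector_derivative (\<lambda>t. (G (rinv c0 (Complex t (Im (zc 0 x)))))\<^sup>2) (at (Re (zc 0 x)))"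
      by (simp add: pdiff_def)
    also have "\<dots> \<noteq> 0"
    proof -
      have "\<forall>l<n. zc l x \<in> (if l = 0 then V else UNIV)" using x unfolding W'_def by blast
      from this[THEN spec, of 0] have "zc 0 x \<in> V" using n by simp
      then show ?thesis by (rule bspec[OF dG])
    qed
    finally show ?thesis .
  qed
  have scl: "scl n g 0 = 1" "scl n g (n - 1) = g" for g using n by (simp_all add: scl_def)
  let ?a = "2 * (n - 1)"
  define f where "f = (\<lambda>j x. snd b (chart_inv c x) j)"
  have fs: "smooth_on (2 * n) W' (f j)" if "j < 2 * n" for j
  proof -
    have "\<forall>c\<in>A \<union> B. \<forall>c'\<in>A \<union> B. \<forall>i<2 * n. smooth_on (2 * n) (snd c ` (fst c \<inter> fst c')) (\<lambda>x. snd c' (chart_inv c x) i)"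
      using sAB unfolding smooth_atlas_def by (elim conjE)
    then have "smooth_on (2 * n) W (f j)"
      using c b(1) that unfolding W_def f_def by simp
    then show ?thesis using W'sub(2) by (rule smooth_on_subset)
  qed
  have jac: "jacobian c b (chart_inv c x) j k = pdiff k (f j) x" if "x \<in> W'" for x j k
    unfolding jacobian_def f_def using inW(2)[OF that] by simp
  have eqs: "pdiff 1 (f (2 * r)) x = - pdiff 0 (f (Suc (2 * r))) x" "pdiff 1 (f (Suc (2 * r))) x = pdiff 0 (f (2 * r)) x"
    "pdiff (Suc ?a) (f (2 * r)) x = - (h x * pdiff ?a (f (Suc (2 * r))) x)"
    "pdiff (Suc ?a) (f (Suc (2 * r))) x = h x * pdiff ?a (f (2 * r)) x" if r: "r < n" and x: "x \<in> W'" for r x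
  proof -
    let ?p = "chart_inv c x" and ?D = "jacobian c b (chart_inv c x)"
    have e: "mat_mult (2 * n) ?D (Jm n (G (dec ?p 0))) (2 * r) k = - ?D (Suc (2 * r)) k"
      "mat_mult (2 * n) ?D (Jm n (G (dec ?p 0))) (Suc (2 * r)) k = ?D (2 * r) k" if "k < 2 * n" for k
      using eq[OF c b(1) inW(1)[OF x], of "2 * r" k] eq[OF c b(1) inW(1)[OF x], of "Suc (2 * r)" k] r that
      unfolding J_def by (simp_all add: mat_mult_std_J)
    show "pdiff 1 (f (2 * r)) x = - pdiff 0 (f (Suc (2 * r))) x" "pdiff 1 (f (Suc (2 * r))) x = pdiff 0 (f (2 * r)) x"
      using e[of "2 * 0"] mat_mult_Jm_right[of 0 n ?D "G (dec ?p 0)"] n scl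
      unfolding jac[OF x] by simp_all
    have "pdiff (Suc ?a) (f (2 * r)) x * inverse (h x) = - pdiff ?a (f (Suc (2 * r))) x"
      "pdiff (Suc ?a) (f (Suc (2 * r))) x * inverse (h x) = pdiff ?a (f (2 * r)) x"
      using e[of ?a] mat_mult_Jm_right[of "n - 1" n ?D "G (dec ?p 0)"] n scl
      unfolding jac[OF x] h_def by simp_all
    moreover have "h x \<noteq> 0" by (simp add: h_def)
    ultimately show "pdiff (Suc ?a) (f (2 * r)) x = - (h x * pdiff ?a (f (Suc (2 * r))) x)"
      "pdiff (Suc ?a) (f (Suc (2 * r))) x = h x * pdiff ?a (f (2 * r)) x"
      by (simp_all add: field_simps)
  qed
  have z: "pdiff ?a (f j) x = 0" if j: "j < 2 * n" and x: "x \<in> W'" for j x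
  proof -
    let ?r = "j div 2"
    have r: "?r < n" "2 * ?r < 2 * n" "Suc (2 * ?r) < 2 * n" using j by (simp, simp, presburger)
    have "pdiff ?a (f (2 * ?r)) x = 0 \<and> pdiff ?a (f (Suc (2 * ?r))) x = 0"
      using commutator_annihilates[OF W' fs[OF r(2)] fs[OF r(3)] hs, of 0 1 ?a "Suc ?a" x] n hd[OF x] x
        eqs[OF r(1)] by simp
    then show ?thesis by (cases "even j") simp_all
  qed
  have "?a < 2 * n" using n by simp
  from eventually_line_mem[OF W' x0 this]
  obtain e where e: "e > 0" "\<And>t. dist t (x0 ?a) < e \<Longrightarrow> x0(?a := t) \<in> W'"
    unfolding eventually_nhds_metric by blast
  \<comment> \<open>A second point, moved from the first along the x-direction of the torus by half
    the admissible radius.\<close>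
  let ?t1 = "x0 ?a + e / 2"
  have const: "f j (x0(?a := ?t1)) = f j (x0(?a := x0 ?a))" if j: "j < 2 * n" for j
  proof -
    have d: "((\<lambda>t. f j (x0(?a := t))) has_real_derivative 0) (at t)" if "dist t (x0 ?a) < e" for t
      using smooth_on_has_pd[OF fs[OF j] \<open>?a < 2 * n\<close> e(2)[OF that]] z[OF j e(2)[OF that]]
      unfolding has_pd_def has_real_derivative_iff_has_vector_derivative by simp
    have near: "dist t (x0 ?a) < e" if "x0 ?a \<le> t" "t \<le> ?t1" for t
      using that e(1) by (simp add: dist_real_def)
    show ?thesis
    proof (rule DERIV_isconst_end[where f = "\<lambda>t. f j (x0(?a := t))"])
      show "continuous_on {x0 ?a..?t1} (\<lambda>t. f j (x0(?a := t)))"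
        by (rule DERIV_atLeastAtMost_imp_continuous_on) (use d near in blast)
      show "((\<lambda>t. f j (x0(?a := t))) has_real_derivative 0) (at t)" if "x0 ?a < t" "t < ?t1" for t
        by (rule d) (use that near in simp)
    qed (use e(1) in simp)
  qed
  have x1: "x0(?a := ?t1) \<in> W'" using e(1) by (intro e(2)) (simp add: dist_real_def)
  let ?p1 = "chart_inv c (x0(?a := ?t1))"
  \<comment> \<open>All coordinates of the two points under \<open>b\<close> agree, those from
    \<open>2 * n\<close> on being 0. Injectivity of \<open>b\<close> then identifies points whose
    coordinates under \<open>c\<close> differ.\<close>
  have "snd b ?p1 = snd b (chart_inv c x0)"
  proof
    fix j show "snd b ?p1 j = snd b (chart_inv c x0) j"
    proof (cases "j < 2 * n")
      case True
      then show ?thesis using const unfolding f_def by simp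
    next
      case False
      have "?p1 \<in> fst b" "chart_inv c x0 \<in> fst b" using inW(1)[OF x1] inW(1)[OF x0] by blast+
      then show ?thesis using False chart_zero[OF chb] by simp
    qed
  qed
  then have "?p1 = chart_inv c x0"
    using inj_onD[OF chart_inj_on[OF chb]] inW(1)[OF x1] inW(1)[OF x0] by blast
  then have "x0(?a := ?t1) = x0" using inW(2)[OF x1] inW(2)[OF x0] by metis
  then have "?t1 = x0 ?a" by (metis fun_upd_same)
  then show False using e(1) by simp
qed

end

section \<open>Pluricanonical sections from products of differentials\<close>

lemma smooth_on_prod_list:
  fixes f :: "'a \<Rightarrow> (nat \<Rightarrow> real) \<Rightarrow> 'b::real_normed_field"
  assumes "openin (Euclidean_space d) W" "\<And>a. smooth_on d W (f a)"
  shows "smooth_on d W (\<lambda>x. \<Prod>a\<leftarrow>xs. f a x)"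
proof (induction xs)
  case Nil
  show ?case using smooth_on_const[OF assms(1)] by simp
next
  case (Cons a xs)
  then show ?case using smooth_on_mult[OF assms(1) assms(2)] by simp
qed

lemma smooth_on_Om:
  assumes W: "openin (Euclidean_space d) W" and g: "smooth_on d W g" "\<And>x. x \<in> W \<Longrightarrow> g x \<noteq> 0"
  shows "smooth_on d W (\<lambda>x. Om n (g x) vs)"
proof -
  have "smooth_on d W (\<lambda>x. complex_of_real (scl n (g x) l))" for l
    using smooth_on_linear[OF W bounded_linear_of_real g(1)] smooth_on_const[OF W]
    by (cases "l = n - 1") (simp_all add: scl_def)
  moreover have "smooth_on d W (\<lambda>x. complex_of_real (inverse (scl n (g x) l)))" for l
    using smooth_on_linear[OF W bounded_linear_of_real smooth_on_inverse[OF W g]] smooth_on_const[OF W]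
    by (cases "l = n - 1") (simp_all add: scl_def del: of_real_inverse)
  ultimately have "smooth_on d W (\<lambda>x. v (2 * l) * complex_of_real (inverse (scl n (g x) l)) +
      \<i> * complex_of_real (scl n (g x) l) * v (Suc (2 * l)))" for l v
    by (intro smooth_on_add[OF W] smooth_on_mult[OF W] smooth_on_const[OF W])
  then have th: "smooth_on d W (\<lambda>x. th n (g x) l v)" for l v
    by (simp add: th_def divide_inverse)
  have "Dt n (th n \<gamma>) vs = (\<Sum>p | p permutes {0..<n}. of_int (sign p) * (\<Prod>i = 0..<n. th n \<gamma> i (vs ! p i)))" for \<gamma>
    unfolding Dt_def by (subst det_def'[of _ n]) (auto intro!: sum.cong prod.cong simp: permutes_in_image)
  then have "smooth_on d W (\<lambda>x. Dt n (th n (g x)) vs)"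
    by (simp only:) (intro smooth_on_sum[OF W] smooth_on_mult[OF W] smooth_on_prod[OF W] smooth_on_const[OF W] th)
  then show ?thesis
    unfolding Om_def by (intro smooth_on_If smooth_on_const[OF W])
qed

lemma has_pd_cauchy_riemann_prod:
  assumes F: "\<And>k. k < N \<Longrightarrow> F k holomorphic_on U k" "\<And>k. k < N \<Longrightarrow> open (U k)" "\<And>k. k < N \<Longrightarrow> zc k x \<in> U k"
    and f: "f = (\<lambda>x. \<Prod>k<N. F k (zc k x))"
  shows "l < N \<Longrightarrow> pdiff (Suc (2 * l)) f x = \<i> * pdiff (2 * l) f x" "i \<ge> 2 * N \<Longrightarrow> pdiff i f x = 0"
proof -
  have const: "has_pd i (\<lambda>x. \<Prod>k\<in>A. F k (zc k x)) 0 x" if "\<And>k. k \<in> A \<Longrightarrow> i \<noteq> 2 * k \<and> i \<noteq> Suc (2 * k)" for i A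
  proof -
    have "(\<Prod>k\<in>A. F k (zc k (x(i := t)))) = (\<Prod>k\<in>A. F k (zc k x))" for t
      using that by (intro prod.cong refl) auto
    then show ?thesis by (simp add: has_pd_def)
  qed
  show "pdiff i f x = 0" if "i \<ge> 2 * N"
    unfolding f by (rule has_pd_pdiff[OF const]) (use that in auto)
  show "pdiff (Suc (2 * l)) f x = \<i> * pdiff (2 * l) f x" if l: "l < N"
  proof -
    let ?A = "{..<N} - {l}"
    have eq: "f = (\<lambda>x. F l (zc l x) * (\<Prod>k\<in>?A. F k (zc k x)))"
      unfolding f using l by (intro ext prod.remove) auto
    have d: "(F l has_field_derivative deriv (F l) (zc l x)) (at (zc l x))"
      using F l by (intro holomorphic_derivI) auto
    have p: "has_pd i f (F l (zc l x) * 0 + (if i = 2 * l then deriv (F l) (zc l x) else if i = Suc (2 * l) then \<i> * deriv (F l) (zc l x) else 0) *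
        (\<Prod>k\<in>?A. F k (zc k x))) x" if "i = 2 * l \<or> i = Suc (2 * l)" for i
    proof -
      have ne: "i \<noteq> 2 * k \<and> i \<noteq> Suc (2 * k)" if "k \<in> ?A" for k
        using that \<open>i = 2 * l \<or> i = Suc (2 * l)\<close> by auto
      show ?thesis
        unfolding eq by (rule has_pd_bilinear[OF bounded_bilinear_mult has_pd_holomorphic[OF d] const[OF ne]])
    qed
    have "2 * l \<noteq> Suc (2 * l)" by presburger
    then show ?thesis
      using has_pd_pdiff[OF p[of "2 * l"]] has_pd_pdiff[OF p[of "Suc (2 * l)"]] by simp
  qed
qed

context surface_product
begin

text \<open>A chart is a bare pair, so its tuple of factor charts is recovered by choice; the
  components below \<open>n\<close> are determined by the chart (\<open>mk_inj\<close>).\<close>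

definition idx :: "(nat \<Rightarrow> real) chart \<Rightarrow> nat \<Rightarrow> 'b rchart" where
  "idx c = (SOME i. i \<in> I \<and> mk i = c)"

lemma idx: "c \<in> A \<Longrightarrow> idx c \<in> I" "c \<in> A \<Longrightarrow> mk (idx c) = c"
proof -
  assume "c \<in> A"
  then have "\<exists>i. i \<in> I \<and> mk i = c" unfolding A_def by blast
  then have "idx c \<in> I \<and> mk (idx c) = c" unfolding idx_def by (rule someI_ex)
  then show "idx c \<in> I" "mk (idx c) = c" by simp_all
qed

lemma A_cases:
  assumes "c \<in> A"
  obtains i where "i \<in> I" "c = mk i"
  using assms unfolding A_def by blast

text \<open>Boxes restrict the first \<open>n - 1\<close> factors only, since the sections built
  below are constant along the torus; \<open>ex\<close> completes the family by the whole last
  factor.\<close>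

definition bx :: "(nat \<Rightarrow> 'b set) \<Rightarrow> (nat \<Rightarrow> real) set" where
  "bx U = {p \<in> K. \<forall>l<n - 1. dec p l \<in> U l}"

definition ex :: "(nat \<Rightarrow> 'b set) \<Rightarrow> nat \<Rightarrow> 'b set" where
  "ex U l = (if l < n - 1 then U l else S l)"

lemma n_Suc: "n = Suc (n - 1)" "0 < n - 1" "n - 1 < n"
  using n by simp_all

lemma all_less_n: "(\<forall>l<n. P l) \<longleftrightarrow> (\<forall>l<n - 1. P l) \<and> P (n - 1)"
proof -
  have "l < n \<longleftrightarrow> l < n - 1 \<or> l = n - 1" for l using n by auto
  then show ?thesis by auto
qed

lemma bx_ex: "bx U = {p \<in> K. \<forall>l<n. dec p l \<in> ex U l}"
  unfolding bx_def all_less_n using dec_S[OF _ n_Suc(3)] by (auto simp: ex_def)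

lemma openin_ex:
  assumes "\<And>l. l < n - 1 \<Longrightarrow> openin (top_of_set (S l)) (U l)"
  shows "l < n \<Longrightarrow> openin (top_of_set (S l)) (ex U l)"
  using assms by (cases "l < n - 1") (simp_all add: ex_def openin_subtopology_self)

lemma openin_bx:
  assumes "\<And>l. l < n - 1 \<Longrightarrow> openin (top_of_set (S l)) (U l)"
  shows "openin (top_of_set K) (bx U)"
  unfolding bx_ex by (rule openin_K_box[OF openin_ex[OF assms]])

lemma fst_mk_bx: "fst (mk i) \<inter> bx U = {p \<in> K. \<forall>l<n. dec p l \<in> fst (i l) \<inter> ex U l}"
  unfolding fst_mk bx_ex by blast

definition coef :: "(nat \<Rightarrow> 'b rchart \<Rightarrow> 'b \<Rightarrow> complex) \<Rightarrow> (nat \<Rightarrow> real) chart \<Rightarrow> (nat \<Rightarrow> real) \<Rightarrow> complex" where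
  "coef f c p = (\<Prod>l<n - 1. f l (idx c l) (dec p l))"

text \<open>The exterior product of differentials of weight \<open>m\<close> on the first
  \<open>n - 1\<close> factors with the m-th power of the twisted covector. \<open>Om\<close>
  already contains the forms dz, so the coefficients are simply multiplied.\<close>

definition sec :: "nat \<Rightarrow> (nat \<Rightarrow> 'b set) \<Rightarrow> (nat \<Rightarrow> 'b rchart \<Rightarrow> 'b \<Rightarrow> complex) \<Rightarrow> (nat \<Rightarrow> real) pluri" where
  "sec m U f c p vss = (if c \<in> A \<and> p \<in> fst c \<inter> bx U \<and> length vss = m
     then coef f c p * (\<Prod>vs\<leftarrow>vss. Om n (G (dec p 0)) vs) else 0)"

lemma prod_n: "(\<Prod>l<n. f l) = (\<Prod>l<n - 1. f l) * (f (n - 1) :: complex)"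
  by (subst n_Suc(1)) simp

lemma Om_jac:
  assumes i: "i \<in> I" and i': "i' \<in> I" and p: "p \<in> fst (mk i) \<inter> fst (mk i')"
    and vs: "length vs = n" "set vs \<subseteq> cvecs (2 * n)" and g: "g \<noteq> 0"
  shows "Om n g (map (mat_app (2 * n) (jacobian (mk i) (mk i') p)) vs) =
    (\<Prod>l<n - 1. tder (i l) (i' l) (dec p l)) * Om n g vs"
proof -
  have "Om n g (map (mat_app (2 * n) (jacobian (mk i) (mk i') p)) vs) =
      (\<Prod>l<n. tder (i l) (i' l) (dec p l)) * Om n g vs"
    by (rule Om_map_app[OF g _ vs]) (rule th_jac[OF i i' p])
  then show ?thesis unfolding prod_n tder_flat[OF i i' p] by simp
qed

lemma prod_list_Om_jac:
  assumes i: "i \<in> I" and i': "i' \<in> I" and p: "p \<in> fst (mk i) \<inter> fst (mk i')"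
    and vss: "\<And>vs. vs \<in> set vss \<Longrightarrow> length vs = n \<and> set vs \<subseteq> cvecs (2 * n)" and g: "g \<noteq> 0"
  shows "(\<Prod>vs\<leftarrow>map (map (mat_app (2 * n) (jacobian (mk i) (mk i') p))) vss. Om n g vs) =
    (\<Prod>l<n - 1. tder (i l) (i' l) (dec p l)) ^ length vss * (\<Prod>vs\<leftarrow>vss. Om n g vs)"
  using vss
proof (induction vss)
  case (Cons vs vss)
  then have "length vs = n" "set vs \<subseteq> cvecs (2 * n)" by simp_all
  from Om_jac[OF i i' p this g] Cons show ?case by simp
qed simp

context
  fixes U :: "nat \<Rightarrow> 'b set" and f :: "nat \<Rightarrow> 'b rchart \<Rightarrow> 'b \<Rightarrow> complex" and m :: nat
  assumes U: "\<And>l. l < n - 1 \<Longrightarrow> openin (top_of_set (S l)) (U l)"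
    and f: "\<And>l. l < n - 1 \<Longrightarrow> f l \<in> holo_diff (C l) (U l) m"
begin

lemma f_hol:
  assumes "l < n - 1" "c \<in> C l"
  shows "(\<lambda>z. f l c (rinv c z)) holomorphic_on snd c ` (fst c \<inter> U l)" "open (snd c ` (fst c \<inter> U l))"
proof -
  show "(\<lambda>z. f l c (rinv c z)) holomorphic_on snd c ` (fst c \<inter> U l)"
    using f[OF assms(1)] assms(2) unfolding holo_diff_def by blast
  have "rs_atlas (S l) (C l)" using assms(1) by (intro atl) simp
  then show "open (snd c ` (fst c \<inter> U l))" using assms(2) U[OF assms(1)] by (rule rs_open_image)
qed

lemma f_trans:
  assumes "l < n - 1" "c \<in> C l" "c' \<in> C l" "q \<in> fst c \<inter> fst c' \<inter> U l"
  shows "f l c q = f l c' q * tder c c' q ^ m"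
  using f[OF assms(1)] assms(2-4) unfolding holo_diff_def by blast

abbreviation "cdom i \<equiv> snd (mk i) ` (fst (mk i) \<inter> bx U)"

lemma cdom: "i \<in> I \<Longrightarrow> openin (Euclidean_space (2 * n)) (cdom i)"
  unfolding fst_mk_bx by (rule open_mk_image[OF _ openin_ex[OF U]])

lemma cdom_zc: "i \<in> I \<Longrightarrow> x \<in> cdom i \<Longrightarrow> l < n - 1 \<Longrightarrow> zc l x \<in> snd (i l) ` (fst (i l) \<inter> U l)"
proof -
  assume i: "i \<in> I" and x: "x \<in> cdom i" and l: "l < n - 1"
  have "zc l x \<in> snd (i l) ` (fst (i l) \<inter> ex U l)"
    using x l unfolding fst_mk_bx mk_image[OF i] by simp
  then show ?thesis using l by (simp add: ex_def)
qed

lemma cdom_in: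
  assumes "i \<in> I" "x \<in> cdom i"
  shows "chart_inv (mk i) x \<in> fst (mk i) \<inter> bx U" "chart_inv (mk i) x = pinv i x" "snd (mk i) (chart_inv (mk i) x) = x"
  using chart_inv_in[OF is_chart_mk[OF assms(1)] assms(2)] chart_inv_mk[OF assms(1)] assms(2) by auto

definition fz :: "(nat \<Rightarrow> 'b rchart) \<Rightarrow> (nat \<Rightarrow> real) \<Rightarrow> complex" where
  "fz i x = (\<Prod>l<n - 1. f l (i l) (rinv (i l) (zc l x)))"

lemma coef_fz:
  assumes "c \<in> A" "x \<in> cdom (idx c)"
  shows "coef f c (chart_inv c x) = fz (idx c) x"
proof -
  have "chart_inv c x = pinv (idx c) x" using cdom_in(2)[OF idx(1)[OF assms(1)] assms(2)] idx(2)[OF assms(1)] by simp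
  then show ?thesis by (simp add: coef_def fz_def dec_pinv)
qed

lemma smooth_fz:
  assumes "i \<in> I"
  shows "smooth_on (2 * n) (cdom i) (fz i)"
  unfolding fz_def
proof (rule smooth_on_prod[OF cdom[OF assms]])
  fix l assume "l \<in> {..<n - 1}"
  then have l: "l < n - 1" "i l \<in> C l" using I_C[OF assms, of l] by simp_all
  show "smooth_on (2 * n) (cdom i) (\<lambda>x. f l (i l) (rinv (i l) (zc l x)))"
    by (rule smooth_on_holomorphic[OF cdom[OF assms] f_hol(2)[OF l] cdom_zc[OF assms _ l(1)] f_hol(1)[OF l]])
qed

lemma smooth_Gdom: "i \<in> I \<Longrightarrow> smooth_on (2 * n) (cdom i) (\<lambda>x. G (dec (chart_inv (mk i) x) 0))"
  by (rule smooth_G[OF _ cdom]) blast+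

lemma pluri_section_sec: "pluri_section n A J (bx U) m (sec m U f)"
  unfolding pluri_section_def
proof (intro conjI allI ballI impI)
  fix c p assume "\<not> (c \<in> A \<and> p \<in> fst c \<inter> bx U)"
  then show "sec m U f c p = (\<lambda>_. 0)" by (auto simp: sec_def)
next
  fix c p assume "c \<in> A" "p \<in> fst c \<inter> bx U"
  then have "sec m U f c p = (\<lambda>vss. if length vss = m then coef f c p * (\<Prod>vs\<leftarrow>vss. Om n (G (dec p 0)) vs) else 0)"
    by (intro ext) (simp add: sec_def)
  then show "canonical_fibre n (J c p) m (sec m U f c p)"
    unfolding J_def using canonical_fibre_Om[OF G_nz] by simp
next
  fix c vss assume c: "c \<in> A"
  note i = idx[OF c]
  have W: "openin (Euclidean_space (2 * n)) (snd c ` (fst c \<inter> bx U))" using cdom[OF i(1)] i(2) by simp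
  have "smooth_on (2 * n) (snd c ` (fst c \<inter> bx U)) (\<lambda>x. if length vss = m
      then fz (idx c) x * (\<Prod>vs\<leftarrow>vss. Om n (G (dec (chart_inv c x) 0)) vs) else 0)"
    using smooth_fz[OF i(1)] smooth_Gdom[OF i(1)] i(2)
    by (intro smooth_on_If smooth_on_const[OF W] smooth_on_mult[OF W] smooth_on_prod_list[OF W] smooth_on_Om[OF W]) simp_all
  then show "smooth_on (2 * n) (snd c ` (fst c \<inter> bx U)) (\<lambda>x. sec m U f c (chart_inv c x) vss)"
  proof (rule smooth_on_cong[OF W, THEN iffD1, rotated])
    fix x assume x: "x \<in> snd c ` (fst c \<inter> bx U)"
    then have x': "x \<in> cdom (idx c)" using i(2) by simp
    have "chart_inv c x \<in> fst c \<inter> bx U" using cdom_in(1)[OF i(1) x'] i(2) by simp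
    then show "(if length vss = m then fz (idx c) x * (\<Prod>vs\<leftarrow>vss. Om n (G (dec (chart_inv c x) 0)) vs) else 0) =
        sec m U f c (chart_inv c x) vss"
      using c coef_fz[OF c x'] by (simp add: sec_def)
  qed
next
  fix c c' p vss
  assume c: "c \<in> A" and c': "c' \<in> A" and p: "p \<in> fst c \<inter> fst c' \<inter> bx U"
    and vss: "length vss = m \<and> (\<forall>vs\<in>set vss. length vs = n \<and> set vs \<subseteq> cvecs (2 * n))"
  note i = idx[OF c] and i' = idx[OF c']
  have pp: "p \<in> fst (mk (idx c)) \<inter> fst (mk (idx c'))" using p i(2) i'(2) by simp
  have Oj: "(\<Prod>vs\<leftarrow>map (map (mat_app (2 * n) (jacobian c c' p))) vss. Om n (G (dec p 0)) vs) =
      (\<Prod>l<n - 1. tder (idx c l) (idx c' l) (dec p l)) ^ m * (\<Prod>vs\<leftarrow>vss. Om n (G (dec p 0)) vs)"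
    using prod_list_Om_jac[OF i(1) i'(1) pp, of vss "G (dec p 0)"] vss i(2) i'(2) by simp
  have "coef f c p = (\<Prod>l<n - 1. f l (idx c' l) (dec p l) * tder (idx c l) (idx c' l) (dec p l) ^ m)"
    unfolding coef_def
  proof (intro prod.cong refl)
    fix l assume "l \<in> {..<n - 1}"
    then have l: "l < n - 1" "l < n" by simp_all
    have "dec p l \<in> fst (idx c l) \<inter> fst (idx c' l) \<inter> U l"
      using pp p l by (simp add: fst_mk bx_def)
    then show "f l (idx c l) (dec p l) = f l (idx c' l) (dec p l) * tder (idx c l) (idx c' l) (dec p l) ^ m"
      by (rule f_trans[OF l(1) I_C[OF i(1) l(2)] I_C[OF i'(1) l(2)]])
  qed
  also have "\<dots> = coef f c' p * (\<Prod>l<n - 1. tder (idx c l) (idx c' l) (dec p l)) ^ m"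
    by (simp add: coef_def prod.distrib prod_power_distrib)
  finally show "sec m U f c' p (map (map (mat_app (2 * n) (jacobian c c' p))) vss) = sec m U f c p vss"
    using c c' p vss Oj by (simp add: sec_def)
qed

text \<open>By \<open>dbar_canonical_formula\<close> only derivatives of the coefficient along
  vectors of type (0,1) enter. The coefficient is holomorphic in the first \<open>n - 1\<close>
  coordinates, where \<open>th\<close> kills such vectors, and constant along the last.\<close>

lemma dbar_sec_zero:
  assumes m: "m = 1" and c: "c \<in> A" and p: "p \<in> fst c \<inter> bx U"
  shows "dbar_canonical n J c (\<lambda>q ws. sec m U f c q [ws]) p u vs = 0"
proof -
  note i = idx[OF c]
  let ?W = "cdom (idx c)" and ?x = "snd c p" and ?G = "\<lambda>x. G (dec (chart_inv c x) 0)"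
  have W: "openin (Euclidean_space (2 * n)) ?W" by (rule cdom[OF i(1)])
  have x: "?x \<in> ?W" using p i(2) by simp
  have ip: "chart_inv c ?x = p"
    using p chart_inj_on[OF is_chart_mk[OF i(1)]] i(2) unfolding chart_inv_def by (simp add: inv_into_f_f)
  have G': "has_pd j ?G (pdiff j ?G ?x) ?x" if "j < 2 * n" for j
    using smooth_on_has_pd[OF smooth_Gdom[OF i(1)] that x] i(2) by simp
  have Gz: "pdiff j ?G ?x = 0" if "2 \<le> j" "j < 2 * n" for j
  proof -
    have "pdiff j ?G ?x = pdiff j (\<lambda>x. G (rinv (idx c 0) (zc 0 x))) ?x"
    proof (rule pdiff_cong[OF W x that(2)])
      fix y assume "y \<in> ?W"
      from cdom_in(2)[OF i(1) this] show "?G y = G (rinv (idx c 0) (zc 0 y))"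
        using i(2) n by (simp add: dec_pinv)
    qed
    also have "\<dots> = 0"
      unfolding pdiff_def using that by simp
    finally show ?thesis .
  qed
  have F': "has_pd j (fz (idx c)) (pdiff j (fz (idx c)) ?x) ?x" if "j < 2 * n" for j
    using smooth_on_has_pd[OF smooth_fz[OF i(1)] that x] .
  have kap: "sec m U f c (chart_inv c x) [ws] = fz (idx c) x * Om n (?G x) ws" if "x \<in> ?W" for x ws
    using cdom_in(1)[OF i(1) that] i(2) c coef_fz[OF c that] m by (simp add: sec_def)
  have J: "J c p = Jm n (?G ?x)" by (simp add: J_def ip)
  have 1: "(\<lambda>z. f k (idx c k) (rinv (idx c k) z)) holomorphic_on snd (idx c k) ` (fst (idx c k) \<inter> U k)"
      "open (snd (idx c k) ` (fst (idx c k) \<inter> U k))" "zc k ?x \<in> snd (idx c k) ` (fst (idx c k) \<inter> U k)" if "k < n - 1" for k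
    proof -
      have "idx c k \<in> C k" using I_C[OF i(1), of k] that by simp
      from f_hol[OF that this] show "(\<lambda>z. f k (idx c k) (rinv (idx c k) z)) holomorphic_on snd (idx c k) ` (fst (idx c k) \<inter> U k)"
        "open (snd (idx c k) ` (fst (idx c k) \<inter> U k))" .
      show "zc k ?x \<in> snd (idx c k) ` (fst (idx c k) \<inter> U k)" by (rule cdom_zc[OF i(1) x that])
    qed
  have fz: "fz (idx c) = (\<lambda>x. \<Prod>k<n - 1. f k (idx c k) (rinv (idx c k) (zc k x)))"
      by (rule ext) (rule fz_def)
  have CR: "pdiff (Suc (2 * l)) (fz (idx c)) ?x = \<i> * pdiff (2 * l) (fz (idx c)) ?x" if "l < n - 1" for l
      by (rule has_pd_cauchy_riemann_prod(1)[where F = "\<lambda>k z. f k (idx c k) (rinv (idx c k) z)", OF 1 fz that])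
  have CR0: "pdiff j (fz (idx c)) ?x = 0" if "j \<ge> 2 * (n - 1)" for j
    by (rule has_pd_cauchy_riemann_prod(2)[where F = "\<lambda>k z. f k (idx c k) (rinv (idx c k) z)", OF 1 fz that])
  have "(\<Sum>j<2 * n. pr01 (2 * n) (J c p) u j * pdiff j (fz (idx c)) ?x) =
      (\<Sum>l<n. pr01 (2 * n) (J c p) u (2 * l) * pdiff (2 * l) (fz (idx c)) ?x +
        pr01 (2 * n) (J c p) u (Suc (2 * l)) * pdiff (Suc (2 * l)) (fz (idx c)) ?x)"
    by (rule sum_pairs)
  also have "\<dots> = 0"
  proof (intro sum.neutral ballI)
    fix l assume "l \<in> {..<n}"
    then have l: "l < n" by simp
    show "pr01 (2 * n) (J c p) u (2 * l) * pdiff (2 * l) (fz (idx c)) ?x +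
        pr01 (2 * n) (J c p) u (Suc (2 * l)) * pdiff (Suc (2 * l)) (fz (idx c)) ?x = 0"
    proof (cases "l < n - 1")
      case True
      have "th n (G (dec p 0)) l (pr01 (2 * n) (J c p) u) = 0"
        unfolding J_def using l by (intro th_pr(3)) simp_all
      then have "pr01 (2 * n) (J c p) u (2 * l) + \<i> * pr01 (2 * n) (J c p) u (Suc (2 * l)) = 0"
        using True by (simp add: th_def scl_def)
      then have "(pr01 (2 * n) (J c p) u (2 * l) + \<i> * pr01 (2 * n) (J c p) u (Suc (2 * l))) * pdiff (2 * l) (fz (idx c)) ?x = 0"
        by simp
      then show ?thesis unfolding CR[OF True] by (simp add: algebra_simps)
    next
      case False
      then show ?thesis using CR0 by simp
    qed
  qed
  finally have z: "(\<Sum>j<2 * n. pr01 (2 * n) (J c p) u j * pdiff j (fz (idx c)) ?x) = 0" .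
  show ?thesis
    using dbar_canonical_formula[where \<kappa> = "\<lambda>q ws. sec m U f c q [ws]" and f = "fz (idx c)" and G = ?G and c = c and p = p and J = J,
        OF n W x kap G_nz F' G' Gz J, of u vs] z by simp
qed

end

text \<open>Induction on the weight over all boxes at once, because the splitting into weights 1 and
  \<open>m\<close> exists only on a smaller box. Both factors are annihilated, so the Leibniz rule
  returns 0.\<close>

lemma dbar_pluri_sec:
  assumes "m \<ge> 1" "\<And>l. l < n - 1 \<Longrightarrow> openin (top_of_set (S l)) (U l)"
    "\<And>l. l < n - 1 \<Longrightarrow> f l \<in> holo_diff (C l) (U l) m"
  shows "dbar_pluri n (top_of_set K) A J (bx U) m (sec m U f) (\<lambda>_ _ _ _. 0)"
  using assms
proof (induction m arbitrary: U f rule: nat_induct_at_least)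
  case base
  show ?case
  proof (rule dbar_pluri.one)
    show "openin (top_of_set K) (bx U)" by (rule openin_bx[OF base(1)])
    show "pluri_section n A J (bx U) 1 (sec 1 U f)" by (rule pluri_section_sec[OF base])
    show "0 = dbar_canonical n J c (\<lambda>q ws. sec 1 U f c q [ws]) p u vs" if "c \<in> A" "p \<in> fst c \<inter> bx U" for c p u vs
      by (rule dbar_sec_zero[OF base refl that, symmetric])
  qed
next
  case (Suc m)
  show ?case
  proof (rule dbar_pluri.tensor)
    show "openin (top_of_set K) (bx U)" by (rule openin_bx[OF Suc.prems(1)])
    show "1 \<le> m" by (rule Suc.hyps)
    show "pluri_section n A J (bx U) (Suc m) (sec (Suc m) U f)" by (rule pluri_section_sec[OF Suc.prems])
    fix p assume p: "p \<in> bx U"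
    then have "p \<in> (\<Union>c\<in>A. fst c)" unfolding cover by (simp add: bx_def)
    then obtain c0 where c0: "c0 \<in> A" "p \<in> fst c0" by blast
    obtain i where i: "i \<in> I" "c0 = mk i" by (rule A_cases[OF c0(1)])
    \<comment> \<open>Around \<open>p\<close> the chart \<open>i l\<close> of each factor supplies a
      nowhere vanishing form dz: \<open>f1\<close> is its coefficient and \<open>f2\<close> the
      quotient by it.\<close>
    define V where "V = (\<lambda>l. fst (i l) \<inter> U l)"
    define f1 where "f1 = (\<lambda>l c q. if c \<in> C l \<and> q \<in> fst c \<inter> fst (i l) \<inter> U l then tder c (i l) q else 0)"
    define f2 where "f2 = (\<lambda>l c q. if c \<in> C l \<and> q \<in> fst c \<inter> fst (i l) \<inter> U l then f l c q / tder c (i l) q else 0)"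
    have al: "rs_atlas (S l) (C l)" "i l \<in> C l" if "l < n - 1" for l
      using that by (intro atl, simp, intro I_C[OF i(1)], simp)
    have V: "openin (top_of_set (S l)) (V l)" if l: "l < n - 1" for l
      unfolding V_def using rs_chart(2)[OF al[OF l]] Suc.prems(1)[OF l] by (rule openin_Int)
    have f1: "f1 l \<in> holo_diff (C l) (V l) 1" if l: "l < n - 1" for l
      unfolding f1_def V_def by (rule holo_diff_tder[OF al[OF l] Suc.prems(1)[OF l]])
    have f2: "f2 l \<in> holo_diff (C l) (V l) m" if l: "l < n - 1" for l
      unfolding f2_def V_def by (rule holo_diff_divide[OF al(1)[OF l] Suc.prems(2)[OF l] Suc.prems(1)[OF l] al(2)[OF l]])
    have D1: "dbar_pluri n (top_of_set K) A J (bx V) 1 (sec 1 V f1) (\<lambda>_ _ _ _. 0)"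
    proof (rule dbar_pluri.one)
      show "openin (top_of_set K) (bx V)" by (rule openin_bx[OF V])
      show "pluri_section n A J (bx V) 1 (sec 1 V f1)" by (rule pluri_section_sec[OF V f1])
      show "0 = dbar_canonical n J c (\<lambda>q ws. sec 1 V f1 c q [ws]) p u vs" if "c \<in> A" "p \<in> fst c \<inter> bx V" for c p u vs
        by (rule dbar_sec_zero[OF V f1 refl that, symmetric])
    qed
    have D2: "dbar_pluri n (top_of_set K) A J (bx V) m (sec m V f2) (\<lambda>_ _ _ _. 0)"
      by (rule Suc.IH[OF V f2])
    have VU: "bx V \<subseteq> bx U" by (auto simp: bx_def V_def)
    have pV: "p \<in> bx V"
      using p c0(2) unfolding i(2) fst_mk bx_def V_def by simp
    have eq: "sec (Suc m) U f c q (vs # vss) = sec 1 V f1 c q [vs] * sec m V f2 c q vss"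
      if c: "c \<in> A" and q: "q \<in> fst c \<inter> bx V" and l: "length vss = m" for c q vs vss
    proof -
      have "coef f c q = coef f1 c q * coef f2 c q"
        unfolding coef_def prod.distrib[symmetric]
      proof (intro prod.cong refl)
        fix l assume "l \<in> {..<n - 1}"
        then have l: "l < n - 1" "l < n" by simp_all
        have ic: "idx c l \<in> C l" by (rule I_C[OF idx(1)[OF c] l(2)])
        have "q \<in> fst (mk (idx c))" using q idx(2)[OF c] by simp
        then have qq: "dec q l \<in> fst (idx c l)" "dec q l \<in> fst (i l)" "dec q l \<in> U l"
          using q l by (simp_all add: fst_mk bx_def V_def)
        have "tder (idx c l) (i l) (dec q l) \<noteq> 0"
          by (rule tder_nz[OF al(1)[OF l(1)] ic al(2)[OF l(1)] qq(1,2)])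
        then show "f l (idx c l) (dec q l) = f1 l (idx c l) (dec q l) * f2 l (idx c l) (dec q l)"
          using ic qq by (simp add: f1_def f2_def)
      qed
      then show ?thesis using c q l VU by (auto simp: sec_def)
    qed
    show "\<exists>V s1 s2 t1 t2. openin (top_of_set K) V \<and> p \<in> V \<and> V \<subseteq> bx U \<and>
        dbar_pluri n (top_of_set K) A J V 1 s1 t1 \<and> dbar_pluri n (top_of_set K) A J V m s2 t2 \<and>
        (\<forall>c\<in>A. \<forall>q\<in>fst c \<inter> V. \<forall>vs vss. length vss = m \<longrightarrow>
           sec (Suc m) U f c q (vs # vss) = s1 c q [vs] * s2 c q vss \<and>
           (\<forall>u. 0 = t1 c q u [vs] * s2 c q vss + s1 c q [vs] * t2 c q u vss))"
      by (rule exI[of _ "bx V"], rule exI[of _ "sec 1 V f1"], rule exI[of _ "sec m V f2"],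
          rule exI[of _ "\<lambda>_ _ _ _. 0"], rule exI[of _ "\<lambda>_ _ _ _. 0"])
        (use openin_bx[OF V] pV VU D1 D2 eq in simp)
  qed
qed

end

section \<open>Coefficients of pluricanonical sections\<close>

text \<open>The periods move every argument into a compact rectangle, so the function is bounded and
  Liouville's theorem applies. Separate periods \<open>a\<close>, \<open>b\<close> are allowed for
  because the twist rescales the two sides of the lattice differently.\<close>

lemma doubly_periodic_entire_constant:
  fixes f :: "complex \<Rightarrow> complex" and a b :: real
  assumes f: "f holomorphic_on UNIV" and ab: "a > 0" "b > 0"
    and per: "\<And>z. f (z + complex_of_real a) = f z" "\<And>z. f (z + \<i> * complex_of_real b) = f z"
  shows "f z = f w"
proof -
  have nat_per: "f (z + of_nat k * c) = f z" if "\<And>z. f (z + c) = f z" for k z and c :: complex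
  proof (induction k)
    case (Suc k)
    have "f (z + of_nat (Suc k) * c) = f ((z + of_nat k * c) + c)" by (simp add: algebra_simps)
    then show ?case using that Suc by simp
  qed simp
  have int_per: "f (z + of_int k * c) = f z" if c: "\<And>z. f (z + c) = f z" for k z and c :: complex
  proof (cases k)
    case (nonneg m)
    then show ?thesis using nat_per[OF c] by simp
  next
    case (neg m)
    have k: "of_int k = - (of_nat (Suc m) :: complex)" using neg by simp
    have "f (z + of_int k * c) = f ((z + of_int k * c) + of_nat (Suc m) * c)" by (rule nat_per[OF c, symmetric])
    also have "(z + of_int k * c) + of_nat (Suc m) * c = z" unfolding k by (simp add: algebra_simps)
    finally show ?thesis .
  qed
  have "\<exists>w\<in>cbox 0 (Complex a b). f z = f w" for z
  proof -
    let ?k = "\<lfloor>Re z / a\<rfloor>" and ?l = "\<lfloor>Im z / b\<rfloor>"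
    let ?w = "z + of_int (- ?k) * complex_of_real a + of_int (- ?l) * (\<i> * b)"
    have "f ?w = f z" by (simp only: int_per[OF per(2)] int_per[OF per(1)])
    moreover have "real_of_int ?k \<le> Re z / a" "Re z / a \<le> real_of_int ?k + 1" by linarith+
    then have "real_of_int ?k * a \<le> Re z" "Re z \<le> (real_of_int ?k + 1) * a"
      using ab by (simp_all only: pos_le_divide_eq pos_divide_le_eq)
    moreover have "real_of_int ?l \<le> Im z / b" "Im z / b \<le> real_of_int ?l + 1" by linarith+
    then have "real_of_int ?l * b \<le> Im z" "Im z \<le> (real_of_int ?l + 1) * b"
      using ab by (simp_all only: pos_le_divide_eq pos_divide_le_eq)
    ultimately show ?thesis
      by (intro bexI[of _ ?w]) (auto simp: in_cbox_complex_iff algebra_simps)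
  qed
  then have "range f \<subseteq> f ` cbox 0 (Complex a b)" by blast
  moreover have "compact (f ` cbox 0 (Complex a b))"
    using f by (intro compact_continuous_image compact_cbox continuous_on_subset[OF holomorphic_on_imp_continuous_on]) auto
  ultimately have "bounded (range f)" using compact_imp_bounded bounded_subset by blast
  then have "f constant_on UNIV" using f by (intro Liouville_theorem)
  then show ?thesis unfolding constant_on_def by auto
qed

definition frame :: "nat \<Rightarrow> real \<Rightarrow> cvec list" where
  "frame n g = map (eb n g) [0..<n]"

lemma frame_cvecs: "g \<noteq> 0 \<Longrightarrow> length (frame n g) = n" "g \<noteq> 0 \<Longrightarrow> set (frame n g) \<subseteq> cvecs (2 * n)"
  unfolding frame_def using ebl_cvecs by blast+

lemma Om_frame: "g \<noteq> 0 \<Longrightarrow> Om n g (frame n g) = 1"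
  unfolding frame_def by (rule Om_ebl)

text \<open>The frame for parameter 1 differs from the dual frame in the last vector only, on which
  the last covector takes the value \<open>(inverse g + g) / 2\<close>, positive for
  \<open>g > 0\<close>.\<close>

lemma Om_frame_1:
  assumes "g > 0"
  shows "Om n g (frame n 1) \<noteq> 0"
proof -
  let ?c = "\<lambda>i. if i = n - 1 then complex_of_real ((inverse g + g) / 2) else 1"
  have "Dt n (th n g) (frame n 1) = Dt n (\<lambda>i v. ?c i * th n 1 i v) (frame n 1)"
  proof (rule Dt_cong)
    fix i j assume "i < n" "j < n"
    then show "th n g i (frame n 1 ! j) = ?c i * th n 1 i (frame n 1 ! j)"
      using assms by (auto simp: frame_def th_def eb_def scl_def field_simps)
  qed
  also have "\<dots> = (\<Prod>i<n. ?c i) * Om n 1 (frame n 1)"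
    unfolding Dt_scale_rows using frame_cvecs[of 1] by (simp add: Om_def)
  also have "\<dots> = (\<Prod>i<n. ?c i)" by (simp add: Om_frame)
  finally have "Om n g (frame n 1) = (\<Prod>i<n. ?c i)"
    using frame_cvecs[of 1] by (simp add: Om_def)
  moreover have "inverse g + g > 0" using assms by (simp add: add_pos_pos)
  then have "?c i \<noteq> 0" for i by (simp del: of_real_add of_real_divide of_real_inverse)
  then have "(\<Prod>i<n. ?c i) \<noteq> 0" by (simp only: prod_zero_iff finite_lessThan) blast
  ultimately show ?thesis by simp
qed

context surface_product
begin

text \<open>The coefficient of \<open>s\<close> with respect to the m-th power of \<open>Om\<close>,
  read off on the dual frame at the point.\<close>

definition F :: "nat \<Rightarrow> (nat \<Rightarrow> real) pluri \<Rightarrow> (nat \<Rightarrow> real) chart \<Rightarrow> (nat \<Rightarrow> real) \<Rightarrow> complex" where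
  "F m s c p = s c p (replicate m (frame n (G (dec p 0))))"

lemma pluri_section_eq:
  assumes s: "pluri_section n A J U m s" and c: "c \<in> A" and p: "p \<in> fst c \<inter> U" and l: "length vss = m"
  shows "s c p vss = F m s c p * (\<Prod>vs\<leftarrow>vss. Om n (G (dec p 0)) vs)"
proof -
  have "canonical_fibre n (Jm n (G (dec p 0))) m (s c p)"
    using s c p unfolding pluri_section_def J_def by blast
  from canonical_fibre_eq[OF G_nz this l] show ?thesis unfolding F_def frame_def .
qed

text \<open>Smoothness of a section is given for fixed arguments, whereas the dual frame varies with
  \<open>G\<close>. So \<open>F\<close> is rewritten as the value on the constant frame divided by
  that of the power of \<open>Om\<close>.\<close>

lemma smooth_F:
  assumes s: "pluri_section n A J U m s" and U: "openin (top_of_set K) U" and c: "c \<in> A"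
  shows "smooth_on (2 * n) (snd c ` (fst c \<inter> U)) (\<lambda>x. F m s c (chart_inv c x))"
proof -
  obtain i where i: "i \<in> I" "c = mk i" by (rule A_cases[OF c])
  let ?W = "snd c ` (fst c \<inter> U)" and ?O = "\<lambda>x. Om n (G (dec (chart_inv c x) 0)) (frame n 1)"
  have ch: "is_chart (2 * n) (top_of_set K) c" unfolding i(2) by (rule is_chart_mk[OF i(1)])
  have W: "openin (Euclidean_space (2 * n)) ?W" by (rule chart_open_image[OF ch U])
  have "smooth_on (2 * n) ?W (\<lambda>x. G (dec (chart_inv c x) 0))"
    unfolding i(2) by (rule smooth_G[OF i(1)]) (use W i(2) in auto)
  then have O: "smooth_on (2 * n) ?W ?O"
    by (rule smooth_on_Om[OF W]) simp
  have On: "?O x \<noteq> 0" for x by (rule Om_frame_1[OF G_pos])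
  have "smooth_on (2 * n) ?W (\<lambda>x. s c (chart_inv c x) (replicate m (frame n 1)))"
    using s c unfolding pluri_section_def by blast
  then have "smooth_on (2 * n) ?W (\<lambda>x. s c (chart_inv c x) (replicate m (frame n 1)) * inverse (\<Prod>_\<in>{..<m}. ?O x))"
    by (intro smooth_on_mult[OF W] smooth_on_inverse[OF W] smooth_on_prod[OF W] O) (simp_all add: On)
  then show ?thesis
  proof (rule smooth_on_cong[OF W, THEN iffD1, rotated])
    fix x assume "x \<in> ?W"
    then have "chart_inv c x \<in> fst c \<inter> U" by (rule chart_inv_in(1)[OF ch])
    from pluri_section_eq[OF s c this, of "replicate m (frame n 1)"] On[of x]
    show "s c (chart_inv c x) (replicate m (frame n 1)) * inverse (\<Prod>_\<in>{..<m}. ?O x) = F m s c (chart_inv c x)"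
      by (simp add: map_replicate prod_list_replicate)
  qed
qed

lemma F_trans:
  assumes s: "pluri_section n A J U m s" and i: "i \<in> I" and i': "i' \<in> I"
    and p: "p \<in> fst (mk i) \<inter> fst (mk i')" "p \<in> U"
  shows "F m s (mk i) p = F m s (mk i') p * (\<Prod>l<n - 1. tder (i l) (i' l) (dec p l)) ^ m"
proof -
  let ?vss = "replicate m (frame n (G (dec p 0)))"
  let ?ws = "map (map (mat_app (2 * n) (jacobian (mk i) (mk i') p))) ?vss"
  have c: "mk i \<in> A" "mk i' \<in> A" unfolding A_def using i i' by blast+
  have v: "length vs = n \<and> set vs \<subseteq> cvecs (2 * n)" if "vs \<in> set ?vss" for vs
    using that frame_cvecs[OF G_nz] by (auto split: if_splits)
  have "\<forall>c\<in>A. \<forall>c'\<in>A. \<forall>p\<in>fst c \<inter> fst c' \<inter> U. \<forall>vss.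
        length vss = m \<and> (\<forall>vs\<in>set vss. length vs = n \<and> set vs \<subseteq> cvecs (2 * n)) \<longrightarrow>
        s c' p (map (map (mat_app (2 * n) (jacobian c c' p))) vss) = s c p vss"
    using s unfolding pluri_section_def by (elim conjE)
  then have "s (mk i') p ?ws = s (mk i) p ?vss"
    using c p v by (auto simp del: map_replicate)
  moreover have "s (mk i') p ?ws = F m s (mk i') p * (\<Prod>vs\<leftarrow>?ws. Om n (G (dec p 0)) vs)"
    by (rule pluri_section_eq[OF s c(2)]) (use p in simp_all)
  moreover have "(\<Prod>vs\<leftarrow>?ws. Om n (G (dec p 0)) vs) =
      (\<Prod>l<n - 1. tder (i l) (i' l) (dec p l)) ^ m * (\<Prod>vs\<leftarrow>?vss. Om n (G (dec p 0)) vs)"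
    by (rule prod_list_Om_jac[OF i i' p(1) v G_nz, where vss = ?vss, unfolded length_replicate])
  moreover have "(\<Prod>vs\<leftarrow>?vss. Om n (G (dec p 0)) vs) = 1"
    by (simp add: map_replicate prod_list_replicate Om_frame)
  ultimately show ?thesis unfolding F_def by simp
qed

text \<open>The invariant for rule induction over \<open>dbar_pluri\<close>: the image of
  \<open>s\<close>, evaluated on the dual frame, is the (0,1)-derivative of the coefficient of
  \<open>s\<close>.\<close>

definition has_coefficient :: "(nat \<Rightarrow> real) set \<Rightarrow> nat \<Rightarrow> (nat \<Rightarrow> real) pluri \<Rightarrow> (nat \<Rightarrow> real) pluri1 \<Rightarrow> bool" where
  "has_coefficient U m s t \<longleftrightarrow> openin (top_of_set K) U \<and> pluri_section n A J U m s \<and>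
    (\<forall>c p u. c \<in> A \<longrightarrow> p \<in> fst c \<inter> U \<longrightarrow> u \<in> cvecs (2 * n) \<longrightarrow>
      t c p u (replicate m (frame n (G (dec p 0)))) =
        (\<Sum>i<2 * n. pr01 (2 * n) (J c p) u i * pdiff i (\<lambda>x. F m s c (chart_inv c x)) (snd c p)))"

lemma has_coefficientD:
  assumes "has_coefficient U m s t"
  shows "pluri_section n A J U m s" "c \<in> A \<Longrightarrow> p \<in> fst c \<inter> U \<Longrightarrow> u \<in> cvecs (2 * n) \<Longrightarrow>
      t c p u (replicate m (frame n (G (dec p 0)))) =
        (\<Sum>i<2 * n. pr01 (2 * n) (J c p) u i * pdiff i (\<lambda>x. F m s c (chart_inv c x)) (snd c p))"
  using assms[unfolded has_coefficient_def, THEN conjunct2, THEN conjunct1]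
    assms[unfolded has_coefficient_def, THEN conjunct2, THEN conjunct2, rule_format, of c p u] by blast+

text \<open>Whatever local splittings witness the relation, coefficients multiply as the sections
  do, and both sides obey the Leibniz rule. The base case is \<open>dbar_canonical_formula\<close>.
  This turns the abstract operator into differential equations for \<open>F\<close>.\<close>

lemma dbar_pluri_coefficient:
  assumes "dbar_pluri n (top_of_set K) A J U m s t"
  shows "has_coefficient U m s t"
  using assms
proof (induction rule: dbar_pluri.induct)
  case (one U s t)
  show ?case
    unfolding has_coefficient_def
  proof (intro conjI allI impI one.hyps)
    fix c p u assume c: "c \<in> A" and p: "p \<in> fst c \<inter> U" and u: "u \<in> cvecs (2 * n)"
    obtain i where i: "i \<in> I" "c = mk i" by (rule A_cases[OF c])
    have ch: "is_chart (2 * n) (top_of_set K) c" unfolding i(2) by (rule is_chart_mk[OF i(1)])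
    let ?W = "snd c ` (fst c \<inter> U)" and ?G = "\<lambda>x. G (dec (chart_inv c x) 0)" and ?f = "\<lambda>x. F 1 s c (chart_inv c x)"
    have W: "openin (Euclidean_space (2 * n)) ?W" by (rule chart_open_image[OF ch one.hyps(1)])
    have x: "snd c p \<in> ?W" using p by blast
    have ip: "chart_inv c (snd c p) = p"
      unfolding chart_inv_def by (rule inv_into_f_f[OF chart_inj_on[OF ch]]) (use p in simp)
    have Gs: "smooth_on (2 * n) ?W ?G"
      unfolding i(2) by (rule smooth_G[OF i(1)]) (use W i(2) in auto)
    have Gz: "pdiff j ?G (snd c p) = 0" if "2 \<le> j" "j < 2 * n" for j
    proof -
      have "pdiff j ?G (snd c p) = pdiff j (\<lambda>x. G (rinv (i 0) (zc 0 x))) (snd c p)"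
      proof (rule pdiff_cong[OF W x that(2)])
        fix y assume "y \<in> ?W"
        then have "y \<in> snd (mk i) ` fst (mk i)" unfolding i(2) by blast
        then show "?G y = G (rinv (i 0) (zc 0 y))"
          unfolding i(2) using n by (simp only: chart_inv_mk[OF i(1)]) (simp add: dec_pinv)
      qed
      also have "\<dots> = 0" unfolding pdiff_def using that by simp
      finally show ?thesis .
    qed
    have kap: "s c (chart_inv c x) [ws] = ?f x * Om n (?G x) ws" if "x \<in> ?W" for x ws
      using pluri_section_eq[OF one.hyps(2) c chart_inv_in(1)[OF ch that], of "[ws]"] by simp
    have J: "J c p = Jm n (?G (snd c p))" by (simp add: J_def ip)
    have "t c p u [frame n (G (dec p 0))] = dbar_canonical n J c (\<lambda>q ws. s c q [ws]) p u (frame n (G (dec p 0)))"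
      by (rule one.hyps(3)[OF c p])
    also have "\<dots> = (\<Sum>j<2 * n. pr01 (2 * n) (J c p) u j * pdiff j ?f (snd c p)) * Om n (?G (snd c p)) (frame n (G (dec p 0)))"
      using dbar_canonical_formula[where \<kappa> = "\<lambda>q ws. s c q [ws]" and f = ?f and G = ?G and c = c and p = p and J = J,
          OF n W x kap G_nz smooth_on_has_pd[OF smooth_F[OF one.hyps(2,1) c] _ x] smooth_on_has_pd[OF Gs _ x] Gz J,
          of u "frame n (G (dec p 0))"] u frame_cvecs[OF G_nz] by simp
    finally show "t c p u (replicate 1 (frame n (G (dec p 0)))) =
        (\<Sum>j<2 * n. pr01 (2 * n) (J c p) u j * pdiff j ?f (snd c p))"
      by (simp add: ip Om_frame)
  qed
next
  case (tensor U m s t)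
  show ?case
    unfolding has_coefficient_def
  proof (intro conjI allI impI tensor.hyps)
    fix c p u assume c: "c \<in> A" and p: "p \<in> fst c \<inter> U" and u: "u \<in> cvecs (2 * n)"
    obtain i where i: "i \<in> I" "c = mk i" by (rule A_cases[OF c])
    have ch: "is_chart (2 * n) (top_of_set K) c" unfolding i(2) by (rule is_chart_mk[OF i(1)])
    have ip: "chart_inv c (snd c p) = p"
      unfolding chart_inv_def by (rule inv_into_f_f[OF chart_inj_on[OF ch]]) (use p in simp)
    obtain V s1 s2 t1 t2 where V: "openin (top_of_set K) V" "p \<in> V" "V \<subseteq> U"
      and IH1: "has_coefficient V 1 s1 t1" and IH2: "has_coefficient V m s2 t2"
      and eq: "\<forall>c\<in>A. \<forall>q\<in>fst c \<inter> V. \<forall>vs vss. length vss = m \<longrightarrow>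
             s c q (vs # vss) = s1 c q [vs] * s2 c q vss \<and>
             (\<forall>u. t c q u (vs # vss) = t1 c q u [vs] * s2 c q vss + s1 c q [vs] * t2 c q u vss)"
    proof -
      have "p \<in> U" using p by blast
      from tensor.IH[OF this] show thesis by (elim exE conjE) (rule that)
    qed
    let ?W = "snd c ` (fst c \<inter> V)" and ?f1 = "\<lambda>x. F 1 s1 c (chart_inv c x)" and ?f2 = "\<lambda>x. F m s2 c (chart_inv c x)"
    let ?fr = "frame n (G (dec p 0))" and ?x = "snd c p"
    have W: "openin (Euclidean_space (2 * n)) ?W" by (rule chart_open_image[OF ch V(1)])
    have x: "?x \<in> ?W" using p V(2) by blast
    have pV: "p \<in> fst c \<inter> V" using p V(2) by blast
    note ps1 = has_coefficientD(1)[OF IH1] and ps2 = has_coefficientD(1)[OF IH2]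
    have t1: "t1 c p u [?fr] = (\<Sum>i<2 * n. pr01 (2 * n) (J c p) u i * pdiff i ?f1 ?x)"
      using has_coefficientD(2)[OF IH1 c pV u] by simp
    have t2: "t2 c p u (replicate m ?fr) = (\<Sum>i<2 * n. pr01 (2 * n) (J c p) u i * pdiff i ?f2 ?x)"
      by (rule has_coefficientD(2)[OF IH2 c pV u])
    have prod: "F (Suc m) s c q = F 1 s1 c q * F m s2 c q" if "q \<in> fst c \<inter> V" for q
      using eq[THEN bspec, OF c, THEN bspec, OF that, THEN spec, of "frame n (G (dec q 0))", THEN spec, of "replicate m (frame n (G (dec q 0)))"]
      by (simp add: F_def)
    have der: "pdiff j (\<lambda>x. F (Suc m) s c (chart_inv c x)) ?x = ?f1 ?x * pdiff j ?f2 ?x + pdiff j ?f1 ?x * ?f2 ?x"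
      if j: "j < 2 * n" for j
    proof -
      have "pdiff j (\<lambda>x. F (Suc m) s c (chart_inv c x)) ?x = pdiff j (\<lambda>x. ?f1 x * ?f2 x) ?x"
        by (rule pdiff_cong[OF W x j]) (rule prod[OF chart_inv_in(1)[OF ch]])
      also have "\<dots> = ?f1 ?x * pdiff j ?f2 ?x + pdiff j ?f1 ?x * ?f2 ?x"
        by (rule has_pd_pdiff[OF has_pd_bilinear[OF bounded_bilinear_mult
            smooth_on_has_pd[OF smooth_F[OF ps1 V(1) c] j x] smooth_on_has_pd[OF smooth_F[OF ps2 V(1) c] j x]]])
      finally show ?thesis .
    qed
    have "t c p u (?fr # replicate m ?fr) = t1 c p u [?fr] * s2 c p (replicate m ?fr) + s1 c p [?fr] * t2 c p u (replicate m ?fr)"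
      using eq[THEN bspec, OF c, THEN bspec, OF pV, THEN spec, of ?fr, THEN spec, of "replicate m ?fr"] by simp
    also have "\<dots> = (\<Sum>i<2 * n. pr01 (2 * n) (J c p) u i * (?f1 ?x * pdiff i ?f2 ?x + pdiff i ?f1 ?x * ?f2 ?x))"
      unfolding t1 t2 ip by (simp add: F_def sum_distrib_left sum_distrib_right sum.distrib algebra_simps)
    also have "\<dots> = (\<Sum>i<2 * n. pr01 (2 * n) (J c p) u i * pdiff i (\<lambda>x. F (Suc m) s c (chart_inv c x)) ?x)"
      by (intro sum.cong refl) (simp add: der)
    finally show "t c p u (replicate (Suc m) ?fr) = (\<Sum>i<2 * n. pr01 (2 * n) (J c p) u i * pdiff i (\<lambda>x. F (Suc m) s c (chart_inv c x)) ?x)"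
      by simp
  qed
qed

lemma pr01_ebb:
  assumes "l < n" "g \<noteq> 0"
  shows "pr01 (2 * n) (Jm n g) (ebb n g l) = ebb n g l"
  by (rule cvec_eqI[OF assms(2), where n = n])
    (use assms in \<open>simp_all add: pr_cvecs eb_cvecs th_pr th_ebb thb_ebb\<close>)

text \<open>Evaluation on the vector \<open>ebb\<close>, which \<open>pr01\<close> fixes, isolates
  one factor; the weights \<open>a\<close> and \<open>1 / a\<close> come from the entries of
  \<open>ebb\<close>.\<close>

lemma cauchy_riemann_F:
  assumes s: "s \<in> holomorphic_pluri n (top_of_set K) A J m" and c: "c \<in> A" and p: "p \<in> fst c" and l: "l < n"
  defines "a \<equiv> scl n (G (dec p 0)) l"
  shows "a * pdiff (2 * l) (\<lambda>x. F m s c (chart_inv c x)) (snd c p) +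
    \<i> * complex_of_real (1 / a) * pdiff (Suc (2 * l)) (\<lambda>x. F m s c (chart_inv c x)) (snd c p) = 0"
proof -
  let ?f = "\<lambda>x. F m s c (chart_inv c x)" and ?u = "ebb n (G (dec p 0)) l"
  have d: "dbar_pluri n (top_of_set K) A J K m s (\<lambda>_ _ _ _. 0)"
    using s unfolding holomorphic_pluri_def by simp
  have pK: "p \<in> fst c \<inter> K" using p c cover by blast
  have "(\<Sum>i<2 * n. pr01 (2 * n) (J c p) ?u i * pdiff i ?f (snd c p)) = 0"
    using has_coefficientD(2)[OF dbar_pluri_coefficient[OF d] c pK, of ?u] eb_cvecs(2)[OF G_nz l] by simp
  then have "(\<Sum>k<n. ?u (2 * k) * pdiff (2 * k) ?f (snd c p) + ?u (Suc (2 * k)) * pdiff (Suc (2 * k)) ?f (snd c p)) = 0"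
    unfolding J_def pr01_ebb[OF l G_nz] sum_pairs .
  also have "(\<Sum>k<n. ?u (2 * k) * pdiff (2 * k) ?f (snd c p) + ?u (Suc (2 * k)) * pdiff (Suc (2 * k)) ?f (snd c p)) =
      ?u (2 * l) * pdiff (2 * l) ?f (snd c p) + ?u (Suc (2 * l)) * pdiff (Suc (2 * l)) ?f (snd c p)"
    by (rule sum_single) (use l in \<open>auto simp: ebb_def\<close>)
  also have "\<dots> = (a * pdiff (2 * l) ?f (snd c p) + \<i> * complex_of_real (1 / a) * pdiff (Suc (2 * l)) ?f (snd c p)) / 2"
    by (simp add: ebb_def a_def field_simps)
  finally show ?thesis by simp
qed

lemma holomorphic_pluri_section: "s \<in> holomorphic_pluri n (top_of_set K) A J m \<Longrightarrow> pluri_section n A J K m s"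
  using has_coefficientD(1)[OF dbar_pluri_coefficient[of K m s "\<lambda>_ _ _ _. 0"]] unfolding holomorphic_pluri_def by simp

section \<open>The coefficient as a function of tuples of charts and points\<close>

definition encn :: "(nat \<Rightarrow> 'b) \<Rightarrow> nat \<Rightarrow> real" where
  "encn q = enc (\<lambda>l. if l < n then q l else undefined)"

definition adm :: "(nat \<Rightarrow> 'b rchart) \<Rightarrow> (nat \<Rightarrow> 'b) \<Rightarrow> bool" where
  "adm i q \<longleftrightarrow> i \<in> I \<and> (\<forall>l<n. q l \<in> fst (i l))"

text \<open>Stated for tuples so that chart and point of a single factor can be changed by function
  update.\<close>

definition H :: "nat \<Rightarrow> (nat \<Rightarrow> real) pluri \<Rightarrow> (nat \<Rightarrow> 'b rchart) \<Rightarrow> (nat \<Rightarrow> 'b) \<Rightarrow> complex" where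
  "H m s i q = F m s (mk i) (encn q)"

lemma dec_encn: "l < n \<Longrightarrow> dec (encn q) l = q l"
  by (simp add: encn_def)

lemma adm_in: "adm i q \<Longrightarrow> encn q \<in> fst (mk i)" "adm i q \<Longrightarrow> encn q \<in> K"
proof -
  assume a: "adm i q"
  have "q l \<in> S l" if "l < n" for l
    using a that rs_subset[OF atl[OF that] I_C[OF _ that]] unfolding adm_def by blast
  then show K: "encn q \<in> K" unfolding K_def encn_def by (intro imageI) simp
  then show "encn q \<in> fst (mk i)" using a by (simp add: fst_mk dec_encn adm_def)
qed

lemma encn_cong: "(\<And>l. l < n \<Longrightarrow> q l = q' l) \<Longrightarrow> encn q = encn q'"
proof -
  assume "\<And>l. l < n \<Longrightarrow> q l = q' l"
  then have "(\<lambda>l. if l < n then q l else undefined) = (\<lambda>l. if l < n then q' l else undefined)" by auto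
  then show ?thesis unfolding encn_def by simp
qed

lemma coordinate_update:
  assumes a: "adm i q" and l: "l < n" and z: "z \<in> snd (i l) ` fst (i l)"
  defines "y \<equiv> (snd (mk i) (encn q))(2 * l := Re z, Suc (2 * l) := Im z)"
  shows "adm i (q(l := rinv (i l) z))" "y = snd (mk i) (encn (q(l := rinv (i l) z)))"
    "chart_inv (mk i) y = encn (q(l := rinv (i l) z))"
proof -
  have i: "i \<in> I" using a by (simp add: adm_def)
  obtain r where r: "r \<in> fst (i l)" "z = snd (i l) r" using z by blast
  have r': "rinv (i l) z = r" unfolding r(2) by (rule rinv_snd[OF atl[OF l] I_C[OF i l] r(1)])
  show a': "adm i (q(l := rinv (i l) z))" using a r unfolding r' adm_def by simp
  show y: "y = snd (mk i) (encn (q(l := rinv (i l) z)))"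
  proof (rule zc_eqI[of n])
    fix k assume k: "k < n"
    show "zc k y = zc k (snd (mk i) (encn (q(l := rinv (i l) z))))"
    proof (cases "k = l")
      case True
      then show ?thesis unfolding zc_mk[OF k] dec_encn[OF k] r' using r by (simp add: y_def)
    next
      case False
      then have "2 * k \<noteq> 2 * l" "2 * k \<noteq> Suc (2 * l)" "Suc (2 * k) \<noteq> 2 * l" "Suc (2 * k) \<noteq> Suc (2 * l)"
        by auto
      then have "zc k y = zc k (snd (mk i) (encn q))" by (simp add: y_def)
      then show ?thesis unfolding zc_mk[OF k] dec_encn[OF k] using False by simp
    qed
  qed (use l in \<open>simp_all add: y_def mk_zero\<close>)
  show "chart_inv (mk i) y = encn (q(l := rinv (i l) z))"
    unfolding y chart_inv_def by (rule inv_into_f_f[OF inj_on_mk[OF i] adm_in(1)[OF a']])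
qed

text \<open>The Cauchy-Riemann equation with weights \<open>\<alpha>\<close> and
  \<open>1 / \<alpha>\<close> expresses holomorphy in
  \<open>w = x / \<alpha> + \<i> \<alpha> y\<close>, and the \<open>Complex\<close> term solves this
  for \<open>x\<close> and \<open>y\<close>. The weight is constant on the slice, since
  \<open>G\<close> depends on the first factor and the last is a different one.\<close>

lemma H_slice:
  assumes s: "s \<in> holomorphic_pluri n (top_of_set K) A J m" and a: "adm i q" and l: "l < n"
  defines "\<alpha> \<equiv> if l = n - 1 then G (q 0) else 1"
  assumes z: "Complex (\<alpha> * Re w) (Im w / \<alpha>) \<in> snd (i l) ` fst (i l)"
  shows "(\<lambda>w. H m s i (q(l := rinv (i l) (Complex (\<alpha> * Re w) (Im w / \<alpha>))))) field_differentiable (at w)"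
proof -
  have i: "i \<in> I" using a by (simp add: adm_def)
  have c: "mk i \<in> A" unfolding A_def using i by blast
  have ch: "is_chart (2 * n) (top_of_set K) (mk i)" by (rule is_chart_mk[OF i])
  let ?W = "snd (mk i) ` fst (mk i)" and ?x = "snd (mk i) (encn q)" and ?f = "\<lambda>x. F m s (mk i) (chart_inv (mk i) x)"
  let ?y = "\<lambda>w. ?x(2 * l := \<alpha> * Re w, Suc (2 * l) := (1 / \<alpha>) * Im w)" and ?Z = "\<lambda>w. Complex (\<alpha> * Re w) (Im w / \<alpha>)"
  have fK: "fst (mk i) \<inter> K = fst (mk i)" unfolding fst_mk by blast
  have W: "openin (Euclidean_space (2 * n)) ?W" using ch by (simp add: is_chart_def)
  have f: "smooth_on (2 * n) ?W ?f"
  proof -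
    have "openin (top_of_set K) K" by (simp add: openin_subtopology_self)
    from smooth_F[OF holomorphic_pluri_section[OF s] this c] show ?thesis unfolding fK .
  qed
  have upd: "?y w = snd (mk i) (encn (q(l := rinv (i l) (?Z w))))" "chart_inv (mk i) (?y w) = encn (q(l := rinv (i l) (?Z w)))"
    "adm i (q(l := rinv (i l) (?Z w)))" if "?Z w \<in> snd (i l) ` fst (i l)" for w
    using coordinate_update[OF a l that] by simp_all
  have yW: "?y w \<in> ?W" unfolding upd(1)[OF z] using adm_in(1)[OF upd(3)[OF z]] by blast
  have sc: "scl n (G (dec (encn (q(l := rinv (i l) (?Z w)))) 0)) l = \<alpha>"
    using n by (simp add: dec_encn scl_def \<alpha>_def)
  have CR: "\<alpha> * pdiff (2 * l) ?f (?y w) + \<i> * complex_of_real (1 / \<alpha>) * pdiff (Suc (2 * l)) ?f (?y w) = 0"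
    using cauchy_riemann_F[OF s c adm_in(1)[OF upd(3)[OF z]] l] unfolding sc upd(1)[OF z, symmetric] .
  have "Suc (2 * l) < 2 * n" using l by simp
  from holomorphic_slice[OF W f this yW CR]
  obtain D where D: "((\<lambda>w. ?f (?y w)) has_field_derivative D) (at w)"
    unfolding field_differentiable_def by blast
  have op: "open (?Z -` (snd (i l) ` fst (i l)))"
  proof (rule open_vimage[OF rs_chart(3)[OF atl[OF l] I_C[OF i l]]])
    show "continuous_on UNIV ?Z" unfolding Complex_eq by (intro continuous_intros) (use G_pos in \<open>auto simp: \<alpha>_def\<close>)
  qed
  have "((\<lambda>w. H m s i (q(l := rinv (i l) (?Z w)))) has_field_derivative D) (at w)"
  proof (rule has_field_derivative_transform_within_open[OF D op])
    show "w \<in> ?Z -` (snd (i l) ` fst (i l))" using z by simp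
    fix v assume "v \<in> ?Z -` (snd (i l) ` fst (i l))"
    then have "?Z v \<in> snd (i l) ` fst (i l)" by simp
    from upd(2)[OF this] show "?f (?y v) = H m s i (q(l := rinv (i l) (?Z v)))" by (simp add: H_def)
  qed
  then show ?thesis unfolding field_differentiable_def by blast
qed

lemma H_trans:
  assumes s: "s \<in> holomorphic_pluri n (top_of_set K) A J m" and a: "adm i q" "adm i' q"
  shows "H m s i q = H m s i' q * (\<Prod>l<n - 1. tder (i l) (i' l) (q l)) ^ m"
proof -
  have ii: "i \<in> I" "i' \<in> I" using a by (simp_all add: adm_def)
  have "(\<Prod>l<n - 1. tder (i l) (i' l) (dec (encn q) l)) = (\<Prod>l<n - 1. tder (i l) (i' l) (q l))"
    by (intro prod.cong refl) (simp add: dec_encn)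
  then show ?thesis
    unfolding H_def using F_trans[OF holomorphic_pluri_section[OF s] ii _ adm_in(2)[OF a(1)]] adm_in(1)[OF a(1)] adm_in(1)[OF a(2)] by simp
qed

lemma H_slice_holo_diff:
  assumes s: "s \<in> holomorphic_pluri n (top_of_set K) A J m" and a: "adm i q" and l: "l < n - 1"
  shows "(\<lambda>c r. if c \<in> C l \<and> r \<in> fst c then H m s (i(l := c)) (q(l := r)) else 0) \<in> holo_diff (C l) (S l) m"
  unfolding holo_diff_def
proof (intro CollectI conjI ballI allI impI)
  have l': "l < n" using l by simp
  have sub: "fst c \<inter> S l = fst c" if "c \<in> C l" for c using rs_subset[OF atl[OF l'] that] by blast
  have adm: "adm (i(l := c)) (q(l := r))" if "c \<in> C l" "r \<in> fst c" for c r
    using a that by (simp add: adm_def I_def)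
  fix c assume c: "c \<in> C l"
  show "(\<lambda>z. if c \<in> C l \<and> rinv c z \<in> fst c then H m s (i(l := c)) (q(l := rinv c z)) else 0)
      holomorphic_on snd c ` (fst c \<inter> S l)"
    unfolding sub[OF c]
  proof (rule holomorphic_transform)
    \<comment> \<open>\<open>q l\<close> need not lie in \<open>c\<close>, so the slice is based at
      some point of \<open>c\<close>, which the update at \<open>l\<close> overwrites.\<close>
    obtain r0 where r0: "r0 \<in> fst c" using rs_chart(1)[OF atl[OF l'] c] by blast
    show "(\<lambda>z. H m s (i(l := c)) (q(l := rinv c z))) holomorphic_on snd c ` fst c"
      unfolding holomorphic_on_def
    proof
      fix z assume z: "z \<in> snd c ` fst c"
      have "(\<lambda>w. H m s (i(l := c)) ((q(l := r0))(l := rinv ((i(l := c)) l)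
          (Complex ((if l = n - 1 then G ((q(l := r0)) 0) else 1) * Re w) (Im w / (if l = n - 1 then G ((q(l := r0)) 0) else 1))))))
        field_differentiable (at z)"
        by (rule H_slice[OF s adm[OF c r0] l']) (use l z in \<open>simp add: complex_eq_iff[symmetric]\<close>)
      then have "(\<lambda>z. H m s (i(l := c)) (q(l := rinv c z))) field_differentiable (at z)"
        using l by simp
      then show "(\<lambda>z. H m s (i(l := c)) (q(l := rinv c z))) field_differentiable (at z within snd c ` fst c)"
        by (rule field_differentiable_at_within)
    qed
    show "H m s (i(l := c)) (q(l := rinv c z)) = (if c \<in> C l \<and> rinv c z \<in> fst c then H m s (i(l := c)) (q(l := rinv c z)) else 0)"
      if "z \<in> snd c ` fst c" for z
      using that c rinv_snd[OF atl[OF l'] c] by auto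
  qed
  fix c' r assume c': "c' \<in> C l" and r: "r \<in> fst c \<inter> fst c' \<inter> S l"
  have "(\<Prod>k<n - 1. tder ((i(l := c)) k) ((i(l := c')) k) ((q(l := r)) k)) = tder c c' r"
  proof -
    have "(\<Prod>k<n - 1. tder ((i(l := c)) k) ((i(l := c')) k) ((q(l := r)) k)) = (\<Prod>k<n - 1. if k = l then tder c c' r else 1)"
    proof (intro prod.cong refl)
      fix k assume "k \<in> {..<n - 1}"
      then have k: "k < n" by simp
      have "i \<in> I" "q k \<in> fst (i k)" using a k by (simp_all add: adm_def)
      then have "tder (i k) (i k) (q k) = 1" by (intro tder_self[OF atl[OF k]] I_C k)
      then show "tder ((i(l := c)) k) ((i(l := c')) k) ((q(l := r)) k) = (if k = l then tder c c' r else 1)" by simp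
    qed
    then show ?thesis using l by simp
  qed
  then have "H m s (i(l := c)) (q(l := r)) = H m s (i(l := c')) (q(l := r)) * tder c c' r ^ m"
    using H_trans[OF s adm[OF c, of r] adm[OF c', of r]] r by simp
  then show "(if c \<in> C l \<and> r \<in> fst c then H m s (i(l := c)) (q(l := r)) else 0) =
      (if c' \<in> C l \<and> r \<in> fst c' then H m s (i(l := c')) (q(l := r)) else 0) * tder c c' r ^ m"
    using c c' r by simp
next
  fix c r assume "\<not> (c \<in> C l \<and> r \<in> fst c \<inter> S l)"
  moreover have "l < n" using l by simp
  ultimately show "(if c \<in> C l \<and> r \<in> fst c then H m s (i(l := c)) (q(l := r)) else 0) = 0"
    using rs_subset[OF atl, of l c] by auto
qed

lemma H_last_chart:
  assumes s: "s \<in> holomorphic_pluri n (top_of_set K) A J m" and a: "adm i q" "adm i' q"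
    and eq: "\<And>l. l < n - 1 \<Longrightarrow> i l = i' l"
  shows "H m s i q = H m s i' q"
proof -
  have "(\<Prod>l<n - 1. tder (i l) (i' l) (q l)) = 1"
  proof (intro prod.neutral ballI)
    fix l assume "l \<in> {..<n - 1}"
    then have l: "l < n" "l < n - 1" by simp_all
    have "i \<in> I" "q l \<in> fst (i l)" using a l by (simp_all add: adm_def)
    then show "tder (i l) (i' l) (q l) = 1" unfolding eq[OF l(2), symmetric] by (intro tder_self[OF atl[OF l(1)]] I_C l(1))
  qed
  then show ?thesis using H_trans[OF s a] by simp
qed

end

text \<open>\<open>pt\<close> is the covering of the last factor by the plane, and
  \<open>Tc w\<close> a chart around \<open>pt w\<close> whose inverse is \<open>pt\<close> itself.
  The lattice is a square one before the twist.\<close>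

locale surface_product_torus = surface_product n S C G enc dec
  for n :: nat and S :: "nat \<Rightarrow> 'b::topological_space set" and C :: "nat \<Rightarrow> 'b rchart set" and G enc dec +
  fixes pt :: "complex \<Rightarrow> 'b" and Tc :: "complex \<Rightarrow> 'b rchart"
  assumes Tc: "\<And>w. Tc w \<in> C (n - 1)" "\<And>w. pt w \<in> fst (Tc w)" "\<And>w. snd (Tc w) (pt w) = w"
      "\<And>w z. z \<in> snd (Tc w) ` fst (Tc w) \<Longrightarrow> rinv (Tc w) z = pt z"
    and pt_surj: "S (n - 1) = range pt"
    and pt_per: "\<And>w. pt (w + complex_of_real (2 * pi)) = pt w" "\<And>w. pt (w + \<i> * complex_of_real (2 * pi)) = pt w"
begin

text \<open>Lifted to the plane, the coefficient is a doubly periodic function, because by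
  \<open>H_last_chart\<close> it does not change with the chart of the last factor. In the
  coordinate that straightens the twist it is entire with periods \<open>2 * pi / a\<close> and
  \<open>2 * pi * a\<close> for \<open>a = G (q 0)\<close>, hence constant.\<close>

lemma H_last_const:
  assumes s: "s \<in> holomorphic_pluri n (top_of_set K) A J m" and a: "adm i q"
  shows "H m s (i(n - 1 := Tc w)) (q(n - 1 := pt w)) = H m s (i(n - 1 := Tc w')) (q(n - 1 := pt w'))"
proof -
  let ?L = "n - 1" and ?a = "G (q 0)"
  let ?Z = "\<lambda>\<zeta>. Complex (?a * Re \<zeta>) (Im \<zeta> / ?a)"
  define E where "E = (\<lambda>w. H m s (i(?L := Tc w)) (q(?L := pt w)))"
  have L: "?L < n" "0 \<noteq> ?L" using n by simp_all
  have adm: "adm (i(?L := Tc w)) (q(?L := r))" if "r \<in> fst (Tc w)" for w r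
    using a that Tc(1)[of w] by (simp add: adm_def I_def)
  have chart: "E w = H m s (i(?L := Tc w')) (q(?L := pt w))" if "pt w \<in> fst (Tc w')" for w w'
    unfolding E_def by (rule H_last_chart[OF s adm[OF Tc(2)] adm[OF that]]) simp
  have per: "E (w + complex_of_real (2 * pi)) = E w" "E (w + \<i> * complex_of_real (2 * pi)) = E w" for w
    using chart[of "w + complex_of_real (2 * pi)" w] chart[of "w + \<i> * complex_of_real (2 * pi)" w] Tc(2)[of w]
    unfolding pt_per by (simp_all add: E_def)
  have diff: "(\<lambda>\<zeta>. E (?Z \<zeta>)) field_differentiable (at \<zeta>)" for \<zeta>
  proof -
    let ?w = "?Z \<zeta>"
    have c: "Tc ?w \<in> C ?L" by (rule Tc(1))
    have "?w = snd (Tc ?w) (pt ?w)" by (rule Tc(3)[symmetric])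
    then have z: "?w \<in> snd (Tc ?w) ` fst (Tc ?w)" using Tc(2)[of ?w] by (rule image_eqI)
    have "(\<lambda>\<zeta>. H m s (i(?L := Tc ?w)) ((q(?L := pt ?w))(?L := rinv ((i(?L := Tc ?w)) ?L)
        (Complex ((if ?L = n - 1 then G ((q(?L := pt ?w)) 0) else 1) * Re \<zeta>) (Im \<zeta> / (if ?L = n - 1 then G ((q(?L := pt ?w)) 0) else 1))))))
      field_differentiable (at \<zeta>)"
      by (rule H_slice[OF s adm[OF Tc(2)] L(1)]) (use z L(2) in simp)
    then obtain D where D: "((\<lambda>\<zeta>. H m s (i(?L := Tc ?w)) (q(?L := rinv (Tc ?w) (?Z \<zeta>)))) has_field_derivative D) (at \<zeta>)"
      using L(2) unfolding field_differentiable_def by auto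
    have op: "open (?Z -` (snd (Tc ?w) ` fst (Tc ?w)))"
    proof (rule open_vimage[OF rs_chart(3)[OF atl[OF L(1)] c]])
      show "continuous_on UNIV ?Z" unfolding Complex_eq by (intro continuous_intros) simp
    qed
    have "((\<lambda>\<zeta>. E (?Z \<zeta>)) has_field_derivative D) (at \<zeta>)"
    proof (rule has_field_derivative_transform_within_open[OF D op])
      show "\<zeta> \<in> ?Z -` (snd (Tc ?w) ` fst (Tc ?w))" using z by simp
      fix v assume "v \<in> ?Z -` (snd (Tc ?w) ` fst (Tc ?w))"
      then have v: "?Z v \<in> snd (Tc ?w) ` fst (Tc ?w)" by simp
      then have r: "rinv (Tc ?w) (?Z v) = pt (?Z v)" by (rule Tc(4))
      obtain r' where "r' \<in> fst (Tc ?w)" "?Z v = snd (Tc ?w) r'" using v by blast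
      then have "rinv (Tc ?w) (?Z v) \<in> fst (Tc ?w)" using rinv_snd[OF atl[OF L(1)] c] by simp
      then show "H m s (i(?L := Tc ?w)) (q(?L := rinv (Tc ?w) (?Z v))) = E (?Z v)"
        unfolding r by (rule chart[symmetric])
    qed
    then show ?thesis unfolding field_differentiable_def by blast
  qed
  have hol: "(\<lambda>\<zeta>. E (?Z \<zeta>)) holomorphic_on UNIV"
    unfolding holomorphic_on_def using diff by simp
  have Z1: "?Z (\<zeta> + complex_of_real (2 * pi / ?a)) = ?Z \<zeta> + complex_of_real (2 * pi)" for \<zeta>
    by (simp add: complex_eq_iff field_simps)
  have Z2: "?Z (\<zeta> + \<i> * complex_of_real (2 * pi * ?a)) = ?Z \<zeta> + \<i> * complex_of_real (2 * pi)" for \<zeta>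
    by (simp add: complex_eq_iff field_simps)
  have "E (?Z \<zeta>) = E (?Z \<zeta>')" for \<zeta> \<zeta>'
    by (rule doubly_periodic_entire_constant[OF hol, of "2 * pi / ?a" "2 * pi * ?a"])
      (use G_pos[of "q 0"] Z1 Z2 per in simp_all)
  from this[of "Complex (Re w / ?a) (Im w * ?a)" "Complex (Re w' / ?a) (Im w' * ?a)"]
  show ?thesis unfolding E_def by simp
qed

lemma H_last_indep:
  assumes s: "s \<in> holomorphic_pluri n (top_of_set K) A J m" and a: "adm i q" "adm i' q'"
    and eq: "\<And>l. l < n - 1 \<Longrightarrow> i l = i' l" "\<And>l. l < n - 1 \<Longrightarrow> q l = q' l"
  shows "H m s i q = H m s i' q'"
proof -
  let ?L = "n - 1"
  have L: "?L < n" using n by simp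
  have red: "\<exists>w. H m s i q = H m s (i(?L := Tc w)) (q(?L := pt w))" if a: "adm i q" for i q
  proof -
    have "q ?L \<in> fst (i ?L)" "i ?L \<in> C ?L" using a L by (simp_all add: adm_def I_def)
    then have "q ?L \<in> range pt" using rs_subset[OF atl[OF L]] pt_surj by blast
    then obtain w where w: "q ?L = pt w" by blast
    then have qw: "q(?L := pt w) = q" by (simp add: fun_upd_idem)
    have "adm (i(?L := Tc w)) q" using a w Tc(1,2)[of w] by (simp add: adm_def I_def)
    then have "H m s i q = H m s (i(?L := Tc w)) q" by (intro H_last_chart[OF s a]) simp_all
    then show ?thesis using qw by (intro exI[of _ w]) simp
  qed
  obtain w w' where "H m s i q = H m s (i(?L := Tc w)) (q(?L := pt w))" "H m s i' q' = H m s (i'(?L := Tc w')) (q'(?L := pt w'))"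
    using red[OF a(1)] red[OF a(2)] by blast
  moreover have "H m s (i(?L := Tc w)) (q(?L := pt w)) = H m s (i(?L := Tc w')) (q(?L := pt w'))"
    by (rule H_last_const[OF s a(1)])
  moreover have "H m s (i(?L := Tc w')) (q(?L := pt w')) = H m s (i'(?L := Tc w')) (q'(?L := pt w'))"
  proof -
    have adm': "adm (j(?L := Tc w')) (r(?L := pt w'))" if "adm j r" for j r
      using that Tc(1,2)[of w'] by (simp add: adm_def I_def)
    have "encn (q(?L := pt w')) = encn (q'(?L := pt w'))"
      by (rule encn_cong) (use eq(2) in auto)
    then have q: "H m s j (q(?L := pt w')) = H m s j (q'(?L := pt w'))" for j by (simp add: H_def)
    have "adm (i(?L := Tc w')) (q'(?L := pt w'))"
      using adm'[OF a(1)] adm'[OF a(2)] eq unfolding adm_def by auto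
    then show ?thesis
      unfolding q by (rule H_last_chart[OF s _ adm'[OF a(2)]]) (use eq(1) in simp)
  qed
  ultimately show ?thesis by simp
qed

end

section \<open>Plurigenera of the product\<close>

definition scf :: "complex \<Rightarrow> ('p \<Rightarrow> complex) \<Rightarrow> 'p \<Rightarrow> complex" where
  "scf a f = (\<lambda>x. a * f x)"

lemma vector_space_scf: "vector_space scf"
  by unfold_locales (auto simp: scf_def fun_eq_iff algebra_simps)

interpretation fs: vector_space scf
  by (rule vector_space_scf)

lemma sum_fun_apply: "(\<Sum>a\<in>A. f a) x = (\<Sum>a\<in>A. f a x)"
  for f :: "'a \<Rightarrow> 'p \<Rightarrow> 'c::comm_monoid_add"
  by (induction A rule: infinite_finite_induct) simp_all

text \<open>Points together with functions dual to evaluation at them. Interpolation takes the place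
  of abstract bases, since evaluations can be carried out in each factor of a product
  separately.\<close>

definition dual_pair :: "('p \<Rightarrow> complex) set \<Rightarrow> 'p set \<Rightarrow> 'p set \<Rightarrow> ('p \<Rightarrow> 'p \<Rightarrow> complex) \<Rightarrow> bool" where
  "dual_pair V P B \<phi> \<longleftrightarrow> finite B \<and> B \<subseteq> P \<and> (\<forall>b\<in>B. \<phi> b \<in> V \<and> (\<forall>b'\<in>B. \<phi> b b' = (if b = b' then 1 else 0)))"

lemma dual_pair_inj:
  assumes "dual_pair V P B \<phi>"
  shows "inj_on \<phi> B"
proof (rule inj_onI)
  fix b b' assume b: "b \<in> B" "b' \<in> B" "\<phi> b = \<phi> b'"
  have d: "\<phi> x y = (if x = y then 1 else 0)" if "x \<in> B" "y \<in> B" for x y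
    using assms that unfolding dual_pair_def by simp
  have "\<phi> b b' = 1" unfolding b(3) d[OF b(2) b(2)] by simp
  then show "b = b'" unfolding d[OF b(1,2)] by (simp split: if_split_asm)
qed

text \<open>A dual pair of maximal size exists by the bound \<open>N\<close>. If the interpolation
  formula failed for some \<open>f\<close>, the residual would vanish on \<open>B\<close> but not at
  some new point, and the pair could be enlarged. The last clause turns independent families into
  lower bounds for the size.\<close>

lemma exists_dual_pair:
  assumes V: "fs.subspace V" and le: "\<forall>B \<phi>. dual_pair V P B \<phi> \<longrightarrow> card B \<le> N"
    and P: "\<forall>f\<in>V. (\<forall>x\<in>P. f x = 0) \<longrightarrow> f = 0"
  shows "\<exists>B \<phi>. dual_pair V P B \<phi> \<and> (\<forall>f\<in>V. \<forall>x. f x = (\<Sum>b\<in>B. f b * \<phi> b x)) \<and> card B \<le> N \<and>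
    (\<forall>R. fs.independent R \<and> R \<subseteq> V \<longrightarrow> card R \<le> card B)"
proof -
  define M where "M = {card B | B \<phi>. dual_pair V P B \<phi>}"
  have "finite M"
  proof (rule finite_subset[of _ "{..N}"])
    show "M \<subseteq> {..N}"
    proof
      fix k assume "k \<in> M"
      then have "\<exists>B \<phi>. k = card B \<and> dual_pair V P B \<phi>" unfolding M_def mem_Collect_eq .
      then obtain B \<phi> where "dual_pair V P B \<phi>" "k = card B" by (elim exE conjE)
      then show "k \<in> {..N}" using le[rule_format, of B \<phi>] by simp
    qed
  qed simp
  have "dual_pair V P {} (\<lambda>_ _. 0)" unfolding dual_pair_def by simp
  then have "card ({} :: 'a set) \<in> M"
    unfolding M_def mem_Collect_eq by (intro exI[of _ "{}"] exI[of _ "\<lambda>_ _. 0"] conjI refl)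
  then have "M \<noteq> {}" by blast
  with \<open>finite M\<close> have "Max M \<in> M" by (rule Max_in)
  then have "\<exists>B \<phi>. Max M = card B \<and> dual_pair V P B \<phi>" unfolding M_def mem_Collect_eq .
  then obtain B \<phi> where d: "dual_pair V P B \<phi>" and B: "Max M = card B" by (elim exE conjE)
  have finB: "finite B" and BP: "B \<subseteq> P" and \<phi>V: "\<And>b. b \<in> B \<Longrightarrow> \<phi> b \<in> V"
    and \<delta>: "\<And>b b'. b \<in> B \<Longrightarrow> b' \<in> B \<Longrightarrow> \<phi> b b' = (if b = b' then 1 else 0)"
    using d unfolding dual_pair_def by auto
  have lin: "(\<lambda>x. a * f x + c * h x) \<in> V" if "f \<in> V" "h \<in> V" for f h a c
  proof -
    have "scf a f + scf c h \<in> V" using V that by (intro fs.subspace_add fs.subspace_scale)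
    moreover have "scf a f + scf c h = (\<lambda>x. a * f x + c * h x)" by (auto simp: scf_def)
    ultimately show ?thesis by simp
  qed
  have sumV: "(\<lambda>x. \<Sum>b\<in>B. k b * \<phi> b x) \<in> V" for k
  proof -
    have "(\<Sum>b\<in>B. scf (k b) (\<phi> b)) \<in> V" using V \<phi>V by (intro fs.subspace_sum fs.subspace_scale)
    moreover have "(\<Sum>b\<in>B. scf (k b) (\<phi> b)) = (\<lambda>x. \<Sum>b\<in>B. k b * \<phi> b x)"
      by (simp add: fun_eq_iff sum_fun_apply scf_def)
    ultimately show ?thesis by simp
  qed
  have exp: "f x = (\<Sum>b\<in>B. f b * \<phi> b x)" if f: "f \<in> V" for f x
  proof (rule ccontr)
    assume ne: "\<not> ?thesis"
    define r where "r = (\<lambda>x. 1 * f x + (-1) * (\<Sum>b\<in>B. f b * \<phi> b x))"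
    have r: "r \<in> V" unfolding r_def by (rule lin[OF f sumV])
    have "r x \<noteq> 0" using ne by (simp add: r_def)
    then have "r \<noteq> 0" by auto
    then obtain y where y: "y \<in> P" "r y \<noteq> 0" using P r by blast
    have rB: "r b = 0" if b: "b \<in> B" for b
    proof -
      have "(\<Sum>b'\<in>B. f b' * \<phi> b' b) = f b * \<phi> b b"
        by (rule sum_single[rule_format, OF finB b]) (use \<delta> b in simp)
      then show ?thesis using \<delta>[OF b b] by (simp add: r_def)
    qed
    then have yB: "y \<notin> B" using y(2) by blast
    \<comment> \<open>The residual, normalised at \<open>y\<close>, joins the pair, and each old
      function is corrected by a multiple of it so as to vanish at \<open>y\<close>.\<close>
    define \<psi> where "\<psi> = (\<lambda>b x. if b = y then (1 / r y) * r x + 0 * r x else 1 * \<phi> b x + (- \<phi> b y / r y) * r x)"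
    have "dual_pair V P (insert y B) \<psi>"
      unfolding dual_pair_def
    proof (intro conjI ballI)
      fix b assume b: "b \<in> insert y B"
      show "\<psi> b \<in> V"
      proof (cases "b = y")
        case True
        then show ?thesis unfolding \<psi>_def using lin[OF r r, of "1 / r y" 0] by simp
      next
        case False
        then have "\<phi> b \<in> V" using b \<phi>V by blast
        from lin[OF this r, of 1 "- \<phi> b y / r y"] show ?thesis unfolding \<psi>_def using False by (simp only: if_False)
      qed
      fix b' assume b': "b' \<in> insert y B"
      show "\<psi> b b' = (if b = b' then 1 else 0)"
        using b b' y(2) yB rB \<delta> by (auto simp: \<psi>_def)
    qed (use finB BP y in auto)
    then have "card (insert y B) \<in> M"
      unfolding M_def mem_Collect_eq by (intro exI[of _ "insert y B"] exI[of _ \<psi>] conjI refl)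
    then have "card (insert y B) \<le> Max M" using \<open>finite M\<close> by (rule Max_ge[rotated])
    then show False using B finB yB by simp
  qed
  have cT: "card B \<le> N" by (rule le[rule_format, OF d])
  have cR: "card R \<le> card B" if R: "fs.independent R" "R \<subseteq> V" for R
  proof -
    have "f \<in> fs.span (\<phi> ` B)" if "f \<in> V" for f
    proof -
      have "f = (\<Sum>b\<in>B. scf (f b) (\<phi> b))"
        by (rule ext) (simp add: sum_fun_apply scf_def exp[OF that, symmetric])
      also have "\<dots> \<in> fs.span (\<phi> ` B)" by (intro fs.span_sum fs.span_scale fs.span_base imageI)
      finally show ?thesis .
    qed
    then have "card R \<le> card (\<phi> ` B)"
      using fs.independent_span_bound[of "\<phi> ` B" R] finB R by blast
    then show ?thesis unfolding card_image[OF dual_pair_inj[OF d]] .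
  qed
  show ?thesis using d exp cT cR by (intro exI[of _ B] exI[of _ \<phi>] conjI) simp_all
qed

lemma holo_diff_lincomb:
  assumes "f \<in> holo_diff C U m" "g \<in> holo_diff C U m"
  shows "(\<lambda>c q. a * f c q + b * g c q) \<in> holo_diff C U m"
  unfolding holo_diff_def
proof (intro CollectI conjI allI impI ballI)
  show "a * f c q + b * g c q = 0" if "\<not> (c \<in> C \<and> q \<in> fst c \<inter> U)" for c q
    using holo_diffD(1)[OF assms(1) that] holo_diffD(1)[OF assms(2) that] by simp
  show "(\<lambda>z. a * f c (rinv c z) + b * g c (rinv c z)) holomorphic_on snd c ` (fst c \<inter> U)" if "c \<in> C" for c
    by (intro holomorphic_intros holo_diffD(2)[OF assms(1) that] holo_diffD(2)[OF assms(2) that])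
  fix c c' q assume q: "c \<in> C" "c' \<in> C" "q \<in> fst c \<inter> fst c' \<inter> U"
  have "f c q = f c' q * tder c c' q ^ m" "g c q = g c' q * tder c c' q ^ m"
    by (rule holo_diffD(3)[OF assms(1) q], rule holo_diffD(3)[OF assms(2) q])
  then show "a * f c q + b * g c q = (a * f c' q + b * g c' q) * tder c c' q ^ m"
    by (simp only:) (simp add: algebra_simps)
qed

lemma holo_diff_zero: "(\<lambda>c q. 0) \<in> holo_diff C U m"
  unfolding holo_diff_def by auto

lemma holo_diff_sum:
  assumes "\<And>a. a \<in> A \<Longrightarrow> f a \<in> holo_diff C U m"
  shows "(\<lambda>c q. \<Sum>a\<in>A. k a * f a c q) \<in> holo_diff C U m"
  using assms
proof (induction A rule: infinite_finite_induct)
  case (insert x A)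
  then show ?case using holo_diff_lincomb[of "f x" C U m "\<lambda>c q. \<Sum>a\<in>A. k a * f a c q" "k x" 1] by simp
qed (simp_all add: holo_diff_zero)

text \<open>The expansion of \<open>f\<close> makes the values at \<open>B\<close> coordinates on
  the space of differentials, so \<open>card B\<close> is its dimension.\<close>

definition dual_system ::
  "'b rchart set \<Rightarrow> 'b set \<Rightarrow> nat \<Rightarrow> ('b rchart \<times> 'b) set \<Rightarrow> ('b rchart \<times> 'b \<Rightarrow> 'b rchart \<Rightarrow> 'b \<Rightarrow> complex) \<Rightarrow> bool" where
  "dual_system C S m B \<phi> \<longleftrightarrow> finite B \<and>
     (\<forall>b\<in>B. fst b \<in> C \<and> snd b \<in> fst (fst b) \<and> \<phi> b \<in> holo_diff C S m \<and>
        (\<forall>b'\<in>B. \<phi> b (fst b') (snd b') = (if b = b' then 1 else 0))) \<and>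
     (\<forall>f\<in>holo_diff C S m. \<forall>c q. f c q = (\<Sum>b\<in>B. f (fst b) (snd b) * \<phi> b c q))"

text \<open>Jointly injective functionals embed the differentials into a space of dimension
  \<open>N\<close>, which bounds every dual pair; \<open>exists_dual_pair\<close> then applies to
  differentials viewed as functions of a chart and a point.\<close>

lemma exists_dual_system:
  fixes C :: "'b::topological_space rchart set" and \<Lambda> :: "nat \<Rightarrow> ('b rchart \<Rightarrow> 'b \<Rightarrow> complex) \<Rightarrow> complex"
  assumes lin: "\<And>j f g a b. f \<in> holo_diff C S m \<Longrightarrow> g \<in> holo_diff C S m \<Longrightarrow>
      \<Lambda> j (\<lambda>c q. a * f c q + b * g c q) = a * \<Lambda> j f + b * \<Lambda> j g"
    and inj: "\<And>f. f \<in> holo_diff C S m \<Longrightarrow> (\<And>j. j < N \<Longrightarrow> \<Lambda> j f = 0) \<Longrightarrow> f = (\<lambda>_ _. 0)"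
  shows "\<exists>B \<phi>. dual_system C S m B \<phi> \<and> card B \<le> N \<and>
    (\<forall>R. fs.independent R \<and> R \<subseteq> case_prod ` holo_diff C S m \<longrightarrow> card R \<le> card B)"
proof -
  \<comment> \<open>Evaluation is restricted to points inside their chart; elsewhere a differential
    is 0 by convention.\<close>
  let ?V = "case_prod ` holo_diff C S m" and ?P = "{(c, q). c \<in> C \<and> q \<in> fst c}"
  have sub: "fs.subspace ?V"
  proof (rule fs.subspaceI)
    show "0 \<in> ?V"
      by (rule image_eqI[of _ _ "\<lambda>c q. 0"]) (auto simp: holo_diff_zero)
    show "x + y \<in> ?V" if xy: "x \<in> ?V" "y \<in> ?V" for x y
    proof -
      obtain f g where fg: "f \<in> holo_diff C S m" "g \<in> holo_diff C S m" "x = case_prod f" "y = case_prod g" using xy by blast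
      show ?thesis
        by (rule image_eqI[OF _ holo_diff_lincomb[OF fg(1,2), of 1 1]]) (auto simp: fg(3,4))
    qed
    show "scf a x \<in> ?V" if x: "x \<in> ?V" for a x
    proof -
      obtain f where f: "f \<in> holo_diff C S m" "x = case_prod f" using x by blast
      show ?thesis
        by (rule image_eqI[OF _ holo_diff_lincomb[OF f(1) f(1), of a 0]]) (auto simp: f(2) scf_def)
    qed
  qed
  have zero: "\<forall>f\<in>?V. (\<forall>x\<in>?P. f x = 0) \<longrightarrow> f = 0"
  proof (intro ballI impI)
    fix f assume f: "f \<in> ?V" "\<forall>x\<in>?P. f x = 0"
    obtain h where h: "h \<in> holo_diff C S m" "f = case_prod h" using f(1) by blast
    have "h c q = 0" for c q
    proof (cases "c \<in> C \<and> q \<in> fst c")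
      case True
      then show ?thesis using f(2)[THEN bspec, of "(c, q)"] h(2) by simp
    next
      case False
      then show ?thesis by (intro holo_diffD(1)[OF h(1)]) blast
    qed
    then show "f = 0" unfolding h(2) by (auto simp: fun_eq_iff)
  qed
  have bound: "\<forall>B \<phi>. dual_pair ?V ?P B \<phi> \<longrightarrow> card B \<le> N"
  proof (intro allI impI)
    fix B \<phi> assume B: "dual_pair ?V ?P B \<phi>"
    let ?\<psi> = "\<lambda>b c q. \<phi> b (c, q)"
    have finB: "finite B" using B unfolding dual_pair_def by blast
    have \<psi>: "?\<psi> b \<in> holo_diff C S m" if "b \<in> B" for b
    proof -
      have "\<phi> b \<in> ?V" using B that unfolding dual_pair_def by blast
      then show ?thesis by auto
    qed
    have sumL: "\<Lambda> j (\<lambda>c q. \<Sum>b\<in>B'. u b * ?\<psi> b c q) = (\<Sum>b\<in>B'. u b * \<Lambda> j (?\<psi> b))" if "finite B'" "B' \<subseteq> B" for j u B'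
      using that
    proof (induction B')
      case empty
      show ?case using lin[OF holo_diff_zero holo_diff_zero, of j 0 0] by simp
    next
      case (insert b B')
      have "\<Lambda> j (\<lambda>c q. u b * ?\<psi> b c q + 1 * (\<Sum>b\<in>B'. u b * ?\<psi> b c q)) =
          u b * \<Lambda> j (?\<psi> b) + 1 * \<Lambda> j (\<lambda>c q. \<Sum>b\<in>B'. u b * ?\<psi> b c q)"
        by (intro lin \<psi> holo_diff_sum) (use insert.prems in auto)
      then show ?case using insert by simp
    qed
    \<comment> \<open>The vector of functional values, cut off at \<open>N\<close>. A linear
      relation between these vectors passes to the differentials by \<open>inj\<close> and becomes
      trivial on evaluation at the points of \<open>B\<close>.\<close>
    define v where "v = (\<lambda>b j. if j < N then \<Lambda> j (?\<psi> b) else 0)"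
    have key: "u b = 0" if z: "(\<lambda>j. \<Sum>b\<in>B. u b * v b j) = (\<lambda>_. 0)" and b: "b \<in> B" for u b
    proof -
      have "(\<lambda>c q. \<Sum>b\<in>B. u b * ?\<psi> b c q) = (\<lambda>_ _. 0)"
      proof (rule inj)
        show "(\<lambda>c q. \<Sum>b\<in>B. u b * ?\<psi> b c q) \<in> holo_diff C S m" by (intro holo_diff_sum \<psi>)
        show "\<Lambda> j (\<lambda>c q. \<Sum>b\<in>B. u b * ?\<psi> b c q) = 0" if "j < N" for j
          unfolding sumL[OF finB subset_refl] using fun_cong[OF z, of j] that by (simp add: v_def)
      qed
      then have "(\<Sum>b'\<in>B. u b' * ?\<psi> b' (fst b) (snd b)) = 0" by (rule fun_cong[THEN fun_cong])
      also have "(\<Sum>b'\<in>B. u b' * ?\<psi> b' (fst b) (snd b)) = u b * ?\<psi> b (fst b) (snd b)"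
        by (rule sum_single[rule_format, OF finB b]) (use B b in \<open>simp add: dual_pair_def\<close>)
      finally show ?thesis using B b by (simp add: dual_pair_def)
    qed
    have vinj: "inj_on v B"
    proof (rule inj_onI, rule ccontr)
      fix b b' assume b: "b \<in> B" "b' \<in> B" "v b = v b'" "b \<noteq> b'"
      have "(\<Sum>x\<in>B. (if x = b then 1 else if x = b' then -1 else 0) * v x j) = 0" for j
      proof -
        have "(\<Sum>x\<in>B. (if x = b then 1 else if x = b' then -1 else 0) * v x j) =
            (\<Sum>x\<in>{b, b'}. (if x = b then 1 else if x = b' then -1 else 0) * v x j)"
          using b finB by (intro sum.mono_neutral_right) auto
        then show ?thesis using b(3,4) by simp
      qed
      then have "(\<lambda>j. \<Sum>x\<in>B. (if x = b then 1 else if x = b' then -1 else 0) * v x j) = (\<lambda>_. 0)" by simp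
      from key[OF this b(1)] show False by simp
    qed
    have ind: "fs.independent (v ` B)"
    proof (rule fs.independent_if_scalars_zero)
      fix u x assume z: "(\<Sum>x\<in>v ` B. scf (u x) x) = 0" and "x \<in> v ` B"
      then obtain b where b: "b \<in> B" "x = v b" by blast
      have "(\<lambda>j. \<Sum>b\<in>B. u (v b) * v b j) = (\<Sum>x\<in>v ` B. scf (u x) x)"
        unfolding sum.reindex[OF vinj] by (rule ext) (simp add: sum_fun_apply scf_def)
      also have "\<dots> = (\<lambda>_. 0)" unfolding z by (rule ext) (rule zero_fun_apply)
      finally have "u (v b) = 0" by (rule key[of "\<lambda>b. u (v b)", OF _ b(1)])
      then show "u x = 0" unfolding b(2) .
    qed (use finB in simp)
    let ?\<delta> = "\<lambda>j k. if k = j then 1 else 0 :: complex"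
    have "v b \<in> fs.span (?\<delta> ` {..<N})" for b
    proof -
      have "v b k = (\<Sum>j<N. v b j * ?\<delta> j k)" for k
      proof -
        have "(\<Sum>j<N. v b j * ?\<delta> j k) = (\<Sum>j<N. if j = k then v b k else 0)"
          by (intro sum.cong) auto
        also have "\<dots> = (if k < N then v b k else 0)" by simp
        also have "\<dots> = v b k" unfolding v_def by simp
        finally show ?thesis by simp
      qed
      then have "v b = (\<Sum>j<N. scf (v b j) (?\<delta> j))"
        unfolding sum_fun_apply[abs_def] fun_eq_iff scf_def by blast
      also have "\<dots> \<in> fs.span (?\<delta> ` {..<N})" by (intro fs.span_sum fs.span_scale fs.span_base imageI)
      finally show ?thesis .
    qed
    then have "v ` B \<subseteq> fs.span (?\<delta> ` {..<N})" by blast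
    then have "card (v ` B) \<le> card (?\<delta> ` {..<N})"
      using fs.independent_span_bound[OF _ ind] by simp
    also have "\<dots> \<le> N" using card_image_le[of "{..<N}" ?\<delta>] by simp
    finally show "card B \<le> N" unfolding card_image[OF vinj] .
  qed
  obtain B \<phi> where B: "dual_pair ?V ?P B \<phi>" and exp: "\<forall>f\<in>?V. \<forall>x. f x = (\<Sum>b\<in>B. f b * \<phi> b x)"
    and c: "card B \<le> N" "\<forall>R. fs.independent R \<and> R \<subseteq> ?V \<longrightarrow> card R \<le> card B"
    using exists_dual_pair[where P = ?P, OF sub bound zero] by (elim exE conjE)
  have "dual_system C S m B (\<lambda>b c q. \<phi> b (c, q))"
    unfolding dual_system_def
  proof (intro conjI ballI allI)
    show "finite B" using B unfolding dual_pair_def by blast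
    fix b assume b: "b \<in> B"
    then have "b \<in> ?P" using B unfolding dual_pair_def by blast
    then show "fst b \<in> C" "snd b \<in> fst (fst b)" by auto
    have "\<phi> b \<in> ?V" using B b unfolding dual_pair_def by blast
    then show "(\<lambda>c q. \<phi> b (c, q)) \<in> holo_diff C S m" by auto
    show "\<phi> b (fst b', snd b') = (if b = b' then 1 else 0)" if "b' \<in> B" for b'
      using B b that unfolding dual_pair_def by simp
  next
    fix f c q assume "f \<in> holo_diff C S m"
    then have "case_prod f \<in> ?V" by blast
    from exp[THEN bspec, OF this, THEN spec, of "(c, q)"] show "f c q = (\<Sum>b\<in>B. f (fst b) (snd b) * \<phi> b (c, q))"
      by (simp add: case_prod_beta)
  qed
  then show ?thesis using c by (intro exI conjI)
qed

context surface_product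
begin

text \<open>With points frozen in the other factors, which exist because chart domains are nonempty,
  both domain and coordinate of factor \<open>l\<close> can be read off the product chart.\<close>

lemma mk_inj:
  assumes i: "i \<in> I" and i': "i' \<in> I" and eq: "mk i = mk i'" and l: "l < n"
  shows "i l = i' l"
proof -
  have "\<forall>k. \<exists>q. k < n \<longrightarrow> q \<in> fst (i k)"
  proof
    fix k show "\<exists>q. k < n \<longrightarrow> q \<in> fst (i k)"
    proof (cases "k < n")
      case True
      then show ?thesis using rs_chart(1)[OF atl[OF True] I_C[OF i True]] by blast
    qed simp
  qed
  from choice[OF this] obtain q where q: "\<forall>k. k < n \<longrightarrow> q k \<in> fst (i k)" by (elim exE)
  have a: "adm i q" using q i by (simp add: adm_def)
  have "adm i' q"
  proof -
    have "encn q \<in> fst (mk i')" using adm_in(1)[OF a] eq by simp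
    then show ?thesis using i' by (simp add: adm_def fst_mk dec_encn)
  qed
  then have a': "adm i' q" .
  have sub: "fst (j l) \<subseteq> fst (j' l)" if "adm j q" "adm j' q" "mk j = mk j'" for j j'
  proof
    fix r assume r: "r \<in> fst (j l)"
    then have "adm j (q(l := r))" using that(1) by (simp add: adm_def)
    then have "encn (q(l := r)) \<in> fst (mk j')" using adm_in(1) that(3) by metis
    then show "r \<in> fst (j' l)" using l by (auto simp: fst_mk dec_encn)
  qed
  have "fst (i l) = fst (i' l)" using sub[OF a a' eq] sub[OF a' a eq[symmetric]] by (rule equalityI)
  moreover have "snd (i l) r = snd (i' l) r" for r
  proof -
    have "zc l (snd (mk i) (encn (q(l := r)))) = zc l (snd (mk i') (encn (q(l := r))))" using eq by simp
    then show ?thesis unfolding zc_mk[OF l] dec_encn[OF l] by simp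
  qed
  ultimately show ?thesis by (simp add: prod_eq_iff fun_eq_iff)
qed

lemma H_sec:
  assumes a: "adm i q"
  shows "H m (sec m S f) i q = (\<Prod>l<n - 1. f l (i l) (q l))"
proof -
  have i: "i \<in> I" using a by (simp add: adm_def)
  have c: "mk i \<in> A" unfolding A_def using i by blast
  have b: "encn q \<in> bx S" unfolding bx_def using adm_in(2)[OF a] dec_S[OF adm_in(2)[OF a]] by simp
  have "coef f (mk i) (encn q) = (\<Prod>l<n - 1. f l (i l) (q l))"
    unfolding coef_def
  proof (intro prod.cong refl)
    fix l assume "l \<in> {..<n - 1}"
    then have l: "l < n" by simp
    show "f l (idx (mk i) l) (dec (encn q) l) = f l (i l) (q l)"
      unfolding dec_encn[OF l] mk_inj[OF idx(1)[OF c] i idx(2)[OF c] l] ..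
  qed
  then show ?thesis
    unfolding H_def F_def sec_def using c b adm_in(1)[OF a] by (simp add: map_replicate prod_list_replicate Om_frame)
qed

lemma bx_S: "bx S = K"
  unfolding bx_def using dec_S by auto

lemma sec_holomorphic:
  assumes "m \<ge> 1" "\<And>l. l < n - 1 \<Longrightarrow> f l \<in> holo_diff (C l) (S l) m"
  shows "sec m S f \<in> holomorphic_pluri n (top_of_set K) A J m"
  using dbar_pluri_sec[OF assms(1) _ assms(2)] unfolding holomorphic_pluri_def bx_S
  by (simp add: openin_subtopology_self)

text \<open>A section is determined by its coefficients in all charts, so linear relations may be
  checked on \<open>H\<close>.\<close>

lemma pluri_eqI:
  assumes s: "pluri_section n A J K m s"
    and eq: "\<And>i q. adm i q \<Longrightarrow> H m s i q = (\<Sum>b\<in>BB. k b * H m (t b) i q)" and t: "\<And>b. b \<in> BB \<Longrightarrow> pluri_section n A J K m (t b)"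
  shows "s c p vss = (\<Sum>b\<in>BB. k b * t b c p vss)"
proof (cases "c \<in> A \<and> p \<in> fst c \<inter> K")
  case False
  have z: "u c p vss = 0" if "pluri_section n A J K m u" for u
  proof -
    have "\<forall>c p. \<not> (c \<in> A \<and> p \<in> fst c \<inter> K) \<longrightarrow> u c p = (\<lambda>_. 0)"
      using that unfolding pluri_section_def by (elim conjE)
    from this[THEN spec, THEN spec, THEN mp, OF False] show ?thesis by simp
  qed
  show ?thesis using z[OF s] z[OF t] by simp
next
  case True
  then have c: "c \<in> A" and p: "p \<in> fst c \<inter> K" by simp_all
  show ?thesis
  proof (cases "length vss = m")
    case False
    have z: "u c p vss = 0" if "pluri_section n A J K m u" for u
    proof -
      have "canonical_fibre n (J c p) m (u c p)" using that c p unfolding pluri_section_def by blast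
      then show ?thesis using False unfolding canonical_fibre_def by blast
    qed
    show ?thesis using z[OF s] z[OF t] by simp
  next
    case l: True
    let ?i = "idx c"
    have pi: "p \<in> fst (mk ?i)" using p idx(2)[OF c] by simp
    then have a: "adm ?i (dec p)" using idx(1)[OF c] by (simp add: adm_def fst_mk)
    have e: "encn (dec p) = p"
      by (rule K_eqI[OF adm_in(2)[OF a]]) (use p in \<open>simp_all add: dec_encn\<close>)
    have F: "F m u c p = H m u ?i (dec p)" for u unfolding H_def e idx(2)[OF c] ..
    have "s c p vss = (\<Sum>b\<in>BB. k b * H m (t b) ?i (dec p)) * (\<Prod>vs\<leftarrow>vss. Om n (G (dec p 0)) vs)"
      unfolding pluri_section_eq[OF s c p l] F eq[OF a] ..
    also have "\<dots> = (\<Sum>b\<in>BB. k b * t b c p vss)"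
      unfolding sum_distrib_right
      by (intro sum.cong refl) (simp add: pluri_section_eq[OF t c p l] F)
    finally show ?thesis .
  qed
qed

end

context surface_product_torus
begin

definition admt :: "(nat \<Rightarrow> 'b rchart \<times> 'b) \<Rightarrow> bool" where
  "admt x \<longleftrightarrow> adm (fst \<circ> x) (snd \<circ> x)"

definition Ht :: "nat \<Rightarrow> (nat \<Rightarrow> real) pluri \<Rightarrow> (nat \<Rightarrow> 'b rchart \<times> 'b) \<Rightarrow> complex" where
  "Ht m s x = H m s (fst \<circ> x) (snd \<circ> x)"

lemma admt_iff: "admt x \<longleftrightarrow> (\<forall>l<n. fst (x l) \<in> C l \<and> snd (x l) \<in> fst (fst (x l)))"
  unfolding admt_def adm_def I_def by auto

lemma Ht_slice:
  assumes "s \<in> holomorphic_pluri n (top_of_set K) A J m" "admt x" "l < n - 1"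
  shows "(\<lambda>c r. if c \<in> C l \<and> r \<in> fst c then Ht m s (x(l := (c, r))) else 0) \<in> holo_diff (C l) (S l) m"
proof -
  have e: "fst \<circ> x(l := (c, r)) = (fst \<circ> x)(l := c)" "snd \<circ> x(l := (c, r)) = (snd \<circ> x)(l := r)" for c r
    by auto
  show ?thesis
    unfolding Ht_def e by (rule H_slice_holo_diff[OF assms(1) assms(2)[unfolded admt_def] assms(3)])
qed

text \<open>Interpolation factor by factor: if \<open>D\<close> vanishes whenever slot
  \<open>k\<close> is at a point of \<open>B k\<close>, then the slice in slot \<open>k\<close> is a
  differential that vanishes on \<open>B k\<close>, hence identically. The induction is on the
  number of leading slots left free.\<close>

lemma slices_zero:
  assumes dual: "\<And>l. l < n - 1 \<Longrightarrow> dual_system (C l) (S l) m (B l) (\<phi> l)"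
    and slice: "\<And>x l. admt x \<Longrightarrow> l < n - 1 \<Longrightarrow>
      (\<lambda>c r. if c \<in> C l \<and> r \<in> fst c then D (x(l := (c, r))) else 0) \<in> holo_diff (C l) (S l) m"
    and grid: "\<And>x. admt x \<Longrightarrow> (\<And>l. l < n - 1 \<Longrightarrow> x l \<in> B l) \<Longrightarrow> D x = 0"
    and x: "admt x"
  shows "D x = 0"
proof -
  have "k \<le> n - 1 \<Longrightarrow> admt x \<Longrightarrow> (\<And>l. k \<le> l \<Longrightarrow> l < n - 1 \<Longrightarrow> x l \<in> B l) \<Longrightarrow> D x = 0" for k x
  proof (induction k arbitrary: x)
    case 0
    then show ?case using grid by simp
  next
    case (Suc k)
    have k: "k < n - 1" using Suc.prems by simp
    let ?f = "\<lambda>c r. if c \<in> C k \<and> r \<in> fst c then D (x(k := (c, r))) else 0"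
    have f: "?f \<in> holo_diff (C k) (S k) m" by (rule slice[OF Suc.prems(2) k])
    have b0: "?f (fst b) (snd b) = 0" if b: "b \<in> B k" for b
    proof -
      have bC: "fst b \<in> C k" "snd b \<in> fst (fst b)" using dual[OF k] b unfolding dual_system_def by blast+
      have "D (x(k := b)) = 0"
      proof (rule Suc.IH)
        show "admt (x(k := b))" using Suc.prems(2) bC unfolding admt_iff by simp
        show "(x(k := b)) l \<in> B l" if "k \<le> l" "l < n - 1" for l
          using Suc.prems(3)[of l] b that by (cases "l = k") simp_all
      qed (use k in simp)
      then show ?thesis by simp
    qed
    have "\<forall>f\<in>holo_diff (C k) (S k) m. \<forall>c q. f c q = (\<Sum>b\<in>B k. f (fst b) (snd b) * \<phi> k b c q)"
      using dual[OF k] unfolding dual_system_def by (elim conjE)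
    from this[THEN bspec, OF f, THEN spec, of "fst (x k)", THEN spec, of "snd (x k)"]
    have "?f (fst (x k)) (snd (x k)) = (\<Sum>b\<in>B k. ?f (fst b) (snd b) * \<phi> k b (fst (x k)) (snd (x k)))" .
    also have "\<dots> = 0" by (intro sum.neutral ballI) (simp only: b0 mult_zero_left)
    finally have "?f (fst (x k)) (snd (x k)) = 0" .
    moreover have "fst (x k) \<in> C k" "snd (x k) \<in> fst (fst (x k))" using Suc.prems(2) k unfolding admt_iff by simp_all
    ultimately show ?case by simp
  qed
  from this[of "n - 1" x] show ?thesis using x by simp
qed

interpretation pl: vector_space scale_pluri
  by (rule vector_space_scale_pluri)

text \<open>The products \<open>sb \<beta>\<close> of dual functions are a basis of the holomorphic
  sections: they are dual to evaluation at the grid points, and a section minus its interpolation on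
  the grid vanishes by \<open>slices_zero\<close>.\<close>

theorem plurigenus_eq:
  assumes m: "m \<ge> 1" and dual: "\<And>l. l < n - 1 \<Longrightarrow> dual_system (C l) (S l) m (B l) (\<phi> l)"
  shows "plurigenus n (top_of_set K) A J m = (\<Prod>l<n - 1. card (B l))"
proof -
  let ?Hol = "holomorphic_pluri n (top_of_set K) A J m"
  define BB where "BB = PiE {..<n - 1} B"
  define sb where "sb = (\<lambda>\<beta>. sec m S (\<lambda>l. \<phi> l (\<beta> l)))"
  \<comment> \<open>The torus slot receives an arbitrary admissible pair, as the values are constant
    along the torus.\<close>
  define tup where "tup = (\<lambda>\<beta> l. if l < n - 1 then \<beta> l else (Tc 0, pt 0))"
  have finB: "finite (B l)" if "l < n - 1" for l using dual[OF that] unfolding dual_system_def by blast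
  have finBB: "finite BB" unfolding BB_def using finB by (intro finite_PiE) auto
  have BC: "fst b \<in> C l" "snd b \<in> fst (fst b)" "\<phi> l b \<in> holo_diff (C l) (S l) m"
    if "l < n - 1" "b \<in> B l" for l b using dual[OF that(1)] that(2) unfolding dual_system_def by blast+
  have \<delta>: "\<phi> l b (fst b') (snd b') = (if b = b' then 1 else 0)" if "l < n - 1" "b \<in> B l" "b' \<in> B l" for l b b'
    using dual[OF that(1)] that(2,3) unfolding dual_system_def by blast
  have BBm: "\<beta> l \<in> B l" if "\<beta> \<in> BB" "l < n - 1" for \<beta> l using that unfolding BB_def by (simp add: PiE_mem)
  have sbH: "sb \<beta> \<in> ?Hol" if "\<beta> \<in> BB" for \<beta>
    unfolding sb_def by (rule sec_holomorphic[OF m BC(3)[OF _ BBm[OF that]]])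
  have adt: "admt (tup \<beta>)" if "\<beta> \<in> BB" for \<beta>
    unfolding admt_iff
  proof (intro allI impI)
    fix l assume "l < n"
    then have "l < n - 1 \<or> l = n - 1" by auto
    then show "fst (tup \<beta> l) \<in> C l \<and> snd (tup \<beta> l) \<in> fst (fst (tup \<beta> l))"
      using BC[OF _ BBm[OF that]] Tc(1,2)[of 0] by (auto simp: tup_def)
  qed
  have Hsb: "Ht m (sb \<beta>) x = (\<Prod>l<n - 1. \<phi> l (\<beta> l) (fst (x l)) (snd (x l)))" if "admt x" for \<beta> x
    unfolding Ht_def sb_def using H_sec[OF that[unfolded admt_def]] by simp
  have grid: "Ht m (sb \<beta>) x = (if \<beta> = \<gamma> then 1 else 0)"
    if "\<beta> \<in> BB" "\<gamma> \<in> BB" "admt x" "\<And>l. l < n - 1 \<Longrightarrow> x l = \<gamma> l" for \<beta> \<gamma> x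
  proof -
    have "Ht m (sb \<beta>) x = (\<Prod>l<n - 1. if \<beta> l = \<gamma> l then 1 else 0)"
      unfolding Hsb[OF that(3)] using that(4) \<delta> BBm[OF that(1)] BBm[OF that(2)] by (intro prod.cong refl) simp
    also have "\<dots> = (if \<beta> = \<gamma> then 1 else 0)"
    proof (cases "\<beta> = \<gamma>")
      case False
      have "\<exists>l<n - 1. \<beta> l \<noteq> \<gamma> l"
      proof (rule ccontr)
        assume "\<not> ?thesis"
        then have "\<beta> = \<gamma>"
          using PiE_ext[OF that(1,2)[unfolded BB_def]] by simp
        then show False using False by contradiction
      qed
      then show ?thesis using False by (auto intro!: prod_zero)
    qed simp
    finally show ?thesis .
  qed
  have grid': "Ht m (sb \<beta>) (tup \<gamma>) = (if \<beta> = \<gamma> then 1 else 0)" if "\<beta> \<in> BB" "\<gamma> \<in> BB" for \<beta> \<gamma>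
    by (rule grid[OF that adt[OF that(2)]]) (simp add: tup_def)
  have exp: "Ht m s x = (\<Sum>\<beta>\<in>BB. Ht m s (tup \<beta>) * Ht m (sb \<beta>) x)" if s: "s \<in> ?Hol" and x: "admt x" for s x
  proof -
    define D where "D = (\<lambda>x. 1 * Ht m s x + (-1) * (\<Sum>\<beta>\<in>BB. Ht m s (tup \<beta>) * Ht m (sb \<beta>) x))"
    have "D x = 0"
    proof (rule slices_zero[OF dual])
      fix x l assume x: "admt x" and l: "l < n - 1"
      have "(\<lambda>c r. 1 * (if c \<in> C l \<and> r \<in> fst c then Ht m s (x(l := (c, r))) else 0) +
          (-1) * (\<Sum>\<beta>\<in>BB. Ht m s (tup \<beta>) * (if c \<in> C l \<and> r \<in> fst c then Ht m (sb \<beta>) (x(l := (c, r))) else 0)))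
          \<in> holo_diff (C l) (S l) m"
        by (intro holo_diff_lincomb holo_diff_sum Ht_slice s sbH x l)
      moreover have "(\<lambda>c r. 1 * (if c \<in> C l \<and> r \<in> fst c then Ht m s (x(l := (c, r))) else 0) +
          (-1) * (\<Sum>\<beta>\<in>BB. Ht m s (tup \<beta>) * (if c \<in> C l \<and> r \<in> fst c then Ht m (sb \<beta>) (x(l := (c, r))) else 0))) =
          (\<lambda>c r. if c \<in> C l \<and> r \<in> fst c then D (x(l := (c, r))) else 0)"
      proof (intro ext)
        fix c r
        show "1 * (if c \<in> C l \<and> r \<in> fst c then Ht m s (x(l := (c, r))) else 0) +
          (-1) * (\<Sum>\<beta>\<in>BB. Ht m s (tup \<beta>) * (if c \<in> C l \<and> r \<in> fst c then Ht m (sb \<beta>) (x(l := (c, r))) else 0)) =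
          (if c \<in> C l \<and> r \<in> fst c then D (x(l := (c, r))) else 0)"
        proof (cases "c \<in> C l \<and> r \<in> fst c")
          case True
          then show ?thesis by (simp add: D_def)
        next
          case False
          show ?thesis by (simp only: False if_False mult_zero_right sum.neutral_const) simp
        qed
      qed
      ultimately show "(\<lambda>c r. if c \<in> C l \<and> r \<in> fst c then D (x(l := (c, r))) else 0) \<in> holo_diff (C l) (S l) m" by simp
    next
      fix x assume x: "admt x" and xB: "\<And>l. l < n - 1 \<Longrightarrow> x l \<in> B l"
      define \<gamma> where "\<gamma> = restrict x {..<n - 1}"
      have \<gamma>: "\<gamma> \<in> BB" unfolding \<gamma>_def BB_def using xB by simp
      have x\<gamma>: "x l = \<gamma> l" if "l < n - 1" for l using that by (simp add: \<gamma>_def)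
      have "(\<Sum>\<beta>\<in>BB. Ht m s (tup \<beta>) * Ht m (sb \<beta>) x) = Ht m s (tup \<gamma>) * Ht m (sb \<gamma>) x"
        by (rule sum_single[rule_format, OF finBB \<gamma>]) (simp add: grid[OF _ \<gamma> x x\<gamma>])
      also have "\<dots> = Ht m s (tup \<gamma>)" using grid[OF \<gamma> \<gamma> x x\<gamma>] by simp
      \<comment> \<open>\<open>x\<close> and the grid point differ at most in the torus slot, which
        does not affect the value by \<open>H_last_indep\<close>.\<close>
      also have "\<dots> = Ht m s x"
        unfolding Ht_def
        by (rule H_last_indep[OF s adt[OF \<gamma>, unfolded admt_def] x[unfolded admt_def]]) (simp_all add: tup_def x\<gamma>)
      finally show "D x = 0" by (simp add: D_def)
    qed (assumption, rule x)
    then show ?thesis by (simp add: D_def)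
  qed
  have val: "Ht m (\<Sum>\<beta>\<in>BB. scale_pluri (k \<beta>) (sb \<beta>)) x = (\<Sum>\<beta>\<in>BB. k \<beta> * Ht m (sb \<beta>) x)" for k x
    unfolding Ht_def H_def F_def by (simp add: sum_fun_apply scale_pluri_def)
  have inj: "inj_on sb BB"
  proof (rule inj_onI)
    fix \<beta> \<gamma> assume "\<beta> \<in> BB" "\<gamma> \<in> BB" "sb \<beta> = sb \<gamma>"
    then show "\<beta> = \<gamma>" using grid'[of \<beta> \<gamma>] grid'[of \<gamma> \<gamma>] by (auto split: if_splits)
  qed
  have "pl.dim ?Hol = card BB"
  proof (rule pl.dim_unique[of "sb ` BB"])
    show "sb ` BB \<subseteq> ?Hol" using sbH by blast
    show "?Hol \<subseteq> pl.span (sb ` BB)"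
    proof
      fix s assume s: "s \<in> ?Hol"
      have "s c p vss = (\<Sum>\<beta>\<in>BB. Ht m s (tup \<beta>) * sb \<beta> c p vss)" for c p vss
      proof (rule pluri_eqI[OF holomorphic_pluri_section[OF s] _ holomorphic_pluri_section[OF sbH]])
        fix i q assume a: "adm i q"
        have ff: "fst \<circ> (\<lambda>l. (i l, q l)) = i" "snd \<circ> (\<lambda>l. (i l, q l)) = q" by auto
        show "H m s i q = (\<Sum>\<beta>\<in>BB. Ht m s (tup \<beta>) * H m (sb \<beta>) i q)"
          using exp[OF s, of "\<lambda>l. (i l, q l)"] a unfolding admt_def Ht_def[of _ _ "\<lambda>l. (i l, q l)"] ff by simp
      qed
      then have "s = (\<Sum>\<beta>\<in>BB. scale_pluri (Ht m s (tup \<beta>)) (sb \<beta>))"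
        by (simp add: fun_eq_iff sum_fun_apply scale_pluri_def)
      also have "\<dots> \<in> pl.span (sb ` BB)" by (intro pl.span_sum pl.span_scale pl.span_base imageI)
      finally show "s \<in> pl.span (sb ` BB)" .
    qed
    show "pl.independent (sb ` BB)"
    proof (rule pl.independent_if_scalars_zero)
      show "finite (sb ` BB)" using finBB by simp
      fix u s assume z: "(\<Sum>s\<in>sb ` BB. scale_pluri (u s) s) = 0" and "s \<in> sb ` BB"
      then obtain \<gamma> where \<gamma>: "\<gamma> \<in> BB" "s = sb \<gamma>" by blast
      have "(\<Sum>\<beta>\<in>BB. scale_pluri (u (sb \<beta>)) (sb \<beta>)) = 0"
        using z by (simp add: sum.reindex[OF inj])
      then have "Ht m (\<Sum>\<beta>\<in>BB. scale_pluri (u (sb \<beta>)) (sb \<beta>)) (tup \<gamma>) = 0"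
        by (simp add: Ht_def H_def F_def)
      then have "(\<Sum>\<beta>\<in>BB. u (sb \<beta>) * Ht m (sb \<beta>) (tup \<gamma>)) = 0" unfolding val .
      also have "(\<Sum>\<beta>\<in>BB. u (sb \<beta>) * Ht m (sb \<beta>) (tup \<gamma>)) = u (sb \<gamma>) * Ht m (sb \<gamma>) (tup \<gamma>)"
        by (rule sum_single[rule_format, OF finBB \<gamma>(1)]) (simp add: grid'[OF _ \<gamma>(1)])
      finally show "u s = 0" using grid'[OF \<gamma>(1) \<gamma>(1)] \<gamma>(2) by simp
    qed
    show "card (sb ` BB) = card BB" by (rule card_image[OF inj])
  qed
  also have "card BB = (\<Prod>l<n - 1. card (B l))" unfolding BB_def by (simp add: card_PiE)
  finally show ?thesis unfolding plurigenus_def .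
qed

end

section \<open>The flat torus\<close>

text \<open>The ambient space of both the torus and the curves, so that products can be formed.\<close>

type_synonym rpt = "complex \<times> real \<times> complex \<times> complex"

text \<open>The covering of the torus with lattice spanned by \<open>2 * pi\<close> and
  \<open>2 * pi * \<i>\<close>; the zeros fill the slots of the ambient space that only the curves
  use.\<close>

definition Tpt :: "complex \<Rightarrow> rpt" where
  "Tpt w = (cis (Re w), 0, cis (Im w), 0)"

definition Tset :: "rpt set" where
  "Tset = range Tpt"

definition Tdom :: "complex \<Rightarrow> complex set" where
  "Tdom w = {z. \<bar>Re z - Re w\<bar> < pi \<and> \<bar>Im z - Im w\<bar> < pi}"

text \<open>Angles are measured relative to the centre \<open>w\<close>, so that the branch cut of
  \<open>Arg\<close> falls on the boundary of the square \<open>Tdom w\<close>.\<close>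

definition Tcoord :: "complex \<Rightarrow> rpt \<Rightarrow> complex" where
  "Tcoord w = (\<lambda>(u, _, v, _). Complex (Re w + Arg (u / cis (Re w))) (Im w + Arg (v / cis (Im w))))"

definition Tchart :: "complex \<Rightarrow> rpt rchart" where
  "Tchart w = (Tpt ` Tdom w, Tcoord w)"

lemma Arg_cis_diff: "\<bar>a - b\<bar> < pi \<Longrightarrow> b + Arg (cis a / cis b) = a"
proof -
  assume "\<bar>a - b\<bar> < pi"
  then have "Arg (cis (a - b)) = a - b" by (intro Arg_cis) auto
  then show ?thesis by (simp add: cis_divide)
qed

lemma Tcoord_Tpt: "z \<in> Tdom w \<Longrightarrow> Tcoord w (Tpt z) = z"
  by (simp add: Tcoord_def Tpt_def Tdom_def Arg_cis_diff)

lemma open_Tdom: "open (Tdom w)"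
  unfolding Tdom_def by (intro open_Collect_conj open_Collect_less continuous_intros)

lemma continuous_Tpt: "continuous_on X Tpt"
  unfolding Tpt_def by (intro continuous_intros)

lemma Tpt_eqD: "Tpt z = Tpt w \<Longrightarrow> \<exists>k l. z = w + Complex (2 * pi * of_int k) (2 * pi * of_int l)"
proof -
  assume "Tpt z = Tpt w"
  then have "cis (Re z) = cis (Re w)" "cis (Im z) = cis (Im w)" by (simp_all add: Tpt_def)
  then have "cis (Re z - Re w) = 1" "cis (Im z - Im w) = 1" by (simp_all add: cis_divide[symmetric])
  moreover have "\<exists>k. t = of_int k * (2 * pi)" if "cis t = 1" for t
  proof -
    have "cos t = 1" using arg_cong[OF that, of Re] by simp
    then obtain k where "t = of_int k * 2 * pi" using cos_one_2pi_int by blast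
    then show ?thesis by (intro exI[of _ k]) simp
  qed
  ultimately obtain k l where "Re z - Re w = of_int k * (2 * pi)" "Im z - Im w = of_int l * (2 * pi)"
    by metis
  then show ?thesis by (intro exI[of _ k] exI[of _ l]) (simp add: complex_eq_iff algebra_simps)
qed

text \<open>Conditions on the ambient coordinates describe the chart domain, which yields its
  openness and the continuity of the coordinate.\<close>

lemma Tpt_image_Tdom: "Tpt ` Tdom w = {p \<in> Tset. fst p / cis (Re w) \<notin> \<real>\<^sub>\<le>\<^sub>0 \<and> fst (snd (snd p)) / cis (Im w) \<notin> \<real>\<^sub>\<le>\<^sub>0}"
proof -
  have np: "cis t \<notin> \<real>\<^sub>\<le>\<^sub>0" if "\<bar>t\<bar> < pi" for t
  proof
    assume "cis t \<in> \<real>\<^sub>\<le>\<^sub>0"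
    then have s: "cos t \<le> 0" "sin t = 0" by (simp_all add: complex_nonpos_Reals_iff)
    then have "t = 0"
      using that sin_gt_zero[of t] sin_gt_zero[of "- t"] by (cases "t > 0"; cases "t < 0") auto
    then show False using s by simp
  qed
  have ex: "\<exists>s. cis s = cis a \<and> \<bar>s - b\<bar> < pi" if "cis a / cis b \<notin> \<real>\<^sub>\<le>\<^sub>0" for a b
  proof (intro exI conjI)
    let ?t = "Arg (cis (a - b))"
    have ct: "cis ?t = cis (a - b)" using rcis_cmod_Arg[of "cis (a - b)"] by (simp add: rcis_def)
    have "cis (b + ?t) = cis b * cis (a - b)" unfolding cis_mult[symmetric] ct ..
    then show "cis (b + ?t) = cis a" by (simp add: cis_mult)
    have "?t \<noteq> pi"
    proof
      assume "?t = pi"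
      then have "cis (a - b) = - 1" using ct by simp
      then show False using that by (simp add: cis_divide complex_nonpos_Reals_iff)
    qed
    moreover have "- pi < ?t" "?t \<le> pi" using Arg_bounded by auto
    ultimately show "\<bar>b + ?t - b\<bar> < pi" by auto
  qed
  show ?thesis
  proof (intro equalityI subsetI)
    fix p assume "p \<in> Tpt ` Tdom w"
    then obtain z where "z \<in> Tdom w" "p = Tpt z" by blast
    then show "p \<in> {p \<in> Tset. fst p / cis (Re w) \<notin> \<real>\<^sub>\<le>\<^sub>0 \<and> fst (snd (snd p)) / cis (Im w) \<notin> \<real>\<^sub>\<le>\<^sub>0}"
      using np[of "Re z - Re w"] np[of "Im z - Im w"] by (simp add: Tset_def Tpt_def Tdom_def cis_divide)
  next
    fix p assume p: "p \<in> {p \<in> Tset. fst p / cis (Re w) \<notin> \<real>\<^sub>\<le>\<^sub>0 \<and> fst (snd (snd p)) / cis (Im w) \<notin> \<real>\<^sub>\<le>\<^sub>0}"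
    then obtain z where z: "p = Tpt z" unfolding Tset_def by blast
    obtain s t where "cis s = cis (Re z)" "\<bar>s - Re w\<bar> < pi" "cis t = cis (Im z)" "\<bar>t - Im w\<bar> < pi"
      using ex[of "Re z" "Re w"] ex[of "Im z" "Im w"] p unfolding z Tpt_def by auto
    then have "Complex s t \<in> Tdom w" "p = Tpt (Complex s t)" by (simp_all add: Tdom_def Tpt_def z)
    then show "p \<in> Tpt ` Tdom w" by blast
  qed
qed

lemma Tchart_image: "snd (Tchart w) ` fst (Tchart w) = Tdom w"
  using Tcoord_Tpt by (force simp: Tchart_def image_image)

lemma rinv_Tchart: "z \<in> Tdom w \<Longrightarrow> rinv (Tchart w) z = Tpt z"
proof -
  assume z: "z \<in> Tdom w"
  have "inj_on (Tcoord w) (Tpt ` Tdom w)"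
    by (rule inj_on_inverseI[of _ Tpt]) (auto simp: Tcoord_Tpt)
  then have "inv_into (Tpt ` Tdom w) (Tcoord w) (Tcoord w (Tpt z)) = Tpt z"
    using z by (intro inv_into_f_f) auto
  then show ?thesis using z by (simp add: rinv_def Tchart_def Tcoord_Tpt)
qed

text \<open>Two lifts of a point differ by a lattice vector, and by openness the same vector serves
  all points nearby: the transition is locally a translation.\<close>

lemma Tcoord_transition:
  assumes z: "z \<in> Tdom w" "Tpt z \<in> Tpt ` Tdom w'"
  shows "((\<lambda>z. Tcoord w' (rinv (Tchart w) z)) has_field_derivative 1) (at z)"
proof -

  obtain z' where z': "z' \<in> Tdom w'" "Tpt z = Tpt z'" using z(2) by blast
  obtain k l where kl: "z' = z + Complex (2 * pi * of_int k) (2 * pi * of_int l)"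
    using Tpt_eqD[OF z'(2)[symmetric]] by blast
  let ?c = "Complex (2 * pi * of_int k) (2 * pi * of_int l)"
  have op: "open (Tdom w \<inter> (\<lambda>v. v + ?c) -` Tdom w')"
    by (intro open_Int open_Tdom open_vimage continuous_intros)
  have "((\<lambda>v. v + ?c) has_field_derivative 1) (at z)"
    by (auto intro!: derivative_eq_intros)
  then show ?thesis
  proof (rule has_field_derivative_transform_within_open[OF _ op])
    show "z \<in> Tdom w \<inter> (\<lambda>v. v + ?c) -` Tdom w'" using z(1) z'(1) kl by simp
    fix v assume v: "v \<in> Tdom w \<inter> (\<lambda>v. v + ?c) -` Tdom w'"
    have per: "cis (t + 2 * pi * of_int j) = cis t" for t j
      by (simp add: cis_mult[symmetric] cis_multiple_2pi)
    have "Tpt (v + ?c) = Tpt v" by (simp add: Tpt_def per)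
    then have "Tcoord w' (Tpt v) = v + ?c" using Tcoord_Tpt[of "v + ?c" w'] v by simp
    then show "v + ?c = Tcoord w' (rinv (Tchart w) v)" using v by (simp add: rinv_Tchart)
  qed
qed

lemma continuous_Tcoord: "continuous_on (Tpt ` Tdom w) (Tcoord w)"
  unfolding Tcoord_def case_prod_beta Complex_eq Tpt_image_Tdom
  by (intro continuous_intros continuous_on_Arg) auto

lemma torus_atlas: "rs_atlas Tset (range Tchart)"
  unfolding rs_atlas_def
proof (intro conjI ballI)
  fix c assume "c \<in> range Tchart"
  then obtain w where c: "c = Tchart w" by blast
  have "w \<in> Tdom w" by (simp add: Tdom_def)
  then show "fst c \<noteq> {}" unfolding c Tchart_def by auto
  have f: "continuous_on UNIV (\<lambda>p::rpt. fst p / cis (Re w))" "continuous_on UNIV (\<lambda>p::rpt. fst (snd (snd p)) / cis (Im w))"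
    by (intro continuous_intros; simp)+
  have "open ((\<lambda>p::rpt. fst p / cis (Re w)) -` (- \<real>\<^sub>\<le>\<^sub>0) \<inter> (\<lambda>p::rpt. fst (snd (snd p)) / cis (Im w)) -` (- \<real>\<^sub>\<le>\<^sub>0))"
    by (intro open_Int open_vimage f) (simp_all add: open_Compl closed_nonpos_Reals_complex)
  moreover have "fst c = Tset \<inter> ((\<lambda>p::rpt. fst p / cis (Re w)) -` (- \<real>\<^sub>\<le>\<^sub>0) \<inter> (\<lambda>p::rpt. fst (snd (snd p)) / cis (Im w)) -` (- \<real>\<^sub>\<le>\<^sub>0))"
    unfolding c Tchart_def fst_conv Tpt_image_Tdom by auto
  ultimately show "openin (top_of_set Tset) (fst c)" unfolding openin_open by blast
  show "open (snd c ` fst c)" unfolding c Tchart_image by (rule open_Tdom)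
  show "inj_on (snd c) (fst c)" unfolding c Tchart_def
    by (rule inj_on_inverseI[of _ Tpt]) (auto simp: Tcoord_Tpt)
  show "continuous_on (fst c) (snd c)" unfolding c Tchart_def using continuous_Tcoord by simp
  show "continuous_on (snd c ` fst c) (rinv c)" unfolding c Tchart_image
    using continuous_Tpt by (rule continuous_on_eq) (simp add: rinv_Tchart)
next
  have "w \<in> Tdom w" for w by (simp add: Tdom_def)
  then show "(\<Union>c\<in>range Tchart. fst c) = Tset" unfolding Tset_def Tchart_def by auto
next
  fix c c' assume "c \<in> range Tchart" "c' \<in> range Tchart"
  then obtain w w' where c: "c = Tchart w" "c' = Tchart w'" by blast
  have "(\<lambda>z. snd c' (rinv c z)) field_differentiable (at z)" if zin: "z \<in> snd c ` (fst c \<inter> fst c')" for z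
  proof -
    obtain p where "p \<in> fst c" "p \<in> fst c'" "z = snd c p" using zin by blast
    then have p: "p \<in> Tpt ` Tdom w" "p \<in> Tpt ` Tdom w'" "z = Tcoord w p"
      unfolding c Tchart_def by simp_all
    then obtain v where v: "v \<in> Tdom w" "p = Tpt v" by (elim imageE)
    then have "z = v" using p(3) Tcoord_Tpt[of v w] by simp
    then have "z \<in> Tdom w" "Tpt z \<in> Tpt ` Tdom w'" using p(2) v by simp_all
    from Tcoord_transition[OF this] show ?thesis
      unfolding field_differentiable_def c by (auto simp: Tchart_def)
  qed
  then show "(\<lambda>z. snd c' (rinv c z)) holomorphic_on snd c ` (fst c \<inter> fst c')"
    unfolding holomorphic_on_def using field_differentiable_at_within by blast
qed

lemma torus_tder:
  assumes "q \<in> fst (Tchart w)" "q \<in> fst (Tchart w')"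
  shows "tder (Tchart w) (Tchart w') q = 1"
proof -
  obtain z where z: "z \<in> Tdom w" "q = Tpt z" using assms(1) unfolding Tchart_def by auto
  have "Tpt z \<in> Tpt ` Tdom w'" using assms(2) z unfolding Tchart_def by simp
  from DERIV_imp_deriv[OF Tcoord_transition[OF z(1) this]]
  show ?thesis unfolding tder_def z(2) by (simp add: Tchart_def Tcoord_Tpt[OF z(1)])
qed

lemma Tpt_periodic: "Tpt (w + complex_of_real (2 * pi)) = Tpt w" "Tpt (w + \<i> * complex_of_real (2 * pi)) = Tpt w"
proof -
  have "cis (t + 2 * pi) = cis t" for t by (simp add: cis_mult[symmetric] cis_2pi)
  then show "Tpt (w + complex_of_real (2 * pi)) = Tpt w" "Tpt (w + \<i> * complex_of_real (2 * pi)) = Tpt w"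
    by (simp_all add: Tpt_def)
qed

lemma torus_riemann_surface: "riemann_surface Tset (range Tchart)"
  unfolding riemann_surface_def
proof (intro conjI)
  show "rs_atlas Tset (range Tchart)" by (rule torus_atlas)
  show "connected Tset" unfolding Tset_def
    by (intro connected_continuous_image continuous_Tpt connected_UNIV)
  show "Tset \<noteq> {}" unfolding Tset_def by simp
  have "Tset = Tpt ` cbox (Complex (-pi) (-pi)) (Complex pi pi)"
  proof (intro equalityI subsetI)
    fix p assume "p \<in> Tset"
    then obtain z where z: "p = Tpt z" unfolding Tset_def by blast
    have cA: "cis (Arg (cis t)) = cis t" for t using rcis_cmod_Arg[of "cis t"] by (simp add: rcis_def)
    let ?z = "Complex (Arg (cis (Re z))) (Arg (cis (Im z)))"
    have "?z \<in> cbox (Complex (-pi) (-pi)) (Complex pi pi)"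
      using Arg_bounded[of "cis (Re z)"] Arg_bounded[of "cis (Im z)"] by (simp add: in_cbox_complex_iff)
    moreover have "p = Tpt ?z" by (simp add: z Tpt_def cA)
    ultimately show "p \<in> Tpt ` cbox (Complex (-pi) (-pi)) (Complex pi pi)" by blast
  qed (auto simp: Tset_def)
  then show "compact Tset"
    using compact_continuous_image[OF continuous_Tpt compact_cbox] by (rule ssubst)
qed

text \<open>As transitions have derivative 1, the coefficient is a global function; its lift to the
  plane is entire with two periods.\<close>

lemma torus_holo_diff_const:
  assumes f: "f \<in> holo_diff (range Tchart) Tset m" and q: "q \<in> fst (Tchart w)"
  shows "f (Tchart w) q = f (Tchart 0) (Tpt 0)"
proof -
  have sub: "fst (Tchart w) \<inter> Tset = fst (Tchart w)" for w
    using rs_subset[OF torus_atlas] by blast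
  have self: "z \<in> Tdom z" for z by (simp add: Tdom_def)
  have mem: "z \<in> Tdom w \<Longrightarrow> Tpt z \<in> fst (Tchart w)" for z w by (simp add: Tchart_def)
  have tr: "f (Tchart w) q = f (Tchart w') q" if "q \<in> fst (Tchart w)" "q \<in> fst (Tchart w')" for w w' q
    using holo_diffD(3)[OF f, of "Tchart w" "Tchart w'" q] that sub[of w] torus_tder[OF that] by auto
  define E where "E = (\<lambda>w. f (Tchart w) (Tpt w))"
  have per: "E (z + c) = E z" if "Tpt (z + c) = Tpt z" for z c
    unfolding E_def that by (rule tr) (use mem[OF self, of "z + c"] mem[OF self, of z] that in simp_all)
  have "E holomorphic_on UNIV"
    unfolding holomorphic_on_def
  proof
    fix w
    have "(\<lambda>z. f (Tchart w) (rinv (Tchart w) z)) holomorphic_on Tdom w"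
      using holo_diffD(2)[OF f, of "Tchart w"] unfolding sub Tchart_image by simp
    then have "(\<lambda>z. f (Tchart w) (rinv (Tchart w) z)) field_differentiable (at w)"
      using open_Tdom self by (rule holomorphic_on_imp_differentiable_at)
    then obtain D where D: "((\<lambda>z. f (Tchart w) (rinv (Tchart w) z)) has_field_derivative D) (at w)"
      unfolding field_differentiable_def by blast
    have "(E has_field_derivative D) (at w)"
    proof (rule has_field_derivative_transform_within_open[OF D open_Tdom self])
      fix z assume z: "z \<in> Tdom w"
      show "f (Tchart w) (rinv (Tchart w) z) = E z"
        unfolding rinv_Tchart[OF z] E_def by (rule tr[OF mem[OF z] mem[OF self]])
    qed
    then show "E field_differentiable (at w within UNIV)" unfolding field_differentiable_def by auto
  qed
  then have const: "E z = E w" for z w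
  proof (rule doubly_periodic_entire_constant[where f = E and a = "2 * pi" and b = "2 * pi"])
    show "2 * pi > 0" "2 * pi > 0" by simp_all
    show "E (z + complex_of_real (2 * pi)) = E z" for z by (rule per, rule Tpt_periodic)
    show "E (z + \<i> * complex_of_real (2 * pi)) = E z" for z by (rule per, rule Tpt_periodic)
  qed
  obtain z where z: "z \<in> Tdom w" "q = Tpt z" using q unfolding Tchart_def by auto
  have "f (Tchart w) q = E z" unfolding E_def z(2) by (rule tr[OF mem[OF z(1)] mem[OF self]])
  also have "\<dots> = E 0" by (rule const)
  finally show ?thesis by (simp add: E_def)
qed

text \<open>One evaluation determines a differential by \<open>torus_holo_diff_const\<close>, and
  the coefficient 1 gives a nonzero differential, so the dimension is exactly 1.\<close>

lemma torus_dual_system: "\<exists>B \<phi>. dual_system (range Tchart) Tset m B \<phi> \<and> card B = 1"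
proof -
  have "\<exists>B \<phi>. dual_system (range Tchart) Tset m B \<phi> \<and> card B \<le> 1 \<and>
    (\<forall>R. fs.independent R \<and> R \<subseteq> case_prod ` holo_diff (range Tchart) Tset m \<longrightarrow> card R \<le> card B)"
  proof (rule exists_dual_system[where \<Lambda> = "\<lambda>_ f. f (Tchart 0) (Tpt 0)" and N = 1])
    fix f :: "rpt rchart \<Rightarrow> rpt \<Rightarrow> complex"
    assume f: "f \<in> holo_diff (range Tchart) Tset m" and z: "\<And>j::nat. j < 1 \<Longrightarrow> f (Tchart 0) (Tpt 0) = 0"
    show "f = (\<lambda>_ _. 0)"
    proof (intro ext)
      fix c q show "f c q = 0"
      proof (cases "c \<in> range Tchart \<and> q \<in> fst c \<inter> Tset")
        case True
        then obtain w where w: "c = Tchart w" by blast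
        then show ?thesis using torus_holo_diff_const[OF f, of q w] True z[of 0] by simp
      qed (rule holo_diffD(1)[OF f])
    qed
  qed simp
  then obtain B \<phi> where B: "dual_system (range Tchart) Tset m B \<phi>" "card B \<le> 1"
    and R: "\<forall>R. fs.independent R \<and> R \<subseteq> case_prod ` holo_diff (range Tchart) Tset m \<longrightarrow> card R \<le> card B"
    by (elim exE conjE)
  let ?f = "\<lambda>(c::rpt rchart) q. if c \<in> range Tchart \<and> q \<in> fst c \<inter> Tset then 1 else 0 :: complex"
  have f: "?f \<in> holo_diff (range Tchart) Tset m"
    unfolding holo_diff_def
  proof (intro CollectI conjI allI impI ballI)
    fix c assume c: "c \<in> range Tchart"
    show "(\<lambda>z. if c \<in> range Tchart \<and> rinv c z \<in> fst c \<inter> Tset then 1 else 0 :: complex) holomorphic_on snd c ` (fst c \<inter> Tset)"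
    proof (rule holomorphic_transform[OF holomorphic_on_const[of 1]])
      fix z assume "z \<in> snd c ` (fst c \<inter> Tset)"
      then obtain q where q: "q \<in> fst c \<inter> Tset" "z = snd c q" by blast
      then have "rinv c z = q" using rinv_snd[OF torus_atlas c, of q] by blast
      then show "1 = (if c \<in> range Tchart \<and> rinv c z \<in> fst c \<inter> Tset then 1 else 0 :: complex)"
        using q(1) c by presburger
    qed
    fix c' q assume c': "c' \<in> range Tchart" and q: "q \<in> fst c \<inter> fst c' \<inter> Tset"
    have "tder c c' q = 1" using c c' q torus_tder by blast
    then show "?f c q = ?f c' q * tder c c' q ^ m" using c c' q by simp
  qed simp
  have "0 \<in> Tdom 0" by (simp add: Tdom_def)
  then have "Tpt 0 \<in> fst (Tchart 0) \<inter> Tset" by (simp add: Tchart_def Tset_def)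
  then have one: "case_prod ?f (Tchart 0, Tpt 0) = 1" by simp
  define h where "h = case_prod ?f"
  have "h \<noteq> 0"
  proof
    assume "h = 0"
    then have "h (Tchart 0, Tpt 0) = 0" by (simp only: zero_fun_apply)
    moreover have "h (Tchart 0, Tpt 0) = 1" unfolding h_def by (rule one)
    ultimately show False by simp
  qed
  then have "fs.independent {h}" by (simp only: fs.dependent_single not_False_eq_True)
  moreover have "{h} \<subseteq> case_prod ` holo_diff (range Tchart) Tset m" unfolding h_def using imageI[OF f, of case_prod] by (intro subsetI) (simp only: singleton_iff)
  ultimately have "card {h} \<le> card B" using R by blast
  then have "card B = 1" using B(2) by simp
  then show ?thesis using B(1) by blast
qed

section \<open>The curves \<open>y\<^sup>2 = 1 + x\<^sup>2\<^sup>e\<close>\<close>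

text \<open>The first two entries are, up to a factor, the stereographic projection of
  \<open>x\<close> to the sphere. The power \<open>e\<close> in the last two matches the growth of
  \<open>y\<close> and makes inversion conjugate the first entry, negate the second and swap the
  last two (\<open>fl_emb\<close>).\<close>

definition emb :: "nat \<Rightarrow> complex \<Rightarrow> complex \<Rightarrow> rpt" where
  "emb e x y = (x / (1 + x * cnj x), (1 - (cmod x)\<^sup>2) / (1 + (cmod x)\<^sup>2),
     y / (1 + x * cnj x) ^ e, y * cnj x ^ e / (1 + x * cnj x) ^ e)"

text \<open>In terms of \<^const>\<open>emb\<close> the map for \<^term>\<open>True\<close> is \<open>(x, y) \<mapsto> (1 / x, y / x\<^sup>e)\<close>, so that the two embedded copies
  of the affine curve are glued to its smooth compactification.\<close>

definition fl :: "bool \<Rightarrow> rpt \<Rightarrow> rpt" where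
  "fl \<sigma> = (\<lambda>(X, t, Y, Z). if \<sigma> then (cnj X, - t, Z, Y) else (X, t, Y, Z))"

text \<open>On embedded points \<open>1 + t = 2 / (1 + (cmod x)\<^sup>2)\<close>, so the factor
  \<open>2 / (1 + t)\<close> undoes the normalisation in \<open>emb\<close>, here and in
  \<open>eta\<close>. The exception is \<open>t = - 1\<close>, the height of infinity.\<close>

definition xi :: "rpt \<Rightarrow> complex" where
  "xi = (\<lambda>(X, t, Y, Z). X * complex_of_real (2 / (1 + t)))"

definition eta :: "nat \<Rightarrow> rpt \<Rightarrow> complex" where
  "eta e = (\<lambda>(X, t, Y, Z). Y * complex_of_real (2 / (1 + t)) ^ e)"

definition ht :: "rpt \<Rightarrow> real" where
  "ht p = fst (snd p)"

lemma fl_fl [simp]: "fl \<sigma> (fl \<sigma> p) = p"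
  by (simp add: fl_def split: prod.splits)

lemma fl_False [simp]: "fl False p = p"
  by (simp add: fl_def split: prod.splits)

lemma cont_fl: "continuous_on X (fl \<sigma>)"
  unfolding fl_def case_prod_beta by (cases \<sigma>) (simp_all, (intro continuous_intros)+)

lemma one_norm_nz: "1 + x * cnj x \<noteq> 0" "1 + (cmod x)\<^sup>2 \<noteq> 0"
proof -
  show "1 + (cmod x)\<^sup>2 \<noteq> 0" by (smt (verit) zero_le_power2)
  then have "complex_of_real (1 + (cmod x)\<^sup>2) \<noteq> 0" by (simp only: of_real_eq_0_iff not_False_eq_True)
  then show "1 + x * cnj x \<noteq> 0" by (simp add: complex_norm_square[symmetric])
qed

lemma emb_scale: "complex_of_real (2 / (1 + ht (emb e x y))) = 1 + x * cnj x"
proof -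
  have "1 + ht (emb e x y) = 2 / (1 + (cmod x)\<^sup>2)"
    using one_norm_nz(2)[of x] by (simp add: ht_def emb_def field_simps)
  then have "2 / (1 + ht (emb e x y)) = 1 + (cmod x)\<^sup>2" using one_norm_nz(2)[of x] by simp
  then show ?thesis by (simp add: complex_norm_square[symmetric])
qed

lemma xi_ht: "xi p = fst p * complex_of_real (2 / (1 + ht p))"
  by (simp add: xi_def ht_def split: prod.splits)

lemma eta_ht: "eta e p = fst (snd (snd p)) * complex_of_real (2 / (1 + ht p)) ^ e"
  by (simp add: eta_def ht_def split: prod.splits)

lemma xi_emb [simp]: "xi (emb e x y) = x"
  unfolding xi_ht emb_scale using one_norm_nz(1)[of x] by (simp add: emb_def)

lemma eta_emb [simp]: "eta e (emb e x y) = y"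
  unfolding eta_ht emb_scale using one_norm_nz(1)[of x] by (simp add: emb_def)

lemma ht_emb: "ht (emb e x y) > - 1"
proof -
  have "ht (emb e x y) + 1 = 2 / (1 + (cmod x)\<^sup>2)"
    using one_norm_nz(2)[of x] by (simp add: ht_def emb_def field_simps)
  also have "\<dots> > 0" by (intro divide_pos_pos add_pos_nonneg) auto
  finally show ?thesis by simp
qed

lemma ht_fl: "ht (fl True p) = - ht p"
  by (simp add: ht_def fl_def split: prod.splits)

lemma fl_emb: "x \<noteq> 0 \<Longrightarrow> fl True (emb e x y) = emb e (1 / x) (y / x ^ e)"
proof -
  assume x: "x \<noteq> 0"
  let ?c = "cnj x"
  have c: "?c \<noteq> 0" using x by simp
  have n: "1 + x * ?c \<noteq> 0" "x * ?c + 1 \<noteq> 0" using one_norm_nz(1)[of x] by (simp_all add: add.commute)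
  have q: "1 + 1 / x * (1 / ?c) = (1 + x * ?c) / (x * ?c)" using x c by (simp add: field_simps)
  have 1: "1 / x / (1 + 1 / x * (1 / ?c)) = ?c / (1 + x * ?c)" unfolding q using x c n by (simp add: field_simps)
  have 2: "(1 - (cmod (1 / x))\<^sup>2) / (1 + (cmod (1 / x))\<^sup>2) = - ((1 - (cmod x)\<^sup>2) / (1 + (cmod x)\<^sup>2))"
  proof -
    have r: "(1 - 1 / r) / (1 + 1 / r) = - ((1 - r) / (1 + r))" if "r > 0" for r :: real
    proof -
      have "1 - 1 / r = (r - 1) / r" "1 + 1 / r = (1 + r) / r" using that by (simp_all add: field_simps)
      then have "(1 - 1 / r) / (1 + 1 / r) = (r - 1) / (1 + r)" using that by simp
      then show ?thesis by (simp add: minus_divide_left)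
    qed
    have "(cmod (1 / x))\<^sup>2 = 1 / (cmod x)\<^sup>2" by (simp add: norm_divide power_divide)
    then show ?thesis using r[of "(cmod x)\<^sup>2"] x by simp
  qed
  have 3: "y / x ^ e / (1 + 1 / x * (1 / ?c)) ^ e = y * ?c ^ e / (1 + x * ?c) ^ e"
    unfolding q using x c n by (simp add: power_divide power_mult_distrib)
  have 4: "y / x ^ e * (1 / ?c) ^ e / (1 + 1 / x * (1 / ?c)) ^ e = y / (1 + x * ?c) ^ e"
    unfolding q using x c n by (simp add: power_divide power_mult_distrib)
  show ?thesis unfolding emb_def fl_def using 1 2 3 4 by simp
qed

text \<open>The genus is \<open>e - 1\<close>: the value 1 gives the conic and 3 the curve of genus
  2.\<close>

locale curve =
  fixes e :: nat
  assumes e: "e \<ge> 1"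
begin

definition aff :: "(complex \<times> complex) set" where
  "aff = {(x, y). y\<^sup>2 = 1 + x ^ (2 * e)}"

definition Cv :: "rpt set" where
  "Cv = {fl \<sigma> (emb e x y) | \<sigma> x y. (x, y) \<in> aff}"

text \<open>The range of the coordinate of a chart around the affine point \<open>u\<close>: the
  coordinate is \<open>x\<close> if \<open>y\<close> is nonzero at \<open>u\<close>, and
  \<open>y\<close> at a branch point. On this range the principal branches used in \<open>aa\<close>
  and \<open>bb\<close> are holomorphic.\<close>

definition WW :: "complex \<times> complex \<Rightarrow> complex set" where
  "WW u = (if snd u \<noteq> 0 then {z. (1 + z ^ (2 * e)) / (snd u)\<^sup>2 \<notin> \<real>\<^sub>\<le>\<^sub>0} else ball 0 1)"

text \<open>At a branch point \<open>fst u ^ (2 * e) = - 1\<close>, so the equation reads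
  \<open>x ^ (2 * e) = fst u ^ (2 * e) * (1 - y\<^sup>2)\<close> and \<open>x\<close> is
  \<open>fst u\<close> times a principal root. Similarly the quotient by the square of
  \<open>snd u\<close> in \<open>bb\<close> selects the sheet through \<open>u\<close>.\<close>

definition aa :: "complex \<times> complex \<Rightarrow> complex \<Rightarrow> complex" where
  "aa u z = (if snd u \<noteq> 0 then z else fst u * exp (Ln (1 - z\<^sup>2) / of_nat (2 * e)))"

definition bb :: "complex \<times> complex \<Rightarrow> complex \<Rightarrow> complex" where
  "bb u z = (if snd u \<noteq> 0 then snd u * csqrt ((1 + z ^ (2 * e)) / (snd u)\<^sup>2) else z)"

definition co :: "complex \<times> complex \<Rightarrow> complex \<times> complex \<Rightarrow> complex" where
  "co u v = (if snd u \<noteq> 0 then fst v else snd v)"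

text \<open>An open set that cuts exactly the chart piece out of the affine curve
  (\<open>image_WW\<close>): it singles out one root, by positive real part of a quotient or by an
  angle below \<open>pi / (2 * e)\<close>.\<close>

definition NN :: "complex \<times> complex \<Rightarrow> (complex \<times> complex) set" where
  "NN u = (if snd u \<noteq> 0 then {v. Re (snd v / snd u) > 0}
     else {v. cmod (snd v) < 1 \<and> fst v / fst u \<notin> \<real>\<^sub>\<le>\<^sub>0 \<and> \<bar>Im (Ln (fst v / fst u))\<bar> < pi / of_nat (2 * e)})"

definition PP :: "bool \<times> complex \<times> complex \<Rightarrow> complex \<Rightarrow> rpt" where
  "PP i z = fl (fst i) (emb e (aa (snd i) z) (bb (snd i) z))"

definition CH :: "bool \<times> complex \<times> complex \<Rightarrow> rpt rchart" where
  "CH i = (PP i ` WW (snd i), \<lambda>p. co (snd i) (xi (fl (fst i) p), eta e (fl (fst i) p)))"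

definition CC :: "rpt rchart set" where
  "CC = CH ` (UNIV \<times> aff)"

lemma aff_zero: "(x, 0) \<in> aff \<Longrightarrow> x ^ (2 * e) = - 1 \<and> x \<noteq> 0"
proof -
  assume "(x, 0) \<in> aff"
  then have "1 + x ^ (2 * e) = 0" by (simp add: aff_def)
  then have "x ^ (2 * e) = - 1" by (simp add: add_eq_0_iff)
  moreover have "x \<noteq> 0"
  proof
    assume x0: "x = 0"
    have z: "x ^ (2 * e) = 0" unfolding x0 using e by (intro zero_power) simp
    show False using \<open>1 + x ^ (2 * e) = 0\<close> unfolding z by simp
  qed
  ultimately show ?thesis by simp
qed

lemma re_pos: "cmod z < 1 \<Longrightarrow> Re (1 - z\<^sup>2) > 0"
proof -
  assume z: "cmod z < 1"
  then have "(cmod z)\<^sup>2 < 1" by (simp add: abs_square_less_1)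
  then have "cmod (z\<^sup>2) < 1" by (simp add: norm_power)
  then show ?thesis using complex_Re_le_cmod[of "z\<^sup>2"] by simp
qed

lemma re_posD: "Re w > 0 \<Longrightarrow> w \<notin> \<real>\<^sub>\<le>\<^sub>0 \<and> w \<noteq> 0"
  by (auto simp: complex_nonpos_Reals_iff)

lemma open_WW: "open (WW u)"
proof (cases "snd u = 0")
  case False
  have "open ((\<lambda>z. (1 + z ^ (2 * e)) / (snd u)\<^sup>2) -` (- \<real>\<^sub>\<le>\<^sub>0))"
    by (intro open_vimage continuous_intros) (use False in \<open>simp_all add: open_Compl closed_nonpos_Reals_complex\<close>)
  moreover have "WW u = (\<lambda>z. (1 + z ^ (2 * e)) / (snd u)\<^sup>2) -` (- \<real>\<^sub>\<le>\<^sub>0)" using False by (auto simp: WW_def)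
  ultimately show ?thesis by simp
qed (simp add: WW_def)

lemma co_ab: "co u (aa u z, bb u z) = z"
  by (simp add: co_def aa_def bb_def)

lemma base:
  assumes "u \<in> aff"
  shows "co u u \<in> WW u" "aa u (co u u) = fst u" "bb u (co u u) = snd u"
proof -
  have eq: "(snd u)\<^sup>2 = 1 + fst u ^ (2 * e)" using assms by (auto simp: aff_def)
  show "co u u \<in> WW u" "aa u (co u u) = fst u" "bb u (co u u) = snd u"
    unfolding co_def WW_def aa_def bb_def using eq[symmetric] by simp_all
qed

lemma aa_holo: "aa u holomorphic_on WW u"
proof (cases "snd u = 0")
  case True
  have "(\<lambda>z. fst u * exp (Ln (1 - z\<^sup>2) / of_nat (2 * e))) holomorphic_on ball 0 1"
    using re_posD[OF re_pos] e by (intro holomorphic_intros) auto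
  then show ?thesis using True by (simp add: aa_def[abs_def] WW_def)
qed (simp add: aa_def[abs_def])

lemma bb_holo: "bb u holomorphic_on WW u"
proof (cases "snd u = 0")
  case False
  have "(\<lambda>z. snd u * csqrt ((1 + z ^ (2 * e)) / (snd u)\<^sup>2)) holomorphic_on WW u"
    using False by (intro holomorphic_intros) (auto simp: WW_def)
  then show ?thesis using False by (simp add: bb_def[abs_def])
qed (simp add: bb_def[abs_def])

lemma exp_root: "exp (w / of_nat (2 * e)) ^ (2 * e) = exp (w :: complex)"
  unfolding exp_of_nat_mult[symmetric] using e by simp

lemma curve_eq:
  assumes "u \<in> aff" "z \<in> WW u"
  shows "(aa u z, bb u z) \<in> aff"
proof (cases "snd u = 0")
  case False
  then show ?thesis by (simp add: aff_def aa_def bb_def power_mult_distrib)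
next
  case True
  then have "fst u ^ (2 * e) = - 1" using aff_zero[of "fst u"] assms(1) by (metis prod.collapse)
  moreover have "1 - z\<^sup>2 \<noteq> 0" using re_posD[OF re_pos[of z]] assms(2) True by (auto simp: WW_def)
  ultimately show ?thesis using True unfolding aff_def aa_def bb_def
    by (simp add: power_mult_distrib exp_root del: of_nat_mult)
qed

lemma ab_nz:
  assumes "u \<in> aff" "z \<in> WW u"
  shows "snd u \<noteq> 0 \<Longrightarrow> bb u z \<noteq> 0" "snd u = 0 \<Longrightarrow> aa u z \<noteq> 0"
proof -
  show "bb u z \<noteq> 0" if "snd u \<noteq> 0"
  proof -
    have "(1 + z ^ (2 * e)) / (snd u)\<^sup>2 \<noteq> 0" using assms(2) that unfolding WW_def by auto
    then show ?thesis using that unfolding bb_def by simp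
  qed
  show "aa u z \<noteq> 0" if "snd u = 0"
    using aff_zero[of "fst u"] assms(1) that unfolding aa_def by (metis exp_not_eq_zero mult_eq_0_iff prod.collapse)
qed

text \<open>In the unramified case \<open>csqrt\<close> is the root with positive real part. In the
  ramified case the angle bound puts \<open>2 * e\<close> times the logarithm of the quotient into
  the principal strip, so the principal root of its power gives the quotient back.\<close>

lemma image_WW:
  assumes u: "u \<in> aff"
  shows "v \<in> aff \<inter> NN u \<longleftrightarrow> (\<exists>z\<in>WW u. v = (aa u z, bb u z))"
proof (cases "snd u = 0")
  case False
  show ?thesis
  proof
    assume v: "v \<in> aff \<inter> NN u"
    define w where "w = snd v / snd u"
    have w: "Re w > 0" using v False by (simp add: NN_def w_def)
    have w2: "w\<^sup>2 = (1 + fst v ^ (2 * e)) / (snd u)\<^sup>2" using v by (auto simp: w_def power_divide aff_def)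
    have "w\<^sup>2 \<notin> \<real>\<^sub>\<le>\<^sub>0"
    proof
      assume "w\<^sup>2 \<in> \<real>\<^sub>\<le>\<^sub>0"
      then have "Re (w\<^sup>2) \<le> 0" "Im (w\<^sup>2) = 0" by (simp_all add: complex_nonpos_Reals_iff)
      then have s: "Re w * Re w \<le> Im w * Im w" "Re w * Im w = 0" by (auto simp: power2_eq_square)
      then have "Im w * Im w = 0" using w by auto
      then show False using s(1) mult_pos_pos[OF w w] by linarith
    qed
    moreover have "csqrt (w\<^sup>2) = w" by (rule csqrt_square) (use w in simp)
    ultimately have "fst v \<in> WW u" "bb u (fst v) = snd v" "aa u (fst v) = fst v"
      using False by (simp_all add: WW_def bb_def aa_def w2[symmetric] w_def)
    then show "\<exists>z\<in>WW u. v = (aa u z, bb u z)" by (metis prod.collapse)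
  next
    assume "\<exists>z\<in>WW u. v = (aa u z, bb u z)"
    then obtain z where z: "z \<in> WW u" "v = (aa u z, bb u z)" by blast
    let ?w = "(1 + z ^ (2 * e)) / (snd u)\<^sup>2"
    have np: "?w \<notin> \<real>\<^sub>\<le>\<^sub>0" using z(1) False by (simp add: WW_def)
    have "Re (csqrt ?w) \<noteq> 0"
    proof
      assume "Re (csqrt ?w) = 0"
      then have "Re ((csqrt ?w)\<^sup>2) \<le> 0" "Im ((csqrt ?w)\<^sup>2) = 0" by (simp_all add: power2_eq_square)
      then show False using np by (simp add: complex_nonpos_Reals_iff del: csqrt.simps)
    qed
    moreover have "Re (csqrt ?w) \<ge> 0" by (rule Re_csqrt)
    ultimately have "Re (csqrt ?w) > 0" by simp
    then have "v \<in> NN u" using False by (simp add: z(2) NN_def bb_def del: csqrt.simps)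
    then show "v \<in> aff \<inter> NN u" using curve_eq[OF u z(1)] z(2) by simp
  qed
next
  case True
  have u0: "fst u ^ (2 * e) = - 1" "fst u \<noteq> 0" using aff_zero[of "fst u"] u True by (metis prod.collapse)+
  have e0: "of_nat (2 * e) \<noteq> (0::complex)" "real (2 * e) > 0" using e by simp_all
  show ?thesis
  proof
    assume v: "v \<in> aff \<inter> NN u"
    define w where "w = fst v / fst u"
    have w: "w \<notin> \<real>\<^sub>\<le>\<^sub>0" "\<bar>Im (Ln w)\<bar> < pi / of_nat (2 * e)" and y: "cmod (snd v) < 1"
      using v True by (simp_all add: NN_def w_def)
    have w0: "w \<noteq> 0" using w(1) by auto
    have I: "Im (of_nat (2 * e) * Ln w) = real (2 * e) * Im (Ln w)" by simp
    have "\<bar>real (2 * e) * Im (Ln w)\<bar> < pi"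
      using w(2) e0(2) by (simp add: abs_mult field_simps)
    then have "- pi < Im (of_nat (2 * e) * Ln w)" "Im (of_nat (2 * e) * Ln w) \<le> pi"
      unfolding I by linarith+
    then have "Ln (exp (of_nat (2 * e) * Ln w)) = of_nat (2 * e) * Ln w" by (rule Ln_exp)
    moreover have "exp (of_nat (2 * e) * Ln w) = w ^ (2 * e)" unfolding exp_of_nat_mult using w0 by simp
    moreover have "w ^ (2 * e) = 1 - (snd v)\<^sup>2"
      using v u0 by (auto simp: w_def power_divide aff_def)
    ultimately have "Ln (1 - (snd v)\<^sup>2) / of_nat (2 * e) = Ln w" using e0 by simp
    then have "aa u (snd v) = fst v" "bb u (snd v) = snd v" "snd v \<in> WW u"
      using True w0 y u0 by (simp_all add: aa_def bb_def WW_def w_def)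
    then show "\<exists>z\<in>WW u. v = (aa u z, bb u z)" by (metis prod.collapse)
  next
    assume "\<exists>z\<in>WW u. v = (aa u z, bb u z)"
    then obtain z where z: "z \<in> WW u" "v = (aa u z, bb u z)" by blast
    let ?L = "Ln (1 - z\<^sup>2)" and ?w = "exp (Ln (1 - z\<^sup>2) / of_nat (2 * e))"
    have z1: "cmod z < 1" using z(1) True by (simp add: WW_def)
    have "\<bar>Im ?L\<bar> < pi / 2" using Re_Ln_pos_lt re_pos[OF z1] re_posD[OF re_pos[OF z1]] by blast
    then have L: "\<bar>Im ?L\<bar> < pi" by simp
    have I: "Im (?L / of_nat (2 * e)) = Im ?L / real (2 * e)"
      using Im_divide_of_real[of ?L "real (2 * e)"] by simp
    have lt: "\<bar>Im ?L / real (2 * e)\<bar> < pi / real (2 * e)" using L e0(2) by (simp add: divide_strict_right_mono)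
    have "pi / real (2 * e) \<le> pi / 2" using e by (intro divide_left_mono) auto
    then have lt': "\<bar>Im ?L / real (2 * e)\<bar> < pi" using lt pi_gt_zero by linarith
    then have "- pi < Im (?L / of_nat (2 * e))" "Im (?L / of_nat (2 * e)) \<le> pi" unfolding I by linarith+
    then have Ln: "Ln ?w = ?L / of_nat (2 * e)" by (rule Ln_exp)
    have "?w \<notin> \<real>\<^sub>\<le>\<^sub>0"
    proof
      assume "?w \<in> \<real>\<^sub>\<le>\<^sub>0"
      then have "Im (Ln ?w) = pi"
        by (metis Arg_eq_Im_Ln Arg_eq_pi complex_nonpos_Reals_iff exp_not_eq_zero less_eq_real_def complex_eq_iff zero_complex.sel)
      then show False using lt' unfolding Ln I by simp
    qed
    then have "v \<in> NN u" using True z1 lt u0(2) unfolding z(2) NN_def aa_def bb_def by (simp add: Ln I del: of_nat_mult)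
    then show "v \<in> aff \<inter> NN u" using curve_eq[OF u z(1)] z(2) by simp
  qed
qed

lemma open_NN: "u \<in> aff \<Longrightarrow> open (NN u)"
proof (cases "snd u = 0")
  case False
  then have eq: "NN u = {v. Re (snd v / snd u) > 0}" by (simp add: NN_def)
  show ?thesis unfolding eq by (intro open_Collect_less continuous_intros) (use False in simp)
next
  case True
  assume "u \<in> aff"
  then have u0: "fst u \<noteq> 0" using aff_zero[of "fst u"] True by (metis prod.collapse)
  have sl: "open (- \<real>\<^sub>\<le>\<^sub>0 :: complex set)" by (simp add: open_Compl closed_nonpos_Reals_complex)
  have "open (- \<real>\<^sub>\<le>\<^sub>0 \<inter> (\<lambda>w. \<bar>Im (Ln w)\<bar>) -` {..<pi / real (2 * e)})"
    by (intro continuous_open_preimage sl continuous_intros) auto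
  then have "open ((\<lambda>v. fst v / fst u) -` (- \<real>\<^sub>\<le>\<^sub>0 \<inter> (\<lambda>w. \<bar>Im (Ln w)\<bar>) -` {..<pi / real (2 * e)}))"
    by (rule open_vimage) (intro continuous_intros, use u0 in simp)
  moreover have "open {v::complex \<times> complex. cmod (snd v) < 1}"
    by (intro open_Collect_less continuous_intros)
  ultimately have "open ({v. cmod (snd v) < 1} \<inter> (\<lambda>v. fst v / fst u) -` (- \<real>\<^sub>\<le>\<^sub>0 \<inter> (\<lambda>w. \<bar>Im (Ln w)\<bar>) -` {..<pi / real (2 * e)}))"
    by (intro open_Int)
  moreover have "NN u = {v. cmod (snd v) < 1} \<inter> (\<lambda>v. fst v / fst u) -` (- \<real>\<^sub>\<le>\<^sub>0 \<inter> (\<lambda>w. \<bar>Im (Ln w)\<bar>) -` {..<pi / real (2 * e)})"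
    using True by (auto simp: NN_def)
  ultimately show ?thesis by simp
qed

lemma aff_inv: "(x, y) \<in> aff \<Longrightarrow> x \<noteq> 0 \<Longrightarrow> (1 / x, y / x ^ e) \<in> aff"
  by (simp add: aff_def power_divide power_mult[symmetric] mult.commute field_simps)

lemma Cv_emb: "(x, y) \<in> aff \<Longrightarrow> fl \<sigma> (emb e x y) \<in> Cv"
  unfolding Cv_def by blast

lemma Cv_fl: "p \<in> Cv \<Longrightarrow> fl \<sigma> p \<in> Cv"
proof -
  assume "p \<in> Cv"
  then obtain \<tau> x y where p: "p = fl \<tau> (emb e x y)" "(x, y) \<in> aff" unfolding Cv_def by blast
  show ?thesis using Cv_emb[OF p(2), of True] Cv_emb[OF p(2), of False] unfolding p(1) by (cases \<sigma>; cases \<tau>) simp_all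
qed

lemma Cv_D: "p \<in> Cv \<Longrightarrow> ht p > - 1 \<Longrightarrow> \<exists>x y. (x, y) \<in> aff \<and> p = emb e x y"
proof -
  assume p: "p \<in> Cv" and t: "ht p > - 1"
  then obtain \<tau> x y where q: "p = fl \<tau> (emb e x y)" "(x, y) \<in> aff" unfolding Cv_def by blast
  show ?thesis
  proof (cases \<tau>)
    case False
    then show ?thesis using q by auto
  next
    case True
    have "x \<noteq> 0"
    proof
      assume "x = 0"
      then show False using t q(1) True by (simp add: ht_fl) (simp add: ht_def emb_def)
    qed
    then show ?thesis using aff_inv[OF q(2)] fl_emb[of x e y] q(1) True by auto
  qed
qed

lemma cont_emb: "continuous_on X (\<lambda>v. emb e (fst v) (snd v))"
  unfolding emb_def by (intro continuous_intros) (use one_norm_nz in auto)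

lemma cont_xi_eta: "continuous_on {p. ht p > - 1} (\<lambda>p. (xi p, eta e p))"
  unfolding xi_def eta_def case_prod_beta ht_def by (intro continuous_intros) auto

text \<open>The right side is relatively open by continuity, which the definition of the domain as
  an image does not show.\<close>

lemma fst_CH:
  assumes u: "u \<in> aff"
  shows "fst (CH (\<sigma>, u)) = Cv \<inter> fl \<sigma> -` ({p. ht p > - 1} \<inter> (\<lambda>p. (xi p, eta e p)) -` NN u)"
proof (intro equalityI subsetI)
  fix q assume "q \<in> fst (CH (\<sigma>, u))"
  then obtain z where z: "z \<in> WW u" "q = fl \<sigma> (emb e (aa u z) (bb u z))" unfolding CH_def PP_def by auto
  then show "q \<in> Cv \<inter> fl \<sigma> -` ({p. ht p > - 1} \<inter> (\<lambda>p. (xi p, eta e p)) -` NN u)"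
    using image_WW[OF u, of "(aa u z, bb u z)"] curve_eq[OF u z(1)] by (auto simp: Cv_emb ht_emb)
next
  fix q assume q: "q \<in> Cv \<inter> fl \<sigma> -` ({p. ht p > - 1} \<inter> (\<lambda>p. (xi p, eta e p)) -` NN u)"
  then obtain x y where xy: "(x, y) \<in> aff" "fl \<sigma> q = emb e x y" using Cv_D[OF Cv_fl[of q \<sigma>]] by auto
  then have "(x, y) \<in> NN u" using q by simp
  then obtain z where z: "z \<in> WW u" "(x, y) = (aa u z, bb u z)" using image_WW[OF u, of "(x, y)"] xy(1) by blast
  have "q = fl \<sigma> (emb e x y)" using xy(2) by (metis fl_fl)
  then have "q = PP (\<sigma>, u) z" using z(2) by (simp add: PP_def)
  then show "q \<in> fst (CH (\<sigma>, u))" using z(1) by (simp add: CH_def)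
qed

lemma snd_CH_PP: "snd (CH i) (PP i z) = z"
  by (simp add: CH_def PP_def co_ab)

lemma CH_image: "snd (CH i) ` fst (CH i) = WW (snd i)"
proof -
  have "fst (CH i) = PP i ` WW (snd i)" by (simp add: CH_def)
  then show ?thesis by (simp add: image_image snd_CH_PP)
qed

lemma rinv_CH: "z \<in> WW (snd i) \<Longrightarrow> rinv (CH i) z = PP i z"
proof -
  assume z: "z \<in> WW (snd i)"
  have f: "fst (CH i) = PP i ` WW (snd i)" by (simp add: CH_def)
  have "inj_on (snd (CH i)) (fst (CH i))" unfolding f by (rule inj_on_inverseI[of _ "PP i"]) (auto simp: snd_CH_PP)
  then have "inv_into (fst (CH i)) (snd (CH i)) (snd (CH i) (PP i z)) = PP i z"
    using z by (intro inv_into_f_f) (auto simp: f)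
  then show ?thesis by (simp add: rinv_def snd_CH_PP)
qed

lemma PP_in: "u \<in> aff \<Longrightarrow> fl \<sigma> (emb e (fst u) (snd u)) \<in> fst (CH (\<sigma>, u))"
  using base[of u] by (auto simp: CH_def PP_def intro!: image_eqI[of _ _ "co u u"])

lemma overlap_same:
  assumes u: "u \<in> aff" and v: "(x, y) \<in> aff" and p: "fl \<sigma> (emb e x y) \<in> fst (CH (\<sigma>, u))"
  shows "\<exists>z\<in>WW u. x = aa u z \<and> y = bb u z \<and> snd (CH (\<sigma>, u)) (fl \<sigma> (emb e x y)) = z"
proof -
  have "(x, y) \<in> NN u" using p unfolding fst_CH[OF u] by simp
  then obtain z where z: "z \<in> WW u" "(x, y) = (aa u z, bb u z)" using image_WW[OF u, of "(x, y)"] v by blast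
  then show ?thesis by (intro bexI[of _ z]) (auto simp: CH_def co_ab)
qed

text \<open>The flipped height of a point with \<open>x = 0\<close> is -1, the value excluded from
  every chart of the other copy.\<close>

lemma overlap_diff:
  assumes u: "u \<in> aff" and p: "fl \<sigma> (emb e x y) \<in> fst (CH (\<not> \<sigma>, u))"
  shows "x \<noteq> 0" "fl \<sigma> (emb e x y) = fl (\<not> \<sigma>) (emb e (1 / x) (y / x ^ e))"
proof -
  have "ht (fl (\<not> \<sigma>) (fl \<sigma> (emb e x y))) > - 1" using p unfolding fst_CH[OF u] by simp
  then have t: "ht (fl True (emb e x y)) > - 1" by (cases \<sigma>) simp_all
  show x: "x \<noteq> 0"
  proof
    assume "x = 0"
    then show False using t by (simp add: ht_fl) (simp add: ht_def emb_def)
  qed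
  show "fl \<sigma> (emb e x y) = fl (\<not> \<sigma>) (emb e (1 / x) (y / x ^ e))"
    unfolding fl_emb[OF x, symmetric] by (cases \<sigma>) simp_all
qed

lemma curve_atlas: "rs_atlas Cv CC"
  unfolding rs_atlas_def
proof (intro conjI ballI)
  fix c assume "c \<in> CC"
  then obtain \<sigma> u where c: "c = CH (\<sigma>, u)" "u \<in> aff" unfolding CC_def by auto
  show "fst c \<noteq> {}" using PP_in[OF c(2)] unfolding c(1) by blast
  have "open ({p. ht p > - 1} \<inter> (\<lambda>p. (xi p, eta e p)) -` NN u)"
    by (intro continuous_open_preimage cont_xi_eta open_NN c(2))
      (unfold ht_def, intro open_Collect_less continuous_intros)
  then have "open (fl \<sigma> -` ({p. ht p > - 1} \<inter> (\<lambda>p. (xi p, eta e p)) -` NN u))"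
    by (rule open_vimage) (rule cont_fl)
  then show "openin (top_of_set Cv) (fst c)" unfolding c(1) fst_CH[OF c(2)] openin_open by blast
  show "open (snd c ` fst c)" unfolding c(1) CH_image by (simp add: open_WW)
  have f: "fst c = PP (\<sigma>, u) ` WW u" by (simp add: c(1) CH_def)
  show "inj_on (snd c) (fst c)" unfolding f
    by (rule inj_on_inverseI[of _ "PP (\<sigma>, u)"]) (auto simp: c(1) snd_CH_PP)
  have "continuous_on (fl \<sigma> -` {p. ht p > - 1}) (\<lambda>p. (xi (fl \<sigma> p), eta e (fl \<sigma> p)))"
    by (rule continuous_on_compose2[OF cont_xi_eta cont_fl]) auto
  then have "continuous_on (fst c) (\<lambda>p. (xi (fl \<sigma> p), eta e (fl \<sigma> p)))"
    by (rule continuous_on_subset) (auto simp: c(1) fst_CH[OF c(2)])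
  then show "continuous_on (fst c) (snd c)" unfolding c(1) CH_def co_def
    by (cases "snd u = 0") (auto dest: continuous_on_fst continuous_on_snd)
  have "continuous_on (WW u) (\<lambda>z. (aa u z, bb u z))"
    using aa_holo bb_holo by (intro continuous_on_Pair holomorphic_on_imp_continuous_on)
  from continuous_on_compose2[OF cont_emb[of UNIV] this]
  have "continuous_on (WW u) (PP (\<sigma>, u))" unfolding PP_def
    by (intro continuous_on_compose2[OF cont_fl[of UNIV]]) auto
  then show "continuous_on (snd c ` fst c) (rinv c)" unfolding c(1) CH_image snd_conv
    by (rule continuous_on_eq) (auto simp: rinv_CH)
next
  show "(\<Union>c\<in>CC. fst c) = Cv"
  proof (intro equalityI subsetI)
    fix p assume "p \<in> (\<Union>c\<in>CC. fst c)"
    then obtain \<sigma> u where "u \<in> aff" "p \<in> fst (CH (\<sigma>, u))" unfolding CC_def by auto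
    then show "p \<in> Cv" using fst_CH by blast
  next
    fix p assume "p \<in> Cv"
    then obtain \<sigma> x y where p: "p = fl \<sigma> (emb e x y)" "(x, y) \<in> aff" unfolding Cv_def by blast
    have "p \<in> fst (CH (\<sigma>, (x, y)))" using PP_in[OF p(2)] p(1) by simp
    then show "p \<in> (\<Union>c\<in>CC. fst c)" using p(2) unfolding CC_def by blast
  qed
next
  fix c c' assume "c \<in> CC" "c' \<in> CC"
  then obtain \<sigma> u \<sigma>' u' where c: "c = CH (\<sigma>, u)" "u \<in> aff" "c' = CH (\<sigma>', u')" "u' \<in> aff" unfolding CC_def by auto
  let ?D = "snd c ` (fst c \<inter> fst c')"
  have D: "z \<in> WW u \<and> PP (\<sigma>, u) z \<in> fst c'" if "z \<in> ?D" for z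
  proof -
    obtain p where p: "p \<in> fst c" "p \<in> fst c'" "z = snd c p" using \<open>z \<in> ?D\<close> by blast
    obtain w where w: "w \<in> WW u" "p = PP (\<sigma>, u) w" using p(1) unfolding c(1) CH_def by auto
    then show ?thesis using p(2,3) by (simp add: c(1) snd_CH_PP)
  qed
  then have sub: "?D \<subseteq> WW u" by blast
  have ho: "aa u holomorphic_on ?D" "bb u holomorphic_on ?D"
    using aa_holo bb_holo sub by (blast intro: holomorphic_on_subset)+
  have "(\<lambda>z. snd c' (PP (\<sigma>, u) z)) holomorphic_on ?D"
  proof (cases "\<sigma>' = \<sigma>")
    case True
    have "(\<lambda>z. co u' (aa u z, bb u z)) holomorphic_on ?D" unfolding co_def using ho by (cases "snd u' = 0") simp_all
    then show ?thesis by (rule holomorphic_transform) (simp add: c(3) True CH_def PP_def)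
  next
    case False
    then have s: "\<sigma>' = (\<not> \<sigma>)" by blast
    have x: "aa u z \<noteq> 0" "PP (\<sigma>, u) z = fl \<sigma>' (emb e (1 / aa u z) (bb u z / aa u z ^ e))" if "z \<in> ?D" for z
      using overlap_diff[OF c(4), of \<sigma> "aa u z" "bb u z"] D[OF that] unfolding c(3) s PP_def by auto
    have "(\<lambda>z. co u' (1 / aa u z, bb u z / aa u z ^ e)) holomorphic_on ?D"
      unfolding co_def using ho x(1) by (cases "snd u' = 0") (auto intro!: holomorphic_intros)
    then show ?thesis by (rule holomorphic_transform) (simp add: x(2), simp add: c(3) CH_def)
  qed
  then show "(\<lambda>z. snd c' (rinv c z)) holomorphic_on ?D"
    by (rule holomorphic_transform) (use sub in \<open>auto simp: c(1) rinv_CH\<close>)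
qed

end

section \<open>The form dx / y and the coefficients of differentials\<close>

context curve
begin

text \<open>The function relating the coordinate of a chart to the form \<open>dx / y = dy / (e x\<^sup>2\<^sup>e\<^sup>-\<^sup>1)\<close>.\<close>

definition om :: "complex \<times> complex \<Rightarrow> complex \<times> complex \<Rightarrow> complex" where
  "om u v = (if snd u \<noteq> 0 then 1 / snd v else 1 / (of_nat e * fst v ^ (2 * e - 1)))"

lemma om_nz:
  assumes "u \<in> aff" "z \<in> WW u"
  shows "om u (aa u z, bb u z) \<noteq> 0"
  using ab_nz[OF assms] e unfolding om_def by (cases "snd u = 0") simp_all

text \<open>Differentiating the equation gives \<open>y dy = e x ^ (2 * e - 1) dx\<close>. In either
  kind of chart one of the two differentials is that of the coordinate, which yields the
  other.\<close>

lemma ab_deriv: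
  assumes u: "u \<in> aff" and z: "z \<in> WW u"
  shows "(aa u has_field_derivative om u (aa u z, bb u z) * bb u z) (at z)"
    "(bb u has_field_derivative om u (aa u z, bb u z) * (of_nat e * aa u z ^ (2 * e - 1))) (at z)"
proof -
  let ?a = "aa u z" and ?b = "bb u z"
  obtain A where A: "(aa u has_field_derivative A) (at z)"
    using holomorphic_on_imp_differentiable_at[OF aa_holo open_WW z] unfolding field_differentiable_def by blast
  obtain B where B: "(bb u has_field_derivative B) (at z)"
    using holomorphic_on_imp_differentiable_at[OF bb_holo open_WW z] unfolding field_differentiable_def by blast
  have "((\<lambda>z. (bb u z)\<^sup>2) has_field_derivative 2 * ?b * B) (at z)"
    using B by (auto intro!: derivative_eq_intros)
  moreover have "((\<lambda>z. 1 + aa u z ^ (2 * e)) has_field_derivative of_nat (2 * e) * ?a ^ (2 * e - 1) * A) (at z)"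
    using A by (auto intro!: derivative_eq_intros)
  then have "((\<lambda>z. (bb u z)\<^sup>2) has_field_derivative of_nat (2 * e) * ?a ^ (2 * e - 1) * A) (at z)"
    by (rule has_field_derivative_transform_within_open[OF _ open_WW z]) (use curve_eq[OF u] in \<open>auto simp: aff_def\<close>)
  ultimately have "2 * ?b * B = of_nat (2 * e) * ?a ^ (2 * e - 1) * A" by (rule DERIV_unique)
  then have rel: "?b * B = of_nat e * ?a ^ (2 * e - 1) * A" by simp
  have "A = om u (?a, ?b) * ?b \<and> B = om u (?a, ?b) * (of_nat e * ?a ^ (2 * e - 1))"
  proof (cases "snd u = 0")
    case False
    then have "aa u = (\<lambda>z. z)" by (simp add: aa_def[abs_def])
    then have "A = 1" using A DERIV_unique[OF _ DERIV_ident] by metis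
    have g: "B' = 1 / b * k" if "b * B' = k * A'" "A' = 1" "b \<noteq> 0" for b k A' B' :: complex
      using that by (simp add: eq_divide_eq mult.commute)
    show ?thesis using g[OF rel \<open>A = 1\<close> ab_nz(1)[OF u z False]] \<open>A = 1\<close> ab_nz(1)[OF u z False] False unfolding om_def by simp
  next
    case True
    then have "bb u = (\<lambda>z. z)" by (simp add: bb_def[abs_def])
    then have "B = 1" using B DERIV_unique[OF _ DERIV_ident] by metis
    have g: "A' = 1 / k * b" if "b * B' = k * A'" "B' = 1" "k \<noteq> 0" for b k A' B' :: complex
      using that by (simp add: eq_divide_eq mult.commute)
    have k: "of_nat e * aa u z ^ (2 * e - 1) \<noteq> 0" using ab_nz(2)[OF u z True] e by simp
    show ?thesis using g[OF rel \<open>B = 1\<close> k] \<open>B = 1\<close> ab_nz(2)[OF u z True] e True unfolding om_def by simp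
  qed
  then show "(aa u has_field_derivative om u (aa u z, bb u z) * bb u z) (at z)"
    "(bb u has_field_derivative om u (aa u z, bb u z) * (of_nat e * aa u z ^ (2 * e - 1))) (at z)"
    using A B by auto
qed

text \<open>Both sides are the coefficient of \<open>dx / y\<close> in the chart around
  \<open>u\<close>; on the left it is obtained by conversion from the chart around
  \<open>u'\<close>.\<close>

lemma tder_same:
  assumes u: "u \<in> aff" and u': "u' \<in> aff" and v: "(x, y) \<in> aff"
    and p: "fl \<sigma> (emb e x y) \<in> fst (CH (\<sigma>, u))" "fl \<sigma> (emb e x y) \<in> fst (CH (\<sigma>, u'))"
  shows "om u' (x, y) * tder (CH (\<sigma>, u)) (CH (\<sigma>, u')) (fl \<sigma> (emb e x y)) = om u (x, y)"
proof -
  obtain z where z: "z \<in> WW u" "x = aa u z" "y = bb u z" "snd (CH (\<sigma>, u)) (fl \<sigma> (emb e x y)) = z"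
    using overlap_same[OF u v p(1)] by blast
  obtain z' where z': "z' \<in> WW u'" "x = aa u' z'" "y = bb u' z'"
    using overlap_same[OF u' v p(2)] by blast
  let ?D = "om u (x, y) * (if snd u' \<noteq> 0 then y else of_nat e * x ^ (2 * e - 1))"
  have "((\<lambda>w. co u' (aa u w, bb u w)) has_field_derivative ?D) (at z)"
    unfolding co_def using ab_deriv[OF u z(1)] unfolding z(2,3)[symmetric] by (cases "snd u' = 0") simp_all
  then have "((\<lambda>w. snd (CH (\<sigma>, u')) (rinv (CH (\<sigma>, u)) w)) has_field_derivative ?D) (at z)"
    by (rule has_field_derivative_transform_within_open[OF _ open_WW z(1)]) (simp add: rinv_CH, simp add: CH_def PP_def)
  then have "tder (CH (\<sigma>, u)) (CH (\<sigma>, u')) (fl \<sigma> (emb e x y)) = ?D"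
    unfolding tder_def z(4) by (rule DERIV_imp_deriv)
  then show ?thesis using ab_nz[OF u' z'(1)] e unfolding z'(2,3)[symmetric] om_def by (cases "snd u' = 0") simp_all
qed

text \<open>Under \<open>x \<mapsto> 1 / x\<close>, \<open>y \<mapsto> y / x ^ e\<close> the form
  \<open>dx / y\<close> is multiplied by \<open>- x ^ (e - 2)\<close>, written as a quotient because
  \<open>e\<close> may be 1.\<close>

lemma tder_diff:
  assumes u: "u \<in> aff" and u': "u' \<in> aff" and v: "(x, y) \<in> aff"
    and p: "fl \<sigma> (emb e x y) \<in> fst (CH (\<sigma>, u))" "fl \<sigma> (emb e x y) \<in> fst (CH (\<not> \<sigma>, u'))"
  shows "om u' (1 / x, y / x ^ e) * tder (CH (\<sigma>, u)) (CH (\<not> \<sigma>, u')) (fl \<sigma> (emb e x y)) =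
    om u (x, y) * (- (x ^ e / x\<^sup>2))"
proof -
  let ?i = "CH (\<sigma>, u)" and ?j = "CH (\<not> \<sigma>, u')" and ?q = "fl \<sigma> (emb e x y)"
  obtain z where z: "z \<in> WW u" "x = aa u z" "y = bb u z" "snd ?i ?q = z"
    using overlap_same[OF u v p(1)] by blast
  note x = overlap_diff[OF u' p(2)]
  obtain z' where z': "z' \<in> WW u'" "1 / x = aa u' z'" "y / x ^ e = bb u' z'"
    using overlap_same[OF u' aff_inv[OF v x(1)] p(2)[unfolded x(2)]] by blast
  let ?o = "om u (x, y)"
  let ?D = "if snd u' \<noteq> 0 then - (?o * y / x\<^sup>2) else - (?o * of_nat e * x ^ (e - 1) / x ^ (2 * e))"
  have a: "(aa u has_field_derivative ?o * y) (at z)"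
    and b: "(bb u has_field_derivative ?o * (of_nat e * x ^ (2 * e - 1))) (at z)"
    using ab_deriv[OF u z(1)] unfolding z(2,3)[symmetric] .
  have xz: "aa u z \<noteq> 0" using x(1) z(2) by simp
  have p1: "x ^ e = x * x ^ (e - 1)" "x ^ (2 * e) = x * x ^ (2 * e - 1)"
    using e by (simp_all add: power_eq_if)
  have p2: "x ^ (2 * e - 1) = x ^ e * x ^ (e - 1)"
    using e by (simp add: power_add[symmetric] mult_2)
  have "((\<lambda>w. co u' (1 / aa u w, bb u w / aa u w ^ e)) has_field_derivative ?D) (at z)"
  proof (cases "snd u' = 0")
    case False
    have "((\<lambda>w. 1 / aa u w) has_field_derivative - (?o * y / x\<^sup>2)) (at z)"
      using a xz z(2) by (auto intro!: derivative_eq_intros simp: power2_eq_square)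
    then show ?thesis using False by (simp add: co_def)
  next
    case True
    have "((\<lambda>w. aa u w ^ e) has_field_derivative of_nat e * x ^ (e - 1) * (?o * y)) (at z)"
      using a z(2) by (auto intro!: derivative_eq_intros)
    from DERIV_divide[OF b this] xz
    have "((\<lambda>w. bb u w / aa u w ^ e) has_field_derivative
      (?o * (of_nat e * x ^ (2 * e - 1)) * x ^ e - y * (of_nat e * x ^ (e - 1) * (?o * y))) / (x ^ e * x ^ e)) (at z)"
      unfolding z(2,3)[symmetric] by simp
    also have "?o * (of_nat e * x ^ (2 * e - 1)) * x ^ e - y * (of_nat e * x ^ (e - 1) * (?o * y)) =
        ?o * of_nat e * x ^ (e - 1) * (x ^ e * x ^ e - y\<^sup>2)"
      unfolding p2 by (simp add: algebra_simps power2_eq_square)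
    also have "x ^ e * x ^ e - y\<^sup>2 = - 1"
      using v by (simp add: aff_def power_add[symmetric] mult_2)
    also have "x ^ e * x ^ e = x ^ (2 * e)" by (simp add: power_add[symmetric] mult_2)
    finally show ?thesis using True by (simp add: co_def)
  qed
  then have "((\<lambda>w. snd ?j (rinv ?i w)) has_field_derivative ?D) (at z)"
  proof (rule has_field_derivative_transform_within_open)
    show "open (snd ?i ` (fst ?i \<inter> fst ?j))"
      by (rule rs_open_overlap[OF curve_atlas]) (use u u' in \<open>auto simp: CC_def\<close>)
    show "z \<in> snd ?i ` (fst ?i \<inter> fst ?j)" using p z(4) by force
    fix w assume "w \<in> snd ?i ` (fst ?i \<inter> fst ?j)"
    then obtain q where q: "q \<in> fst ?i" "q \<in> fst ?j" "w = snd ?i q" by blast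
    obtain w' where w': "w' \<in> WW u" "q = PP (\<sigma>, u) w'" using q(1) unfolding CH_def by auto
    then have w: "w \<in> WW u" "q = PP (\<sigma>, u) w" using q(3) by (simp_all add: snd_CH_PP)
    have "fl \<sigma> (emb e (aa u w) (bb u w)) \<in> fst (CH (\<not> \<sigma>, u'))" using q(2) w(2) by (simp add: PP_def)
    from overlap_diff(2)[OF u' this] have "PP (\<sigma>, u) w = fl (\<not> \<sigma>) (emb e (1 / aa u w) (bb u w / aa u w ^ e))"
      by (simp add: PP_def)
    then show "co u' (1 / aa u w, bb u w / aa u w ^ e) = snd ?j (rinv ?i w)"
      using w(1) by (simp add: rinv_CH) (simp add: CH_def)
  qed
  then have t: "tder ?i ?j ?q = ?D" unfolding tder_def z(4) by (rule DERIV_imp_deriv)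
  show ?thesis
  proof (cases "snd u' = 0")
    case False
    then have "y \<noteq> 0" using ab_nz(1)[OF u' z'(1)] z'(3) by auto
    then have g: "1 / (y / X) * (- (w * y / s)) = w * (- (X / s))" for w s X by simp
    have "om u' (1 / x, y / x ^ e) = 1 / (y / x ^ e)" using False by (simp add: om_def)
    then show ?thesis using g[of "x ^ e" ?o "x\<^sup>2"] t False by simp
  next
    case True
    have g: "1 / (E * (1 / X)) * (- (w * E * p / s)) = - (w * (X * p / s))" if "E \<noteq> 0" "X \<noteq> 0" for E X w p s :: complex
      using that by simp
    have "om u' (1 / x, y / x ^ e) = 1 / (of_nat e * (1 / x ^ (2 * e - 1)))"
      using True by (simp add: om_def power_one_over)
    then have "om u' (1 / x, y / x ^ e) * ?D = - (?o * (x ^ (2 * e - 1) * x ^ (e - 1) / x ^ (2 * e)))"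
      using g[of "of_nat e" "x ^ (2 * e - 1)" ?o "x ^ (e - 1)" "x ^ (2 * e)"] True e x(1) by simp
    also have "x ^ (2 * e - 1) * x ^ (e - 1) / x ^ (2 * e) = x ^ e / x\<^sup>2"
      unfolding p1 using x(1) by (simp add: power2_eq_square)
    finally show ?thesis using t by simp
  qed
qed

text \<open>The coefficient of \<open>f\<close> with respect to the m-th power of
  \<open>dx / y\<close>, as a function on one copy of the affine curve. It is read in the chart
  centred at \<open>v\<close> and governs all charts of that copy around the point
  (\<open>vl_chart\<close>).\<close>

definition vl :: "nat \<Rightarrow> (rpt rchart \<Rightarrow> rpt \<Rightarrow> complex) \<Rightarrow> bool \<Rightarrow> complex \<times> complex \<Rightarrow> complex" where
  "vl m f \<sigma> v = f (CH (\<sigma>, v)) (fl \<sigma> (emb e (fst v) (snd v))) / om v v ^ m"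

lemma CH_CC: "u \<in> aff \<Longrightarrow> CH (\<sigma>, u) \<in> CC"
  unfolding CC_def by blast

lemma CH_Cv: "u \<in> aff \<Longrightarrow> fst (CH (\<sigma>, u)) \<inter> Cv = fst (CH (\<sigma>, u))"
  using rs_subset[OF curve_atlas CH_CC] by blast

lemma om_self_nz: "v \<in> aff \<Longrightarrow> om v v \<noteq> 0"
  using om_nz[of v "co v v"] base[of v] by simp

lemma vl_chart:
  assumes f: "f \<in> holo_diff CC Cv m" and u: "u \<in> aff" and v: "v \<in> aff"
    and p: "fl \<sigma> (emb e (fst v) (snd v)) \<in> fst (CH (\<sigma>, u))"
  shows "f (CH (\<sigma>, u)) (fl \<sigma> (emb e (fst v) (snd v))) = vl m f \<sigma> v * om u v ^ m"
proof -
  let ?q = "fl \<sigma> (emb e (fst v) (snd v))"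
  have p': "?q \<in> fst (CH (\<sigma>, v))" by (rule PP_in[OF v])
  have "f (CH (\<sigma>, u)) ?q = f (CH (\<sigma>, v)) ?q * tder (CH (\<sigma>, u)) (CH (\<sigma>, v)) ?q ^ m"
    by (rule holo_diffD(3)[OF f CH_CC[OF u] CH_CC[OF v]]) (use p p' CH_Cv[OF u] in blast)
  also have "f (CH (\<sigma>, v)) ?q = vl m f \<sigma> v * om v v ^ m" unfolding vl_def using om_self_nz[OF v] by simp
  also have "vl m f \<sigma> v * om v v ^ m * tder (CH (\<sigma>, u)) (CH (\<sigma>, v)) ?q ^ m =
      vl m f \<sigma> v * (om v v * tder (CH (\<sigma>, u)) (CH (\<sigma>, v)) ?q) ^ m"
    by (simp add: power_mult_distrib)
  also have "om v v * tder (CH (\<sigma>, u)) (CH (\<sigma>, v)) ?q = om u v"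
    using tder_same[OF u v, of "fst v" "snd v" \<sigma>] v p p' by simp
  finally show ?thesis .
qed

text \<open>The m-th power of the factor in \<open>tder_diff\<close>; it converts boundedness near
  \<open>x = 0\<close> in one copy into a growth condition at infinity in the other.\<close>

lemma vl_swap:
  assumes f: "f \<in> holo_diff CC Cv m" and v: "(x, y) \<in> aff" and x: "x \<noteq> 0"
  shows "vl m f \<sigma> (x, y) = vl m f (\<not> \<sigma>) (1 / x, y / x ^ e) * (- (x ^ e / x\<^sup>2)) ^ m"
proof -
  let ?q = "fl \<sigma> (emb e x y)" and ?v = "(1 / x, y / x ^ e)"
  have v': "?v \<in> aff" by (rule aff_inv[OF v x])
  have eq: "?q = fl (\<not> \<sigma>) (emb e (1 / x) (y / x ^ e))"
    unfolding fl_emb[OF x, symmetric] by (cases \<sigma>) simp_all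
  have p: "?q \<in> fst (CH (\<sigma>, (x, y)))" using PP_in[OF v] by simp
  have p': "?q \<in> fst (CH (\<not> \<sigma>, ?v))" unfolding eq using PP_in[OF v'] by simp
  have "f (CH (\<sigma>, (x, y))) ?q = f (CH (\<not> \<sigma>, ?v)) ?q * tder (CH (\<sigma>, (x, y))) (CH (\<not> \<sigma>, ?v)) ?q ^ m"
    by (rule holo_diffD(3)[OF f CH_CC[OF v] CH_CC[OF v']]) (use p p' CH_Cv[OF v] in blast)
  also have "f (CH (\<not> \<sigma>, ?v)) ?q = vl m f (\<not> \<sigma>) ?v * om ?v ?v ^ m"
    unfolding vl_def eq using om_self_nz[OF v'] by simp
  also have "vl m f (\<not> \<sigma>) ?v * om ?v ?v ^ m * tder (CH (\<sigma>, (x, y))) (CH (\<not> \<sigma>, ?v)) ?q ^ m =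
      vl m f (\<not> \<sigma>) ?v * (om ?v ?v * tder (CH (\<sigma>, (x, y))) (CH (\<not> \<sigma>, ?v)) ?q) ^ m"
    by (simp add: power_mult_distrib)
  also have "om ?v ?v * tder (CH (\<sigma>, (x, y))) (CH (\<not> \<sigma>, ?v)) ?q = om (x, y) (x, y) * (- (x ^ e / x\<^sup>2))"
    by (rule tder_diff[OF v v' v p p'])
  also have "(om (x, y) (x, y) * (- (x ^ e / x\<^sup>2))) ^ m = om (x, y) (x, y) ^ m * (- (x ^ e / x\<^sup>2)) ^ m"
    by (rule power_mult_distrib)
  finally have F: "f (CH (\<sigma>, (x, y))) ?q = vl m f (\<not> \<sigma>) ?v * (om (x, y) (x, y) ^ m * (- (x ^ e / x\<^sup>2)) ^ m)" .
  have cancel: "a * (b * k) / b = a * k" if "b \<noteq> 0" for a b k :: complex using that by simp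
  show ?thesis unfolding vl_def[of m f \<sigma>] fst_conv snd_conv F
    by (rule cancel) (use om_self_nz[OF v] in simp)
qed

lemma vl_holo:
  assumes f: "f \<in> holo_diff CC Cv m" and u: "u \<in> aff"
  shows "(\<lambda>z. vl m f \<sigma> (aa u z, bb u z)) holomorphic_on WW u"
proof -
  have "(\<lambda>z. f (CH (\<sigma>, u)) (rinv (CH (\<sigma>, u)) z)) holomorphic_on WW u"
    using holo_diffD(2)[OF f CH_CC[OF u], of \<sigma>] unfolding CH_Cv[OF u] CH_image by simp
  moreover have "(\<lambda>z. om u (aa u z, bb u z)) holomorphic_on WW u"
    unfolding om_def using aa_holo[of u] bb_holo[of u] ab_nz[OF u] e by (cases "snd u = 0") (auto intro!: holomorphic_intros)
  ultimately have "(\<lambda>z. f (CH (\<sigma>, u)) (rinv (CH (\<sigma>, u)) z) / om u (aa u z, bb u z) ^ m) holomorphic_on WW u"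
    using om_nz[OF u] by (intro holomorphic_intros) auto
  then show ?thesis
  proof (rule holomorphic_transform)
    fix z assume z: "z \<in> WW u"
    have "PP (\<sigma>, u) z \<in> fst (CH (\<sigma>, u))" using z by (simp add: CH_def)
    then have "f (CH (\<sigma>, u)) (PP (\<sigma>, u) z) = vl m f \<sigma> (aa u z, bb u z) * om u (aa u z, bb u z) ^ m"
      using vl_chart[OF f u curve_eq[OF u z], of \<sigma>] by (simp add: PP_def)
    then show "f (CH (\<sigma>, u)) (rinv (CH (\<sigma>, u)) z) / om u (aa u z, bb u z) ^ m = vl m f \<sigma> (aa u z, bb u z)"
      using z om_nz[OF u z] by (simp add: rinv_CH)
  qed
qed

text \<open>One copy contains all points except those over infinity, which have \<open>x = 0\<close>
  in the other copy; there the coefficient vanishes by continuity.\<close>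

lemma vl_zero:
  assumes f: "f \<in> holo_diff CC Cv m" and z: "\<And>v. v \<in> aff \<Longrightarrow> vl m f False v = 0"
  shows "f = (\<lambda>_ _. 0)"
proof (intro ext)
  have zT: "vl m f True v = 0" if v: "v \<in> aff" for v
  proof (cases "fst v = 0")
    case False
    then show ?thesis using vl_swap[OF f, of "fst v" "snd v" True] aff_inv[of "fst v" "snd v"] v z by simp
  next
    case True
    then have "(snd v)\<^sup>2 = 1" using v e by (auto simp: aff_def power_0_left)
    then have s0: "snd v \<noteq> 0" by auto
    have W: "WW v = {z. (1 + z ^ (2 * e)) / (snd v)\<^sup>2 \<notin> \<real>\<^sub>\<le>\<^sub>0}" using s0 by (simp add: WW_def)
    have 0: "0 \<in> WW v" "co v v = 0" using base(1)[OF v] s0 True by (simp_all add: co_def)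
    have cont: "isCont (\<lambda>z. vl m f True (aa v z, bb v z)) 0"
      using continuous_on_eq_continuous_at[OF open_WW, THEN iffD1, OF holomorphic_on_imp_continuous_on[OF vl_holo[OF f v]]] 0(1)
      by (rule bspec)
    \<comment> \<open>In this chart the coordinate is \<open>x\<close>, so the nearby points other
      than \<open>v\<close> lie in the first copy too.\<close>
    have "eventually (\<lambda>z. z \<in> WW v \<and> z \<noteq> 0) (at 0)"
      using eventually_at_in_open'[OF open_WW 0(1)] eventually_neq_at_within[of 0 0 UNIV] by eventually_elim simp
    then have "eventually (\<lambda>z. vl m f True (aa v z, bb v z) = 0) (at 0)"
    proof eventually_elim
      case (elim z)
      have "aa v z \<noteq> 0" using elim s0 by (simp add: aa_def)
      then show ?case
        using vl_swap[OF f curve_eq[OF v], of z True] elim aff_inv[OF curve_eq[OF v], of z] z by simp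
    qed
    then have "((\<lambda>z. vl m f True (aa v z, bb v z)) \<longlongrightarrow> 0) (at 0)" by (rule tendsto_eventually)
    with cont[unfolded isCont_def] have "vl m f True (aa v 0, bb v 0) = 0" by (rule tendsto_unique[OF at_neq_bot])
    then show ?thesis using base(2,3)[OF v] 0(2) by simp
  qed
  fix c q show "f c q = 0"
  proof (cases "c \<in> CC \<and> q \<in> fst c \<inter> Cv")
    case True
    then obtain \<sigma> u where c: "c = CH (\<sigma>, u)" "u \<in> aff" unfolding CC_def by auto
    then obtain z where w: "z \<in> WW u" "q = PP (\<sigma>, u) z" using True unfolding CH_def by auto
    have "vl m f \<sigma> (aa u z, bb u z) = 0" using z zT curve_eq[OF c(2) w(1)] by (cases \<sigma>) auto
    then show ?thesis using vl_chart[OF f c(2) curve_eq[OF c(2) w(1)], of \<sigma>] True om_nz[OF c(2) w(1)]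
      unfolding c(1) w(2) PP_def by simp
  qed (rule holo_diffD(1)[OF f])
qed

text \<open>Every chart of the atlas is of the form \<^term>\<open>CH i\<close>, but \<open>i\<close> is not determined by it.\<close>

definition sct :: "nat \<Rightarrow> (bool \<Rightarrow> complex \<times> complex \<Rightarrow> complex) \<Rightarrow> rpt rchart \<Rightarrow> rpt \<Rightarrow> complex" where
  "sct m h c q = (if c \<in> CC \<and> q \<in> fst c then
     let i = (SOME i. i \<in> UNIV \<times> aff \<and> c = CH i); v = (xi (fl (fst i) q), eta e (fl (fst i) q))
     in h (fst i) v * om (snd i) v ^ m else 0)"

lemma sct_chart:
  assumes c: "c \<in> CC"
  shows "\<exists>\<sigma> u. u \<in> aff \<and> c = CH (\<sigma>, u) \<and> (\<forall>h x y. (x, y) \<in> aff \<longrightarrow> fl \<sigma> (emb e x y) \<in> fst c \<longrightarrow>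
    sct m h c (fl \<sigma> (emb e x y)) = h \<sigma> (x, y) * om u (x, y) ^ m)"
proof -
  define i where "i = (SOME i. i \<in> UNIV \<times> aff \<and> c = CH i)"
  have "\<exists>i. i \<in> UNIV \<times> aff \<and> c = CH i" using c unfolding CC_def by blast
  from someI_ex[OF this] have i: "i \<in> UNIV \<times> aff" "c = CH i" unfolding i_def by (rule conjunct1, rule conjunct2)
  show ?thesis
  proof (intro exI[of _ "fst i"] exI[of _ "snd i"] conjI allI impI)
    show "snd i \<in> aff" using i(1) by (simp add: mem_Times_iff)
    show "c = CH (fst i, snd i)" unfolding prod.collapse by (rule i(2))
    fix h x y assume "(x, y) \<in> aff" "fl (fst i) (emb e x y) \<in> fst c"
    then show "sct m h c (fl (fst i) (emb e x y)) = h (fst i) (x, y) * om (snd i) (x, y) ^ m"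
      using c unfolding sct_def Let_def i_def[symmetric] by simp
  qed
qed

text \<open>A chart might be \<open>CH i\<close> for several \<open>i\<close>, even in different
  copies, and \<open>sct\<close> picks one of them. Since \<open>tder\<close> of a chart with itself
  is 1, \<open>tder_same\<close> and \<open>tder_diff\<close> show that the pick does not matter,
  given the compatibility \<open>sw\<close> of \<open>h\<close>.\<close>

lemma vl_sct:
  assumes v: "(x, y) \<in> aff"
    and sw: "\<And>\<sigma> x y. (x, y) \<in> aff \<Longrightarrow> x \<noteq> 0 \<Longrightarrow> h \<sigma> (x, y) = h (\<not> \<sigma>) (1 / x, y / x ^ e) * (- (x ^ e / x\<^sup>2)) ^ m"
  shows "vl m (sct m h) False (x, y) = h False (x, y)"
proof -
  let ?c = "CH (False, (x, y))" and ?q = "fl False (emb e x y)"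
  have c: "?c \<in> CC" by (rule CH_CC[OF v])
  have q: "?q \<in> fst ?c" using PP_in[OF v, of False] by simp
  obtain \<sigma> u where u: "u \<in> aff" "?c = CH (\<sigma>, u)"
    and s0: "\<forall>h x y. (x, y) \<in> aff \<longrightarrow> fl \<sigma> (emb e x y) \<in> fst ?c \<longrightarrow> sct m h ?c (fl \<sigma> (emb e x y)) = h \<sigma> (x, y) * om u (x, y) ^ m"
    using sct_chart[OF c, of m] by (elim exE conjE)
  note s = s0[THEN spec, of h, rule_format]
  have t1: "tder ?c ?c ?q = 1" by (rule tder_self[OF curve_atlas c q])
  have "sct m h ?c ?q = h False (x, y) * om (x, y) (x, y) ^ m"
  proof (cases \<sigma>)
    case False
    then have cu: "?c = CH (False, u)" using u(2) by simp
    have "om u (x, y) * tder ?c (CH (False, u)) ?q = om (x, y) (x, y)"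
      by (rule tder_same[OF v u(1) v q]) (use q cu in argo)
    then have "om u (x, y) = om (x, y) (x, y)" unfolding cu[symmetric] t1 by simp
    then show ?thesis using s[OF v] q False by simp
  next
    case True
    then have cu: "?c = CH (\<not> False, u)" using u(2) by simp
    have q2: "?q \<in> fst (CH (\<not> False, u))" using q unfolding cu .
    note x = overlap_diff[OF u(1) q2]
    have "om u (1 / x, y / x ^ e) * tder ?c (CH (\<not> False, u)) ?q = om (x, y) (x, y) * (- (x ^ e / x\<^sup>2))"
      by (rule tder_diff[OF v u(1) v q q2])
    then have o: "om u (1 / x, y / x ^ e) = om (x, y) (x, y) * (- (x ^ e / x\<^sup>2))" unfolding cu[symmetric] t1 by simp
    have q3: "fl \<sigma> (emb e (1 / x) (y / x ^ e)) \<in> fst ?c" using q x(2) True by simp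
    have "sct m h ?c ?q = h True (1 / x, y / x ^ e) * om u (1 / x, y / x ^ e) ^ m"
      using s[OF aff_inv[OF v x(1)] q3] x(2) True by simp
    also have "\<dots> = h (\<not> False) (1 / x, y / x ^ e) * (- (x ^ e / x\<^sup>2)) ^ m * om (x, y) (x, y) ^ m"
      unfolding o power_mult_distrib by (simp only: not_False_eq_True mult.assoc mult.commute mult.left_commute)
    finally show ?thesis unfolding sw[OF v x(1), symmetric] .
  qed
  then show ?thesis unfolding vl_def using om_self_nz[OF v] by simp
qed

lemma sct_holo:
  assumes h: "\<And>\<sigma> u. u \<in> aff \<Longrightarrow> (\<lambda>z. h \<sigma> (aa u z, bb u z)) holomorphic_on WW u"
    and sw: "\<And>\<sigma> x y. (x, y) \<in> aff \<Longrightarrow> x \<noteq> 0 \<Longrightarrow> h \<sigma> (x, y) = h (\<not> \<sigma>) (1 / x, y / x ^ e) * (- (x ^ e / x\<^sup>2)) ^ m"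
  shows "sct m h \<in> holo_diff CC Cv m"
  unfolding holo_diff_def
proof (intro CollectI conjI allI impI ballI)
  fix c q assume "\<not> (c \<in> CC \<and> q \<in> fst c \<inter> Cv)"
  then have "\<not> (c \<in> CC \<and> q \<in> fst c)" using rs_subset[OF curve_atlas, of c] by blast
  then show "sct m h c q = 0" unfolding sct_def by (simp only: if_False)
next
  fix c assume c: "c \<in> CC"
  obtain \<sigma> u where u: "u \<in> aff" "c = CH (\<sigma>, u)"
    and s0: "\<forall>h x y. (x, y) \<in> aff \<longrightarrow> fl \<sigma> (emb e x y) \<in> fst c \<longrightarrow> sct m h c (fl \<sigma> (emb e x y)) = h \<sigma> (x, y) * om u (x, y) ^ m"
    using sct_chart[OF c, of m] by (elim exE conjE)
  note s = s0[THEN spec, of h, rule_format]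
  have "(\<lambda>z. om u (aa u z, bb u z)) holomorphic_on WW u"
    unfolding om_def using aa_holo[of u] bb_holo[of u] ab_nz[OF u(1)] e by (cases "snd u = 0") (auto intro!: holomorphic_intros)
  then have "(\<lambda>z. h \<sigma> (aa u z, bb u z) * om u (aa u z, bb u z) ^ m) holomorphic_on WW u"
    by (intro holomorphic_intros h u(1))
  then have "(\<lambda>z. sct m h c (rinv c z)) holomorphic_on WW u"
  proof (rule holomorphic_transform)
    fix z assume z: "z \<in> WW u"
    then have "PP (\<sigma>, u) z \<in> fst c" by (simp add: u(2) CH_def)
    then show "h \<sigma> (aa u z, bb u z) * om u (aa u z, bb u z) ^ m = sct m h c (rinv c z)"
      using s[OF curve_eq[OF u(1) z]] z by (simp add: u(2) rinv_CH PP_def)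
  qed
  then show "(\<lambda>z. sct m h c (rinv c z)) holomorphic_on snd c ` (fst c \<inter> Cv)"
    unfolding u(2) CH_Cv[OF u(1)] CH_image by simp
  fix c' q assume c': "c' \<in> CC" and q: "q \<in> fst c \<inter> fst c' \<inter> Cv"
  obtain \<sigma>' u' where u': "u' \<in> aff" "c' = CH (\<sigma>', u')"
    and s'0: "\<forall>h x y. (x, y) \<in> aff \<longrightarrow> fl \<sigma>' (emb e x y) \<in> fst c' \<longrightarrow> sct m h c' (fl \<sigma>' (emb e x y)) = h \<sigma>' (x, y) * om u' (x, y) ^ m"
    using sct_chart[OF c', of m] by (elim exE conjE)
  note s' = s'0[THEN spec, of h, rule_format]
  obtain z where z: "z \<in> WW u" "q = PP (\<sigma>, u) z" using q unfolding u(2) CH_def by auto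
  define x y where "x = aa u z" and "y = bb u z"
  have v: "(x, y) \<in> aff" unfolding x_def y_def by (rule curve_eq[OF u(1) z(1)])
  have q': "q = fl \<sigma> (emb e x y)" by (simp add: z(2) PP_def x_def y_def)
  have 1: "sct m h c q = h \<sigma> (x, y) * om u (x, y) ^ m" using s[OF v] q unfolding q' by blast
  show "sct m h c q = sct m h c' q * tder c c' q ^ m"
  proof (cases "\<sigma>' = \<sigma>")
    case True
    have "sct m h c' q = h \<sigma> (x, y) * om u' (x, y) ^ m" using s'[OF v] q unfolding q' True by blast
    moreover have "om u' (x, y) * tder c c' q = om u (x, y)"
      unfolding u(2) u'(2) True q' by (rule tder_same[OF u(1) u'(1) v]) (use q u(2) u'(2) True q' in simp_all)
    then have "(om u' (x, y) * tder c c' q) ^ m = om u (x, y) ^ m" by (rule arg_cong)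
    then have "om u (x, y) ^ m = om u' (x, y) ^ m * tder c c' q ^ m" unfolding power_mult_distrib by (rule sym)
    ultimately show ?thesis unfolding 1 by (simp only: mult.assoc)
  next
    case False
    then have sg: "\<sigma>' = (\<not> \<sigma>)" by blast
    have qq: "fl \<sigma> (emb e x y) \<in> fst (CH (\<sigma>, u))" "fl \<sigma> (emb e x y) \<in> fst (CH (\<not> \<sigma>, u'))"
      using q u(2) u'(2) sg q' by simp_all
    note x = overlap_diff[OF u'(1) qq(2)]
    have "sct m h c' q = h (\<not> \<sigma>) (1 / x, y / x ^ e) * om u' (1 / x, y / x ^ e) ^ m"
      using s'[OF aff_inv[OF v x(1)]] q unfolding sg q' x(2) by blast
    moreover have "om u' (1 / x, y / x ^ e) * tder c c' q = om u (x, y) * (- (x ^ e / x\<^sup>2))"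
      unfolding u(2) u'(2) sg q' by (rule tder_diff[OF u(1) u'(1) v qq])
    then have "(om u' (1 / x, y / x ^ e) * tder c c' q) ^ m = (om u (x, y) * (- (x ^ e / x\<^sup>2))) ^ m" by (rule arg_cong)
    then have F: "om u (x, y) ^ m * (- (x ^ e / x\<^sup>2)) ^ m = om u' (1 / x, y / x ^ e) ^ m * tder c c' q ^ m"
      unfolding power_mult_distrib by (rule sym)
    have "h (\<not> \<sigma>) (1 / x, y / x ^ e) * (- (x ^ e / x\<^sup>2)) ^ m * om u (x, y) ^ m =
        h (\<not> \<sigma>) (1 / x, y / x ^ e) * (om u (x, y) ^ m * (- (x ^ e / x\<^sup>2)) ^ m)"
      by (simp only: mult.assoc mult.commute mult.left_commute)
    note F' = this[unfolded F]
    ultimately show ?thesis unfolding 1 sw[OF v x(1)] F' by (simp only: mult.assoc)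
  qed
qed


end

section \<open>Compactness, polynomial growth, dimension bounds and connectedness of the
  curves\<close>

context curve
begin

lemma compact_unit: "compact {v \<in> aff. cmod (fst v) \<le> 1}"
proof -
  have eq: "{v \<in> aff. cmod (fst v) \<le> 1} =
      (cball 0 1 \<times> cball 0 2) \<inter> {v. (snd v)\<^sup>2 = 1 + fst v ^ (2 * e)}"
  proof -
    have "cmod y \<le> 2" if "cmod x \<le> 1" "y\<^sup>2 = 1 + x ^ (2 * e)" for x y :: complex
    proof -
      have "(cmod y)\<^sup>2 = cmod (1 + x ^ (2 * e))" unfolding norm_power[symmetric] that(2) ..
      also have "\<dots> \<le> 1 + cmod x ^ (2 * e)" using norm_triangle_ineq[of 1 "x ^ (2 * e)"] by (simp add: norm_power)
      also have "\<dots> \<le> 2\<^sup>2" using power_le_one[of "cmod x" "2 * e"] that(1) by simp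
      finally show ?thesis by (rule power2_le_imp_le) simp
    qed
    then show ?thesis by (auto simp: aff_def)
  qed
  have "closed {v::complex \<times> complex. (snd v)\<^sup>2 = 1 + fst v ^ (2 * e)}"
    by (intro closed_Collect_eq continuous_intros)
  then show ?thesis unfolding eq by (intro compact_Int_closed compact_Times compact_cball)
qed

text \<open>The compact parts \<open>cmod x \<le> 1\<close> of the two copies cover the curve, since
  inversion exchanges small and large \<open>x\<close>.\<close>

lemma compact_Cv: "compact Cv"
proof -
  let ?E = "\<lambda>v. emb e (fst v) (snd v)" and ?U = "{v \<in> aff. cmod (fst v) \<le> 1}"
  have "fl \<sigma> (emb e x y) \<in> ?E ` ?U \<union> fl True ` ?E ` ?U" if v: "(x, y) \<in> aff" for \<sigma> x y
  proof (cases "cmod x \<le> 1")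
    case True
    then show ?thesis using v by (cases \<sigma>) force+
  next
    case False
    then have x: "x \<noteq> 0" by auto
    have "cmod x > 0" using x by simp
    then have "cmod (1 / x) \<le> 1" using False by (simp add: norm_divide)
    then have "emb e (1 / x) (y / x ^ e) \<in> ?E ` ?U" using aff_inv[OF v x] by force
    then have "fl True (emb e x y) \<in> ?E ` ?U" unfolding fl_emb[OF x] .
    moreover from this have "fl True (fl True (emb e x y)) \<in> fl True ` ?E ` ?U" by (rule imageI)
    ultimately show ?thesis by (cases \<sigma>) simp_all
  qed
  then have "Cv \<subseteq> ?E ` ?U \<union> fl True ` ?E ` ?U" unfolding Cv_def by blast
  moreover have "?E ` ?U \<union> fl True ` ?E ` ?U \<subseteq> Cv"
    using Cv_emb[of _ _ False] Cv_emb[of _ _ True] by auto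
  ultimately have "Cv = ?E ` ?U \<union> fl True ` ?E ` ?U" by (rule equalityI)
  moreover have "compact (?E ` ?U \<union> fl True ` ?E ` ?U)"
    by (intro compact_Un compact_continuous_image cont_emb cont_fl compact_unit)
  ultimately show ?thesis by simp
qed

text \<open>Continuity at branch points, where \<open>x\<close> is not a coordinate, is what makes
  the singularities in \<open>AD_entire\<close> removable.\<close>

lemma vl_cont:
  assumes f: "f \<in> holo_diff CC Cv m"
  shows "continuous_on aff (vl m f \<sigma>)"
  unfolding continuous_on_eq_continuous_within
proof
  fix u assume u: "u \<in> aff"
  have uN: "u \<in> NN u" using image_WW[OF u, of u] base[OF u] u by (metis IntE prod.collapse)
  have im: "co u v \<in> WW u \<and> v = (aa u (co u v), bb u (co u v))" if vin: "v \<in> aff \<inter> NN u" for v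
  proof -
    obtain z where z: "z \<in> WW u" "v = (aa u z, bb u z)" using image_WW[OF u, of v] vin by blast
    then have "co u v = z" by (simp add: co_ab)
    then show ?thesis using z by simp
  qed
  have "continuous_on (aff \<inter> NN u) (co u)"
    unfolding co_def by (cases "snd u = 0") (simp_all add: continuous_on_fst continuous_on_snd continuous_on_id)
  then have "continuous_on (aff \<inter> NN u) (\<lambda>v. vl m f \<sigma> (aa u (co u v), bb u (co u v)))"
    by (rule continuous_on_compose2[OF holomorphic_on_imp_continuous_on[OF vl_holo[OF f u]]]) (use im in blast)
  then have "continuous_on (aff \<inter> NN u) (vl m f \<sigma>)"
    by (rule continuous_on_eq) (use im in metis)
  then have "continuous (at u within aff \<inter> NN u) (vl m f \<sigma>)"
    using u uN unfolding continuous_on_eq_continuous_within by blast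
  moreover have "at u within aff \<inter> NN u = at u within aff"
    by (rule at_within_nhd[OF uN open_NN[OF u]]) blast
  ultimately show "continuous (at u within aff) (vl m f \<sigma>)" by simp
qed

text \<open>A choice of root without continuity. \<open>AA\<close> and \<open>DD\<close> below are
  unchanged when the root changes its sign, so the choice does not affect them.\<close>

definition rt :: "complex \<Rightarrow> complex" where
  "rt x = csqrt (1 + x ^ (2 * e))"

text \<open>A function on the curve is \<open>A + B y\<close> with \<open>A\<close> and \<open>B\<close> functions of \<open>x\<close>; \<open>DD\<close> is
  \<open>B y\<^sup>2\<close>, which has no poles.\<close>

definition AA :: "nat \<Rightarrow> (rpt rchart \<Rightarrow> rpt \<Rightarrow> complex) \<Rightarrow> bool \<Rightarrow> complex \<Rightarrow> complex" where
  "AA m f \<sigma> x = (vl m f \<sigma> (x, rt x) + vl m f \<sigma> (x, - rt x)) / 2"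

definition DD :: "nat \<Rightarrow> (rpt rchart \<Rightarrow> rpt \<Rightarrow> complex) \<Rightarrow> bool \<Rightarrow> complex \<Rightarrow> complex" where
  "DD m f \<sigma> x = rt x * (vl m f \<sigma> (x, rt x) - vl m f \<sigma> (x, - rt x)) / 2"

lemma rt_sq [simp]: "(rt x)\<^sup>2 = 1 + x ^ (2 * e)"
  by (simp add: rt_def)

lemma rt_aff: "(x, rt x) \<in> aff" "(x, - rt x) \<in> aff"
  by (simp_all add: aff_def)

lemma aff_rt: "(x, y) \<in> aff \<Longrightarrow> y = rt x \<or> y = - rt x"
proof -
  assume "(x, y) \<in> aff"
  then have "y\<^sup>2 = (rt x)\<^sup>2" by (simp add: aff_def)
  then show ?thesis by (simp only: power2_eq_iff)
qed

lemma AD_zero: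
  assumes "AA m f \<sigma> x = 0" "DD m f \<sigma> x = 0" "(x, y) \<in> aff"
  shows "vl m f \<sigma> (x, y) = 0"
proof (cases "rt x = 0")
  case True
  then show ?thesis using assms aff_rt[OF assms(3)] by (auto simp: AA_def)
next
  case False
  then have "vl m f \<sigma> (x, rt x) = vl m f \<sigma> (x, - rt x)" using assms(2) by (simp add: DD_def)
  then show ?thesis using assms(1) aff_rt[OF assms(3)] by (auto simp: AA_def)
qed

text \<open>Away from the branch points the root can be replaced locally by the holomorphic
  \<open>bb\<close>, up to a sign that does not matter. At the branch points both functions are
  continuous, because the two values of \<open>vl\<close> merge, so the singularities are
  removable.\<close>

lemma AD_entire:
  assumes f: "f \<in> holo_diff CC Cv m"
  shows "AA m f \<sigma> holomorphic_on UNIV" "DD m f \<sigma> holomorphic_on UNIV"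
proof -
  let ?Z = "{x::complex. x ^ (2 * e) = - 1}"
  have fin: "finite ?Z" by (rule finite_nth_roots) (use e in simp)
  have d: "AA m f \<sigma> field_differentiable at x \<and> DD m f \<sigma> field_differentiable at x" if x: "x \<in> UNIV - ?Z" for x
  proof -
    have nz: "rt x \<noteq> 0"
    proof
      assume "rt x = 0"
      then have "1 + x ^ (2 * e) = 0" using rt_sq[of x] by simp
      then have "x ^ (2 * e) = - 1" by (simp add: add_eq_0_iff)
      then show False using x by blast
    qed
    let ?u = "(x, rt x)" and ?w = "(x, - rt x)"
    have u: "?u \<in> aff" "?w \<in> aff" by (rule rt_aff)+
    have W: "WW ?w = WW ?u" "x \<in> WW ?u" using base(1)[OF u(1)] nz by (simp_all add: WW_def co_def)
    have a: "aa ?u z = z" "aa ?w z = z" "bb ?w z = - bb ?u z" for z using nz by (simp_all add: aa_def bb_def)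
    let ?p = "\<lambda>z. vl m f \<sigma> (z, bb ?u z)" and ?q = "\<lambda>z. vl m f \<sigma> (z, - bb ?u z)"
    have h: "?p holomorphic_on WW ?u" "?q holomorphic_on WW ?u"
      using vl_holo[OF f u(1), of \<sigma>] vl_holo[OF f u(2), of \<sigma>] unfolding a W(1) by simp_all
    have b: "bb ?u z = rt z \<or> bb ?u z = - rt z" if "z \<in> WW ?u" for z
      using aff_rt[OF curve_eq[OF u(1) that]] unfolding a .
    have "(\<lambda>z. (?p z + ?q z) / 2) holomorphic_on WW ?u" "(\<lambda>z. bb ?u z * (?p z - ?q z) / 2) holomorphic_on WW ?u"
      using h bb_holo[of ?u] by (auto intro!: holomorphic_intros)
    then have "AA m f \<sigma> holomorphic_on WW ?u \<and> DD m f \<sigma> holomorphic_on WW ?u"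
    proof (intro conjI)
      assume "(\<lambda>z. (?p z + ?q z) / 2) holomorphic_on WW ?u"
      then show "AA m f \<sigma> holomorphic_on WW ?u"
        by (rule holomorphic_transform) (use b in \<open>force simp: AA_def\<close>)
      assume "(\<lambda>z. bb ?u z * (?p z - ?q z) / 2) holomorphic_on WW ?u"
      then show "DD m f \<sigma> holomorphic_on WW ?u"
      proof (rule holomorphic_transform)
        fix z assume "z \<in> WW ?u"
        from b[OF this] show "bb ?u z * (?p z - ?q z) / 2 = DD m f \<sigma> z"
        proof
          assume b: "bb ?u z = - rt z"
          show ?thesis unfolding b DD_def by (simp add: algebra_simps)
        qed (simp add: DD_def)
      qed
    qed
    then show ?thesis using holomorphic_on_imp_differentiable_at[OF _ open_WW W(2)] by blast
  qed
  have lim: "(AA m f \<sigma> \<longlongrightarrow> AA m f \<sigma> x) (at x within UNIV) \<and> (DD m f \<sigma> \<longlongrightarrow> DD m f \<sigma> x) (at x within UNIV)"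
    if x: "x \<in> ?Z" for x
  proof -
    have r0: "rt x = 0" using x by (simp add: rt_def)
    have "((\<lambda>z. sqrt (cmod (1 + z ^ (2 * e)))) \<longlongrightarrow> sqrt (cmod (1 + x ^ (2 * e)))) (at x)"
      by (intro tendsto_intros)
    moreover have "cmod (rt z) = sqrt (cmod (1 + z ^ (2 * e)))" for z
    proof -
      have "(cmod (rt z))\<^sup>2 = cmod (1 + z ^ (2 * e))" unfolding norm_power[symmetric] rt_sq ..
      then show ?thesis by (metis norm_ge_zero real_sqrt_abs abs_of_nonneg)
    qed
    ultimately have "((\<lambda>z. cmod (rt z)) \<longlongrightarrow> 0) (at x)" using x by simp
    then have r: "(rt \<longlongrightarrow> 0) (at x)" by (rule tendsto_norm_zero_cancel)
    have v0: "(x, 0) \<in> aff" using rt_aff(1)[of x] r0 by simp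
    have v1: "((\<lambda>z. vl m f \<sigma> (z, rt z)) \<longlongrightarrow> vl m f \<sigma> (x, 0)) (at x)"
      by (rule continuous_on_tendsto_compose[OF vl_cont[OF f] _ v0]) (auto intro!: tendsto_intros r simp: rt_aff)
    have "((\<lambda>z. (z, - rt z)) \<longlongrightarrow> (x, - 0)) (at x)" by (intro tendsto_intros r)
    then have v2: "((\<lambda>z. vl m f \<sigma> (z, - rt z)) \<longlongrightarrow> vl m f \<sigma> (x, 0)) (at x)"
      by (intro continuous_on_tendsto_compose[OF vl_cont[OF f] _ v0]) (simp_all add: rt_aff)
    have "((\<lambda>z. (vl m f \<sigma> (z, rt z) + vl m f \<sigma> (z, - rt z)) / 2) \<longlongrightarrow> (vl m f \<sigma> (x, 0) + vl m f \<sigma> (x, 0)) / 2) (at x)"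
      by (intro tendsto_intros v1 v2) simp
    moreover have "((\<lambda>z. rt z * (vl m f \<sigma> (z, rt z) - vl m f \<sigma> (z, - rt z)) / 2) \<longlongrightarrow> 0 * (vl m f \<sigma> (x, 0) - vl m f \<sigma> (x, 0)) / 2) (at x)"
      by (intro tendsto_intros v1 v2 r) simp
    ultimately show ?thesis unfolding AA_def[abs_def] DD_def[abs_def] r0 by simp
  qed
  have hol: "AA m f \<sigma> holomorphic_on UNIV - ?Z" "DD m f \<sigma> holomorphic_on UNIV - ?Z"
    unfolding holomorphic_on_def using d field_differentiable_at_within by blast+
  show "AA m f \<sigma> holomorphic_on UNIV"
    by (rule no_isolated_singularity'[OF _ hol(1) open_UNIV fin]) (rule lim[THEN conjunct1])
  show "DD m f \<sigma> holomorphic_on UNIV"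
    by (rule no_isolated_singularity'[OF _ hol(2) open_UNIV fin]) (rule lim[THEN conjunct2])
qed

text \<open>For \<open>cmod x \<ge> 1\<close> the other copy is evaluated in its compact part, and
  \<open>vl_swap\<close> contributes the m-th power of \<open>x ^ e / x\<^sup>2\<close>. Powers are
  kept on both sides because \<open>e - 2\<close> may be negative.\<close>

lemma AD_bound:
  assumes f: "f \<in> holo_diff CC Cv m"
  shows "\<exists>M. M \<ge> 0 \<and> (\<forall>x. cmod x \<ge> 1 \<longrightarrow> cmod (AA m f \<sigma> x) * cmod x ^ (2 * m) \<le> M * cmod x ^ (e * m)) \<and>
    (\<forall>x. cmod x \<ge> 1 \<longrightarrow> cmod (DD m f \<sigma> x) * cmod x ^ (2 * m) \<le> 2 * M * cmod x ^ (e * m + e))"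
proof -
  have "bounded (vl m f (\<not> \<sigma>) ` {v \<in> aff. cmod (fst v) \<le> 1})"
    by (intro compact_imp_bounded compact_continuous_image compact_unit continuous_on_subset[OF vl_cont[OF f]]) auto
  then obtain M where M: "M > 0" "\<forall>w\<in>vl m f (\<not> \<sigma>) ` {v \<in> aff. cmod (fst v) \<le> 1}. cmod w \<le> M"
    unfolding bounded_pos by blast
  have b: "cmod (vl m f \<sigma> (x, y)) * cmod x ^ (2 * m) \<le> M * cmod x ^ (e * m)" if x: "cmod x \<ge> 1" and v: "(x, y) \<in> aff" for x y
  proof -
    have x0: "x \<noteq> 0" using x by auto
    have "cmod x > 0" using x0 by simp
    then have "cmod (1 / x) \<le> 1" using x by (simp add: norm_divide)
    then have "cmod (vl m f (\<not> \<sigma>) (1 / x, y / x ^ e)) \<le> M" using M(2) aff_inv[OF v x0] by auto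
    then have "cmod (vl m f (\<not> \<sigma>) (1 / x, y / x ^ e)) * cmod x ^ (e * m) \<le> M * cmod x ^ (e * m)"
      by (rule mult_right_mono) simp
    moreover have "cmod (vl m f \<sigma> (x, y)) * cmod x ^ (2 * m) = cmod (vl m f (\<not> \<sigma>) (1 / x, y / x ^ e)) * cmod x ^ (e * m)"
      unfolding vl_swap[OF f v x0, of \<sigma>] using x0
      by (simp add: norm_mult norm_power norm_divide power_divide power_mult[symmetric])
    ultimately show ?thesis by simp
  qed
  have s: "cmod (vl m f \<sigma> (x, rt x) + c * vl m f \<sigma> (x, - rt x)) / 2 * cmod x ^ (2 * m) \<le> M * cmod x ^ (e * m)"
    if x: "cmod x \<ge> 1" and c: "cmod c = 1" for x c
  proof -
    have "cmod (vl m f \<sigma> (x, rt x) + c * vl m f \<sigma> (x, - rt x)) \<le> cmod (vl m f \<sigma> (x, rt x)) + cmod (vl m f \<sigma> (x, - rt x))"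
      using norm_triangle_ineq[of "vl m f \<sigma> (x, rt x)" "c * vl m f \<sigma> (x, - rt x)"] c by (simp add: norm_mult)
    then have "cmod (vl m f \<sigma> (x, rt x) + c * vl m f \<sigma> (x, - rt x)) * cmod x ^ (2 * m) \<le>
        (cmod (vl m f \<sigma> (x, rt x)) + cmod (vl m f \<sigma> (x, - rt x))) * cmod x ^ (2 * m)"
      by (rule mult_right_mono) simp
    then show ?thesis using b[OF x rt_aff(1)] b[OF x rt_aff(2)] by (simp add: distrib_right)
  qed
  show ?thesis
  proof (intro exI[of _ M] conjI allI impI)
    show "M \<ge> 0" using M(1) by simp
    fix x assume x: "cmod x \<ge> 1"
    show "cmod (AA m f \<sigma> x) * cmod x ^ (2 * m) \<le> M * cmod x ^ (e * m)"
      using s[OF x, of 1] by (simp add: AA_def norm_divide)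
    \<comment> \<open>The factor \<open>rt x\<close> in \<open>DD\<close> raises the degree by
      \<open>e\<close> and doubles the constant.\<close>
    have "(cmod (rt x))\<^sup>2 = cmod (1 + x ^ (2 * e))" unfolding norm_power[symmetric] rt_sq ..
    also have "\<dots> \<le> 1 + cmod x ^ (2 * e)" using norm_triangle_ineq[of 1 "x ^ (2 * e)"] by (simp add: norm_power)
    also have "\<dots> \<le> 2 * cmod x ^ (2 * e)" using one_le_power[OF x, of "2 * e"] by simp
    also have "\<dots> \<le> (2 * cmod x ^ e)\<^sup>2" by (simp add: power_mult_distrib power_mult[symmetric] mult.commute)
    finally have r: "cmod (rt x) \<le> 2 * cmod x ^ e" by (rule power2_le_imp_le) simp
    have "cmod (DD m f \<sigma> x) * cmod x ^ (2 * m) =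
        cmod (rt x) * (cmod (vl m f \<sigma> (x, rt x) + (- 1) * vl m f \<sigma> (x, - rt x)) / 2 * cmod x ^ (2 * m))"
      by (simp add: DD_def norm_mult norm_divide)
    also have "\<dots> \<le> (2 * cmod x ^ e) * (M * cmod x ^ (e * m))"
      by (intro mult_mono r s[OF x]) simp_all
    finally show "cmod (DD m f \<sigma> x) * cmod x ^ (2 * m) \<le> 2 * M * cmod x ^ (e * m + e)"
      by (simp add: power_add mult_ac)
  qed
qed

text \<open>Liouville's theorem for polynomial growth, after cancelling \<open>cmod x ^ k\<close>;
  in this form it fits the bounds of \<open>AD_bound\<close>.\<close>

lemma entire_degree_le:
  assumes "F holomorphic_on UNIV" "\<And>x. cmod x \<ge> 1 \<Longrightarrow> cmod (F x) * cmod x ^ k \<le> M * cmod x ^ (k + n)"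
  shows "F x = (\<Sum>i\<le>n. (deriv ^^ i) F 0 / fact i * x ^ i)"
proof (rule Liouville_polynomial[OF assms(1), of 1 M n])
  fix z assume z: "1 \<le> cmod z"
  then have "0 < cmod z ^ k" by (intro zero_less_power) linarith
  then show "cmod (F z) \<le> M * cmod z ^ n" using assms(2)[OF z] by (simp add: power_add mult.left_commute mult.commute)
qed

text \<open>For \<open>e = 1\<close> the coefficient decays like the m-th power of
  \<open>1 / x\<close>. So \<open>DD\<close> is constant and vanishes at a branch point, while
  \<open>AA\<close> and \<open>x * AA\<close> are both constant, which leaves only 0.\<close>

lemma dual_system_genus_0:
  assumes e1: "e = 1" and m: "m \<ge> 1"
  shows "\<exists>B \<phi>. dual_system CC Cv m B \<phi> \<and> card B = 0"
proof -
  have "\<exists>B \<phi>. dual_system CC Cv m B \<phi> \<and> card B \<le> 0 \<and>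
    (\<forall>R. fs.independent R \<and> R \<subseteq> case_prod ` holo_diff CC Cv m \<longrightarrow> card R \<le> card B)"
  proof (rule exists_dual_system[where \<Lambda> = "\<lambda>_ _. 0" and N = 0])
    fix f assume f: "f \<in> holo_diff CC Cv m"
    obtain M where M0: "M \<ge> 0" "\<forall>x. cmod x \<ge> 1 \<longrightarrow> cmod (AA m f False x) * cmod x ^ (2 * m) \<le> M * cmod x ^ (e * m)"
      "\<forall>x. cmod x \<ge> 1 \<longrightarrow> cmod (DD m f False x) * cmod x ^ (2 * m) \<le> 2 * M * cmod x ^ (e * m + e)"
      using AD_bound[OF f, of False] by (elim exE conjE)
    note M = M0(1) M0(2)[rule_format] M0(3)[rule_format]
    note h = AD_entire[OF f, of False]
    have D: "DD m f False x = DD m f False 0" for x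
    proof -
      have "cmod (DD m f False x) * cmod x ^ (2 * m) \<le> 2 * M * cmod x ^ (2 * m + 0)" if x: "cmod x \<ge> 1" for x
      proof -
        have "cmod x ^ (e * m + e) \<le> cmod x ^ (2 * m)" using x m e1 by (intro power_increasing) auto
        then have "2 * M * cmod x ^ (e * m + e) \<le> 2 * M * cmod x ^ (2 * m)" using M(1) by (intro mult_left_mono) auto
        then show ?thesis using M(3)[OF x] by simp
      qed
      from entire_degree_le[OF h(2) this] show ?thesis by simp
    qed
    \<comment> \<open>\<open>\<i>\<close> is a branch point of the conic, and \<open>DD\<close> has
      the factor \<open>rt\<close>.\<close>
    have "rt \<i> = 0" unfolding rt_def by (simp add: e1)
    then have D0: "DD m f False x = 0" for x using D[of x] D[of \<i>] by (simp add: DD_def)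
    have A: "AA m f False x = AA m f False 0" for x
    proof -
      have "cmod (AA m f False x) * cmod x ^ (2 * m) \<le> M * cmod x ^ (2 * m + 0)" if x: "cmod x \<ge> 1" for x
      proof -
        have "cmod x ^ (e * m) \<le> cmod x ^ (2 * m)" using x m e1 by (intro power_increasing) auto
        then have "M * cmod x ^ (e * m) \<le> M * cmod x ^ (2 * m)" using M(1) by (intro mult_left_mono) auto
        then show ?thesis using M(2)[OF x] by simp
      qed
      from entire_degree_le[OF h(1) this] show ?thesis by simp
    qed
    have "x * AA m f False x = 0 * AA m f False 0" for x
    proof -
      have h': "(\<lambda>x. x * AA m f False x) holomorphic_on UNIV" using h(1) by (intro holomorphic_intros)
      have "cmod (x * AA m f False x) * cmod x ^ (2 * m) \<le> M * cmod x ^ (2 * m + 0)" if x: "cmod x \<ge> 1" for x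
      proof -
        have "cmod x * (cmod (AA m f False x) * cmod x ^ (2 * m)) \<le> cmod x * (M * cmod x ^ (e * m))"
          using M(2)[OF x] by (rule mult_left_mono) simp
        also have "\<dots> = M * cmod x ^ Suc m" by (simp add: e1)
        also have "\<dots> \<le> M * cmod x ^ (2 * m)" using M(1) x m by (intro mult_left_mono power_increasing) auto
        finally show ?thesis by (simp add: norm_mult mult.assoc)
      qed
      from entire_degree_le[OF h' this] show ?thesis by simp
    qed
    from this[of 1] have "AA m f False 1 = 0" by simp
    then have A0: "AA m f False x = 0" for x using A[of x] A[of 1] by simp
    show "f = (\<lambda>_ _. 0)"
      by (rule vl_zero[OF f]) (metis A0 D0 AD_zero prod.collapse)
  qed simp
  then show ?thesis by auto
qed

text \<open>A nonzero polynomial of degree at most \<open>n\<close> cannot have the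
  \<open>n + 1\<close> roots \<open>0, ..., n\<close>.\<close>

lemma vanishing_degree:
  fixes F :: "complex \<Rightarrow> complex"
  assumes "\<And>x. F x = (\<Sum>i\<le>n. c i * x ^ i)" "\<And>j. j \<le> n \<Longrightarrow> F (of_nat j) = 0"
  shows "F x = 0"
proof -
  have "c k = 0" if k: "k \<le> n" for k
  proof (rule ccontr)
    assume "c k \<noteq> 0"
    then have ex: "\<exists>k. k \<le> n \<and> c k \<noteq> 0" using k by blast
    have fin: "finite {z. (\<Sum>i\<le>n. c i * z ^ i) = 0}" "card {z. (\<Sum>i\<le>n. c i * z ^ i) = 0} \<le> n"
      using polyfun_rootbound[OF ex] by blast+
    have "of_nat ` {..n} \<subseteq> {z. (\<Sum>i\<le>n. c i * z ^ i) = 0}" using assms by auto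
    then have "card ((of_nat :: nat \<Rightarrow> complex) ` {..n}) \<le> n" using card_mono[OF fin(1)] fin(2) le_trans by blast
    then show False by (simp add: card_image inj_on_def)
  qed
  then show ?thesis unfolding assms(1) by simp
qed

lemma vl_lin: "vl m (\<lambda>c q. a * f c q + b * g c q) \<sigma> v = a * vl m f \<sigma> v + b * vl m g \<sigma> v"
  by (simp add: vl_def add_divide_distrib)

lemma vl_sum: "vl m (\<lambda>c q. \<Sum>i\<in>I. k i * f i c q) \<sigma> v = (\<Sum>i\<in>I. k i * vl m (f i) \<sigma> v)"
  by (simp add: vl_def sum_divide_distrib)

text \<open>For \<open>e = 3\<close> the degrees of \<open>AA\<close> and \<open>DD\<close> are at
  most \<open>m\<close> and \<open>m + 3\<close>, so the values on both sheets over the integers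
  \<open>0, ..., m + 3\<close> determine a differential: this is the bound
  \<open>2 * (m + 4)\<close>. Conversely \<open>x ^ i\<close> times the m-th power of
  \<open>dx / y\<close> is holomorphic for \<open>i \<le> m\<close>, which gives
  \<open>m + 1\<close> independent differentials.\<close>

lemma dual_system_genus_2:
  assumes e3: "e = 3"
  shows "\<exists>B \<phi>. dual_system CC Cv m B \<phi> \<and> m + 1 \<le> card B \<and> card B \<le> 2 * m + 8"
proof -
  \<comment> \<open>The first \<open>m + 4\<close> functionals evaluate on the sheet
    \<open>rt\<close>, the others on \<open>- rt\<close>.\<close>
  let ?L = "\<lambda>j f. if j < m + 4 then vl m f False (of_nat j, rt (of_nat j))
     else vl m f False (of_nat (j - (m + 4)), - rt (of_nat (j - (m + 4))))"
  have "\<exists>B \<phi>. dual_system CC Cv m B \<phi> \<and> card B \<le> 2 * m + 8 \<and>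
    (\<forall>R. fs.independent R \<and> R \<subseteq> case_prod ` holo_diff CC Cv m \<longrightarrow> card R \<le> card B)"
  proof (rule exists_dual_system[where \<Lambda> = ?L and N = "2 * m + 8"])
    show "?L j (\<lambda>c q. a * f c q + b * g c q) = a * ?L j f + b * ?L j g" for j f g a b
      by (simp add: vl_lin)
    fix f assume f: "f \<in> holo_diff CC Cv m" and z: "\<And>j. j < 2 * m + 8 \<Longrightarrow> ?L j f = 0"
    have z1: "vl m f False (of_nat j, rt (of_nat j)) = 0" if "j \<le> m + 3" for j using z[of j] that by simp
    have z2: "vl m f False (of_nat j, - rt (of_nat j)) = 0" if "j \<le> m + 3" for j using z[of "j + (m + 4)"] that by simp
    obtain M where M0: "M \<ge> 0" "\<forall>x. cmod x \<ge> 1 \<longrightarrow> cmod (AA m f False x) * cmod x ^ (2 * m) \<le> M * cmod x ^ (e * m)"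
      "\<forall>x. cmod x \<ge> 1 \<longrightarrow> cmod (DD m f False x) * cmod x ^ (2 * m) \<le> 2 * M * cmod x ^ (e * m + e)"
      using AD_bound[OF f, of False] by (elim exE conjE)
    note M = M0(1) M0(2)[rule_format] M0(3)[rule_format]
    note h = AD_entire[OF f, of False]
    have ex: "e * m = 2 * m + m" "e * m + e = 2 * m + (m + 3)" using e3 by simp_all
    have A: "AA m f False x = 0" for x
      by (rule vanishing_degree[OF entire_degree_le[OF h(1) M(2)[unfolded ex(1)]]]) (simp_all add: AA_def z1 z2)
    have D: "DD m f False x = 0" for x
      by (rule vanishing_degree[OF entire_degree_le[OF h(2) M(3)[unfolded ex(2)]]]) (simp_all add: DD_def z1 z2)
    show "f = (\<lambda>_ _. 0)"
      by (rule vl_zero[OF f]) (metis A D AD_zero prod.collapse)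
  qed
  then obtain B \<phi> where B: "dual_system CC Cv m B \<phi>" "card B \<le> 2 * m + 8"
    and R: "\<forall>R. fs.independent R \<and> R \<subseteq> case_prod ` holo_diff CC Cv m \<longrightarrow> card R \<le> card B"
    by (elim exE conjE)
  \<comment> \<open>The coefficient \<open>x ^ i\<close>. In the other copy inversion and the factor
    \<open>- x\<close> per weight turn it into \<open>(- 1) ^ m * x ^ (m - i)\<close>, a polynomial
    because \<open>i \<le> m\<close>.\<close>
  define h where "h = (\<lambda>i \<sigma> (v :: complex \<times> complex). if \<sigma> then (- 1) ^ m * fst v ^ (m - i) else fst v ^ i)"
  have sw: "h i \<sigma> (x, y) = h i (\<not> \<sigma>) (1 / x, y / x ^ e) * (- (x ^ e / x\<^sup>2)) ^ m"
    if i: "i \<le> m" and x: "x \<noteq> 0" for i \<sigma> x y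
  proof -
    have xx: "x ^ e / x\<^sup>2 = x" using x unfolding e3 by (simp add: power3_eq_cube power2_eq_square)
    have xm: "x ^ m = x ^ (m - i) * x ^ i" using i by (simp add: power_add[symmetric])
    have neg: "(- x) ^ m = (- 1) ^ m * x ^ m" by (rule power_minus)
    have sq: "(- 1) ^ m * (- 1) ^ m = (1::complex)" by (simp add: power_mult_distrib[symmetric])
    show ?thesis
    proof (cases \<sigma>)
      case True
      have "(1 / x) ^ i * ((- 1) ^ m * (x ^ (m - i) * x ^ i)) = (- 1) ^ m * x ^ (m - i)"
        using x by (simp add: power_divide)
      then show ?thesis unfolding h_def xx neg xm using True by simp
    next
      case False
      have "(- 1) ^ m * (1 / x) ^ (m - i) * ((- 1) ^ m * (x ^ (m - i) * x ^ i)) =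
          ((- 1) ^ m * (- 1) ^ m) * ((1 / x) ^ (m - i) * x ^ (m - i)) * x ^ i"
        by (simp only: mult.assoc mult.commute mult.left_commute)
      also have "(1 / x) ^ (m - i) * x ^ (m - i) = 1" using x by (simp add: power_divide)
      finally show ?thesis unfolding h_def xx neg xm sq using False by simp
    qed
  qed
  have hd: "sct m (h i) \<in> holo_diff CC Cv m" if "i \<le> m" for i
  proof (rule sct_holo)
    show "(\<lambda>z. h i \<sigma> (aa u z, bb u z)) holomorphic_on WW u" for \<sigma> u
      unfolding h_def using aa_holo[of u] by (cases \<sigma>) (auto intro!: holomorphic_intros)
  qed (rule sw[OF that])
  have val: "vl m (sct m (h i)) False (x, rt x) = x ^ i" if "i \<le> m" for i x
    using vl_sct[where h = "h i", OF rt_aff(1)[of x] sw[OF that]] by (simp add: h_def)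
  let ?b = "\<lambda>i. case_prod (sct m (h i))"
  have inj: "inj_on ?b {..m}"
  proof (rule inj_onI)
    fix i j assume ij: "i \<in> {..m}" "j \<in> {..m}" "?b i = ?b j"
    have "sct m (h i) = sct m (h j)" using ij(3) by (metis curry_case_prod)
    then have "(2::complex) ^ i = 2 ^ j" using val[of i 2] val[of j 2] ij by simp
    then have "of_nat (2 ^ i) = (of_nat (2 ^ j) :: complex)" by simp
    then have "(2::nat) ^ i = 2 ^ j" by (simp only: of_nat_eq_iff)
    then show "i = j" by simp
  qed
  have "fs.independent (?b ` {..m})"
  proof (rule fs.independent_if_scalars_zero)
    fix u x assume z: "(\<Sum>x\<in>?b ` {..m}. scf (u x) x) = 0" and "x \<in> ?b ` {..m}"
    then obtain i where i: "i \<le> m" "x = ?b i" by blast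
    have "(\<Sum>i\<le>m. scf (u (?b i)) (?b i)) = 0" using z unfolding sum.reindex[OF inj] by (simp only: o_def)
    then have "(\<Sum>i\<le>m. scf (u (?b i)) (?b i)) (c, q) = 0" for c q by (simp only: zero_fun_apply)
    then have "(\<Sum>i\<le>m. u (?b i) * sct m (h i) c q) = 0" for c q by (simp add: sum_fun_apply scf_def)
    then have z': "(\<lambda>c q. \<Sum>i\<le>m. u (?b i) * sct m (h i) c q) = (\<lambda>_ _. 0)" by (intro ext)
    have "(\<Sum>i\<le>m. u (?b i) * x ^ i) = 0" for x
    proof -
      have "(\<Sum>i\<le>m. u (?b i) * x ^ i) = vl m (\<lambda>c q. \<Sum>i\<le>m. u (?b i) * sct m (h i) c q) False (x, rt x)"
        unfolding vl_sum by (intro sum.cong refl) (simp add: val)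
      also have "\<dots> = 0" unfolding z' by (simp add: vl_def)
      finally show ?thesis .
    qed
    then have "u (?b i) = 0" using polyfun_eq_0[of "\<lambda>i. u (?b i)" m] i(1) by blast
    then show "u x = 0" unfolding i(2) .
  qed simp
  moreover have "?b ` {..m} \<subseteq> case_prod ` holo_diff CC Cv m" using hd by blast
  ultimately have "card (?b ` {..m}) \<le> card B" using R by blast
  then have "m + 1 \<le> card B" unfolding card_image[OF inj] by simp
  then show ?thesis using B by blast
qed

text \<open>The indicator function of a clopen part is a differential of weight 0. The growth bound
  makes the mean \<open>AA\<close> over its two sheets constant; at a branch point the sheets meet,
  so the mean is 0 or 1 and both sheets carry this value everywhere. Inversion links the two
  copies.\<close>

lemma connected_Cv: "connected Cv"
  unfolding connected_openin
proof (intro notI)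
  assume "\<exists>E1 E2. openin (top_of_set Cv) E1 \<and> openin (top_of_set Cv) E2 \<and> Cv \<subseteq> E1 \<union> E2 \<and> E1 \<inter> E2 = {} \<and> E1 \<noteq> {} \<and> E2 \<noteq> {}"
  then obtain E1 E2 where o: "openin (top_of_set Cv) E1" "openin (top_of_set Cv) E2"
    and E: "Cv \<subseteq> E1 \<union> E2" "E1 \<inter> E2 = {}" "E1 \<noteq> {}" "E2 \<noteq> {}" by blast
  have sub: "E1 \<subseteq> Cv" "E2 \<subseteq> Cv" using o openin_imp_subset by blast+
  define f where "f = (\<lambda>(c :: rpt rchart) q. if c \<in> CC \<and> q \<in> fst c \<inter> Cv \<and> q \<in> E1 then 1 else 0 :: complex)"
  have f: "f \<in> holo_diff CC Cv 0"
    unfolding holo_diff_def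
  proof (intro CollectI conjI allI impI ballI)
    fix c assume c: "c \<in> CC"
    have lc: "(\<lambda>z. f c (rinv c z)) field_differentiable at z"
      if z: "z \<in> snd c ` (fst c \<inter> E)" and oE: "openin (top_of_set Cv) E" and k: "\<And>q. q \<in> fst c \<inter> E \<Longrightarrow> f c q = k" for z E k
    proof -
      have "((\<lambda>z. k) has_field_derivative 0) (at z)" by simp
      then have "((\<lambda>z. f c (rinv c z)) has_field_derivative 0) (at z)"
      proof (rule has_field_derivative_transform_within_open)
        show "open (snd c ` (fst c \<inter> E))" by (rule rs_open_image[OF curve_atlas c oE])
        fix w assume "w \<in> snd c ` (fst c \<inter> E)"
        then obtain q where q: "q \<in> fst c \<inter> E" "w = snd c q" by blast
        then have "rinv c w = q" using rinv_snd[OF curve_atlas c, of q] by blast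
        then show "k = f c (rinv c w)" using k[OF q(1)] by simp
      qed (rule z)
      then show ?thesis unfolding field_differentiable_def by blast
    qed
    show "(\<lambda>z. f c (rinv c z)) holomorphic_on snd c ` (fst c \<inter> Cv)"
      unfolding holomorphic_on_def
    proof
      fix z assume "z \<in> snd c ` (fst c \<inter> Cv)"
      then have "z \<in> snd c ` (fst c \<inter> E1) \<or> z \<in> snd c ` (fst c \<inter> E2)" using E(1) by blast
      then have "(\<lambda>z. f c (rinv c z)) field_differentiable at z"
      proof
        assume z: "z \<in> snd c ` (fst c \<inter> E1)"
        show ?thesis by (rule lc[OF z o(1), of 1]) (use sub c in \<open>auto simp: f_def\<close>)
      next
        assume z: "z \<in> snd c ` (fst c \<inter> E2)"
        show ?thesis by (rule lc[OF z o(2), of 0]) (use E(2) in \<open>auto simp: f_def\<close>)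
      qed
      then show "(\<lambda>z. f c (rinv c z)) field_differentiable at z within snd c ` (fst c \<inter> Cv)"
        by (rule field_differentiable_at_within)
    qed
  qed (auto simp: f_def)
  have vf: "vl 0 f \<sigma> (x, y) = (if fl \<sigma> (emb e x y) \<in> E1 then 1 else 0)" if v: "(x, y) \<in> aff" for \<sigma> x y
    using PP_in[OF v, of \<sigma>] CH_CC[OF v, of \<sigma>] Cv_emb[OF v, of \<sigma>] by (simp add: vl_def f_def)
  \<comment> \<open>A branch point: its power with exponent \<open>2 * e\<close> is -1.\<close>
  define x0 where "x0 = cis (pi / real (2 * e))"
  have "x0 ^ (2 * e) = cis (real (2 * e) * (pi / real (2 * e)))" unfolding x0_def by (rule Complex.DeMoivre)
  also have "real (2 * e) * (pi / real (2 * e)) = pi" using e by simp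
  finally have "rt x0 = 0" by (simp add: rt_def)
  then have x0: "(x0, 0) \<in> aff" "AA 0 f \<sigma> x0 = vl 0 f \<sigma> (x0, 0)" for \<sigma>
    using rt_aff(1)[of x0] by (simp_all add: AA_def)
  have const: "vl 0 f \<sigma> (x, y) = vl 0 f \<sigma> (x0, 0)" if v: "(x, y) \<in> aff" for \<sigma> x y
  proof -
    obtain M where "\<forall>x. cmod x \<ge> 1 \<longrightarrow> cmod (AA 0 f \<sigma> x) * cmod x ^ (2 * 0) \<le> M * cmod x ^ (e * 0)"
      using AD_bound[OF f, of \<sigma>] by (elim exE conjE)
    note M = this[rule_format]
    have "AA 0 f \<sigma> x = AA 0 f \<sigma> 0" for x
    proof -
      have "cmod (AA 0 f \<sigma> x) * cmod x ^ (2 * 0) \<le> M * cmod x ^ (2 * 0 + 0)" if "cmod x \<ge> 1" for x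
        using M[OF that] by simp
      from entire_degree_le[OF AD_entire(1)[OF f] this] show ?thesis by simp
    qed
    then have "AA 0 f \<sigma> x = vl 0 f \<sigma> (x0, 0)" using x0(2) by metis
    then have s: "vl 0 f \<sigma> (x, rt x) + vl 0 f \<sigma> (x, - rt x) = 2 * vl 0 f \<sigma> (x0, 0)" by (simp add: AA_def)
    show ?thesis using aff_rt[OF v] s vf[OF rt_aff(1)[of x], of \<sigma>] vf[OF rt_aff(2)[of x], of \<sigma>] vf[OF x0(1), of \<sigma>]
      by (auto split: if_splits)
  qed
  have sw: "vl 0 f True (x0, 0) = vl 0 f False (x0, 0)"
    using vl_swap[OF f rt_aff(1)[of 1], of True] const[OF rt_aff(1)[of 1], of True]
      const[OF aff_inv[OF rt_aff(1)[of 1]], of False] by simp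
  obtain q1 q2 where q: "q1 \<in> E1" "q2 \<in> E2" using E(3,4) by blast
  then have "q1 \<in> Cv" "q2 \<in> Cv" "q2 \<notin> E1" using sub E(2) by blast+
  then obtain \<sigma> x y \<tau> x' y' where p: "q1 = fl \<sigma> (emb e x y)" "(x, y) \<in> aff" "q2 = fl \<tau> (emb e x' y')" "(x', y') \<in> aff"
    unfolding Cv_def by blast
  have "vl 0 f \<sigma> (x, y) = 1" "vl 0 f \<tau> (x', y') = 0"
    using vf[OF p(2), of \<sigma>] vf[OF p(4), of \<tau>] p(1,3) q \<open>q2 \<notin> E1\<close> by simp_all
  then have "vl 0 f \<sigma> (x0, 0) = 1" "vl 0 f \<tau> (x0, 0) = 0" using const[OF p(2), of \<sigma>] const[OF p(4), of \<tau>] by simp_all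
  then show False using sw by (cases \<sigma>; cases \<tau>) simp_all
qed

lemma curve_riemann_surface: "riemann_surface Cv CC"
  unfolding riemann_surface_def using curve_atlas compact_Cv connected_Cv Cv_emb[OF rt_aff(1)] by blast

end

section \<open>The examples\<close>

text \<open>A point has seven real coordinates; numbers above 6 repeat the last one, so that every
  pair coded by \<open>prod_encode\<close> has a meaning in \<open>renc\<close>.\<close>

definition rcoord :: "nat \<Rightarrow> rpt \<Rightarrow> real" where
  "rcoord j p = (if j = 0 then Re (fst p) else if j = 1 then Im (fst p) else if j = 2 then ht p
     else if j = 3 then Re (fst (snd (snd p))) else if j = 4 then Im (fst (snd (snd p)))
     else if j = 5 then Re (snd (snd (snd p))) else Im (snd (snd (snd p))))"

definition renc :: "(nat \<Rightarrow> rpt) \<Rightarrow> nat \<Rightarrow> real" where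
  "renc q k = rcoord (snd (prod_decode k)) (q (fst (prod_decode k)))"

definition rdec :: "(nat \<Rightarrow> real) \<Rightarrow> nat \<Rightarrow> rpt" where
  "rdec x i = (Complex (x (prod_encode (i, 0))) (x (prod_encode (i, 1))), x (prod_encode (i, 2)),
     Complex (x (prod_encode (i, 3))) (x (prod_encode (i, 4))),
     Complex (x (prod_encode (i, 5))) (x (prod_encode (i, 6))))"

lemma rdec_renc: "rdec (renc q) = q"
  by (rule ext) (simp add: rdec_def renc_def rcoord_def ht_def prod_eq_iff)

lemma cont_renc: "continuous_on UNIV renc"
proof (rule continuous_on_coordinatewise_then_product)
  fix k
  have r: "continuous_on UNIV (rcoord j)" for j
  proof -
    have if_cont: "continuous_on UNIV (\<lambda>p. if b then f p else g p)"
      if "continuous_on UNIV f" "continuous_on UNIV g" for b and f g :: "rpt \<Rightarrow> real"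
      using that by (cases b) simp_all
    show ?thesis unfolding rcoord_def ht_def by (intro if_cont continuous_intros)
  qed
  have "continuous_on UNIV (\<lambda>q::nat \<Rightarrow> rpt. q (fst (prod_decode k)))" by (rule continuous_on_product_coordinates)
  from continuous_on_compose2[OF r this subset_UNIV] show "continuous_on UNIV (\<lambda>q. renc q k)" unfolding renc_def .
qed

lemma cont_rdec: "continuous_on UNIV rdec"
  by (rule continuous_on_coordinatewise_then_product)
    (unfold rdec_def Complex_eq, intro continuous_intros continuous_on_product_coordinates)

lemma product_with_torus:
  fixes S :: "nat \<Rightarrow> rpt set" and C :: "nat \<Rightarrow> rpt rchart set" and G :: "rpt \<Rightarrow> real" and d :: "nat \<Rightarrow> nat \<Rightarrow> nat"
  assumes n: "n \<ge> 2" and rs: "\<And>l. l < n \<Longrightarrow> riemann_surface (S l) (C l)"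
    and last: "S (n - 1) = Tset" "C (n - 1) = range Tchart"
    and G_pos: "\<And>q. G q > 0"
    and G_smooth: "\<And>c d W l. c \<in> C 0 \<Longrightarrow> openin (Euclidean_space d) W \<Longrightarrow> Suc (2 * l) < d \<Longrightarrow>
      (\<And>x. x \<in> W \<Longrightarrow> zc l x \<in> snd c ` fst c) \<Longrightarrow> smooth_on d W (\<lambda>x. G (rinv c (zc l x)))"
    and G_nonconst: "\<exists>c\<in>C 0. \<exists>V. open V \<and> V \<noteq> {} \<and> V \<subseteq> snd c ` fst c \<and>
      (\<forall>z\<in>V. vector_derivative (\<lambda>t. (G (rinv c (Complex t (Im z))))\<^sup>2) (at (Re z)) \<noteq> 0)"
    and dims: "\<And>m l. m \<ge> 1 \<Longrightarrow> l < n - 1 \<Longrightarrow> \<exists>B \<phi>. dual_system (C l) (S l) m B \<phi> \<and> card B = d l m"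
  shows "\<exists>(X :: (nat \<Rightarrow> real) topology) A J. almost_complex_manifold n X A J \<and> compact_space X \<and> connected_space X \<and>
    \<not> integrable_acs n X A J \<and> (\<forall>m\<ge>1. plurigenus n X A J m = (\<Prod>l<n - 1. d l m))"
proof -
  have self: "w \<in> Tdom w" for w by (simp add: Tdom_def)
  have sp: "surface_product n S C G renc rdec"
  proof (rule surface_product.intro)
    show "2 \<le> n" by (rule n)
    show "riemann_surface (S l) (C l)" if "l < n" for l by (rule rs[OF that])
    show "tder c c' q = 1" if "c \<in> C (n - 1)" "c' \<in> C (n - 1)" "q \<in> fst c" "q \<in> fst c'" for c c' q
    proof -
      obtain w w' where "c = Tchart w" "c' = Tchart w'" using \<open>c \<in> C (n - 1)\<close> \<open>c' \<in> C (n - 1)\<close> unfolding last by blast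
      then show ?thesis using torus_tder \<open>q \<in> fst c\<close> \<open>q \<in> fst c'\<close> by blast
    qed
    show "rdec (renc q) = q" for q by (rule rdec_renc)
    show "continuous_on UNIV renc" by (rule cont_renc)
    show "continuous_on UNIV rdec" by (rule cont_rdec)
    show "G q > 0" for q by (rule G_pos)
  qed (rule G_smooth G_nonconst; assumption)+
  have "surface_product_torus n S C G renc rdec Tpt Tchart"
  proof (rule surface_product_torus.intro[OF sp], rule surface_product_torus_axioms.intro)
    show "Tchart w \<in> C (n - 1)" for w unfolding last by blast
    show "Tpt w \<in> fst (Tchart w)" for w using self[of w] by (simp add: Tchart_def)
    show "snd (Tchart w) (Tpt w) = w" for w using Tcoord_Tpt[OF self] by (simp add: Tchart_def)
    show "rinv (Tchart w) z = Tpt z" if "z \<in> snd (Tchart w) ` fst (Tchart w)" for w z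
      by (rule rinv_Tchart) (use that in \<open>simp only: Tchart_image\<close>)
    show "S (n - 1) = range Tpt" unfolding last Tset_def ..
    show "Tpt (w + complex_of_real (2 * pi)) = Tpt w" for w by (rule Tpt_periodic)
    show "Tpt (w + \<i> * complex_of_real (2 * pi)) = Tpt w" for w by (rule Tpt_periodic)
  qed
  then interpret st: surface_product_torus n S C G renc rdec Tpt Tchart .
  have "plurigenus n (top_of_set st.K) st.A st.J m = (\<Prod>l<n - 1. d l m)" if m: "m \<ge> 1" for m
  proof -
    have "\<forall>l. \<exists>B\<phi>. l < n - 1 \<longrightarrow> dual_system (C l) (S l) m (fst B\<phi>) (snd B\<phi>) \<and> card (fst B\<phi>) = d l m"
    proof
      fix l show "\<exists>B\<phi>. l < n - 1 \<longrightarrow> dual_system (C l) (S l) m (fst B\<phi>) (snd B\<phi>) \<and> card (fst B\<phi>) = d l m"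
      proof (cases "l < n - 1")
        case True
        obtain B \<phi> where "dual_system (C l) (S l) m B \<phi>" "card B = d l m" using dims[OF m True] by (elim exE conjE)
        then show ?thesis by (intro exI[of _ "(B, \<phi>)"]) simp
      qed simp
    qed
    from choice[OF this] obtain b where b: "\<forall>l. l < n - 1 \<longrightarrow> dual_system (C l) (S l) m (fst (b l)) (snd (b l)) \<and> card (fst (b l)) = d l m"
      by (elim exE)
    have "plurigenus n (top_of_set st.K) st.A st.J m = (\<Prod>l<n - 1. card (fst (b l)))"
      by (rule st.plurigenus_eq[OF m, where B = "\<lambda>l. fst (b l)" and \<phi> = "\<lambda>l. snd (b l)"]) (use b in blast)
    also have "\<dots> = (\<Prod>l<n - 1. d l m)" using b by (intro prod.cong) auto
    finally show ?thesis .
  qed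
  then show ?thesis using st.almost_complex_manifold st.compact_connected st.not_integrable
    by (intro exI[of _ "top_of_set st.K"] exI[of _ st.A] exI[of _ st.J] conjI allI impI)
qed

text \<open>For \<open>H = 1 + f^2\<close> the derivative of the square is
  \<open>4 * (1 + f^2) * f\<close> times that of \<open>f\<close>, and all factors are
  nonzero.\<close>

lemma vector_derivative_nz:
  fixes f H :: "real \<Rightarrow> real"
  assumes f: "(f has_real_derivative D) (at t)" and nz: "f t \<noteq> 0" "D \<noteq> 0"
    and T: "open T" "t \<in> T" and H: "\<And>s. s \<in> T \<Longrightarrow> H s = 1 + (f s)\<^sup>2"
  shows "vector_derivative (\<lambda>s. (H s)\<^sup>2) (at t) \<noteq> 0"
proof -
  let ?E = "2 * (1 + (f t)\<^sup>2) * (2 * f t * D)"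
  have "((\<lambda>s. (1 + (f s)\<^sup>2)\<^sup>2) has_real_derivative ?E) (at t)"
    using f by (auto intro!: derivative_eq_intros)
  then have "((\<lambda>s. (H s)\<^sup>2) has_real_derivative ?E) (at t)"
    by (rule has_field_derivative_transform_within_open[OF _ T]) (simp add: H)
  then have "vector_derivative (\<lambda>s. (H s)\<^sup>2) (at t) = ?E"
    by (intro vector_derivative_at) (simp add: has_real_derivative_iff_has_vector_derivative)
  moreover have "1 + (f t)\<^sup>2 \<noteq> 0" by (smt (verit) zero_le_power2)
  ultimately show ?thesis using nz by simp
qed

lemma torus_G_smooth:
  assumes c: "c \<in> range Tchart" and W: "openin (Euclidean_space d) W" and z: "\<And>x. x \<in> W \<Longrightarrow> zc l x \<in> snd c ` fst c"
  shows "smooth_on d W (\<lambda>x. 1 + (Re (fst (rinv c (zc l x))))\<^sup>2)"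
proof -
  obtain w where w: "c = Tchart w" using c by blast
  \<comment> \<open>Smoothness is at hand for holomorphic functions of \<open>z\<close> and their
    conjugates, so \<open>cis (Re z)\<close> is written as a product of the two kinds.\<close>
  have cis: "cis (Re z) = exp (\<i> * z / 2) * cnj (exp (- (\<i> * z / 2)))" for z
  proof -
    have "\<i> * z / 2 + cnj (- (\<i> * z / 2)) = \<i> * complex_of_real (Re z)" by (simp add: complex_eq_iff)
    then show ?thesis unfolding exp_cnj exp_add[symmetric] cis_conv_exp by (simp only:)
  qed
  have hol: "(\<lambda>z. exp (\<i> * z / 2)) holomorphic_on UNIV" "(\<lambda>z. exp (- (\<i> * z / 2))) holomorphic_on UNIV"
    by (intro holomorphic_intros; simp)+
  have "smooth_on d W (\<lambda>x. exp (\<i> * zc l x / 2))" "smooth_on d W (\<lambda>x. exp (- (\<i> * zc l x / 2)))"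
    by (rule smooth_on_holomorphic[OF W open_UNIV UNIV_I hol(1)], rule smooth_on_holomorphic[OF W open_UNIV UNIV_I hol(2)])
  then have "smooth_on d W (\<lambda>x. exp (\<i> * zc l x / 2) * cnj (exp (- (\<i> * zc l x / 2))))"
    by (intro smooth_on_mult[OF W] smooth_on_linear[OF W bounded_linear_cnj])
  then have r: "smooth_on d W (\<lambda>x. Re (exp (\<i> * zc l x / 2) * cnj (exp (- (\<i> * zc l x / 2)))))"
    by (rule smooth_on_linear[OF W bounded_linear_Re])
  have s: "smooth_on d W (\<lambda>x. 1 + Re (exp (\<i> * zc l x / 2) * cnj (exp (- (\<i> * zc l x / 2)))) *
      Re (exp (\<i> * zc l x / 2) * cnj (exp (- (\<i> * zc l x / 2)))))"
    by (intro smooth_on_add[OF W] smooth_on_const[OF W] smooth_on_mult[OF W] r)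
  have eq: "1 + (Re (fst (rinv c (zc l x))))\<^sup>2 = 1 + Re (exp (\<i> * zc l x / 2) * cnj (exp (- (\<i> * zc l x / 2)))) *
      Re (exp (\<i> * zc l x / 2) * cnj (exp (- (\<i> * zc l x / 2))))" if "x \<in> W" for x
  proof -
    have "zc l x \<in> Tdom w" using z[OF that] unfolding w Tchart_image .
    then have "fst (rinv c (zc l x)) = cis (Re (zc l x))" unfolding w by (simp only: rinv_Tchart) (simp add: Tpt_def)
    then show ?thesis unfolding cis by (simp only: power2_eq_square)
  qed
  show ?thesis by (rule smooth_on_cong[OF W, THEN iffD2, OF _ s]) (rule eq)
qed

lemma torus_G_nonconst:
  "\<exists>c\<in>range Tchart. \<exists>V. open V \<and> V \<noteq> {} \<and> V \<subseteq> snd c ` fst c \<and>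
    (\<forall>z\<in>V. vector_derivative (\<lambda>t. (1 + (Re (fst (rinv c (Complex t (Im z)))))\<^sup>2)\<^sup>2) (at (Re z)) \<noteq> 0)"
proof (intro bexI exI conjI ballI)
  \<comment> \<open>A rectangle inside one chart on which \<open>cos\<close> and \<open>sin\<close>
    of the real part are both nonzero.\<close>
  let ?V = "{z. 0 < Re z \<and> Re z < pi / 2 \<and> - pi < Im z \<and> Im z < pi}"
  show "open ?V" by (intro open_Collect_conj open_Collect_less continuous_intros)
  have "Complex (pi / 4) 0 \<in> ?V" by simp
  then show "?V \<noteq> {}" by blast
  have sub: "?V \<subseteq> Tdom 0" unfolding Tdom_def using pi_gt_zero by auto
  then show "?V \<subseteq> snd (Tchart 0) ` fst (Tchart 0)" unfolding Tchart_image .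
  fix z assume z: "z \<in> ?V"
  show "vector_derivative (\<lambda>t. (1 + (Re (fst (rinv (Tchart 0) (Complex t (Im z)))))\<^sup>2)\<^sup>2) (at (Re z)) \<noteq> 0"
  proof (rule vector_derivative_nz[where f = cos and D = "- sin (Re z)" and T = "{0<..<pi / 2}"])
    show "(cos has_real_derivative - sin (Re z)) (at (Re z))" by (rule DERIV_cos)
    show "cos (Re z) \<noteq> 0" "- sin (Re z) \<noteq> 0"
      using cos_gt_zero_pi[of "Re z"] sin_gt_zero[of "Re z"] z pi_gt_zero by auto
    fix s :: real assume "s \<in> {0<..<pi / 2}"
    then have "Complex s (Im z) \<in> Tdom 0" using sub z by (intro subsetD[OF sub]) simp
    then show "1 + (Re (fst (rinv (Tchart 0) (Complex s (Im z)))))\<^sup>2 = 1 + (cos s)\<^sup>2"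
      by (simp add: rinv_Tchart Tpt_def)
  qed (use z in auto)
qed simp

context curve
begin

text \<open>The flip negates the height, so its square is given by one formula in both copies; this
  is why \<open>G\<close> is built from the square.\<close>

lemma ht_PP: "(ht (PP (\<sigma>, u) z))\<^sup>2 = ((1 - (cmod (aa u z))\<^sup>2) / (1 + (cmod (aa u z))\<^sup>2))\<^sup>2"
proof -
  have "(ht (fl \<sigma> p))\<^sup>2 = (ht p)\<^sup>2" for p by (cases \<sigma>) (simp_all add: ht_fl)
  then show ?thesis by (simp add: PP_def) (simp add: ht_def emb_def)
qed

lemma curve_G_smooth:
  assumes c: "c \<in> CC" and W: "openin (Euclidean_space d) W" and z: "\<And>x. x \<in> W \<Longrightarrow> zc l x \<in> snd c ` fst c"
  shows "smooth_on d W (\<lambda>x. 1 + (ht (rinv c (zc l x)))\<^sup>2)"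
proof -
  obtain \<sigma> u where u: "c = CH (\<sigma>, u)" using c unfolding CC_def by auto
  have zW: "zc l x \<in> WW u" if "x \<in> W" for x using z[OF that] unfolding u CH_image by simp
  have a: "smooth_on d W (\<lambda>x. aa u (zc l x))" by (rule smooth_on_holomorphic[OF W open_WW zW aa_holo])
  define N where "N = (\<lambda>x. Re (aa u (zc l x)) * Re (aa u (zc l x)) + Im (aa u (zc l x)) * Im (aa u (zc l x)))"
  have sN: "smooth_on d W N" unfolding N_def
    by (intro smooth_on_add[OF W] smooth_on_mult[OF W] smooth_on_linear[OF W bounded_linear_Re a] smooth_on_linear[OF W bounded_linear_Im a])
  have N: "N x = (cmod (aa u (zc l x)))\<^sup>2" for x unfolding N_def cmod_power2 by (simp add: power2_eq_square)
  have "1 + N x \<noteq> 0" for x unfolding N by (rule one_norm_nz)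
  then have s: "smooth_on d W (\<lambda>x. 1 + ((1 + (- 1) * N x) * inverse (1 + N x)) * ((1 + (- 1) * N x) * inverse (1 + N x)))"
    by (intro smooth_on_add[OF W] smooth_on_const[OF W] smooth_on_mult[OF W] smooth_on_inverse[OF W] sN)
  have eq: "1 + (ht (rinv c (zc l x)))\<^sup>2 = 1 + ((1 + (- 1) * N x) * inverse (1 + N x)) * ((1 + (- 1) * N x) * inverse (1 + N x))" if "x \<in> W" for x
  proof -
    have r: "rinv (CH (\<sigma>, u)) (zc l x) = PP (\<sigma>, u) (zc l x)" by (rule rinv_CH) (use zW[OF that] in simp)
    show ?thesis unfolding \<open>c = CH (\<sigma>, u)\<close> r ht_PP N by (simp add: power2_eq_square divide_inverse)
  qed
  show ?thesis by (rule smooth_on_cong[OF W, THEN iffD2, OF _ s]) (rule eq)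
qed

lemma curve_G_nonconst:
  "\<exists>c\<in>CC. \<exists>V. open V \<and> V \<noteq> {} \<and> V \<subseteq> snd c ` fst c \<and>
    (\<forall>z\<in>V. vector_derivative (\<lambda>t. (1 + (ht (rinv c (Complex t (Im z))))\<^sup>2)\<^sup>2) (at (Re z)) \<noteq> 0)"
proof (intro bexI exI conjI ballI)
  \<comment> \<open>The chart around \<open>(0, 1)\<close> has coordinate \<open>x\<close>. On the
    half disc the height is nonzero because \<open>cmod z < 1\<close>, and its derivative in the
    real direction is nonzero because \<open>Re z > 0\<close>.\<close>
  let ?u = "(0, 1) :: complex \<times> complex" and ?V = "{z. 0 < Re z \<and> cmod z < 1}"
  let ?c = "CH (False, ?u)"
  have u: "?u \<in> aff" using e by (simp add: aff_def power_0_left)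
  then show "?c \<in> CC" by (rule CH_CC)
  show "open ?V" by (intro open_Collect_conj open_Collect_less continuous_intros)
  have "1 / 2 \<in> ?V" by simp
  then show "?V \<noteq> {}" by blast
  have sub: "?V \<subseteq> WW ?u"
  proof
    fix z assume z: "z \<in> ?V"
    have "cmod (z ^ (2 * e)) < 1" using z e by (simp add: norm_power power_Suc_less_one power_less_one_iff)
    then have "Re (1 + z ^ (2 * e)) > 0" using abs_Re_le_cmod[of "z ^ (2 * e)"] by simp
    then show "z \<in> WW ?u" by (simp add: WW_def complex_nonpos_Reals_iff)
  qed
  then show "?V \<subseteq> snd ?c ` fst ?c" unfolding CH_image by simp
  fix z assume z: "z \<in> ?V"
  define y t where "y = Im z" and "t = Re z"
  have N: "(cmod (Complex s y))\<^sup>2 = s\<^sup>2 + y\<^sup>2" for s by (simp add: cmod_power2)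
  have zt: "z = Complex t y" by (simp add: y_def t_def)
  let ?f = "\<lambda>s. (1 - (s\<^sup>2 + y\<^sup>2)) / (1 + (s\<^sup>2 + y\<^sup>2))"
  let ?D = "((0 - (2 * t)) * (1 + (t\<^sup>2 + y\<^sup>2)) - (1 - (t\<^sup>2 + y\<^sup>2)) * (0 + 2 * t)) / ((1 + (t\<^sup>2 + y\<^sup>2)) * (1 + (t\<^sup>2 + y\<^sup>2)))"
  have "(cmod z)\<^sup>2 < 1" using z by (simp add: abs_square_less_1)
  moreover have "(cmod z)\<^sup>2 = t\<^sup>2 + y\<^sup>2" using N[of t] unfolding zt[symmetric] .
  ultimately have lt: "t\<^sup>2 + y\<^sup>2 < 1" "t > 0" using z by (simp_all add: t_def)
  have pos: "1 + (t\<^sup>2 + y\<^sup>2) > 0" by (intro add_pos_nonneg) auto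
  have dN: "((\<lambda>s. s\<^sup>2 + y\<^sup>2) has_real_derivative 2 * t) (at t)" by (auto intro!: derivative_eq_intros)
  have "(?f has_real_derivative ?D) (at t)"
    by (intro DERIV_divide DERIV_diff DERIV_add DERIV_const dN) (use pos in auto)
  moreover have "?f t \<noteq> 0" using lt(1) pos by simp
  moreover have "?D \<noteq> 0"
  proof -
    have "(0 - (2 * t)) * (1 + (t\<^sup>2 + y\<^sup>2)) - (1 - (t\<^sup>2 + y\<^sup>2)) * (0 + 2 * t) = - 4 * t" by (simp add: algebra_simps)
    then show ?thesis using lt(2) pos by simp
  qed
  moreover have "open {s. Complex s y \<in> ?V}"
    by (simp only: mem_Collect_eq Complex_eq) (intro open_Collect_conj open_Collect_less continuous_intros)
  moreover have "t \<in> {s. Complex s y \<in> ?V}" using z unfolding zt by simp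
  moreover have "1 + (ht (rinv ?c (Complex s y)))\<^sup>2 = 1 + (?f s)\<^sup>2" if "s \<in> {s. Complex s y \<in> ?V}" for s
  proof -
    have "Complex s y \<in> WW ?u" using that sub by blast
    then have "rinv ?c (Complex s y) = PP (False, ?u) (Complex s y)" by (intro rinv_CH) simp
    moreover have "aa ?u (Complex s y) = Complex s y" by (simp add: aa_def)
    ultimately show ?thesis by (simp only: ht_PP N)
  qed
  ultimately have "vector_derivative (\<lambda>s. (1 + (ht (rinv ?c (Complex s y)))\<^sup>2)\<^sup>2) (at t) \<noteq> 0"
    by (rule vector_derivative_nz)
  then show "vector_derivative (\<lambda>s. (1 + (ht (rinv ?c (Complex s (Im z))))\<^sup>2)\<^sup>2) (at (Re z)) \<noteq> 0"
    unfolding y_def t_def .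
qed

end

text \<open>The linear bounds squeeze \<open>ln (D m) / ln m\<close> to 1, and the exponent
  \<open>j\<close> comes out as a factor.\<close>

lemma kodaira_dim_power:
  assumes P: "\<And>m. m \<ge> 1 \<Longrightarrow> plurigenus n X A J m = D m ^ j" and D: "\<And>m. m + 1 \<le> D m" "\<And>m. D m \<le> 2 * m + 8"
  shows "kodaira_dim n X A J = ereal (real j)"
proof -
  have pos: "D m > 0" for m using D(1)[of m] by linarith
  have "(\<lambda>m. ln (real (D m)) / ln (real m)) \<longlonglongrightarrow> 1"
  proof (rule tendsto_sandwich)
    show "(\<lambda>m::nat. ln (real m + 1) / ln (real m)) \<longlonglongrightarrow> 1" by real_asymp
    show "(\<lambda>m::nat. ln (2 * real m + 8) / ln (real m)) \<longlonglongrightarrow> 1" by real_asymp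
    show "eventually (\<lambda>m. ln (real m + 1) / ln (real m) \<le> ln (real (D m)) / ln (real m)) sequentially"
      using eventually_ge_at_top[of 2]
    proof eventually_elim
      case (elim m)
      have "real m + 1 \<le> real (D m)" using D(1)[of m] by linarith
      then show ?case using elim by (intro divide_right_mono) auto
    qed
    show "eventually (\<lambda>m. ln (real (D m)) / ln (real m) \<le> ln (2 * real m + 8) / ln (real m)) sequentially"
      using eventually_ge_at_top[of 2]
    proof eventually_elim
      case (elim m)
      have "real (D m) \<le> 2 * real m + 8" using D(2)[of m] by linarith
      then show ?case using elim pos[of m] by (intro divide_right_mono) auto
    qed
  qed
  then have "(\<lambda>m. real j * (ln (real (D m)) / ln (real m))) \<longlonglongrightarrow> real j * 1" by (intro tendsto_intros)
  then have "(\<lambda>m. ereal (real j * (ln (real (D m)) / ln (real m)))) \<longlonglongrightarrow> ereal (real j)" by simp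
  moreover have "eventually (\<lambda>m. ereal (real j * (ln (real (D m)) / ln (real m))) =
      (if plurigenus n X A J m = 0 then -\<infinity> else ereal (ln (real (plurigenus n X A J m)) / ln (real m)))) sequentially"
    using eventually_ge_at_top[of 1]
  proof eventually_elim
    case (elim m)
    have "ln (real (D m ^ j)) = real j * ln (real (D m))" using pos[of m] by (simp add: ln_realpow)
    then show ?case using P[OF elim] pos[of m] by simp
  qed
  ultimately have "(\<lambda>m. if plurigenus n X A J m = 0 then -\<infinity> else ereal (ln (real (plurigenus n X A J m)) / ln (real m))) \<longlonglongrightarrow> ereal (real j)"
    by (rule Lim_transform_eventually)
  then have "limsup (\<lambda>m. if plurigenus n X A J m = 0 then -\<infinity> else ereal (ln (real (plurigenus n X A J m)) / ln (real m))) = ereal (real j)"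
    by (rule lim_imp_Limsup[OF sequentially_bot])
  moreover have "\<not> (\<forall>m\<ge>1. plurigenus n X A J m = 0)" using P[of 1] pos[of 1] by auto
  ultimately show ?thesis unfolding kodaira_dim_def by (simp only: if_False)
qed

theorem theorem1p5:
  fixes n :: nat and k :: ereal
  assumes "n \<ge> 2"
    and "k \<in> {-\<infinity>} \<union> (\<lambda>j. ereal (real j)) ` {0..n - 1}"
  shows "\<exists>(X :: (nat \<Rightarrow> real) topology) (A :: (nat \<Rightarrow> real) chart set) (J :: (nat \<Rightarrow> real) acs).
           almost_complex_manifold n X A J \<and> compact_space X \<and> connected_space X \<and>
           \<not> integrable_acs n X A J \<and> kodaira_dim n X A J = k"
proof -
  have pos: "1 + (x::real)\<^sup>2 > 0" for x by (intro add_pos_nonneg) auto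
  have c1: "curve 1" and c3: "curve 3" by unfold_locales simp_all
  consider "k = - \<infinity>" | "k = ereal (real 0)" | j where "k = ereal (real j)" "1 \<le> j" "j \<le> n - 1"
  proof -
    have "k = -\<infinity> \<or> (\<exists>j\<le>n - 1. k = ereal (real j))" using assms(2) by auto
    then show thesis
    proof (elim disjE exE conjE)
      assume "k = -\<infinity>"
      then show thesis by (rule that(1))
    next
      fix j assume j: "j \<le> n - 1" "k = ereal (real j)"
      show thesis
      proof (cases "j = 0")
        case True
        then show thesis using j(2) by (intro that(2)) simp
      next
        case False
        then show thesis using j by (intro that(3)[of j]) simp_all
      qed
    qed
  qed
  then show ?thesis
  proof cases
    case 1
    \<comment> \<open>The conic as first factor has no nonzero differentials of positive weight, so
      every plurigenus has a factor 0.\<close>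
    let ?S = "\<lambda>l::nat. if l = 0 then curve.Cv 1 else Tset"
    let ?C = "\<lambda>l::nat. if l = 0 then curve.CC 1 else range Tchart"
    let ?d = "\<lambda>(l::nat) (m::nat). if l = 0 then 0 else 1 :: nat"
    have "\<exists>(X :: (nat \<Rightarrow> real) topology) A J. almost_complex_manifold n X A J \<and> compact_space X \<and> connected_space X \<and>
      \<not> integrable_acs n X A J \<and> (\<forall>m\<ge>1. plurigenus n X A J m = (\<Prod>l<n - 1. ?d l m))"
    proof (rule product_with_torus[where S = ?S and C = ?C and G = "\<lambda>q. 1 + (ht q)\<^sup>2", OF assms(1)])
      show "riemann_surface (?S l) (?C l)" for l
        using curve.curve_riemann_surface[OF c1] torus_riemann_surface by simp
      show "?S (n - 1) = Tset" "?C (n - 1) = range Tchart" using assms(1) by simp_all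
      show "0 < 1 + (ht q)\<^sup>2" for q by (rule pos)
      show "\<exists>c\<in>?C 0. \<exists>V. open V \<and> V \<noteq> {} \<and> V \<subseteq> snd c ` fst c \<and>
        (\<forall>z\<in>V. vector_derivative (\<lambda>t. (1 + (ht (rinv c (Complex t (Im z))))\<^sup>2)\<^sup>2) (at (Re z)) \<noteq> 0)"
        unfolding if_P[OF refl] by (rule curve.curve_G_nonconst[OF c1])
      show "smooth_on d W (\<lambda>x. 1 + (ht (rinv c (zc l x)))\<^sup>2)"
        if "c \<in> ?C 0" "openin (Euclidean_space d) W" "Suc (2 * l) < d" "\<And>x. x \<in> W \<Longrightarrow> zc l x \<in> snd c ` fst c" for c d W l
        by (rule curve.curve_G_smooth[OF c1 that(1)[unfolded if_P[OF refl]] that(2) that(4)])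
      show "\<exists>B \<phi>. dual_system (?C l) (?S l) m B \<phi> \<and> card B = ?d l m" if "m \<ge> 1" for m l
        using curve.dual_system_genus_0[OF c1 refl that] torus_dual_system[of m] by simp
    qed
    then obtain X :: "(nat \<Rightarrow> real) topology" and A J where X: "almost_complex_manifold n X A J" "compact_space X" "connected_space X"
      "\<not> integrable_acs n X A J" "\<forall>m\<ge>1. plurigenus n X A J m = (\<Prod>l<n - 1. ?d l m)" by (elim exE conjE)
    have "(\<Prod>l<n - 1. ?d l m) = 0" for m using assms(1) by (intro prod_zero bexI[of _ 0]) auto
    then have "\<forall>m\<ge>1. plurigenus n X A J m = 0" using X(5) by simp
    then have K: "kodaira_dim n X A J = - \<infinity>" unfolding kodaira_dim_def by (rule if_P)
    show ?thesis unfolding 1 by (intro exI[of _ X] exI[of _ A] exI[of _ J] conjI X(1-4) K)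
  next
    case 2
    \<comment> \<open>All factors are tori, and \<open>G\<close> varies with the first circle
      coordinate of the first one; every plurigenus is 1.\<close>
    have "\<exists>(X :: (nat \<Rightarrow> real) topology) A J. almost_complex_manifold n X A J \<and> compact_space X \<and> connected_space X \<and>
      \<not> integrable_acs n X A J \<and> (\<forall>m\<ge>1. plurigenus n X A J m = (\<Prod>l<n - 1. 1))"
    proof (rule product_with_torus[where S = "\<lambda>_. Tset" and C = "\<lambda>_. range Tchart" and G = "\<lambda>q. 1 + (Re (fst q))\<^sup>2" and d = "\<lambda>_ _. 1", OF assms(1)])
      show "riemann_surface Tset (range Tchart)" by (rule torus_riemann_surface)
      show "0 < 1 + (Re (fst q))\<^sup>2" for q :: rpt by (rule pos)
      show "smooth_on d W (\<lambda>x. 1 + (Re (fst (rinv c (zc l x))))\<^sup>2)"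
        if "c \<in> range Tchart" "openin (Euclidean_space d) W" "Suc (2 * l) < d" "\<And>x. x \<in> W \<Longrightarrow> zc l x \<in> snd c ` fst c" for c d W l
        by (rule torus_G_smooth[OF that(1,2,4)])
      show "\<exists>c\<in>range Tchart. \<exists>V. open V \<and> V \<noteq> {} \<and> V \<subseteq> snd c ` fst c \<and>
        (\<forall>z\<in>V. vector_derivative (\<lambda>t. (1 + (Re (fst (rinv c (Complex t (Im z)))))\<^sup>2)\<^sup>2) (at (Re z)) \<noteq> 0)"
        by (rule torus_G_nonconst)
      show "\<exists>B \<phi>. dual_system (range Tchart) Tset m B \<phi> \<and> card B = 1" for m by (rule torus_dual_system)
    qed simp_all
    then obtain X :: "(nat \<Rightarrow> real) topology" and A J where X: "almost_complex_manifold n X A J" "compact_space X" "connected_space X"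
      "\<not> integrable_acs n X A J" "\<forall>m\<ge>1. plurigenus n X A J m = (\<Prod>l<n - 1. 1)" by (elim exE conjE)
    \<comment> \<open>The exponent is 0, so any \<open>D\<close> within the linear bounds
      serves.\<close>
    have K: "kodaira_dim n X A J = ereal (real 0)"
      by (rule kodaira_dim_power[where D = "\<lambda>m. m + 1"]) (use X(5) in simp_all)
    show ?thesis unfolding 2 by (intro exI[of _ X] exI[of _ A] exI[of _ J] conjI X(1-4) K)
  next
    case (3 j)
    \<comment> \<open>\<open>D m\<close> will be the dimension of the differentials of weight
      \<open>m\<close> on the curve of genus 2; \<open>j\<close> copies of this curve followed by
      tori give the plurigenera \<open>D m ^ j\<close>.\<close>
    have "\<forall>m. \<exists>d. (\<exists>B \<phi>. dual_system (curve.CC 3) (curve.Cv 3) m B \<phi> \<and> card B = d) \<and> m + 1 \<le> d \<and> d \<le> 2 * m + 8"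
    proof
      fix m
      obtain B \<phi> where B: "dual_system (curve.CC 3) (curve.Cv 3) m B \<phi>" "m + 1 \<le> card B" "card B \<le> 2 * m + 8"
        using curve.dual_system_genus_2[OF c3 refl, of m] by (elim exE conjE)
      show "\<exists>d. (\<exists>B \<phi>. dual_system (curve.CC 3) (curve.Cv 3) m B \<phi> \<and> card B = d) \<and> m + 1 \<le> d \<and> d \<le> 2 * m + 8"
        by (intro exI[of _ "card B"] conjI exI[of _ B] exI[of _ \<phi>] B refl)
    qed
    from choice[OF this] obtain D where
      D: "\<forall>m. (\<exists>B \<phi>. dual_system (curve.CC 3) (curve.Cv 3) m B \<phi> \<and> card B = D m) \<and> m + 1 \<le> D m \<and> D m \<le> 2 * m + 8"
      by (elim exE)
    let ?S = "\<lambda>l. if l < j then curve.Cv 3 else Tset"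
    let ?C = "\<lambda>l. if l < j then curve.CC 3 else range Tchart"
    let ?d = "\<lambda>l m. if l < j then D m else 1"
    have j0: "0 < j" using 3 by simp
    have "\<exists>(X :: (nat \<Rightarrow> real) topology) A J. almost_complex_manifold n X A J \<and> compact_space X \<and> connected_space X \<and>
      \<not> integrable_acs n X A J \<and> (\<forall>m\<ge>1. plurigenus n X A J m = (\<Prod>l<n - 1. ?d l m))"
    proof (rule product_with_torus[where S = ?S and C = ?C and G = "\<lambda>q. 1 + (ht q)\<^sup>2", OF assms(1)])
      show "riemann_surface (?S l) (?C l)" for l
        using curve.curve_riemann_surface[OF c3] torus_riemann_surface by simp
      show "?S (n - 1) = Tset" "?C (n - 1) = range Tchart" using 3 by simp_all
      show "0 < 1 + (ht q)\<^sup>2" for q by (rule pos)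
      show "\<exists>c\<in>?C 0. \<exists>V. open V \<and> V \<noteq> {} \<and> V \<subseteq> snd c ` fst c \<and>
        (\<forall>z\<in>V. vector_derivative (\<lambda>t. (1 + (ht (rinv c (Complex t (Im z))))\<^sup>2)\<^sup>2) (at (Re z)) \<noteq> 0)"
        unfolding if_P[OF j0] by (rule curve.curve_G_nonconst[OF c3])
      show "smooth_on d W (\<lambda>x. 1 + (ht (rinv c (zc l x)))\<^sup>2)"
        if "c \<in> ?C 0" "openin (Euclidean_space d) W" "Suc (2 * l) < d" "\<And>x. x \<in> W \<Longrightarrow> zc l x \<in> snd c ` fst c" for c d W l
        by (rule curve.curve_G_smooth[OF c3 that(1)[unfolded if_P[OF j0]] that(2) that(4)])
      show "\<exists>B \<phi>. dual_system (?C l) (?S l) m B \<phi> \<and> card B = ?d l m" for m l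
        using D[THEN spec, of m] torus_dual_system[of m] by simp
    qed
    then obtain X :: "(nat \<Rightarrow> real) topology" and A J where X: "almost_complex_manifold n X A J" "compact_space X" "connected_space X"
      "\<not> integrable_acs n X A J" "\<forall>m\<ge>1. plurigenus n X A J m = (\<Prod>l<n - 1. ?d l m)" by (elim exE conjE)
    have "(\<Prod>l<n - 1. ?d l m) = D m ^ j" for m
    proof -
      have "(\<Prod>l<n - 1. ?d l m) = (\<Prod>l\<in>{..<n - 1} \<inter> {..<j}. D m)"
        by (subst prod.inter_restrict) simp_all
      also have "{..<n - 1} \<inter> {..<j} = {..<j}" using 3 by auto
      finally show ?thesis by simp
    qed
    then have K: "kodaira_dim n X A J = ereal (real j)"
      by (intro kodaira_dim_power[where D = D]) (use X(5) D in simp_all)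
    show ?thesis unfolding 3(1) by (intro exI[of _ X] exI[of _ A] exI[of _ J] conjI X(1-4) K)
  qed
qed

end
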